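(* Let $-3\le\gamma\le 1$ and let $\lambda,\mu,F:\mathbb{R}^3\to(0,\infty)$ satisfy, for all $v\in\mathbb{R}^3$, $$\lambda(v)\gtrsim\langle v\rangle^{\gamma},\qquad \mu(v)\gtrsim\langle v\rangle^{\gamma},\qquad F(v)\gtrsim\langle v\rangle^{\gamma+2},$$ $$|D_v^m\lambda(v)|\lesssim\langle v\rangle^{\gamma-m},\qquad |D_v^m\mu(v)|\lesssim\langle v\rangle^{\gamma-m},\qquad |D_v^mF(v)|\lesssim\langle v\rangle^{\gamma+2-m}$$ for all orders of derivation $m\in\{0,1,2\}$. Then there is a constant $C>0$ such that, for all smooth real-valued functions $f,h\in L^2(\mathbb{R}_t\times\mathbb{R}^3_x\times\mathbb{R}^3_v)$ satisfying $$\partial_t f+v\cdot\nabla_x f-\nabla_v\cdot\big(\lambda(v)\nabla_v f\big)-(v\wedge\nabla_v)\cdot\big(\mu(v)(v\wedge\nabla_v f)\big)+F(v)f=h ,$$ one has $$\|\langle v\rangle^{\gamma+2}f\|^2+\|\langle v\rangle^{\gamma}|D_v|^2f\|^2+\|\langle v\rangle^{\gamma}|v\wedge\nabla_v|^2f\|^2+\|\langle v\rangle^{\gamma/3}|D_x|^{2/3}f\|^2+\|\langle v\rangle^{\gamma/3}|v\wedge\nabla_x|^{2/3}f\|^2\le C\big(\|f\|^2+\|h\|^2\big).$$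
   Context: Functions depend on $(t,x,v)\in\mathbb{R}\times\mathbb{R}^3\times\mathbb{R}^3$; $\|\cdot\|$ is the norm of $L^2=L^2(\mathbb{R}_t\times\mathbb{R}^3_x\times\mathbb{R}^3_v)$. $\langle v\rangle=(1+|v|^2)^{1/2}$; $\wedge$ is the cross product in $\mathbb{R}^3$. $D_v^m$ denotes any partial derivative in $v$ of order $m$. The notation $A\lesssim B$ (or $B\gtrsim A$) means $A\le CB$ for some constant $C>0$; the constant in the conclusion depends only on $\gamma$ and on the constants in the bounds on $\lambda,\mu,F$. With $(e_j)$ the canonical basis of $\mathbb{R}^3$ and $V_j=(v\wedge e_j)\cdot\nabla_v$, one has $v\wedge\nabla_v f=-\sum_j V_j(f)e_j$, $(v\wedge\nabla_v)\cdot(\mu (v\wedge\nabla_v f))=\sum_j V_j(\mu V_jf)$, and $|v\wedge\nabla_v|^2=-\sum_jV_j^2$ (the sign being irrelevant in norms). $|D_v|^2=-\Delta_v$. $|D_x|^{s}$ is the Fourier multiplier in $x$ with symbol $|k|^{s}$, and $|v\wedge\nabla_x|^{s}$ (also written $|v\wedge D_x|^s$) is the operator acting, for fixed $v$, as the Fourier multiplier in $x$ with symbol $|v\wedge k|^{s}$, where $k$ is the variable dual to $x$. *)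

theory Defs
  imports "HOL-Analysis.Analysis"
begin

text \<open>Points of phase space are triples \<open>(t, x, v)\<close>.\<close>

type_synonym phase = "real \<times> (real^3) \<times> (real^3)"

abbreviation vel :: "phase \<Rightarrow> real^3" where
  "vel p \<equiv> snd (snd p)"

definition japanese :: "real^3 \<Rightarrow> real" where
  "japanese v = sqrt (1 + (norm v)^2)"

definition partial :: "'a::euclidean_space \<Rightarrow> ('a \<Rightarrow> real) \<Rightarrow> 'a \<Rightarrow> real" where
  "partial b f p = frechet_derivative f (at p) b"

text \<open>No continuity of the derivatives of the highest order \<open>n\<close> is required;
  for \<open>smooth\<close> below this makes no difference, since differentiable functions are continuous.\<close>

primrec times_differentiable :: "nat \<Rightarrow> ('a::euclidean_space \<Rightarrow> real) \<Rightarrow> bool" where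
  "times_differentiable 0 f \<longleftrightarrow> True"
| "times_differentiable (Suc n) f \<longleftrightarrow>
     (\<forall>p. f differentiable (at p)) \<and> (\<forall>b\<in>Basis. times_differentiable n (partial b f))"

definition smooth :: "('a::euclidean_space \<Rightarrow> real) \<Rightarrow> bool" where
  "smooth f \<longleftrightarrow> (\<forall>n. times_differentiable n f)"

text \<open>The partial derivative of order \<open>length bs\<close> in the list of directions \<open>bs\<close>.\<close>

primrec partials :: "'a::euclidean_space list \<Rightarrow> ('a \<Rightarrow> real) \<Rightarrow> 'a \<Rightarrow> real" where
  "partials [] f = f"
| "partials (b # bs) f = partial b (partials bs f)"

text \<open>The hypotheses on a coefficient of order \<open>s\<close>: it is positive, bounded below by \<open>\<langle>v\<rangle>\<^sup>s\<close>,
  and its derivatives of order \<open>m \<le> 2\<close> are bounded by \<open>\<langle>v\<rangle>\<^bsup>s - m\<^esup>\<close>, all with implied constant \<open>A\<close>.\<close>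

definition coefficient_bounds :: "real \<Rightarrow> real \<Rightarrow> (real^3 \<Rightarrow> real) \<Rightarrow> bool" where
  "coefficient_bounds A s c \<longleftrightarrow>
     times_differentiable 2 c \<and>
     (\<forall>v. c v > 0) \<and>
     (\<forall>v. japanese v powr s \<le> A * c v) \<and>
     (\<forall>bs. set bs \<subseteq> Basis \<and> length bs \<le> 2 \<longrightarrow>
        (\<forall>v. \<bar>partials bs c v\<bar> \<le> A * japanese v powr (s - real (length bs))))"

definition d_t :: "(phase \<Rightarrow> real) \<Rightarrow> phase \<Rightarrow> real" where
  "d_t f = partial (1, 0, 0) f"

definition grad_x :: "(phase \<Rightarrow> real) \<Rightarrow> phase \<Rightarrow> real^3" where
  "grad_x f p = (\<chi> i. partial (0, axis i 1, 0) f p)"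

definition grad_v :: "(phase \<Rightarrow> real) \<Rightarrow> phase \<Rightarrow> real^3" where
  "grad_v f p = (\<chi> i. partial (0, 0, axis i 1) f p)"

definition div_v :: "(phase \<Rightarrow> real^3) \<Rightarrow> phase \<Rightarrow> real" where
  "div_v W p = (\<Sum>i\<in>UNIV. grad_v (\<lambda>q. W q $ i) p $ i)"

text \<open>\<open>rot_v f\<close> is \<open>v \<and> \<nabla>\<^sub>v f\<close>, and \<open>rot_div_v W\<close> is \<open>(v \<and> \<nabla>\<^sub>v) \<cdot> W\<close>.\<close>

definition rot_v :: "(phase \<Rightarrow> real) \<Rightarrow> phase \<Rightarrow> real^3" where
  "rot_v f p = cross3 (vel p) (grad_v f p)"

definition rot_div_v :: "(phase \<Rightarrow> real^3) \<Rightarrow> phase \<Rightarrow> real" where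
  "rot_div_v W p = (\<Sum>i\<in>UNIV. rot_v (\<lambda>q. W q $ i) p $ i)"

definition V :: "3 \<Rightarrow> (phase \<Rightarrow> real) \<Rightarrow> phase \<Rightarrow> real" where
  "V j f p = cross3 (vel p) (axis j 1) \<bullet> grad_v f p"

lemma rot_v_eq_V: "rot_v f p = - (\<Sum>j\<in>UNIV. V j f p *\<^sub>R axis j 1)"
  by (simp add: rot_v_def V_def cross3_def vec_eq_iff forall_3 sum_3 inner_vec_def axis_def vector_3)

text \<open>\<open>|D\<^sub>v|\<^sup>2 = - \<Delta>\<^sub>v\<close> and \<open>|v \<and> \<nabla>\<^sub>v|\<^sup>2 = - \<Sum>\<^sub>j V\<^sub>j\<^sup>2\<close>.\<close>

definition Dv_squared :: "(phase \<Rightarrow> real) \<Rightarrow> phase \<Rightarrow> real" where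
  "Dv_squared f p = - div_v (grad_v f) p"

definition rot_squared :: "(phase \<Rightarrow> real) \<Rightarrow> phase \<Rightarrow> real" where
  "rot_squared f p = - (\<Sum>j\<in>UNIV. V j (V j f) p)"

definition kinetic_op ::
    "(real^3 \<Rightarrow> real) \<Rightarrow> (real^3 \<Rightarrow> real) \<Rightarrow> (real^3 \<Rightarrow> real) \<Rightarrow> (phase \<Rightarrow> real) \<Rightarrow> phase \<Rightarrow> real" where
  "kinetic_op lam mu F f p =
     d_t f p + vel p \<bullet> grad_x f p
     - div_v (\<lambda>q. lam (vel q) *\<^sub>R grad_v f q) p
     - rot_div_v (\<lambda>q. mu (vel q) *\<^sub>R rot_v f q) p
     + F (vel p) * f p"

text \<open>The squared \<open>L\<^sup>2\<close> norm, with value \<open>\<infinity>\<close> for a measurable function outside \<open>L\<^sup>2\<close>.\<close>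

definition sqnorm :: "('a::euclidean_space \<Rightarrow> 'b::real_normed_vector) \<Rightarrow> ennreal" where
  "sqnorm g = (\<integral>\<^sup>+ p. ennreal ((norm (g p))^2) \<partial>lborel)"

definition in_L2 :: "('a::euclidean_space \<Rightarrow> 'b::real_normed_vector) \<Rightarrow> bool" where
  "in_L2 g \<longleftrightarrow> g \<in> borel_measurable lborel \<and> sqnorm g < \<infinity>"

text \<open>\<open>U\<close> is the Fourier-Plancherel transform of \<open>u\<close>: the \<open>L\<^sup>2\<close> limit, as \<open>R \<rightarrow> \<infinity>\<close>, of the Fourier
  integrals over balls of radius \<open>R\<close>. With the phase \<open>exp (- i k \<cdot> x)\<close> the operator \<open>- i \<partial>\<^sub>x\<close> has
  symbol \<open>k\<close>. The normalising factor in front of the integral plays no role for multipliers.\<close>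

definition fourier_L2 :: "(real^3 \<Rightarrow> complex) \<Rightarrow> (real^3 \<Rightarrow> complex) \<Rightarrow> bool" where
  "fourier_L2 u U \<longleftrightarrow> in_L2 u \<and> in_L2 U \<and>
     ((\<lambda>R::real. sqnorm (\<lambda>k. U k -
         (LINT x:ball 0 R|lborel. exp (- (\<i> * complex_of_real (k \<bullet> x))) * u x))) \<longlongrightarrow> 0) at_top"

text \<open>\<open>w = m(D) u\<close>, the image of \<open>u\<close> under the \<open>L\<^sup>2\<close> Fourier multiplier with symbol \<open>m\<close>.
  This includes that \<open>u\<close> lies in the domain of \<open>m(D)\<close>, and determines \<open>w\<close> almost everywhere.\<close>

definition fourier_multiplier ::
    "(real^3 \<Rightarrow> real) \<Rightarrow> (real^3 \<Rightarrow> complex) \<Rightarrow> (real^3 \<Rightarrow> complex) \<Rightarrow> bool" where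
  "fourier_multiplier m u w \<longleftrightarrow>
     (\<exists>U. fourier_L2 u U \<and> fourier_L2 w (\<lambda>k. complex_of_real (m k) * U k))"

text \<open>\<open>g = m(v, D\<^sub>x) f\<close>: the multiplier acts in \<open>x\<close> only, for (almost every) fixed \<open>t, v\<close>.
  So \<open>g\<close> itself need not lie in \<open>L\<^sup>2\<close> of phase space, only its slices in \<open>L\<^sup>2\<close> of \<open>x\<close>; this matters
  because the weights in \<open>v\<close> applied to \<open>g\<close> may decay.\<close>

definition x_multiplier ::
    "(real^3 \<Rightarrow> real^3 \<Rightarrow> real) \<Rightarrow> (phase \<Rightarrow> real) \<Rightarrow> (phase \<Rightarrow> complex) \<Rightarrow> bool" where
  "x_multiplier m f g \<longleftrightarrow> g \<in> borel_measurable lborel \<and>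
     (AE tv in (lborel :: (real \<times> (real^3)) measure).
        fourier_multiplier (m (snd tv))
          (\<lambda>x. complex_of_real (f (fst tv, x, snd tv))) (\<lambda>x. g (fst tv, x, snd tv)))"

definition is_Dx_power :: "real \<Rightarrow> (phase \<Rightarrow> real) \<Rightarrow> (phase \<Rightarrow> complex) \<Rightarrow> bool" where
  "is_Dx_power s = x_multiplier (\<lambda>v k. norm k powr s)"

definition is_rot_Dx_power :: "real \<Rightarrow> (phase \<Rightarrow> real) \<Rightarrow> (phase \<Rightarrow> complex) \<Rightarrow> bool" where
  "is_rot_Dx_power s = x_multiplier (\<lambda>v k. norm (cross3 v k) powr s)"

end

theory Submission
  imports Defs "HOL-Probability.Characteristic_Functions"
begin

text \<open>Cut \<open>f\<close> off in \<open>y = (t, x)\<close> and take the Fourier transform in \<open>y\<close>. At the frequency \<open>(\<tau>, k)\<close> its real and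
  imaginary parts solve \<open>L u\<^sub>1 - \<phi> u\<^sub>2 = h\<^sub>1\<close>, \<open>L u\<^sub>2 + \<phi> u\<^sub>1 = h\<^sub>2\<close> in \<open>v\<close> alone, where \<open>\<phi> v = \<tau> + v \<cdot> k\<close> and
  \<open>L = - \<Sum>\<^sub>a X\<^sub>a \<sigma>\<^sub>a X\<^sub>a + F\<close> for the six skew-adjoint fields \<open>X\<^sub>a\<close> (three translations, three rotations).
  Since \<open>\<Sum>\<^sub>a (X\<^sub>a \<phi>)\<^sup>2 = \<bar>k\<bar>\<^sup>2 + \<bar>v \<and> k\<bar>\<^sup>2\<close>, the field \<open>\<Sum>\<^sub>a (X\<^sub>a \<phi>) X\<^sub>a\<close>, weighted by a negative power of this
  symbol, has a commutator with \<open>\<phi>\<close> that controls the fractional derivatives in \<open>x\<close>, and weighted energy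
  estimates close the bound with a constant independent of \<open>\<tau>\<close> and \<open>k\<close>. The second order terms in \<open>v\<close>
  follow because rotations commute with the Laplacian in \<open>v\<close>. After integration
  over the frequencies, Plancherel's theorem and Fatou's lemma remove the cutoffs.\<close>

section \<open>Partial derivatives\<close>

text \<open>Nothing on the left of the estimate is known to be finite, so every step runs on cut-off
  functions and no constant may see the cutoff radius \<open>S\<close>. The cutoffs in (t, x) and in
  v share this radius: the transport field then changes the first by O(1) although v is unbounded,
  and \<gamma> \<le> 1 pays for the derivatives of the second. The exponents come from two
  requirements on the weight m of the multiplier field, with q the symbol: its commutator with the
  phase is \<rho>^2 = m q, and its square is bounded by the diffusion weighted by \<rho>, that is
  m^2 q = <v>^\<gamma> \<rho>. Together \<rho>^3 = <v>^\<gamma> q: a gain of 2/3 derivative with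
  weight <v>^(\<gamma>/3). The estimates do not close linearly: bounding \<rho> u by the multiplier
  involves L u, and bounding L u involves \<rho> u through the commutator of L and \<phi>. They
  close by homogeneity: if the norm of \<rho> u is y^4 times the data, then L u and the multiplier
  term are of order at most y^3 and y^2 for large y, and y^8 of order at most y^5 bounds y.\<close>

lemma partial_eqI:
  assumes "(g has_derivative g') (at p)"
  shows "partial b g p = g' b"
  using frechet_derivative_at[OF assms] by (simp add: partial_def)

lemma has_derivative_frechet:
  assumes "g differentiable (at p)"
  shows "(g has_derivative frechet_derivative g (at p)) (at p)"
  using assms frechet_derivative_works by blast

lemma partial_const [simp]: "partial b (\<lambda>x. c) p = 0"
  by (rule partial_eqI) (rule has_derivative_const)

lemma partial_add:
  assumes "g differentiable (at p)" "h differentiable (at p)"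
  shows "partial b (\<lambda>x. g x + h x) p = partial b g p + partial b h p"
  unfolding partial_def[of b g] partial_def[of b h]
  by (rule partial_eqI) (intro has_derivative_add has_derivative_frechet assms)

lemma partial_diff:
  assumes "g differentiable (at p)" "h differentiable (at p)"
  shows "partial b (\<lambda>x. g x - h x) p = partial b g p - partial b h p"
  unfolding partial_def[of b g] partial_def[of b h]
  by (rule partial_eqI) (intro has_derivative_diff has_derivative_frechet assms)

lemma partial_mult:
  assumes "g differentiable (at p)" "h differentiable (at p)"
  shows "partial b (\<lambda>x. g x * h x) p = g p * partial b h p + partial b g p * h p"
  unfolding partial_def[of b g] partial_def[of b h]
  by (rule partial_eqI) (intro has_derivative_mult has_derivative_frechet assms)

lemma partial_sum:
  assumes "finite I" "\<And>i. i \<in> I \<Longrightarrow> g i differentiable (at p)"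
  shows "partial b (\<lambda>x. \<Sum>i\<in>I. g i x) p = (\<Sum>i\<in>I. partial b (g i) p)"
  unfolding partial_def[of b "g _"]
  by (rule partial_eqI) (intro has_derivative_sum has_derivative_frechet assms)

lemma partial_inner [simp]: "partial b (\<lambda>x. x \<bullet> c) p = b \<bullet> c"
  by (rule partial_eqI) (auto intro!: derivative_eq_intros)

lemma partial_chain:
  fixes \<phi> :: "real \<Rightarrow> real"
  assumes "g differentiable (at p)" "(\<phi> has_real_derivative d) (at (g p))"
  shows "partial b (\<lambda>x. \<phi> (g x)) p = d * partial b g p"
proof -
  have "((\<lambda>x. \<phi> (g x)) has_derivative (\<lambda>h. d * frechet_derivative g (at p) h)) (at p)"
    using has_derivative_compose[OF has_derivative_frechet[OF assms(1)], of \<phi> "\<lambda>h. d * h"] assms(2)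
    by (auto simp: has_field_derivative_def mult.commute[of d] mult_commute_abs)
  then show ?thesis
    unfolding partial_def[of b g] by (rule partial_eqI)
qed

lemma differentiable_chain:
  fixes \<phi> :: "real \<Rightarrow> real"
  assumes "g differentiable (at p)" "(\<phi> has_real_derivative d) (at (g p))"
  shows "(\<lambda>x. \<phi> (g x)) differentiable (at p)"
proof -
  have "\<phi> differentiable (at (g p))"
    using assms(2) real_differentiable_def by blast
  then show ?thesis
    using differentiable_compose[of \<phi> g p UNIV] assms(1) by simp
qed

lemma times_diff_SucD: "times_differentiable (Suc n) g \<Longrightarrow> times_differentiable n g"
proof (induction n arbitrary: g)
  case (Suc n)
  then show ?case
    by (metis times_differentiable.simps(2))
qed simp

lemma times_diff_mono: "times_differentiable n g \<Longrightarrow> m \<le> n \<Longrightarrow> times_differentiable m g"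
  by (induction n) (auto simp: le_Suc_eq simp del: times_differentiable.simps intro: times_diff_SucD)

lemma times_differentiableD:
  "times_differentiable n g \<Longrightarrow> 1 \<le> n \<Longrightarrow> g differentiable (at p)"
  by (cases n) auto

lemma times_diff_partial:
  "times_differentiable (Suc n) g \<Longrightarrow> b \<in> Basis \<Longrightarrow> times_differentiable n (partial b g)"
  by simp

lemma times_diff_continuous:
  assumes "times_differentiable n g" "1 \<le> n"
  shows "continuous_on S g"
  using times_differentiableD[OF assms]
  by (meson continuous_at_imp_continuous_on differentiable_imp_continuous_within)

lemma times_diff_const [intro, simp]: "times_differentiable n (\<lambda>x. c)"
proof (induction n arbitrary: c)
  case (Suc n)
  have "partial b (\<lambda>x::'a. c) = (\<lambda>x. 0)" for b by auto
  then show ?case using Suc by simp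
qed simp

lemma times_diff_inner [intro, simp]: "times_differentiable n (\<lambda>x. x \<bullet> c)"
proof (cases n)
  case (Suc m)
  have "partial b (\<lambda>x::'a. x \<bullet> c) = (\<lambda>x. b \<bullet> c)" for b by auto
  then show ?thesis using Suc by (auto intro!: derivative_intros)
qed simp

lemma times_diff_add [intro]:
  "times_differentiable n g \<Longrightarrow> times_differentiable n h \<Longrightarrow> times_differentiable n (\<lambda>x. g x + h x)"
proof (induction n arbitrary: g h)
  case (Suc n)
  have "partial b (\<lambda>x. g x + h x) = (\<lambda>x. partial b g x + partial b h x)" for b
    using Suc.prems by (auto simp: partial_add)
  then show ?case using Suc by auto
qed simp

lemma times_diff_diff [intro]:
  "times_differentiable n g \<Longrightarrow> times_differentiable n h \<Longrightarrow> times_differentiable n (\<lambda>x. g x - h x)"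
proof (induction n arbitrary: g h)
  case (Suc n)
  have "partial b (\<lambda>x. g x - h x) = (\<lambda>x. partial b g x - partial b h x)" for b
    using Suc.prems by (auto simp: partial_diff)
  then show ?case using Suc by auto
qed simp

lemma times_diff_mult [intro]:
  "times_differentiable n g \<Longrightarrow> times_differentiable n h \<Longrightarrow> times_differentiable n (\<lambda>x. g x * h x)"
proof (induction n arbitrary: g h)
  case (Suc n)
  have "partial b (\<lambda>x. g x * h x) = (\<lambda>x. g x * partial b h x + partial b g x * h x)" for b
    using Suc.prems by (auto simp: partial_mult)
  moreover have "times_differentiable n g" "times_differentiable n h"
    using Suc.prems times_diff_SucD by blast+
  ultimately show ?case using Suc by (auto intro!: times_diff_add)
qed simp

lemma times_diff_sum [intro]:
  "(\<And>i. i \<in> I \<Longrightarrow> times_differentiable n (g i)) \<Longrightarrow> times_differentiable n (\<lambda>x. \<Sum>i\<in>I. g i x)"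
  by (induction I rule: infinite_finite_induct) auto

lemma times_diff_powr [intro]:
  assumes "times_differentiable n g" "\<And>x. g x > 0"
  shows "times_differentiable n (\<lambda>x. g x powr s)"
  using assms
proof (induction n arbitrary: s)
  case (Suc n)
  have d: "g differentiable (at p)" for p using Suc.prems by auto
  have D: "((\<lambda>y. y powr s) has_real_derivative s * g p powr (s - 1)) (at (g p))" for p
    using Suc.prems(2)[of p] by (auto intro!: derivative_eq_intros)
  have "partial b (\<lambda>x. g x powr s) = (\<lambda>x. s * g x powr (s - 1) * partial b g x)" for b
    using partial_chain[OF d D] by auto
  moreover have "times_differentiable n (\<lambda>x. g x powr (s - 1))"
    using Suc times_diff_SucD by blast
  ultimately show ?case using Suc.prems differentiable_chain[OF d D]
    by (auto intro!: times_diff_mult)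
qed simp

text \<open>Powers of the positive part are the cutoffs used throughout. Only the kink at 0 needs
  care: there the difference quotient is at most |h|^(n+1), which tends to 0 because the power is at
  least a square.\<close>

lemma has_real_derivative_max_power:
  "((\<lambda>y::real. max 0 y ^ Suc (Suc n)) has_real_derivative real (Suc (Suc n)) * max 0 x ^ Suc n) (at x)"
proof -
  consider "x > 0" | "x < 0" | "x = 0" by linarith
  then show ?thesis
  proof cases
    case 1
    have "((\<lambda>y. y ^ Suc (Suc n)) has_real_derivative real (Suc (Suc n)) * x ^ Suc n) (at x)"
      using DERIV_pow[of "Suc (Suc n)" x] by simp
    then have "((\<lambda>y. max 0 y ^ Suc (Suc n)) has_real_derivative real (Suc (Suc n)) * x ^ Suc n) (at x)"
      by (rule has_field_derivative_transform_within_open[where S = "{0<..}"]) (use 1 in auto)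
    moreover have "max 0 x = x" using 1 by simp
    ultimately show ?thesis by metis
  next
    case 2
    have "((\<lambda>y. 0) has_real_derivative 0) (at x)" by simp
    then have "((\<lambda>y::real. max 0 y ^ Suc (Suc n)) has_real_derivative 0) (at x)"
      by (rule has_field_derivative_transform_within_open[where S = "{..<0}"]) (use 2 in auto)
    then show ?thesis using 2 by simp
  next
    case 3
    have "((\<lambda>h::real. max 0 h ^ Suc (Suc n) / h) \<longlongrightarrow> 0) (at 0)"
    proof (rule Lim_null_comparison)
      show "eventually (\<lambda>h::real. norm (max 0 h ^ Suc (Suc n) / h) \<le> \<bar>h\<bar> ^ Suc n) (at 0)"
      proof (rule always_eventually, rule allI)
        fix h :: real
        show "norm (max 0 h ^ Suc (Suc n) / h) \<le> \<bar>h\<bar> ^ Suc n"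
        proof (cases "h > 0")
          case True
          then have "max 0 h = h" by simp
          then show ?thesis using True by simp
        next
          case False
          then have "norm (max 0 h ^ Suc (Suc n) / h) = 0" by simp
          also have "0 \<le> \<bar>h\<bar> ^ Suc n" by (rule zero_le_power) simp
          finally show ?thesis .
        qed
      qed
      show "((\<lambda>h::real. \<bar>h\<bar> ^ Suc n) \<longlongrightarrow> 0) (at 0)"
        by (auto intro!: tendsto_eq_intros)
    qed
    then show ?thesis using 3 by (simp add: DERIV_def)
  qed
qed

lemma partial_max_power:
  assumes "g differentiable (at p)"
  shows "partial b (\<lambda>x. max 0 (g x) ^ Suc (Suc n)) p = real (Suc (Suc n)) * max 0 (g p) ^ Suc n * partial b g p"
  by (rule partial_chain[OF assms has_real_derivative_max_power])

text \<open>Each derivative lowers the exponent by one and the first power has a kink, hence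
  exponent n + 1 for n derivatives. The exponents 3 and 5 of the cutoffs below count derivatives in
  this way.\<close>

lemma times_diff_max_power [intro]:
  "times_differentiable n g \<Longrightarrow> times_differentiable n (\<lambda>x. max 0 (g x) ^ Suc n)"
proof (induction n)
  case (Suc n)
  have d: "g differentiable (at p)" for p using Suc.prems by auto
  have "partial b (\<lambda>x. max 0 (g x) ^ Suc (Suc n)) = (\<lambda>p. real (Suc (Suc n)) * max 0 (g p) ^ Suc n * partial b g p)" for b
    by (rule ext) (rule partial_max_power[OF d])
  moreover have "times_differentiable n (\<lambda>x. max 0 (g x) ^ Suc n)"
    using Suc times_diff_SucD by blast
  ultimately show ?case
    using differentiable_chain[OF d has_real_derivative_max_power] Suc.prems
    by (simp del: power_Suc of_nat_Suc) (intro ballI times_diff_mult; simp)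
qed simp

text \<open>One statement for translations, for slices with some variables frozen and for functions
  of the velocity alone: in all three the linear part sends a basis vector to a basis vector or to
  0.\<close>

lemma times_diff_affine:
  fixes g :: "'b::euclidean_space \<Rightarrow> real" and e :: "'a::euclidean_space \<Rightarrow> 'b"
  assumes "linear e" and B: "\<And>b. b \<in> Basis \<Longrightarrow> e b \<in> Basis \<or> e b = 0"
  shows "times_differentiable n g \<Longrightarrow> times_differentiable n (\<lambda>x. g (c + e x))"
    and "times_differentiable 1 g \<Longrightarrow> partial b (\<lambda>x. g (c + e x)) p = partial (e b) g (c + e p)"
proof -
  have e: "(e has_derivative e) (at p)" for p
    using assms(1) by (simp add: linear_imp_has_derivative)
  have e': "((\<lambda>x. c + e x) has_derivative e) (at p)" for p
    by (auto intro!: derivative_eq_intros e)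
  have D: "((\<lambda>x. g (c + e x)) has_derivative (\<lambda>h. frechet_derivative g (at (c + e p)) (e h))) (at p)"
    if "times_differentiable 1 g" for g p
    using has_derivative_compose[OF e' has_derivative_frechet] times_differentiableD[OF that] by blast
  have P: "partial b (\<lambda>x. g (c + e x)) p = partial (e b) g (c + e p)"
    if "times_differentiable 1 g" for g p b
    using partial_eqI[OF D[OF that]] by (simp add: partial_def)
  show "times_differentiable 1 g \<Longrightarrow> partial b (\<lambda>x. g (c + e x)) p = partial (e b) g (c + e p)"
    by (rule P)
  show "times_differentiable n g \<Longrightarrow> times_differentiable n (\<lambda>x. g (c + e x))"
  proof (induction n arbitrary: g)
    case (Suc n)
    have 1: "times_differentiable 1 g"
      using Suc.prems times_diff_mono[of "Suc n" g 1] by simp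
    have "times_differentiable n (partial b (\<lambda>x. g (c + e x)))" if "b \<in> Basis" for b
    proof (cases "e b = 0")
      case True
      have "frechet_derivative g (at (c + e p)) 0 = 0" for p
        using has_derivative_frechet[of g "c + e p"] 1
        by (metis differentiable_def frechet_derivative_works has_derivative_zero_unique linear_0 has_derivative_linear times_differentiableD[OF 1 order_refl])
      then have "partial b (\<lambda>x. g (c + e x)) = (\<lambda>x. 0)"
        using P[OF 1] True by (auto simp: partial_def)
      then show ?thesis by simp
    next
      case False
      then have "times_differentiable n (\<lambda>x. partial (e b) g (c + e x))"
        using Suc B[OF that] by (intro Suc.IH) auto
      moreover have "partial b (\<lambda>x. g (c + e x)) = (\<lambda>x. partial (e b) g (c + e x))"
        using P[OF 1] by auto
      ultimately show ?thesis by simp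
    qed
    then show ?case using D[OF 1] by (auto simp: differentiable_def)
  qed simp
qed

lemma partial_mvt:
  assumes "times_differentiable 1 g" "0 < (s::real)"
  shows "\<exists>\<xi>. 0 < \<xi> \<and> \<xi> < s \<and> g (p + s *\<^sub>R b) - g p = s * partial b g (p + \<xi> *\<^sub>R b)"
proof -
  have "((\<lambda>s. g (p + s *\<^sub>R b)) has_real_derivative partial b g (p + s *\<^sub>R b)) (at s)" for s
  proof -
    have "((\<lambda>s. p + s *\<^sub>R b) has_derivative (\<lambda>h. h *\<^sub>R b)) (at s)"
      by (auto intro!: derivative_eq_intros)
    from has_derivative_compose[OF this has_derivative_frechet[OF times_differentiableD[OF assms(1)]]]
    have D: "((\<lambda>s. g (p + s *\<^sub>R b)) has_derivative (\<lambda>h. frechet_derivative g (at (p + s *\<^sub>R b)) (h *\<^sub>R b))) (at s)"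
      by simp
    have "linear (frechet_derivative g (at (p + s *\<^sub>R b)))"
      using assms(1) linear_frechet_derivative times_differentiableD by blast
    then show ?thesis using D
      by (simp add: has_field_derivative_def partial_def linear_cmul mult_commute_abs)
  qed
  from MVT2[OF assms(2) this] show ?thesis by auto
qed

text \<open>Both mixed derivatives are limits of the same second difference divided by s^2, by
  applying the mean value theorem twice in either order. Order 3 is assumed because
  \<open>times_differentiable 2\<close> does not make the mixed derivatives continuous.\<close>

lemma partial_commute:
  fixes g :: "'a::euclidean_space \<Rightarrow> real"
  assumes g: "times_differentiable 3 g" and b: "b \<in> Basis" and c: "c \<in> Basis"
  shows "partial b (partial c g) p = partial c (partial b g) p"
proof -
  have g1: "times_differentiable 1 g" "\<And>b. b \<in> Basis \<Longrightarrow> times_differentiable 1 (partial b g)"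
    using g by (auto simp: numeral_eq_Suc)
  have cont: "continuous_on UNIV (partial b (partial c g))" if "b \<in> Basis" "c \<in> Basis" for b c
    using g that by (intro times_diff_continuous[of 1]) (auto simp: numeral_eq_Suc)
  have mv: "\<exists>\<xi> \<eta>. 0 < \<xi> \<and> \<xi> < s \<and> 0 < \<eta> \<and> \<eta> < s \<and>
      g (p + s *\<^sub>R b + s *\<^sub>R c) - g (p + s *\<^sub>R b) - g (p + s *\<^sub>R c) + g p
      = s * s * partial c (partial b g) (p + \<xi> *\<^sub>R b + \<eta> *\<^sub>R c)"
    if s: "0 < s" and b: "b \<in> Basis" and c: "c \<in> Basis" for s :: real and b c
  proof -
    let ?G = "\<lambda>x. g (s *\<^sub>R c + x) - g x"
    have t: "times_differentiable 1 (\<lambda>x. g (s *\<^sub>R c + x))"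
      using times_diff_affine(1)[of "\<lambda>x. x" 1 g "s *\<^sub>R c"] g1(1) by (auto simp: linear_id[unfolded id_def])
    have G: "times_differentiable 1 ?G"
      using t g1(1) by (rule times_diff_diff)
    have pG: "partial b ?G q = partial b g (s *\<^sub>R c + q) - partial b g q" for q
      using partial_diff[OF times_differentiableD[OF t] times_differentiableD[OF g1(1)]]
        times_diff_affine(2)[of "\<lambda>x. x" g b "s *\<^sub>R c" q] g1(1) by (auto simp: linear_id[unfolded id_def])
    obtain \<xi> where x: "0 < \<xi>" "\<xi> < s" "?G (p + s *\<^sub>R b) - ?G p = s * partial b ?G (p + \<xi> *\<^sub>R b)"
      using partial_mvt[OF G s] by blast
    obtain \<eta> where "0 < \<eta>" "\<eta> < s" "partial b g ((p + \<xi> *\<^sub>R b) + s *\<^sub>R c) - partial b g (p + \<xi> *\<^sub>R b)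
        = s * partial c (partial b g) ((p + \<xi> *\<^sub>R b) + \<eta> *\<^sub>R c)"
      using partial_mvt[OF g1(2)[OF b] s] by blast
    with x pG show ?thesis
      by - (rule exI[of _ \<xi>], rule exI[of _ \<eta>], simp only: pG,
        simp add: algebra_simps)
  qed
  define s where "s n = 1 / real (Suc n)" for n
  have s: "s n > 0" for n by (simp add: s_def)
  have s0: "s \<longlonglongrightarrow> 0" unfolding s_def using LIMSEQ_inverse_real_of_nat by (simp add: inverse_eq_divide)
  have lim: "\<exists>X. (\<lambda>n. partial c (partial b g) (X n)) \<longlonglongrightarrow> partial c (partial b g) p \<and>
     (\<forall>n. g (p + s n *\<^sub>R b + s n *\<^sub>R c) - g (p + s n *\<^sub>R b) - g (p + s n *\<^sub>R c) + g p
      = s n * s n * partial c (partial b g) (X n))" if b: "b \<in> Basis" and c: "c \<in> Basis" for b c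
  proof -
    obtain \<xi> \<eta> where x: "\<And>n. 0 < \<xi> n \<and> \<xi> n < s n \<and> 0 < \<eta> n \<and> \<eta> n < s n \<and>
      g (p + s n *\<^sub>R b + s n *\<^sub>R c) - g (p + s n *\<^sub>R b) - g (p + s n *\<^sub>R c) + g p
      = s n * s n * partial c (partial b g) (p + \<xi> n *\<^sub>R b + \<eta> n *\<^sub>R c)"
      using mv[OF s b c] by metis
    have "\<xi> \<longlonglongrightarrow> 0" "\<eta> \<longlonglongrightarrow> 0"
      using tendsto_sandwich[OF always_eventually always_eventually tendsto_const s0, of \<xi>]
        tendsto_sandwich[OF always_eventually always_eventually tendsto_const s0, of \<eta>] x
      by (force intro: less_imp_le)+
    then have "(\<lambda>n. p + \<xi> n *\<^sub>R b + \<eta> n *\<^sub>R c) \<longlonglongrightarrow> p"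
      by (auto intro!: tendsto_eq_intros)
    then have "(\<lambda>n. partial c (partial b g) (p + \<xi> n *\<^sub>R b + \<eta> n *\<^sub>R c)) \<longlonglongrightarrow> partial c (partial b g) p"
      using cont[OF c b] by (auto simp: continuous_on_eq_continuous_at intro: isCont_tendsto_compose)
    then show ?thesis using x by (intro exI[of _ "\<lambda>n. p + \<xi> n *\<^sub>R b + \<eta> n *\<^sub>R c"]) auto
  qed
  obtain X where X: "(\<lambda>n. partial c (partial b g) (X n)) \<longlonglongrightarrow> partial c (partial b g) p"
     "\<And>n. g (p + s n *\<^sub>R b + s n *\<^sub>R c) - g (p + s n *\<^sub>R b) - g (p + s n *\<^sub>R c) + g p
      = s n * s n * partial c (partial b g) (X n)" using lim[OF b c] by blast
  obtain Y where Y: "(\<lambda>n. partial b (partial c g) (Y n)) \<longlonglongrightarrow> partial b (partial c g) p"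
     "\<And>n. g (p + s n *\<^sub>R c + s n *\<^sub>R b) - g (p + s n *\<^sub>R c) - g (p + s n *\<^sub>R b) + g p
      = s n * s n * partial b (partial c g) (Y n)" using lim[OF c b] by blast
  have eqs: "s n * s n * partial c (partial b g) (X n) = s n * s n * partial b (partial c g) (Y n)" for n
    unfolding X(2)[symmetric] Y(2)[symmetric] by (simp add: add.commute add.left_commute)
  have "partial c (partial b g) (X n) = partial b (partial c g) (Y n)" for n
    using eqs[of n] less_imp_neq[OF s[of n]] by auto
  then show ?thesis using LIMSEQ_unique[OF Y(1)] X(1) by simp
qed

lemma integrable_continuous_support:
  fixes g :: "'a::euclidean_space \<Rightarrow> 'b::euclidean_space"
  assumes "continuous_on UNIV g" "\<And>x. norm x > r \<Longrightarrow> g x = 0"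
  shows "integrable lborel g"
proof -
  have "integrable lborel (\<lambda>x. indicator (cball 0 r) x *\<^sub>R g x)"
    by (rule borel_integrable_compact) (use assms(1) continuous_on_subset[of UNIV g] in auto)
  moreover have "indicator (cball 0 r) x *\<^sub>R g x = g x" for x
    using assms(2)[of x] by (auto simp: indicator_def not_le)
  ultimately show ?thesis by simp
qed

text \<open>By translation invariance the difference quotients have integral 0, and they converge to
  the partial derivative while staying bounded on a fixed ball.\<close>

lemma integral_partial_eq_0:
  fixes g :: "'a::euclidean_space \<Rightarrow> real"
  assumes g: "times_differentiable 2 g" and z: "\<And>x. norm x > r \<Longrightarrow> g x = 0" and b: "b \<in> Basis"
  shows "(LBINT x. partial b g x) = 0"
proof -
  have g1: "times_differentiable 1 g" using g times_diff_mono[of 2 g 1] by simp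
  have cg: "continuous_on UNIV g" by (rule times_diff_continuous[OF g1 order_refl])
  have cp: "continuous_on UNIV (partial b g)"
    using g b by (intro times_diff_continuous[of 1]) (auto simp: numeral_eq_Suc)
  \<comment> \<open>Difference quotients with step at most 1 vanish outside radius r + 1, and the
    mean value points inside it have norm at most r + 2.\<close>
  obtain M where M: "\<And>x. x \<in> cball 0 (r + 2) \<Longrightarrow> norm (partial b g x) \<le> M"
    using compact_imp_bounded[OF compact_continuous_image[OF continuous_on_subset[OF cp] compact_cball]]
    unfolding bounded_iff by (metis imageI subset_UNIV)
  define s where "s n = 1 / real (Suc n)" for n
  have s: "s n > 0" "s n \<le> 1" for n by (auto simp: s_def)
  have s0: "s \<longlonglongrightarrow> 0" unfolding s_def using LIMSEQ_inverse_real_of_nat by (simp add: inverse_eq_divide)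
  have ig: "integrable lborel g" by (rule integrable_continuous_support[OF cg z])
  have ig': "integrable lborel (\<lambda>x. g (x + c))" and eq: "(LBINT x. g (x + c)) = (LBINT x. g x)" for c
    using ig integral_distr[of "(+) c" lborel borel g] integrable_distr_eq[of "(+) c" lborel borel g]
      lborel_distr_plus[of c] borel_measurable_continuous_onI[OF cg]
    by (simp_all add: add.commute)
  define D where "D n x = (g (x + s n *\<^sub>R b) - g x) / s n" for n x
  have mv: "\<exists>\<xi>. 0 < \<xi> \<and> \<xi> < s n \<and> D n x = partial b g (x + \<xi> *\<^sub>R b)" for n x
    using partial_mvt[OF g1 s(1)[of n], of x b] s(1)[of n] by (fastforce simp: D_def)
  have "(\<lambda>n. \<integral>x. D n x \<partial>lborel) \<longlonglongrightarrow> (LBINT x. partial b g x)"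
  proof (rule integral_dominated_convergence[where w = "\<lambda>x. M * indicat_real (cball 0 (r + 1)) x"])
    show "partial b g \<in> borel_measurable lborel" using cp borel_measurable_continuous_onI by auto
    show "D n \<in> borel_measurable lborel" for n
      unfolding D_def using borel_measurable_continuous_onI[OF cg] by measurable
    show "integrable lborel (\<lambda>x. M * indicat_real (cball 0 (r + 1)) x)"
      by (rule integrable_mult_right)
        (use integrable_real_indicator[OF _ emeasure_lborel_cball_finite] in auto)
    show "AE x in lborel. (\<lambda>n. D n x) \<longlonglongrightarrow> partial b g x"
    proof (rule AE_I2)
      fix x
      have "\<forall>n. \<exists>\<xi>. 0 < \<xi> \<and> \<xi> < s n \<and> D n x = partial b g (x + \<xi> *\<^sub>R b)"
        using mv by blast
      from choice[OF this] obtain \<xi> where x: "\<And>n. 0 < \<xi> n \<and> \<xi> n < s n \<and> D n x = partial b g (x + \<xi> n *\<^sub>R b)"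
        by auto
      have "\<xi> \<longlonglongrightarrow> 0"
        using tendsto_sandwich[OF always_eventually always_eventually tendsto_const s0, of \<xi>] x
        by (force intro: less_imp_le)
      then have "(\<lambda>n. x + \<xi> n *\<^sub>R b) \<longlonglongrightarrow> x" by (auto intro!: tendsto_eq_intros)
      then have "(\<lambda>n. partial b g (x + \<xi> n *\<^sub>R b)) \<longlonglongrightarrow> partial b g x"
        using cp by (auto simp: continuous_on_eq_continuous_at intro: isCont_tendsto_compose)
      then show "(\<lambda>n. D n x) \<longlonglongrightarrow> partial b g x" using x by simp
    qed
    show "AE x in lborel. norm (D n x) \<le> M * indicat_real (cball 0 (r + 1)) x" for n
    proof (rule AE_I2)
      fix x
      show "norm (D n x) \<le> M * indicat_real (cball 0 (r + 1)) x"
      proof (cases "norm x \<le> r + 1")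
        case True
        obtain \<xi> where x: "0 < \<xi>" "\<xi> < s n" "D n x = partial b g (x + \<xi> *\<^sub>R b)" using mv by blast
        have "norm (x + \<xi> *\<^sub>R b) \<le> r + 2"
          using norm_triangle_ineq[of x "\<xi> *\<^sub>R b"] x True s(2)[of n] b by simp
        then show ?thesis using M True x by (simp add: indicator_def)
      next
        case False
        have "norm x \<le> norm (x + s n *\<^sub>R b) + s n"
          using norm_triangle_ineq4[of "x + s n *\<^sub>R b" "s n *\<^sub>R b"] b s[of n] by simp
        then have "norm (x + s n *\<^sub>R b) > r" using False s(2)[of n] by linarith
        then show ?thesis using z False by (simp add: D_def)
      qed
    qed
  qed
  moreover have "(LBINT x. D n x) = 0" for n
    unfolding D_def using ig ig' eq by simp
  ultimately show ?thesis by (simp add: LIMSEQ_const_iff)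
qed

declare times_differentiable.simps(2) [simp del]

lemma times_diff_Suc_0D [simp]: "times_differentiable (Suc 0) g \<Longrightarrow> g differentiable (at p)"
  by (rule times_differentiableD[of "Suc 0"]) auto

section \<open>Translation and rotation fields\<close>

text \<open>The index (False, i) is the i-th translation and (True, j) the rotation
  \<open>V j\<close>. One index type for all six fields lets the diffusion be a single sum whose
  coefficient depends only on the tag \<open>fst a\<close>.\<close>

definition field_dir :: "bool \<times> 3 \<Rightarrow> real^3 \<Rightarrow> real^3" where
  "field_dir a v = (if fst a then cross3 v (axis (snd a) 1) else axis (snd a) 1)"

definition field :: "bool \<times> 3 \<Rightarrow> (real^3 \<Rightarrow> real) \<Rightarrow> real^3 \<Rightarrow> real" where
  "field a g v = (\<Sum>i\<in>UNIV. field_dir a v $ i * partial (axis i 1) g v)"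

lemma sum_bool_3: "(\<Sum>a\<in>(UNIV :: (bool \<times> 3) set). g a) = (\<Sum>i\<in>UNIV. g (False, i)) + (\<Sum>j\<in>UNIV. g (True, j))"
proof -
  have "(\<Sum>a\<in>(UNIV :: (bool \<times> 3) set). g a) = (\<Sum>b\<in>UNIV. \<Sum>i\<in>UNIV. g (b, i))"
    by (simp add: sum.cartesian_product flip: UNIV_Times_UNIV)
  then show ?thesis by (simp add: UNIV_bool)
qed

lemma axis_Basis [simp]: "axis i (1::real) \<in> Basis"
  by (auto simp: Basis_vec_def)

text \<open>Written as a triple product, a component of a rotation is visibly linear in v. Its i-th
  component does not involve the i-th coordinate, since \<open>cross3 (axis j 1) (axis i 1)\<close>
  is orthogonal to \<open>axis i 1\<close>.\<close>

lemma field_dir_nth: "field_dir a v $ i =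
    (if fst a then v \<bullet> cross3 (axis (snd a) 1) (axis i 1) else axis (snd a) 1 $ i)"
  using exhaust_3[of i] exhaust_3[of "snd a"]
  by (auto simp: field_dir_def cross3_def inner_vec_def sum_3 axis_def vector_3)

lemma times_diff_field_dir: "times_differentiable n (\<lambda>v. field_dir a v $ i)"
  unfolding field_dir_nth by (cases "fst a") auto

lemma times_diff_field [intro]:
  "times_differentiable (Suc n) g \<Longrightarrow> times_differentiable n (field a g)"
  unfolding field_def
  by (intro times_diff_sum times_diff_mult times_diff_field_dir
      times_diff_partial axis_Basis)

lemma times_diff_field':
  "times_differentiable m g \<Longrightarrow> Suc n \<le> m \<Longrightarrow> times_differentiable n (field a g)"
  by (rule times_diff_field) (rule times_diff_mono)

lemma field_False: "field (False, i) g = partial (axis i 1) g"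
  by (rule ext) (simp add: field_def field_dir_def axis_def if_distrib[of "\<lambda>x. x * _"] cong: if_cong)

lemma field_const [simp]: "field a (\<lambda>x. c) v = 0"
  by (simp add: field_def)

lemma field_inner [simp]: "field a (\<lambda>x. x \<bullet> k) v = field_dir a v \<bullet> k"
proof -
  have "field a (\<lambda>x. x \<bullet> k) v = (\<Sum>i\<in>UNIV. field_dir a v $ i * k $ i)"
    by (simp add: field_def inner_axis' )
  then show ?thesis by (simp add: inner_vec_def)
qed

lemma field_add:
  "times_differentiable 1 g \<Longrightarrow> times_differentiable 1 h \<Longrightarrow>
    field a (\<lambda>x. g x + h x) v = field a g v + field a h v"
  by (simp add: field_def partial_add distrib_left sum.distrib)

lemma field_diff:
  "times_differentiable 1 g \<Longrightarrow> times_differentiable 1 h \<Longrightarrow>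
    field a (\<lambda>x. g x - h x) v = field a g v - field a h v"
  by (simp add: field_def partial_diff right_diff_distrib sum_subtractf)

lemma field_sum:
  "finite I \<Longrightarrow> (\<And>i. i \<in> I \<Longrightarrow> times_differentiable 1 (g i)) \<Longrightarrow>
    field a (\<lambda>x. \<Sum>i\<in>I. g i x) v = (\<Sum>i\<in>I. field a (g i) v)"
  by (induction I rule: finite_induct) (auto simp: field_add intro!: field_add[THEN trans] times_diff_sum simp del: One_nat_def)

lemma field_mult:
  "times_differentiable 1 g \<Longrightarrow> times_differentiable 1 h \<Longrightarrow>
    field a (\<lambda>x. g x * h x) v = g v * field a h v + field a g v * h v"
  by (simp add: field_def partial_mult distrib_left sum.distrib sum_distrib_left sum_distrib_right algebra_simps)

lemma field_cmult:
  "times_differentiable 1 g \<Longrightarrow> field a (\<lambda>x. c * g x) v = c * field a g v"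
  using field_mult[of "\<lambda>x. c" g a v] by simp

lemma field_chain:
  assumes "times_differentiable 1 g" "(\<phi> has_real_derivative d) (at (g v))"
  shows "field a (\<lambda>x. \<phi> (g x)) v = d * field a g v"
  using assms by (simp add: field_def partial_chain[where d = d] sum_distrib_left algebra_simps)

lemma field_powr:
  assumes "times_differentiable 1 g" "g v > 0"
  shows "field a (\<lambda>x. g x powr s) v = s * g v powr (s - 1) * field a g v"
  by (rule field_chain[OF assms(1)]) (use assms(2) in \<open>auto intro!: derivative_eq_intros\<close>)

lemma field_eq_0:
  assumes "\<And>x. norm x > r \<Longrightarrow> g x = 0" "norm v > r"
  shows "field a g v = 0"
proof -
  have "open {x::real^3. norm x > r}" by (intro open_Collect_less continuous_intros)
  then have "(g has_derivative (\<lambda>x. 0)) (at v)"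
    by (intro has_derivative_transform_within_open[OF has_derivative_const[of 0], of "{x. norm x > r}"])
       (use assms in auto)
  then have "partial b g v = 0" for b by (simp add: partial_eqI)
  then show ?thesis by (simp add: field_def)
qed

text \<open>All six directions are divergence free, so the field applied to g is a sum of pure
  partial derivatives. Every integration by parts in v below is this lemma applied to a
  product.\<close>

lemma integral_field_eq_0:
  assumes g: "times_differentiable 2 g" and z: "\<And>x. norm x > r \<Longrightarrow> g x = 0"
  shows "(LBINT v. field a g v) = 0"
proof -
  have g1: "times_differentiable 1 g" using g times_diff_mono[of 2 g 1] by simp
  have p: "partial (axis i 1) (\<lambda>v. field_dir a v $ i) v = 0" for i v
    unfolding field_dir_nth by (cases "fst a") (simp_all add: dot_cross_self)
  have *: "field a g v = (\<Sum>i\<in>UNIV. partial (axis i 1) (\<lambda>v. field_dir a v $ i * g v) v)" for v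
    unfolding field_def
    using g1 by (intro sum.cong refl)
      (simp add: partial_mult times_differentiableD[OF times_diff_field_dir order_refl] p)
  have t: "times_differentiable 2 (\<lambda>v. field_dir a v $ i * g v)" for i
    by (intro times_diff_mult times_diff_field_dir g)
  have zz: "norm v > r \<Longrightarrow> partial (axis i 1) (\<lambda>v. field_dir a v $ i * g v) v = 0" for i v
    using field_eq_0[of r "\<lambda>v. field_dir a v $ i * g v" v "(False, i)"] z
    by (simp add: field_def field_dir_def axis_def if_distrib[of "\<lambda>x. x * _"] cong: if_cong)
  have "integrable lborel (partial (axis i 1) (\<lambda>v. field_dir a v $ i * g v))" for i
    using t[of i] zz
    by (intro integrable_continuous_support[of _ r] times_diff_continuous[of 1])
       (auto simp: numeral_2_eq_2 intro!: times_diff_partial)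
  then show ?thesis
    unfolding * using integral_partial_eq_0[OF t, of r] z by simp
qed

text \<open>The best choice of s is sqrt b / sqrt a. Adding e > 0 to both roots keeps this quotient
  defined and positive when a root vanishes; then e tends to 0.\<close>

lemma real_le_sqrt_mult:
  fixes a b W :: real
  assumes "a \<ge> 0" "b \<ge> 0" "\<And>s. s > 0 \<Longrightarrow> 2 * \<bar>W\<bar> \<le> s * a + b / s"
  shows "\<bar>W\<bar> \<le> sqrt a * sqrt b"
proof -
  have "((\<lambda>e. (sqrt a + e) * (sqrt b + e)) \<longlongrightarrow> (sqrt a + 0) * (sqrt b + 0)) (at_right 0)"
    by (intro tendsto_intros)
  moreover have "\<forall>\<^sub>F e in at_right 0. \<bar>W\<bar> \<le> (sqrt a + e) * (sqrt b + e)"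
    using eventually_at_right_less[of 0]
  proof eventually_elim
    case (elim e)
    define a' b' where "a' = sqrt a + e" and "b' = sqrt b + e"
    have pos: "a' > 0" "b' > 0" using assms elim by (auto simp: a'_def b'_def add_nonneg_pos)
    have le: "a \<le> a'^2" "b \<le> b'^2"
      using assms(1,2) elim by (auto simp: a'_def b'_def power2_sum)
    have "2 * \<bar>W\<bar> \<le> b' / a' * a + b / (b' / a')"
      using assms(3)[of "b' / a'"] pos by simp
    also have "\<dots> \<le> b' / a' * a'^2 + b'^2 / (b' / a')"
      using pos le by (intro add_mono mult_left_mono divide_right_mono) auto
    also have "\<dots> = 2 * (a' * b')" using pos by (simp add: power2_eq_square)
    finally show ?case by (simp add: a'_def b'_def)
  qed
  ultimately show ?thesis
    using tendsto_lowerbound by fastforce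
qed

lemma four_mult_le_square: "4 * (a * b) \<le> (a + b)^2" for a b :: real
  using zero_le_power2[of "a - b"] unfolding power2_sum power2_diff by (simp add: algebra_simps)

text \<open>The hypothesis is pointwise, so that w may itself be a sum of products already bounded
  by a finite Cauchy-Schwarz inequality, and weights can be distributed freely between \<alpha> and
  \<beta>.\<close>

lemma integral_cauchy_schwarz:
  fixes w \<alpha> \<beta> :: "'a \<Rightarrow> real"
  assumes i: "integrable M w" "integrable M \<alpha>" "integrable M \<beta>"
    and le: "\<And>x. \<alpha> x \<ge> 0" "\<And>x. \<beta> x \<ge> 0" "\<And>x. (w x)^2 \<le> \<alpha> x * \<beta> x"
  shows "\<bar>\<integral>x. w x \<partial>M\<bar> \<le> sqrt (\<integral>x. \<alpha> x \<partial>M) * sqrt (\<integral>x. \<beta> x \<partial>M)"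
proof (rule real_le_sqrt_mult)
  fix s :: real assume s: "s > 0"
  have p: "2 * \<bar>w x\<bar> \<le> s * \<alpha> x + \<beta> x / s" for x
  proof (rule power2_le_imp_le)
    have "(2 * \<bar>w x\<bar>)^2 \<le> 4 * (\<alpha> x * \<beta> x)" using le(3)[of x] by (simp add: power2_eq_square)
    also have "\<dots> = 4 * ((s * \<alpha> x) * (\<beta> x / s))" using s by simp
    also have "\<dots> \<le> (s * \<alpha> x + \<beta> x / s)^2"
      by (rule four_mult_le_square)
    finally show "(2 * \<bar>w x\<bar>)^2 \<le> (s * \<alpha> x + \<beta> x / s)^2" .
    show "0 \<le> s * \<alpha> x + \<beta> x / s" using s le by simp
  qed
  have "2 * \<bar>\<integral>x. w x \<partial>M\<bar> \<le> 2 * (\<integral>x. \<bar>w x\<bar> \<partial>M)" by simp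
  also have "\<dots> = (\<integral>x. 2 * \<bar>w x\<bar> \<partial>M)" by simp
  also have "\<dots> \<le> (\<integral>x. s * \<alpha> x + \<beta> x / s \<partial>M)"
    by (intro integral_mono p) (use i in auto)
  also have "\<dots> = s * (\<integral>x. \<alpha> x \<partial>M) + (\<integral>x. \<beta> x \<partial>M) / s" using i by simp
  finally show "2 * \<bar>\<integral>x. w x \<partial>M\<bar> \<le> s * (\<integral>x. \<alpha> x \<partial>M) + (\<integral>x. \<beta> x \<partial>M) / s" .
qed (use le in auto)

lemma japanese_powr: "japanese v powr s = (1 + v \<bullet> v) powr (s / 2)"
proof -
  have "1 + v \<bullet> v > 0" by (simp add: add_pos_nonneg)
  then show ?thesis
    by (simp add: japanese_def power2_norm_eq_inner powr_half_sqrt[symmetric] powr_powr)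
qed

lemma one_plus_inner_pos [simp]: "1 + v \<bullet> v > (0::real)"
  by (simp add: add_pos_nonneg)

lemma japanese_ge_1: "japanese v \<ge> 1"
  by (simp add: japanese_def)

lemma norm_le_japanese: "norm v \<le> japanese v"
  by (simp add: japanese_def real_le_rsqrt)

lemma times_diff_quadratic [intro, simp]: "times_differentiable n (\<lambda>v::'a::euclidean_space. v \<bullet> v)"
proof -
  have "(\<lambda>v::'a. v \<bullet> v) = (\<lambda>v. \<Sum>b\<in>Basis. (v \<bullet> b) * (v \<bullet> b))"
    using euclidean_inner by auto
  then show ?thesis
    by (simp only:) (intro times_diff_sum times_diff_mult times_diff_inner)
qed

lemma field_quadratic [simp]: "field a (\<lambda>v. v \<bullet> v) v = 2 * (v \<bullet> field_dir a v)"
proof -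
  have "((\<lambda>v::real^3. v \<bullet> v) has_derivative (\<lambda>h. v \<bullet> h + h \<bullet> v)) (at v)" for v
    by (auto intro!: derivative_eq_intros)
  from partial_eqI[OF this] show ?thesis
    by (simp add: field_def inner_axis inner_axis' inner_vec_def[of v "field_dir a v"] sum_distrib_left algebra_simps)
qed

lemma abs_inner_field_dir: "\<bar>v \<bullet> field_dir a v\<bar> \<le> norm v"
  using component_le_norm_cart[of v "snd a"]
  by (cases "fst a") (auto simp: field_dir_def dot_cross_self inner_axis)

lemma times_diff_japanese [intro, simp]: "times_differentiable n (\<lambda>v. japanese v powr s)"
  unfolding japanese_powr by (intro times_diff_powr) auto

text \<open>Rotations annihilate radial functions and translations would even gain a power of <v>;
  keeping the order s gives one bound for all six fields.\<close>

lemma field_japanese: "\<bar>field a (\<lambda>v. japanese v powr s) v\<bar> \<le> \<bar>s\<bar> * japanese v powr s"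
proof -
  have J: "japanese v \<ge> 1" by (rule japanese_ge_1)
  have "field a (\<lambda>v. japanese v powr s) v = s / 2 * (1 + v \<bullet> v) powr (s / 2 - 1) * (2 * (v \<bullet> field_dir a v))"
    unfolding japanese_powr by (subst field_powr) (auto simp: field_add)
  also have "(1 + v \<bullet> v) powr (s / 2 - 1) = japanese v powr (s - 2)"
    by (simp add: japanese_powr diff_divide_distrib)
  finally have "\<bar>field a (\<lambda>v. japanese v powr s) v\<bar> = \<bar>s\<bar> * japanese v powr (s - 2) * \<bar>v \<bullet> field_dir a v\<bar>"
    by (simp add: abs_mult)
  also have "\<dots> \<le> \<bar>s\<bar> * japanese v powr (s - 2) * (japanese v * japanese v)"
    using abs_inner_field_dir[of v a] norm_le_japanese[of v] J mult_mono[of 1 "japanese v" "norm v" "japanese v"]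
    by (intro mult_left_mono) auto
  also have "\<dots> = \<bar>s\<bar> * japanese v powr s"
    using J powr_add[of "japanese v" "s - 2" 2] by (simp add: power2_eq_square mult.assoc)
  finally show ?thesis .
qed

text \<open>The outer derivative meets the coefficients of the rotation, which are linear, so the
  commutator is a combination of translations with constant coefficients.\<close>

lemma field_commute:
  assumes "times_differentiable 3 g"
  shows "field (False, i) (field (True, j) g) v = field (True, j) (field (False, i) g) v
     + (\<Sum>l\<in>UNIV. cross3 (axis i 1) (axis j 1) $ l * field (False, l) g v)"
proof -
  have t: "times_differentiable 1 (partial (axis l 1) g)" for l
    using assms by (auto simp: numeral_eq_Suc times_differentiable.simps)
  have cr: "axis i 1 \<bullet> cross3 (axis j 1) (axis l 1) = cross3 (axis i 1) (axis j 1) $ l" for l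
    using exhaust_3[of i] exhaust_3[of j] exhaust_3[of l]
    by (auto simp: cross3_def inner_vec_def sum_3 axis_def vector_3)
  have "partial (axis i 1) (\<lambda>v. \<Sum>l\<in>UNIV. field_dir (True, j) v $ l * partial (axis l 1) g v) v
    = (\<Sum>l\<in>UNIV. field_dir (True, j) v $ l * partial (axis i 1) (partial (axis l 1) g) v
       + axis i 1 \<bullet> cross3 (axis j 1) (axis l 1) * partial (axis l 1) g v)"
    using t by (subst partial_sum)
      (auto simp: partial_mult field_dir_nth intro!: derivative_intros times_differentiableD[of 1])
  also have "\<dots> = field (True, j) (partial (axis i 1) g) v
     + (\<Sum>l\<in>UNIV. cross3 (axis i 1) (axis j 1) $ l * partial (axis l 1) g v)"
    unfolding field_def cr sum.distrib using partial_commute[OF assms axis_Basis axis_Basis] by simp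
  finally have "partial (axis i 1) (field (True, j) g) v = field (True, j) (partial (axis i 1) g) v
     + (\<Sum>l\<in>UNIV. cross3 (axis i 1) (axis j 1) $ l * partial (axis l 1) g v)"
    unfolding field_def[of "(True, j)" g, abs_def] .
  then show ?thesis unfolding field_False .
qed

text \<open>Using the commutator twice leaves twice the second derivatives in i and l summed against
  \<open>cross3 (axis i 1) (axis j 1) $ l\<close>. This coefficient is antisymmetric in i and l
  while the second derivatives are symmetric, so the sum vanishes.\<close>

lemma field_rotation_laplacian:
  assumes g: "times_differentiable 4 g"
  shows "(\<Sum>i\<in>UNIV. field (False, i) (field (False, i) (field (True, j) g)) v)
       = field (True, j) (\<lambda>w. \<Sum>i\<in>UNIV. field (False, i) (field (False, i) g) w) v"
proof -
  have g3: "times_differentiable 3 g" using g times_diff_mono[of 4 g 3] by simp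
  have gF: "times_differentiable 3 (field (False, i) g)" "times_differentiable 2 (field (False, i) g)" 
    "times_differentiable 1 (field (False, i) g)" for i
    using times_diff_field'[OF g] by auto
  let ?c = "\<lambda>i l. cross3 (axis i 1) (axis j 1) $ l"
  have 1: "field (False, i) (field (True, j) g) = (\<lambda>w. field (True, j) (field (False, i) g) w
     + (\<Sum>l\<in>UNIV. ?c i l * field (False, l) g w))" for i
    using field_commute[OF g3] by auto
  have sym: "field (False, i) (field (False, l) g) v = field (False, l) (field (False, i) g) v" for i l
    unfolding field_False by (rule partial_commute[OF g3]) auto
  have 2: "field (False, i) (field (False, i) (field (True, j) g)) v
     = field (True, j) (field (False, i) (field (False, i) g)) v
       + 2 * (\<Sum>l\<in>UNIV. ?c i l * field (False, i) (field (False, l) g) v)" for i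
  proof -
    have td: "times_differentiable 1 (\<lambda>w. field (True, j) (field (False, i) g) w)"
      using times_diff_field'[OF gF(1)] by auto
    have "field (False, i) (field (False, i) (field (True, j) g)) v
      = field (False, i) (field (True, j) (field (False, i) g)) v
       + (\<Sum>l\<in>UNIV. ?c i l * field (False, i) (field (False, l) g) v)"
      unfolding 1 using td gF(3)
      by (subst field_add) (auto simp: field_sum field_cmult times_diff_mult simp del: One_nat_def intro!: times_diff_sum)
    then show ?thesis
      unfolding field_commute[OF gF(1)[of i]]
      using sym[of _ i] by simp
  qed
  have skew: "(\<Sum>i\<in>UNIV. \<Sum>l\<in>UNIV. ?c i l * field (False, i) (field (False, l) g) v) = 0"
    using exhaust_3[of j] sym[of 1 2] sym[of 1 3] sym[of 2 3]
    by (auto simp: sum_3 cross3_def axis_def vector_3)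
  have td2: "times_differentiable 1 (field (False, i) (field (False, i) g))" for i
    using times_diff_field'[OF gF(1)] by auto
  show ?thesis
    unfolding 2 sum.distrib using td2 skew
    by (simp add: field_sum flip: sum_distrib_left del: One_nat_def)
qed

section \<open>The symbol and the weights built from it\<close>

definition symb :: "real^3 \<Rightarrow> real^3 \<Rightarrow> real" where
  "symb k v = (\<Sum>a\<in>UNIV. (field_dir a v \<bullet> k)^2)"

lemma symb_eq: "symb k v = (1 + v \<bullet> v) * (k \<bullet> k) - (v \<bullet> k) * (v \<bullet> k)"
  by (simp add: symb_def sum_bool_3 sum_3 field_dir_def inner_vec_def cross3_def axis_def vector_3
      power2_eq_square algebra_simps)

lemma symb_cross: "symb k v = (norm k)^2 + (norm (cross3 v k))^2"
  unfolding symb_eq power2_norm_eq_inner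
  by (simp add: inner_vec_def cross3_def sum_3 vector_3 algebra_simps)

lemma norm_le_symb: "(norm k)^2 \<le> symb k v" and cross_le_symb: "(norm (cross3 v k))^2 \<le> symb k v"
  by (simp_all add: symb_cross)

lemma symb_pos: "k \<noteq> 0 \<Longrightarrow> symb k v > 0"
  unfolding symb_cross by (simp add: add_pos_nonneg)

lemma times_diff_symb [intro, simp]: "times_differentiable n (symb k)"
  unfolding symb_eq[abs_def] by (intro times_diff_diff times_diff_mult
      times_diff_add times_diff_const times_diff_inner times_diff_quadratic)

lemma times_diff_field_dir_inner [intro, simp]: "times_differentiable n (\<lambda>v. field_dir a v \<bullet> k)"
  unfolding inner_vec_def by (auto intro!: times_diff_sum times_diff_mult times_diff_field_dir)

text \<open>For translations and rotations alike the derivative is at most <v> times 2 |k| |v \<and>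
  k|, which the inequality of the means bounds by <v> times |k|^2 + |v \<and> k|^2.\<close>

lemma field_symb: "\<bar>field a (symb k) v\<bar> \<le> japanese v * symb k v"
proof -
  have "field a (symb k) v = 2 * (v \<bullet> field_dir a v) * (k \<bullet> k) - 2 * (v \<bullet> k) * (field_dir a v \<bullet> k)"
    unfolding symb_eq[abs_def]
    by (simp add: field_diff field_mult field_add times_diff_diff times_diff_mult times_diff_add del: One_nat_def)
  also have "\<bar>\<dots>\<bar> \<le> japanese v * (2 * (norm k * norm (cross3 v k)))"
  proof (cases "fst a")
    case True
    then have e: "v \<bullet> field_dir a v = 0" "field_dir a v \<bullet> k = - cross3 v k $ snd a"
      using exhaust_3[of "snd a"]
      by (auto simp: field_dir_def dot_cross_self cross3_def inner_vec_def axis_def sum_3 vector_3)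
    have "\<bar>2 * (v \<bullet> k) * (field_dir a v \<bullet> k)\<bar> = 2 * (\<bar>v \<bullet> k\<bar> * \<bar>cross3 v k $ snd a\<bar>)"
      using e by (simp add: abs_mult)
    also have "\<dots> \<le> 2 * ((japanese v * norm k) * norm (cross3 v k))"
      using Cauchy_Schwarz_ineq2[of v k] mult_right_mono[OF norm_le_japanese[of v], of "norm k"]
        component_le_norm_cart[of "cross3 v k" "snd a"]
      by (intro mult_left_mono mult_mono) auto
    finally show ?thesis using e by (simp add: mult_ac)
  next
    case False
    \<comment> \<open>This is k \<and> (v \<and> k); as the two factors are orthogonal, its norm is
      the product of their norms.\<close>
    define w where "w = (k \<bullet> k) *\<^sub>R v - (v \<bullet> k) *\<^sub>R k"
    have "2 * (v \<bullet> field_dir a v) * (k \<bullet> k) - 2 * (v \<bullet> k) * (field_dir a v \<bullet> k) = 2 * w $ snd a"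
      using False by (simp add: field_dir_def w_def inner_axis inner_axis' algebra_simps)
    moreover have "norm w = norm k * norm (cross3 v k)"
    proof (rule power2_eq_imp_eq)
      have n: "(norm (cross3 v k))^2 = (v \<bullet> v) * (k \<bullet> k) - (v \<bullet> k)^2"
        by (simp add: norm_cross power2_norm_eq_inner[symmetric])
      show "(norm w)^2 = (norm k * norm (cross3 v k))^2"
        unfolding power_mult_distrib n unfolding power2_norm_eq_inner w_def
        by (simp add: inner_diff_left inner_diff_right inner_commute power2_eq_square algebra_simps)
    qed auto
    moreover have "\<bar>w $ snd a\<bar> \<le> norm w" by (rule component_le_norm_cart)
    ultimately have "\<bar>2 * (v \<bullet> field_dir a v) * (k \<bullet> k) - 2 * (v \<bullet> k) * (field_dir a v \<bullet> k)\<bar>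
      \<le> 1 * (2 * (norm k * norm (cross3 v k)))" by simp
    also have "\<dots> \<le> japanese v * (2 * (norm k * norm (cross3 v k)))"
      using japanese_ge_1[of v] by (intro mult_right_mono) auto
    finally show ?thesis .
  qed
  also have "\<dots> \<le> japanese v * symb k v"
    unfolding symb_cross using japanese_ge_1[of v] sum_squares_bound[of "norm k" "norm (cross3 v k)"]
    by (intro mult_left_mono) auto
  finally show ?thesis .
qed

text \<open>The translations contribute nothing. The sum of squares of the rotations is the
  spherical Laplacian, whose eigenvalue -l(l+1) on linear functions is -2.\<close>

lemma div_field_dir: "(\<Sum>a\<in>UNIV. field a (\<lambda>w. field_dir a w \<bullet> k) v) = - 2 * (v \<bullet> k)"
proof -
  have "field a (\<lambda>w. field_dir a w \<bullet> k) v =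
     (if fst a then field_dir a v \<bullet> (\<Sum>i\<in>UNIV. k $ i *\<^sub>R cross3 (axis (snd a) 1) (axis i 1)) else 0)" for a
  proof -
    have "(\<lambda>w. field_dir a w \<bullet> k) =
      (if fst a then (\<lambda>w. w \<bullet> (\<Sum>i\<in>UNIV. k $ i *\<^sub>R cross3 (axis (snd a) 1) (axis i 1)))
       else (\<lambda>w. axis (snd a) 1 \<bullet> k))"
      by (auto simp: fun_eq_iff inner_vec_def[of _ k] field_dir_nth inner_sum_right mult.commute)
    then show ?thesis by simp
  qed
  then show ?thesis
    by (simp add: sum_bool_3 sum_3 field_dir_def inner_vec_def cross3_def axis_def vector_3 algebra_simps)
qed

text \<open>As the symbol dominates |k|^2 and |v \<and> k|^2, \<open>rho\<close> dominates both
  Fourier weights to be estimated. Its partner \<open>mult_weight\<close> is fixed by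
  \<open>mult_weight_symb\<close> and \<open>mult_weight_square\<close>, the two identities that the
  multiplier needs.\<close>

definition rho :: "real \<Rightarrow> real^3 \<Rightarrow> real^3 \<Rightarrow> real" where
  "rho \<gamma> k v = japanese v powr (\<gamma> / 3) * symb k v powr (1 / 3)"

definition mult_weight :: "real \<Rightarrow> real^3 \<Rightarrow> real^3 \<Rightarrow> real" where
  "mult_weight \<gamma> k v = japanese v powr (2 * \<gamma> / 3) * symb k v powr (- 1 / 3)"

lemma japanese_pos [simp]: "japanese v > 0"
  using japanese_ge_1[of v] by linarith

lemma japanese_mult_powr: "japanese v powr a * japanese v powr b = japanese v powr (a + b)"
  by (simp add: powr_add)

lemma japanese_square: "(japanese v)^2 = japanese v powr 2"
  using japanese_pos[of v] by (simp only: powr_numeral)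

lemma
  assumes "k \<noteq> 0"
  shows rho_pos: "rho \<gamma> k v > 0"
    and mult_weight_pos: "mult_weight \<gamma> k v > 0"
    and times_diff_rho: "times_differentiable n (rho \<gamma> k)"
    and times_diff_mult_weight: "times_differentiable n (mult_weight \<gamma> k)"
    and mult_weight_symb: "mult_weight \<gamma> k v * symb k v = (rho \<gamma> k v)^2"
    and mult_weight_square: "(mult_weight \<gamma> k v)^2 * symb k v = japanese v powr \<gamma> * rho \<gamma> k v"
    and rho_cube: "rho \<gamma> k v ^ 3 = japanese v powr \<gamma> * symb k v"
proof -
  have q: "symb k v > 0" for v by (rule symb_pos[OF assms])
  show "rho \<gamma> k v > 0" "mult_weight \<gamma> k v > 0"
    unfolding rho_def mult_weight_def using q[of v] japanese_pos[of v]
    by (auto intro!: mult_pos_pos simp: less_imp_neq[symmetric] simp del: japanese_pos)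
  show "times_differentiable n (rho \<gamma> k)" "times_differentiable n (mult_weight \<gamma> k)"
    unfolding rho_def[abs_def] mult_weight_def[abs_def] using q
    by (intro times_diff_mult times_diff_powr[of _ "symb k"]
      times_diff_japanese times_diff_symb; simp)+
  have q1: "symb k v powr a * symb k v = symb k v powr (a + 1)" for a
    using q[of v] by (simp add: powr_add)
  have qq: "symb k v powr a * symb k v powr b = symb k v powr (a + b)" for a b
    by (simp add: powr_add)
  have "mult_weight \<gamma> k v * symb k v = japanese v powr (2 * \<gamma> / 3) * (symb k v powr (- 1 / 3) * symb k v)"
    unfolding mult_weight_def by (simp only: mult_ac)
  also have "\<dots> = japanese v powr (\<gamma> / 3 + \<gamma> / 3) * symb k v powr (1 / 3 + 1 / 3)"
    unfolding q1 by simp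
  also have "\<dots> = (rho \<gamma> k v)^2"
    unfolding rho_def power2_eq_square powr_add by (simp only: mult_ac)
  finally show "mult_weight \<gamma> k v * symb k v = (rho \<gamma> k v)^2" .
  have "(mult_weight \<gamma> k v)^2 * symb k v = (japanese v powr (2 * \<gamma> / 3) * japanese v powr (2 * \<gamma> / 3))
      * (symb k v powr (- 1 / 3) * (symb k v powr (- 1 / 3) * symb k v))"
    unfolding mult_weight_def power2_eq_square by (simp only: mult_ac)
  also have "\<dots> = japanese v powr (\<gamma> + \<gamma> / 3) * symb k v powr (1 / 3)"
    unfolding q1 qq japanese_mult_powr by simp
  also have "\<dots> = japanese v powr \<gamma> * rho \<gamma> k v"
    unfolding rho_def powr_add by (simp only: mult_ac)
  finally show "(mult_weight \<gamma> k v)^2 * symb k v = japanese v powr \<gamma> * rho \<gamma> k v" .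
  have "rho \<gamma> k v ^ 3 = (japanese v powr (\<gamma> / 3) * japanese v powr (\<gamma> / 3) * japanese v powr (\<gamma> / 3))
      * (symb k v powr (1 / 3) * symb k v powr (1 / 3) * symb k v powr (1 / 3))"
    unfolding rho_def power3_eq_cube by (simp only: mult_ac)
  also have "\<dots> = japanese v powr \<gamma> * symb k v"
    unfolding qq japanese_mult_powr using q[of v] by simp
  finally show "rho \<gamma> k v ^ 3 = japanese v powr \<gamma> * symb k v" .
qed

text \<open>The logarithmic derivatives of <v> and of the symbol along the fields are at most <v>,
  hence those of a product of their powers are controlled by the exponents.\<close>

lemma field_weight:
  assumes k: "k \<noteq> 0"
  shows "\<bar>field a (\<lambda>v. japanese v powr s * symb k v powr t) v\<bar>
     \<le> (\<bar>s\<bar> + \<bar>t\<bar>) * japanese v * (japanese v powr s * symb k v powr t)"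
proof -
  have q: "symb k v > 0" for v by (rule symb_pos[OF k])
  have J: "japanese v \<ge> 1" by (rule japanese_ge_1)
  have "field a (\<lambda>v. japanese v powr s * symb k v powr t) v
     = japanese v powr s * (t * symb k v powr (t - 1) * field a (symb k) v)
       + field a (\<lambda>v. japanese v powr s) v * symb k v powr t"
    using q by (subst field_mult) (auto simp: field_powr intro!: times_diff_powr)
  also have "\<bar>\<dots>\<bar> \<le> japanese v powr s * (\<bar>t\<bar> * symb k v powr (t - 1) * (japanese v * symb k v))
       + \<bar>s\<bar> * japanese v powr s * symb k v powr t"
    using field_symb[of a k v] field_japanese[of a s v]
    by (intro order_trans[OF abs_triangle_ineq] add_mono) (auto simp: abs_mult intro!: mult_left_mono mult_right_mono)
  also have "\<dots> \<le> japanese v powr s * (\<bar>t\<bar> * symb k v powr (t - 1) * (japanese v * symb k v))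
       + (\<bar>s\<bar> * japanese v powr s * symb k v powr t) * japanese v"
    using mult_left_mono[OF J, of "\<bar>s\<bar> * japanese v powr s * symb k v powr t"] by simp
  finally show ?thesis
    using q[of v] by (simp add: algebra_simps powr_diff)
qed

text \<open>In the application d is the norm of \<rho> u, \<Lambda> that of L u, T that of the
  multiplier applied to u, B the diffusion energy with weight \<rho>, H the norm of h and e that of
  <v>^(\<gamma>+2) u. Up to constants, with S = H + e: B and T^2 are at most S d, \<Lambda>^2 is at
  most S^2 + d sqrt B, and d^2 is at most (H + \<Lambda>) T. For d = S y^4 this gives S^2 y^8 of
  order at most S^2 y^5, impossible for large y.\<close>

lemma closing_inequality:
  fixes K H e d \<Lambda> B T :: real
  assumes K: "K \<ge> 1" and nn: "H \<ge> 0" "e \<ge> 0" "d \<ge> 0" "\<Lambda> \<ge> 0" "B \<ge> 0" "T \<ge> 0"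
    and B: "B \<le> 2 * K * (H * d + 12 * K * (e * d))"
    and T: "T^2 \<le> 2 * B + 58 * (e * d)"
    and D: "d^2 \<le> 2 * (sqrt (2 * H^2 + 2 * \<Lambda>^2) * T)"
    and L: "\<Lambda>^2 \<le> H * \<Lambda> + K * (d * sqrt B)"
  shows "d^2 + \<Lambda>^2 \<le> 400 * K^2 * (200 * K^2) ^ 8 * (H^2 + e^2)"
proof -
  define S where "S = H + e"
  have S0: "S \<ge> 0" "H \<le> S" "e \<le> S" using nn by (auto simp: S_def)
  have K2: "K * K \<ge> 1" using K mult_mono[of 1 K 1 K] by simp
  have "2 * K * (H * d + 12 * K * (e * d)) \<le> 24 * (K * K) * (S * d)"
  proof -
    have "H * d + 12 * K * (e * d) \<le> 12 * K * (H * d) + 12 * K * (e * d)"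
      using K nn mult_right_mono[of 1 "12 * K" "H * d"] by simp
    also have "\<dots> = 12 * K * (S * d)" by (simp add: S_def algebra_simps)
    finally show ?thesis using K mult_left_mono[of _ _ "2 * K"] by fastforce
  qed
  then have B1: "B \<le> 24 * (K * K) * (S * d)" using B by linarith
  have "e * d \<le> S * d" using S0 nn by (intro mult_right_mono) auto
  also have "\<dots> \<le> (K * K) * (S * d)" using K2 S0 nn mult_right_mono[of 1 "K * K" "S * d"] by simp
  finally have T1: "T^2 \<le> 106 * (K * K) * (S * d)" using T B1 by linarith
  have L2: "\<Lambda>^2 \<le> S^2 + 2 * K * (d * sqrt B)"
  proof -
    have "2 * (H * \<Lambda>) \<le> H^2 + \<Lambda>^2" using sum_squares_bound[of H \<Lambda>] by simp
    moreover have "H^2 \<le> S^2" using S0 nn by (intro power_mono) auto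
    ultimately show ?thesis using L by linarith
  qed
  \<comment> \<open>The fourth power makes all quantities integral powers of y: sqrt B and T are of
    order y^2 and \<Lambda> of order y^3.\<close>
  have key: "d \<le> S * y ^ 4 \<Longrightarrow> 1 \<le> y \<Longrightarrow> \<Lambda> \<le> 4 * K * y ^ 3 * S \<and> T \<le> 11 * K * y ^ 2 * S" for y
  proof -
    assume d: "d \<le> S * y ^ 4" and y: "1 \<le> y"
    have Sd: "S * d \<le> S * S * y ^ 4" using mult_left_mono[OF d S0(1)] by simp
    have "B \<le> 24 * (K * K) * (S * S * y ^ 4)"
      using B1 mult_left_mono[OF Sd, of "24 * (K * K)"] K2 by linarith
    also have "\<dots> \<le> (5 * K * y ^ 2 * S)^2"
      using zero_le_power2[of "K * y ^ 2 * S"] by (simp add: power2_eq_square power4_eq_xxxx algebra_simps)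
    finally have sB: "sqrt B \<le> 5 * K * y ^ 2 * S"
      using K y S0 by (intro real_le_lsqrt) (auto simp: nn)
    have "T^2 \<le> 106 * (K * K) * (S * S * y ^ 4)"
      using T1 mult_left_mono[OF Sd, of "106 * (K * K)"] K2 by linarith
    also have "\<dots> \<le> (11 * K * y ^ 2 * S)^2"
      using zero_le_power2[of "K * y ^ 2 * S"] by (simp add: power2_eq_square power4_eq_xxxx algebra_simps)
    finally have TT: "T \<le> 11 * K * y ^ 2 * S"
      using K y S0 by (intro power2_le_imp_le[of T]) auto
    have "d * sqrt B \<le> (S * y ^ 4) * (5 * K * y ^ 2 * S)"
      using d sB nn S0 y by (intro mult_mono) auto
    then have "2 * K * (d * sqrt B) \<le> 2 * K * ((S * y ^ 4) * (5 * K * y ^ 2 * S))"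
      using K by (intro mult_left_mono) auto
    also have "\<dots> = 10 * (K * y ^ 3 * S)^2" by (simp add: power2_eq_square numeral_eq_Suc algebra_simps)
    finally have "\<Lambda>^2 \<le> S^2 + 10 * (K * y ^ 3 * S)^2" using L2 by linarith
    also have "S^2 \<le> (K * y ^ 3 * S)^2"
    proof (rule power_mono)
      have "1 \<le> K * y ^ 3" using K y mult_mono[of 1 K 1 "y ^ 3"] by (simp add: one_le_power)
      then show "S \<le> K * y ^ 3 * S" using S0 mult_right_mono[of 1 "K * y ^ 3" S] by simp
    qed (use S0 in auto)
    also have "(K * y ^ 3 * S)^2 + 10 * (K * y ^ 3 * S)^2 \<le> (4 * K * y ^ 3 * S)^2"
      using zero_le_power2[of "K * y ^ 3 * S"] by (simp add: power2_eq_square algebra_simps)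
    finally have "\<Lambda> \<le> 4 * K * y ^ 3 * S" using K y S0 by (intro power2_le_imp_le[of \<Lambda>]) auto
    with TT show ?thesis by blast
  qed
  \<comment> \<open>Chosen to exceed 132 K^2, where 132 = 2 * 6 * 11 collects the constants met in
    the contradiction below.\<close>
  define M where "M = 200 * K^2"
  have M: "M \<ge> 1" using K2 by (simp add: M_def power2_eq_square)
  have dM: "d \<le> S * M ^ 4"
  proof (rule ccontr)
    assume "\<not> d \<le> S * M ^ 4"
    then have gt: "d > S * M ^ 4" by simp
    have Spos: "S > 0"
    proof (rule ccontr)
      assume "\<not> S > 0"
      then have "S = 0" using S0 by simp
      then have "T^2 \<le> 0" "d > 0" using T1 gt by simp_all
      then show False using D by simp
    qed
    define y where "y = root 4 (d / S)"
    have y4: "y ^ 4 = d / S" unfolding y_def using nn Spos by (intro real_root_pow_pos2) auto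
    have y0: "y \<ge> 0" unfolding y_def using nn Spos by simp
    have "M ^ 4 < y ^ 4" using gt Spos by (simp add: y4 field_simps)
    then have My: "M < y" using y0 power_less_imp_less_base by blast
    then have y1: "1 \<le> y" using M by linarith
    have d: "d = S * y ^ 4" using y4 Spos by simp
    have b: "\<Lambda> \<le> 4 * K * y ^ 3 * S" "T \<le> 11 * K * y ^ 2 * S" using key[OF _ y1] d by auto
    have "2 * H^2 + 2 * \<Lambda>^2 \<le> (6 * K * y ^ 3 * S)^2"
    proof -
      have "\<Lambda>^2 \<le> (4 * K * y ^ 3 * S)^2" using b nn by (intro power_mono) auto
      moreover have "H^2 \<le> (K * y ^ 3 * S)^2"
      proof (rule power_mono)
        have "1 \<le> K * y ^ 3" using K y1 mult_mono[of 1 K 1 "y ^ 3"] by (simp add: one_le_power)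
        then have "S \<le> K * y ^ 3 * S" using S0 mult_right_mono[of 1 "K * y ^ 3" S] by simp
        then show "H \<le> K * y ^ 3 * S" using S0 by linarith
      qed (use nn in auto)
      ultimately show ?thesis
        using zero_le_power2[of "K * y ^ 3 * S"] by (simp add: power2_eq_square algebra_simps)
    qed
    then have "sqrt (2 * H^2 + 2 * \<Lambda>^2) \<le> 6 * K * y ^ 3 * S"
      using K y1 S0 by (intro real_le_lsqrt) auto
    then have "sqrt (2 * H^2 + 2 * \<Lambda>^2) * T \<le> (6 * K * y ^ 3 * S) * (11 * K * y ^ 2 * S)"
      using b nn K y1 S0 by (intro mult_mono) auto
    then have "d^2 \<le> 2 * ((6 * K * y ^ 3 * S) * (11 * K * y ^ 2 * S))" using D by linarith
    then have "(S^2 * y ^ 5) * y ^ 3 \<le> (S^2 * y ^ 5) * (132 * K^2)"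
      by (simp add: d power2_eq_square numeral_eq_Suc algebra_simps)
    moreover have "S^2 * y ^ 5 > 0" using Spos y1 by simp
    ultimately have "y ^ 3 \<le> 132 * K^2" by (rule mult_left_le_imp_le)
    moreover have "y \<le> y ^ 3" using y1 by (simp add: self_le_power)
    ultimately show False using My K2 by (simp add: M_def power2_eq_square)
  qed
  have "\<Lambda> \<le> 4 * K * M ^ 3 * S" using key[OF dM M] by blast
  then have "\<Lambda>^2 \<le> (4 * K * M ^ 3 * S)^2" using nn by (intro power_mono) auto
  also have "\<dots> = 16 * K^2 * M ^ 6 * S^2" by (simp add: power2_eq_square numeral_eq_Suc)
  also have "\<dots> \<le> 16 * K^2 * M ^ 8 * S^2"
    using M by (intro mult_left_mono mult_right_mono power_increasing) auto
  finally have 1: "\<Lambda>^2 \<le> 16 * K^2 * M ^ 8 * S^2" .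
  have "d^2 \<le> (S * M ^ 4)^2" using dM nn by (intro power_mono) auto
  also have "\<dots> = 1 * (M ^ 8 * S^2)" by (simp add: power2_eq_square numeral_eq_Suc)
  also have "\<dots> \<le> K^2 * (M ^ 8 * S^2)"
    using K2 M by (intro mult_right_mono) (auto simp: power2_eq_square)
  finally have 2: "d^2 \<le> K^2 * M ^ 8 * S^2" by (simp add: mult_ac)
  have "S^2 \<le> 2 * (H^2 + e^2)"
    using sum_squares_bound[of H e] by (simp add: S_def power2_sum)
  then have "17 * K^2 * M ^ 8 * S^2 \<le> 17 * K^2 * M ^ 8 * (2 * (H^2 + e^2))"
    using M by (intro mult_left_mono) auto
  moreover have "0 \<le> K^2 * M ^ 8 * (H^2 + e^2)" using M by simp
  ultimately show ?thesis using 1 2 unfolding M_def by linarith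
qed

section \<open>Estimates at a fixed frequency\<close>

lemma japanese_neq_0 [simp]: "japanese v \<noteq> 0"
  using japanese_pos[of v] by linarith

lemma japanese_nonneg [simp]: "0 \<le> japanese v"
  using japanese_pos[of v] by linarith

text \<open>The final summation in the pointwise bound of \<open>energy\<close>, over opaque reals
  so that no product has to be expanded.\<close>

lemma energy_arith:
  fixes x :: real
  assumes "x \<le> y" "b \<le> b'" "g \<le> p" "e1 = g / 2" "e2 = p + y" "x = - p / 2 - b / 2" "e3 = b' / 2"
  shows "e1 \<le> e2 + e3"
  using assms by linarith

lemma half_abs_le: "2 * \<bar>X\<bar> \<le> Y \<Longrightarrow> - Y / 2 \<le> X" for X Y :: real
  by linarith

lemma minus_mult3_le: "- (2 * (a * b * c)) \<le> 2 * (\<bar>a\<bar> * (\<bar>b\<bar> * \<bar>c\<bar>))" for a b c :: real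
  using abs_ge_minus_self[of "a * b * c"] unfolding abs_mult mult.assoc by simp

text \<open>\<open>sig False\<close> stands for \<lambda> and \<open>sig True\<close> for \<mu>.
  Derivatives are bounded along the six fields at the order of the coefficient itself: the growth
  |v| of a rotation cancels the power that a derivative gains.\<close>

locale coefficients =
  fixes \<gamma> K :: real and sig :: "bool \<Rightarrow> real^3 \<Rightarrow> real" and F :: "real^3 \<Rightarrow> real"
  assumes gamma: "-3 \<le> \<gamma>" "\<gamma> \<le> 1" and K: "1 \<le> K"
    and sig_td: "times_differentiable 2 (sig b)" and F_td: "times_differentiable 2 F"
    and sig_lower: "japanese v powr \<gamma> \<le> K * sig b v"
    and sig_upper: "sig b v \<le> K * japanese v powr \<gamma>"
    and sig_field: "\<bar>field a (sig b) v\<bar> \<le> K * japanese v powr \<gamma>"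
    and F_lower: "japanese v powr (\<gamma> + 2) \<le> K * F v"
    and F_upper: "F v \<le> K * japanese v powr (\<gamma> + 2)"
begin

definition diffusion :: "(real^3 \<Rightarrow> real) \<Rightarrow> real^3 \<Rightarrow> real" where
  "diffusion u v = - (\<Sum>a\<in>UNIV. field a (\<lambda>w. sig (fst a) w * field a u w) v) + F v * u v"

lemma sig_td': "n \<le> 2 \<Longrightarrow> times_differentiable n (sig b)"
  using sig_td times_diff_mono by blast

lemma sig_pos: "sig b v > 0"
proof -
  have "0 < japanese v powr \<gamma>" by simp
  then have "0 < K * sig b v" using sig_lower[of v b] by linarith
  then show ?thesis using K by (simp add: zero_less_mult_iff)
qed

lemma G_le: "japanese v powr \<gamma> / K \<le> sig b v"
  using sig_lower[of v b] K by (simp add: pos_divide_le_eq mult.commute)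

lemma continuous_sig: "continuous_on S (sig b)"
  using sig_td times_diff_continuous by fastforce

lemma continuous_F: "continuous_on S F"
  using F_td times_diff_continuous by fastforce

lemma continuous_japanese: "continuous_on S (\<lambda>v. japanese v powr s)"
  using times_diff_japanese[of 1] by (rule times_diff_continuous) simp

lemma times_diff_diffusion:
  assumes u: "times_differentiable 3 u"
  shows "continuous_on S (diffusion u)"
proof -
  have "times_differentiable 1 (field a (\<lambda>w. sig (fst a) w * field a u w))" for a
    by (rule times_diff_field'[of 2])
       (auto intro!: times_diff_mult sig_td times_diff_field'[OF u])
  then have "continuous_on S (field a (\<lambda>w. sig (fst a) w * field a u w))" for a
    using times_diff_continuous by blast
  moreover have "continuous_on S u" using u times_diff_continuous by fastforce
  ultimately show ?thesis
    unfolding diffusion_def[abs_def] by (intro continuous_intros continuous_F)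
qed

text \<open>Test L u with \<rho> u and integrate by parts. The derivative of the weight costs (X
  \<rho>) u (X u), which the condition (X \<rho>)^2 \<le> \<rho> \<beta> splits into half of the
  dissipation and a multiple of \<beta> u^2. Stated without quotients, the condition admits weights
  that vanish, hence cutoffs. The factor 3 K is K / 2 for each of the six fields.\<close>

lemma energy:
  assumes u: "times_differentiable 3 u" and \<rho>: "times_differentiable 2 \<rho>" and \<beta>: "continuous_on UNIV \<beta>"
    and nn: "\<And>v. \<rho> v \<ge> 0" "\<And>v. \<beta> v \<ge> 0" and le: "\<And>a v. (field a \<rho> v)^2 \<le> \<rho> v * \<beta> v"
    and supp: "(\<forall>v. norm v > r \<longrightarrow> \<rho> v = 0 \<and> \<beta> v = 0) \<or> (\<forall>v. norm v > r \<longrightarrow> u v = 0)"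
  shows "(LBINT v. \<rho> v * (japanese v powr \<gamma> * (\<Sum>a\<in>UNIV. (field a u v)^2))) / (2 * K)
    + (LBINT v. \<rho> v * (japanese v powr (\<gamma> + 2) * (u v)^2)) / K
    \<le> (LBINT v. \<rho> v * (u v * diffusion u v)) + 3 * K * (LBINT v. japanese v powr \<gamma> * (\<beta> v * (u v)^2))"
proof -
  have u2: "times_differentiable 2 u" "times_differentiable 1 u"
    using times_diff_mono[OF u] by auto
  have Xu: "times_differentiable 2 (field a u)" "times_differentiable 1 (field a u)" for a
    using times_diff_field'[OF u] by auto
  have \<rho>1: "times_differentiable 1 \<rho>" using times_diff_mono[OF \<rho>] by auto
  have cont: "continuous_on UNIV u" "continuous_on UNIV \<rho>" "continuous_on UNIV (field a u)"
     "continuous_on UNIV (field a \<rho>)" "continuous_on UNIV (diffusion u)" for a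
    by (rule times_diff_continuous[of 1] times_diff_diffusion[OF u];
        (rule order_refl u2 \<rho>1 Xu times_diff_field'[OF \<rho>])?; simp)+
  have z: "\<rho> v * u v = 0" "\<rho> v * field a u v = 0" "\<beta> v * u v = 0" if "norm v > r" for a v
    using supp that field_eq_0[of r u v a] by auto
  have zz: "(\<rho> v = 0 \<and> \<beta> v = 0) \<or> (u v = 0 \<and> (\<Sum>a\<in>UNIV. (field a u v)^2) = 0)" if "norm v > r" for v
    using supp
  proof (elim disjE)
    assume s: "\<forall>v. norm v > r \<longrightarrow> u v = 0"
    then have "field a u v = 0" for a using field_eq_0[of r u v a] that by simp
    then show ?thesis using s that by simp
  qed (use that in simp)
  \<comment> \<open>The flux whose divergence turns \<rho> u L u into the dissipation; it vanishes
    outside the ball under either of the two support hypotheses.\<close>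
  define N where "N a = (\<lambda>w. \<rho> w * u w * (sig (fst a) w * field a u w))" for a
  have N: "times_differentiable 2 (N a)" for a
    unfolding N_def by (intro times_diff_mult \<rho> u2 sig_td Xu)
  have fN: "field a (N a) v = \<rho> v * u v * field a (\<lambda>w. sig (fst a) w * field a u w) v
     + (\<rho> v * field a u v + field a \<rho> v * u v) * (sig (fst a) v * field a u v)" for a v
    unfolding N_def
    by (subst field_mult) (auto simp: field_mult \<rho>1 u2 Xu sig_td' simp del: One_nat_def intro!: times_diff_mult)
  have pw: "\<rho> v * (japanese v powr \<gamma> * (\<Sum>a\<in>UNIV. (field a u v)^2)) / (2 * K)
     + \<rho> v * (japanese v powr (\<gamma> + 2) * (u v)^2) / K
    \<le> \<rho> v * (u v * diffusion u v) + (\<Sum>a\<in>UNIV. field a (N a) v) + 3 * K * (japanese v powr \<gamma> * (\<beta> v * (u v)^2))" for v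
  proof -
    let ?G = "japanese v powr \<gamma>"
    have a: "\<rho> v * (?G * (field a u v)^2) / (2 * K)
      \<le> (\<rho> v * field a u v + field a \<rho> v * u v) * (sig (fst a) v * field a u v)
         + K / 2 * (?G * (\<beta> v * (u v)^2))" for a
    proof -
      let ?s = "sig (fst a) v" and ?x = "field a u v" and ?p = "field a \<rho> v"
      have "(2 * \<bar>?p * u v * ?x\<bar>)^2 \<le> (\<rho> v * ?x^2 + \<beta> v * (u v)^2)^2"
      proof -
        have "(2 * \<bar>?p * u v * ?x\<bar>)^2 = 4 * (?p^2 * ((u v)^2 * ?x^2))"
          by (simp add: power_mult_distrib)
        also have "\<dots> \<le> 4 * ((\<rho> v * \<beta> v) * ((u v)^2 * ?x^2))"
          using le[of a v] by (intro mult_left_mono mult_right_mono) auto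
        also have "\<dots> = 4 * ((\<rho> v * ?x^2) * (\<beta> v * (u v)^2))" by simp
        finally show ?thesis using four_mult_le_square order_trans by blast
      qed
      then have "2 * \<bar>?p * u v * ?x\<bar> \<le> \<rho> v * ?x^2 + \<beta> v * (u v)^2"
        by (rule power2_le_imp_le) (intro add_nonneg_nonneg mult_nonneg_nonneg nn zero_le_power2)
      then have "- (\<rho> v * ?x^2 + \<beta> v * (u v)^2) / 2 \<le> ?p * u v * ?x"
        by (rule half_abs_le)
      then have "?s * (- (\<rho> v * ?x^2 + \<beta> v * (u v)^2) / 2) \<le> ?s * (?p * u v * ?x)"
        using sig_pos[of "fst a" v] by (intro mult_left_mono) auto
      moreover have "?s * (\<beta> v * (u v)^2) \<le> K * ?G * (\<beta> v * (u v)^2)"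
        using sig_upper[of "fst a" v] nn[of v] by (intro mult_right_mono) simp_all
      moreover have "?G / K * (\<rho> v * ?x^2) \<le> ?s * (\<rho> v * ?x^2)"
        using G_le[of v "fst a"] nn[of v] by (intro mult_right_mono) simp_all
      moreover have "\<rho> v * (?G * ?x^2) / (2 * K) = (?G / K * (\<rho> v * ?x^2)) / 2" by (simp add: mult_ac)
      moreover have "(\<rho> v * ?x + ?p * u v) * (?s * ?x) = ?s * (\<rho> v * ?x^2) + ?s * (?p * u v * ?x)"
        by (simp add: power2_eq_square algebra_simps)
      moreover have "?s * (- (\<rho> v * ?x^2 + \<beta> v * (u v)^2) / 2) = - (?s * (\<rho> v * ?x^2)) / 2 - (?s * (\<beta> v * (u v)^2)) / 2"
        by (simp add: field_simps)
      moreover have "K / 2 * (?G * (\<beta> v * (u v)^2)) = (K * ?G * (\<beta> v * (u v)^2)) / 2" by simp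
      ultimately show ?thesis by (rule energy_arith)
    qed
    have "\<rho> v * (japanese v powr (\<gamma> + 2) * (u v)^2) / K \<le> \<rho> v * (F v * (u v)^2)"
    proof -
      have "japanese v powr (\<gamma> + 2) / K \<le> F v"
        using F_lower[of v] K by (simp add: pos_divide_le_eq mult.commute)
      then have "japanese v powr (\<gamma> + 2) / K * (\<rho> v * (u v)^2) \<le> F v * (\<rho> v * (u v)^2)"
        using nn[of v] by (intro mult_right_mono) simp_all
      then show ?thesis by (simp add: algebra_simps)
    qed
    moreover have "\<rho> v * (?G * (\<Sum>a\<in>UNIV. (field a u v)^2)) / (2 * K)
       \<le> (\<Sum>a\<in>UNIV. (\<rho> v * field a u v + field a \<rho> v * u v) * (sig (fst a) v * field a u v))
         + 3 * K * (?G * (\<beta> v * (u v)^2))"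
    proof -
      have "(\<Sum>a\<in>UNIV. \<rho> v * (?G * (field a u v)^2) / (2 * K))
        \<le> (\<Sum>a\<in>UNIV. (\<rho> v * field a u v + field a \<rho> v * u v) * (sig (fst a) v * field a u v)
         + K / 2 * (?G * (\<beta> v * (u v)^2)))"
        by (rule sum_mono) (rule a)
      then show ?thesis
        by (simp add: sum_distrib_left sum_divide_distrib sum.distrib mult_ac)
    qed
    ultimately show ?thesis
      unfolding fN sum.distrib diffusion_def
      by (simp add: sum_distrib_left algebra_simps power2_eq_square)
  qed
  have iN: "integrable lborel (field a (N a))" "(LBINT v. field a (N a) v) = 0" for a
  proof -
    have zN: "norm v > r \<Longrightarrow> N a v = 0" for v using z(1)[of v] by (simp add: N_def)
    show "(LBINT v. field a (N a) v) = 0" by (rule integral_field_eq_0[OF N zN])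
    show "integrable lborel (field a (N a))"
      using times_diff_field'[OF N, of 1] field_eq_0[of r "N a", OF zN]
      by (intro integrable_continuous_support[of _ r] times_diff_continuous[of 1]) auto
  qed
  have i: "integrable lborel (\<lambda>v. \<rho> v * (japanese v powr \<gamma> * (\<Sum>a\<in>UNIV. (field a u v)^2)))"
    "integrable lborel (\<lambda>v. \<rho> v * (japanese v powr (\<gamma> + 2) * (u v)^2))"
    "integrable lborel (\<lambda>v. \<rho> v * (u v * diffusion u v))"
    "integrable lborel (\<lambda>v. japanese v powr \<gamma> * (\<beta> v * (u v)^2))"
    by (intro integrable_continuous_support[of _ r] continuous_intros cont \<beta> continuous_japanese;
        drule zz; elim disjE conjE; simp)+
  have "(LBINT v. \<rho> v * (japanese v powr \<gamma> * (\<Sum>a\<in>UNIV. (field a u v)^2)) / (2 * K)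
     + \<rho> v * (japanese v powr (\<gamma> + 2) * (u v)^2) / K)
    \<le> (LBINT v. \<rho> v * (u v * diffusion u v) + (\<Sum>a\<in>UNIV. field a (N a) v) + 3 * K * (japanese v powr \<gamma> * (\<beta> v * (u v)^2)))"
    by (intro integral_mono pw) (use i iN in auto)
  then show ?thesis using i iN by simp
qed

text \<open>For weights whose logarithmic derivative is of order <v>^s the choice \<beta> = c^2
  <v>^(2 s) \<rho> is admissible. Here u carries the compact support.\<close>

lemma energy_weight:
  assumes u: "times_differentiable 3 u" and z: "\<And>v. norm v > r \<Longrightarrow> u v = 0"
    and \<rho>: "times_differentiable 2 \<rho>" "\<And>v. \<rho> v \<ge> 0"
    and \<beta>: "\<And>a v. \<bar>field a \<rho> v\<bar> \<le> c * japanese v powr s * \<rho> v" "c \<ge> 0"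
  shows "(LBINT v. \<rho> v * (japanese v powr \<gamma> * (\<Sum>a\<in>UNIV. (field a u v)^2))) / (2 * K)
    + (LBINT v. \<rho> v * (japanese v powr (\<gamma> + 2) * (u v)^2)) / K
    \<le> (LBINT v. \<rho> v * (u v * diffusion u v))
      + 3 * K * c^2 * (LBINT v. japanese v powr (\<gamma> + 2 * s) * \<rho> v * (u v)^2)"
proof -
  let ?b = "\<lambda>v. c^2 * (japanese v powr (2 * s) * \<rho> v)"
  have c\<rho>: "continuous_on UNIV \<rho>" using \<rho>(1) times_diff_continuous by fastforce
  have le: "(field a \<rho> v)^2 \<le> \<rho> v * ?b v" for a v
  proof -
    have "(field a \<rho> v)^2 \<le> (c * japanese v powr s * \<rho> v)^2"
      using power_mono[OF \<beta>(1)[of a v], of 2] by simp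
    also have "\<dots> = \<rho> v * ?b v"
      using japanese_mult_powr[of v s s] by (simp add: power2_eq_square)
    finally show ?thesis .
  qed
  have eq: "japanese v powr \<gamma> * (?b v * (u v)^2) = c^2 * (japanese v powr (\<gamma> + 2 * s) * \<rho> v * (u v)^2)" for v
    using japanese_mult_powr[of v \<gamma> "2 * s"] by (simp add: mult_ac flip: japanese_mult_powr)
  have "continuous_on UNIV ?b" by (intro continuous_intros continuous_japanese c\<rho>)
  from energy[OF u \<rho>(1) this \<rho>(2) _ le, of r] z \<rho>(2) show ?thesis
    unfolding eq by simp
qed

text \<open>Rotations commute with the Laplacian, so the product of the two second order terms has,
  up to lower order terms, a nonnegative integral.\<close>

lemma static_estimate:
  assumes u: "times_differentiable 4 u" and z: "\<And>v. norm v > r \<Longrightarrow> u v = 0"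
  defines "W \<equiv> \<lambda>b v. \<Sum>i\<in>UNIV. field (b, i) (field (b, i) u) v"
  shows "(LBINT v. (japanese v powr \<gamma> * W False v)^2) + (LBINT v. (japanese v powr \<gamma> * W True v)^2)
    \<le> 6 * K^2 * (LBINT v. (diffusion u v)^2)
      + 100 * K^8 * (LBINT v. japanese v powr (2 * \<gamma> + 2) * (\<Sum>a\<in>UNIV. (field a u v)^2))
      + 6 * K^4 * (LBINT v. japanese v powr (2 * \<gamma> + 4) * (u v)^2)"
proof -
  let ?G = "\<lambda>v. japanese v powr \<gamma>"
  have X3: "times_differentiable 3 (field a u)" for a
    by (rule times_diff_field'[OF u]) simp
  have X: "times_differentiable 2 (field a u)" "times_differentiable 1 (field a u)"
    "times_differentiable 2 (field b (field a u))" "times_differentiable 1 (field b (field a u))" for a b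
    using times_diff_mono[OF X3] times_diff_field'[OF X3] by auto
  have Wd: "times_differentiable 2 (W b)" "times_differentiable 1 (W b)" for b
    unfolding W_def by (intro times_diff_sum X)+
  have zX: "norm v > r \<Longrightarrow> field a u v = 0" for a v by (rule field_eq_0[OF z])
  have zXX: "norm v > r \<Longrightarrow> field b (field a u) v = 0" for a b v by (rule field_eq_0[OF zX])
  have zW: "norm v > r \<Longrightarrow> W b v = 0" for b v using zXX by (simp add: W_def)
  \<comment> \<open>Half the coefficient of the mixed term in the square of the second order
    part.\<close>
  define lm where "lm v = sig False v * sig True v" for v
  have lmd: "times_differentiable 2 lm" "times_differentiable 1 lm"
    unfolding lm_def[abs_def] by (auto intro!: times_diff_mult sig_td')
  have lm_lower: "(?G v)^2 \<le> K^2 * lm v" for v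
    using mult_mono[OF sig_lower[of v False] sig_lower[of v True]] K sig_pos[of False v]
    by (simp add: lm_def power2_eq_square mult_ac)
  have lm_field: "\<bar>field a lm v\<bar> \<le> 2 * K^2 * (?G v)^2" for a v
  proof -
    have "\<bar>field a lm v\<bar> \<le> sig False v * \<bar>field a (sig True) v\<bar> + \<bar>field a (sig False) v\<bar> * sig True v"
      unfolding lm_def[abs_def] using sig_pos[of False v] sig_pos[of True v]
      by (subst field_mult) (auto intro!: sig_td' order_trans[OF abs_triangle_ineq] simp: abs_mult)
    also have "\<dots> \<le> (K * ?G v) * (K * ?G v) + (K * ?G v) * (K * ?G v)"
      using sig_upper sig_field sig_pos[of _ v] K
      by (intro add_mono mult_mono) (auto intro: less_imp_le)
    finally show ?thesis by (simp add: power2_eq_square)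
  qed
  \<comment> \<open>Fluxes that move one rotation and one translation across the mixed term. In the
    difference of their divergences the third order terms cancel, because rotations commute with the
    Laplacian.\<close>
  define N1 where "N1 j = (\<lambda>w. lm w * field (True, j) u w * W False w)" for j
  define N2 where "N2 i j = (\<lambda>w. lm w * field (True, j) u w * field (False, i) (field (True, j) u) w)" for i j
  have N: "times_differentiable 2 (N1 j)" "times_differentiable 2 (N2 i j)" for i j
    unfolding N1_def N2_def by (intro times_diff_mult lmd X Wd)+
  have zN: "norm v > r \<Longrightarrow> N1 j v = 0" "norm v > r \<Longrightarrow> N2 i j v = 0" for i j v
    by (simp_all add: N1_def N2_def zX)
  have f1: "field (True, j) (N1 j) v = lm v * field (True, j) u v * field (True, j) (W False) v
     + (lm v * field (True, j) (field (True, j) u) v + field (True, j) lm v * field (True, j) u v) * W False v" for j v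
    unfolding N1_def
    by (subst field_mult) (auto simp: field_mult lmd X Wd simp del: One_nat_def intro!: times_diff_mult)
  have f2: "field (False, i) (N2 i j) v = lm v * field (True, j) u v * field (False, i) (field (False, i) (field (True, j) u)) v
     + (lm v * field (False, i) (field (True, j) u) v + field (False, i) lm v * field (True, j) u v)
        * field (False, i) (field (True, j) u) v" for i j v
    unfolding N2_def
    by (subst field_mult) (auto simp: field_mult lmd X Wd simp del: One_nat_def intro!: times_diff_mult)
  have rot: "field (True, j) (W False) v = (\<Sum>i\<in>UNIV. field (False, i) (field (False, i) (field (True, j) u)) v)" for j v
    using field_rotation_laplacian[OF u, of j v] unfolding W_def by simp
  define NN where "NN v = (\<Sum>j\<in>UNIV. field (True, j) (N1 j) v) - (\<Sum>j\<in>UNIV. \<Sum>i\<in>UNIV. field (False, i) (N2 i j) v)" for v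
  define Y where "Y i j v = field (False, i) (field (True, j) u) v" for i j v
  let ?V = "\<lambda>v. \<Sum>j\<in>UNIV. (field (True, j) u v)^2"
  have NN: "NN v = lm v * W True v * W False v + (\<Sum>j\<in>UNIV. field (True, j) lm v * field (True, j) u v * W False v)
      - (\<Sum>j\<in>UNIV. \<Sum>i\<in>UNIV. lm v * (Y i j v)^2 + field (False, i) lm v * field (True, j) u v * Y i j v)" for v
    unfolding NN_def f1 f2 rot Y_def[symmetric]
    by (simp add: W_def sum.distrib sum_distrib_left sum_distrib_right power2_eq_square algebra_simps sum_subtractf)
  \<comment> \<open>Up to the divergence \<open>NN\<close> the mixed term is \<open>lm\<close> times
    the sum of the squares of all \<open>Y i j\<close>, which has the good sign. What remains are
    terms with a derivative on \<open>lm\<close>.\<close>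
  have cross: "- (2 * (lm v * W True v * W False v)) + 2 * NN v
      \<le> (?G v * W False v)^2 / (2 * K^2) + 30 * K^6 * ((?G v)^2 * ?V v)" for v
  proof -
    let ?g = "(?G v)^2"
    \<comment> \<open>With the share 1 / (6 K^2) the three values of j add up to 1 / (2 K^2), half
      of what ellipticity gives for the Laplacian.\<close>
    have 1: "2 * (field (True, j) lm v * field (True, j) u v * W False v)
       \<le> ?g * (W False v)^2 / (6 * K^2) + 24 * K^6 * (?g * (field (True, j) u v)^2)" for j
    proof -
      let ?x = "field (True, j) u v" and ?w = "W False v"
      have "2 * (field (True, j) lm v * ?x * ?w) \<le> 2 * (\<bar>field (True, j) lm v\<bar> * (\<bar>?x\<bar> * \<bar>?w\<bar>))"
        by (simp add: abs_mult[symmetric] mult.assoc)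
      also have "\<dots> \<le> 2 * (2 * K^2 * ?g * (\<bar>?x\<bar> * \<bar>?w\<bar>))"
        using lm_field by (intro mult_left_mono mult_right_mono) auto
      also have "\<dots> = ?g * (4 * K^2 * (\<bar>?x\<bar> * \<bar>?w\<bar>))" by simp
      also have "\<dots> \<le> ?g * (?w^2 / (6 * K^2) + 24 * K^6 * ?x^2)"
      proof (rule mult_left_mono)
        have "0 \<le> (\<bar>?w\<bar> - 12 * K^4 * \<bar>?x\<bar>)^2 / (6 * K^2)" by simp
        also have "\<dots> = ?w^2 / (6 * K^2) + 24 * K^6 * ?x^2 - 4 * K^2 * (\<bar>?x\<bar> * \<bar>?w\<bar>)"
          using K by (simp add: power2_diff field_simps power_mult_distrib power_add[symmetric] power_mult[symmetric] eval_nat_numeral)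
        finally show "4 * K^2 * (\<bar>?x\<bar> * \<bar>?w\<bar>) \<le> ?w^2 / (6 * K^2) + 24 * K^6 * ?x^2" by simp
      qed simp
      finally show ?thesis by (simp add: algebra_simps)
    qed
    \<comment> \<open>Here the derivative of \<open>lm\<close> is paid by the good term
      \<open>lm v * (Y i j v)^2\<close>, which is at least
      \<open>(?G v)^2 / K^2 * (Y i j v)^2\<close>.\<close>
    have 2: "- (2 * (lm v * (Y i j v)^2 + field (False, i) lm v * field (True, j) u v * Y i j v))
       \<le> 2 * K^6 * (?g * (field (True, j) u v)^2)" for i j
    proof -
      let ?x = "field (True, j) u v" and ?y = "Y i j v"
      have "- (2 * (field (False, i) lm v * ?x * ?y)) \<le> 2 * (\<bar>field (False, i) lm v\<bar> * (\<bar>?x\<bar> * \<bar>?y\<bar>))"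
        by (rule minus_mult3_le)
      also have "\<dots> \<le> 2 * (2 * K^2 * ?g * (\<bar>?x\<bar> * \<bar>?y\<bar>))"
        using lm_field by (intro mult_left_mono mult_right_mono) auto
      also have "\<dots> = ?g * (4 * K^2 * (\<bar>?x\<bar> * \<bar>?y\<bar>))" by simp
      also have "\<dots> \<le> ?g * (2 * ?y^2 / K^2 + 2 * K^6 * ?x^2)"
      proof (rule mult_left_mono)
        have "0 \<le> 2 * (\<bar>?y\<bar> - K^4 * \<bar>?x\<bar>)^2 / K^2" by simp
        also have "\<dots> = 2 * ?y^2 / K^2 + 2 * K^6 * ?x^2 - 4 * K^2 * (\<bar>?x\<bar> * \<bar>?y\<bar>)"
          using K by (simp add: power2_diff field_simps power_mult_distrib power_add[symmetric] power_mult[symmetric] eval_nat_numeral)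
        finally show "4 * K^2 * (\<bar>?x\<bar> * \<bar>?y\<bar>) \<le> 2 * ?y^2 / K^2 + 2 * K^6 * ?x^2" by simp
      qed simp
      also have "\<dots> = 2 * ((?g / K^2) * ?y^2) + 2 * K^6 * (?g * ?x^2)" by (simp add: algebra_simps)
      also have "(?g / K^2) * ?y^2 \<le> lm v * ?y^2"
        using lm_lower[of v] K by (intro mult_right_mono) (auto simp: field_simps)
      finally show ?thesis by simp
    qed
    have "(\<Sum>j\<in>UNIV. 2 * (field (True, j) lm v * field (True, j) u v * W False v))
      + (\<Sum>j\<in>UNIV. \<Sum>i\<in>UNIV. - (2 * (lm v * (Y i j v)^2 + field (False, i) lm v * field (True, j) u v * Y i j v)))
      \<le> (\<Sum>j\<in>UNIV. ?g * (W False v)^2 / (6 * K^2) + 24 * K^6 * (?g * (field (True, j) u v)^2))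
       + (\<Sum>j\<in>(UNIV::3 set). \<Sum>i\<in>(UNIV::3 set). 2 * K^6 * (?g * (field (True, j) u v)^2))"
      by (intro add_mono sum_mono 1 2)
    then show ?thesis
      unfolding NN
      by (simp add: sum.distrib sum_distrib_left[symmetric] sum_negf sum_subtractf power_mult_distrib algebra_simps)
  qed
  let ?S = "\<lambda>v. \<Sum>a\<in>UNIV. (field a u v)^2"
  \<comment> \<open>Besides the second order part L contains the first order term \<open>R\<close>,
    where a field hits the coefficient, and F u. The factor 3 comes from squaring three terms, the 6
    in 18 from summing over the six fields.\<close>
  have Nsq: "(sig False v * W False v + sig True v * W True v)^2
     \<le> 3 * (diffusion u v)^2 + 18 * K^2 * (japanese v powr (2 * \<gamma> + 2) * ?S v)
        + 3 * K^2 * (japanese v powr (2 * \<gamma> + 4) * (u v)^2)" for v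
  proof -
    define R where "R = (\<Sum>a\<in>UNIV. field a (sig (fst a)) v * field a u v)"
    have "diffusion u v = - (sig False v * W False v + sig True v * W True v) - R + F v * u v"
      unfolding diffusion_def
      by (subst field_mult) (auto simp: X sig_td' sum.distrib R_def sum_bool_3 W_def sum_distrib_left simp del: One_nat_def)
    then have e: "sig False v * W False v + sig True v * W True v = (- diffusion u v) + (- R) + F v * u v" by simp
    have "(a + b + c)^2 \<le> 3 * a^2 + 3 * b^2 + 3 * c^2" for a b c :: real
      using zero_le_power2[of "a - b"] zero_le_power2[of "b - c"] zero_le_power2[of "a - c"]
      by (simp add: power2_eq_square algebra_simps)
    from this[of "- diffusion u v" "- R" "F v * u v"]
    have "(sig False v * W False v + sig True v * W True v)^2 \<le> 3 * (diffusion u v)^2 + 3 * R^2 + 3 * (F v * u v)^2"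
      unfolding e by simp
    moreover have "R^2 \<le> 6 * K^2 * (japanese v powr (2 * \<gamma> + 2) * ?S v)"
    proof -
      have "R^2 \<le> (\<Sum>a\<in>UNIV. (field a (sig (fst a)) v)^2) * ?S v"
        unfolding R_def by (rule Cauchy_Schwarz_ineq_sum)
      also have "\<dots> \<le> (\<Sum>a\<in>(UNIV::(bool\<times>3) set). (K * ?G v)^2) * ?S v"
        using sig_field K by (intro mult_right_mono sum_mono sum_nonneg zero_le_power2) (simp add: abs_le_square_iff[symmetric] abs_mult)
      also have "\<dots> = 6 * K^2 * (japanese v powr (2 * \<gamma>) * ?S v)"
        using japanese_mult_powr[of v \<gamma> \<gamma>] by (simp add: power2_eq_square)
      also have "\<dots> \<le> 6 * K^2 * (japanese v powr (2 * \<gamma> + 2) * ?S v)"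
        using japanese_ge_1[of v] by (intro mult_left_mono mult_right_mono powr_mono) (auto intro: sum_nonneg)
      finally show ?thesis .
    qed
    moreover have "(F v * u v)^2 \<le> K^2 * (japanese v powr (2 * \<gamma> + 4) * (u v)^2)"
    proof -
      have F0: "0 \<le> F v"
        using F_lower[of v] K by (metis less_le_trans powr_gt_zero japanese_pos less_irrefl less_imp_le not_less zero_le_mult_iff le_less_trans not_one_le_zero linorder_le_cases order_trans powr_ge_zero)
      have "(F v)^2 \<le> (K * japanese v powr (\<gamma> + 2))^2"
        using F_upper[of v] F0 by (intro power_mono) auto
      also have "\<dots> = K^2 * japanese v powr (2 * \<gamma> + 4)"
        using japanese_mult_powr[of v "\<gamma> + 2" "\<gamma> + 2"] by (simp add: power2_eq_square algebra_simps)
      finally show ?thesis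
        using mult_right_mono[of "(F v)^2" _ "(u v)^2"] by (fastforce simp: power_mult_distrib mult_ac)
    qed
    ultimately show ?thesis by linarith
  qed
  have main: "((?G v * W False v)^2 + (?G v * W True v)^2) / (2 * K^2) + 2 * NN v
    \<le> 3 * (diffusion u v)^2 + 50 * K^6 * (japanese v powr (2 * \<gamma> + 2) * ?S v)
        + 3 * K^2 * (japanese v powr (2 * \<gamma> + 4) * (u v)^2)" for v
  proof -
    have sq: "(?G v * W b v)^2 / K^2 \<le> (sig b v * W b v)^2" for b
    proof -
      have "(?G v / K)^2 \<le> (sig b v)^2"
        using G_le[of v b] K by (intro power_mono) simp_all
      then have "(?G v / K)^2 * (W b v)^2 \<le> (sig b v)^2 * (W b v)^2" by (rule mult_right_mono) simp
      then show ?thesis by (simp add: power_mult_distrib power_divide)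
    qed
    have K6: "K^2 \<le> K^6" using K by (intro power_increasing) auto
    have V: "(?G v)^2 * ?V v \<le> japanese v powr (2 * \<gamma> + 2) * ?S v"
    proof (rule mult_mono)
      show "(?G v)^2 \<le> japanese v powr (2 * \<gamma> + 2)"
        using japanese_mult_powr[of v \<gamma> \<gamma>] powr_mono[OF _ japanese_ge_1[of v], of "2 * \<gamma>" "2 * \<gamma> + 2"]
        by (simp add: power2_eq_square)
      show "?V v \<le> ?S v" by (simp add: sum_bool_3 sum_nonneg)
    qed (auto intro: sum_nonneg)
    have "30 * K^6 * ((?G v)^2 * ?V v) \<le> 30 * K^6 * (japanese v powr (2 * \<gamma> + 2) * ?S v)"
      using V K by (intro mult_left_mono) auto
    moreover have "18 * K^2 * (japanese v powr (2 * \<gamma> + 2) * ?S v) \<le> 20 * K^6 * (japanese v powr (2 * \<gamma> + 2) * ?S v)"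
      using K6 zero_le_power[of K 6] K by (intro mult_right_mono mult_nonneg_nonneg sum_nonneg zero_le_power2 powr_ge_zero) linarith
    moreover have "(sig False v * W False v + sig True v * W True v)^2
       = (sig False v * W False v)^2 + (sig True v * W True v)^2 + 2 * (lm v * W True v * W False v)"
      by (simp add: lm_def power2_sum)
    moreover have "((?G v * W False v)^2 + (?G v * W True v)^2) / (2 * K^2)
       = (?G v * W False v)^2 / K^2 - (?G v * W False v)^2 / (2 * K^2) + (?G v * W True v)^2 / K^2 - (?G v * W True v)^2 / (2 * K^2)"
      using K by (simp add: field_simps)
    moreover have "0 \<le> (?G v * W True v)^2 / (2 * K^2)" by simp
    ultimately show ?thesis using sq[of False] sq[of True] cross[of v] Nsq[of v] by linarith
  qed
  have cont: "continuous_on UNIV (W b)" "continuous_on UNIV (field a u)" "continuous_on UNIV u"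
    "continuous_on UNIV (diffusion u)" for a b
    by (rule times_diff_continuous[of 1] times_diff_diffusion times_diff_mono[OF u];
        (rule Wd X times_diff_mono[OF u])?; simp)+
  have zD: "norm v > r \<Longrightarrow> diffusion u v = 0" for v
    unfolding diffusion_def using z zX by (simp add: field_eq_0[of r])
  have iN: "integrable lborel (field a (N1 j))" "(LBINT v. field a (N1 j) v) = 0"
     "integrable lborel (field a (N2 i j))" "(LBINT v. field a (N2 i j) v) = 0" for a i j
  proof -
    show "(LBINT v. field a (N1 j) v) = 0" by (rule integral_field_eq_0[OF N(1) zN(1)])
    show "(LBINT v. field a (N2 i j) v) = 0" by (rule integral_field_eq_0[OF N(2) zN(2)])
    show "integrable lborel (field a (N1 j))"
      using times_diff_field'[OF N(1), of 1] field_eq_0[of r "N1 j", OF zN(1)]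
      by (intro integrable_continuous_support[of _ r] times_diff_continuous[of 1]) auto
    show "integrable lborel (field a (N2 i j))"
      using times_diff_field'[OF N(2), of 1] field_eq_0[of r "N2 i j", OF zN(2)]
      by (intro integrable_continuous_support[of _ r] times_diff_continuous[of 1]) auto
  qed
  have iNN: "integrable lborel NN" "(LBINT v. NN v) = 0"
    unfolding NN_def[abs_def] using iN by auto
  have i: "integrable lborel (\<lambda>v. (?G v * W b v)^2)" "integrable lborel (\<lambda>v. (diffusion u v)^2)"
    "integrable lborel (\<lambda>v. japanese v powr (2 * \<gamma> + 2) * ?S v)"
    "integrable lborel (\<lambda>v. japanese v powr (2 * \<gamma> + 4) * (u v)^2)" for b
    by (intro integrable_continuous_support[of _ r] continuous_intros cont continuous_japanese; simp add: z zX zW zD)+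
  have "(LBINT v. ((?G v * W False v)^2 + (?G v * W True v)^2) / (2 * K^2) + 2 * NN v)
    \<le> (LBINT v. 3 * (diffusion u v)^2 + 50 * K^6 * (japanese v powr (2 * \<gamma> + 2) * ?S v)
        + 3 * K^2 * (japanese v powr (2 * \<gamma> + 4) * (u v)^2))"
    by (intro integral_mono main) (use i iNN in auto)
  then have "((LBINT v. (?G v * W False v)^2) + (LBINT v. (?G v * W True v)^2)) / (2 * K^2)
    \<le> 3 * (LBINT v. (diffusion u v)^2) + 50 * K^6 * (LBINT v. japanese v powr (2 * \<gamma> + 2) * ?S v)
        + 3 * K^2 * (LBINT v. japanese v powr (2 * \<gamma> + 4) * (u v)^2)"
    using i iNN by simp
  then show ?thesis
    using K by (simp add: divide_le_eq field_simps power_add[symmetric] eval_nat_numeral)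
qed

end

text \<open>The transport multiplier \<open>T\<close>: the skew-adjoint first order operator in the direction
  \<open>\<Sum>\<^sub>a (X\<^sub>a \<phi>) X\<^sub>a\<close> for the phase \<open>\<phi> v = \<tau> + v \<cdot> k\<close>, weighted so that \<open>[T, \<phi>] = \<rho>^2\<close>.\<close>

definition drift :: "real \<Rightarrow> real^3 \<Rightarrow> real^3 \<Rightarrow> real" where
  "drift \<gamma> k v = (\<Sum>a\<in>UNIV. field a (\<lambda>w. mult_weight \<gamma> k w * (field_dir a w \<bullet> k)) v)"

definition transport :: "real \<Rightarrow> real^3 \<Rightarrow> (real^3 \<Rightarrow> real) \<Rightarrow> real^3 \<Rightarrow> real" where
  "transport \<gamma> k u v =
     (\<Sum>a\<in>UNIV. mult_weight \<gamma> k v * (field_dir a v \<bullet> k) * field a u v) + drift \<gamma> k v / 2 * u v"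

lemma continuous_drift:
  assumes "k \<noteq> 0"
  shows "continuous_on S (drift \<gamma> k)"
proof -
  have "times_differentiable 1 (field a (\<lambda>w. mult_weight \<gamma> k w * (field_dir a w \<bullet> k)))" for a
    using assms by (intro times_diff_field times_diff_mult times_diff_mult_weight
        times_diff_field_dir_inner)
  then have "continuous_on S (field a (\<lambda>w. mult_weight \<gamma> k w * (field_dir a w \<bullet> k)))" for a
    by (rule times_diff_continuous) simp
  then show ?thesis unfolding drift_def[abs_def] by (intro continuous_intros)
qed

lemma times_diff_phase: "times_differentiable n (\<lambda>v. \<tau> + v \<bullet> k)"
  by auto

lemma field_phase: "field a (\<lambda>v. \<tau> + v \<bullet> k) v = field_dir a v \<bullet> k"
  by (simp add: field_add)

text \<open>The derivative falls on the weight or on the direction. The first part gives 54 = 6 *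
  3^2 by Cauchy-Schwarz over the fields, with |2 \<gamma> / 3| + 1 / 3 \<le> 3; the second gives 4
  by \<open>div_field_dir\<close>. Squaring the sum doubles both: 116 = 2 * (54 + 4).\<close>

lemma drift_bound:
  assumes k: "k \<noteq> 0" and \<gamma>: "-3 \<le> \<gamma>" "\<gamma> \<le> 1"
  shows "(drift \<gamma> k v)^2 \<le> 116 * (japanese v powr (\<gamma> + 2) * rho \<gamma> k v)"
proof -
  let ?m = "mult_weight \<gamma> k" and ?J = "japanese v"
  have m: "?m v > 0" by (rule mult_weight_pos[OF k])
  have q: "symb k v > 0" by (rule symb_pos[OF k])
  have "drift \<gamma> k v = (\<Sum>a\<in>UNIV. field a ?m v * (field_dir a v \<bullet> k)) + ?m v * (\<Sum>a\<in>UNIV. field a (\<lambda>w. field_dir a w \<bullet> k) v)"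
    unfolding drift_def
    by (subst field_mult) (auto simp: times_diff_mult_weight[OF k] sum.distrib sum_distrib_left simp del: One_nat_def)
  then have d: "drift \<gamma> k v = (\<Sum>a\<in>UNIV. field a ?m v * (field_dir a v \<bullet> k)) + ?m v * (- 2 * (v \<bullet> k))"
    by (simp add: div_field_dir)
  have "(\<Sum>a\<in>UNIV. field a ?m v * (field_dir a v \<bullet> k))^2 \<le> (\<Sum>a\<in>UNIV. (field a ?m v)^2) * symb k v"
    unfolding symb_def by (rule Cauchy_Schwarz_ineq_sum)
  also have "\<dots> \<le> (\<Sum>a\<in>(UNIV::(bool\<times>3) set). (3 * ?J * ?m v)^2) * symb k v"
  proof (intro mult_right_mono sum_mono)
    fix a
    have "\<bar>field a ?m v\<bar> \<le> (\<bar>2 * \<gamma> / 3\<bar> + \<bar>- 1 / 3\<bar>) * ?J * ?m v"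
      unfolding mult_weight_def by (rule field_weight[OF k])
    also have "\<dots> \<le> 3 * ?J * ?m v"
      using \<gamma> m by (intro mult_right_mono) (auto intro: less_imp_le)
    finally show "(field a ?m v)^2 \<le> (3 * ?J * ?m v)^2"
      using m by (simp add: abs_le_square_iff[symmetric] abs_mult abs_of_pos)
  qed (use q in auto)
  also have "\<dots> = 54 * (?J^2 * ((?m v)^2 * symb k v))" by (simp add: power_mult_distrib)
  finally have 1: "(\<Sum>a\<in>UNIV. field a ?m v * (field_dir a v \<bullet> k))^2 \<le> 54 * (?J^2 * ((?m v)^2 * symb k v))" .
  have "(v \<bullet> k)^2 \<le> (norm v * norm k)^2"
    using Cauchy_Schwarz_ineq2[of v k] by (simp add: abs_le_square_iff[symmetric])
  also have "\<dots> \<le> ?J^2 * symb k v"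
    unfolding power_mult_distrib using norm_le_japanese[of v] norm_le_symb[of k v]
    by (intro mult_mono power_mono) auto
  finally have "(?m v)^2 * (v \<bullet> k)^2 \<le> (?m v)^2 * (?J^2 * symb k v)" by (rule mult_left_mono) simp
  then have 2: "(?m v * (- 2 * (v \<bullet> k)))^2 \<le> 4 * (?J^2 * ((?m v)^2 * symb k v))"
    by (simp add: power_mult_distrib mult_ac)
  have "(x + y)^2 \<le> 2 * x^2 + 2 * y^2" for x y :: real
    using zero_le_power2[of "x - y"] by (simp add: power2_eq_square algebra_simps)
  from this[of "\<Sum>a\<in>UNIV. field a ?m v * (field_dir a v \<bullet> k)" "?m v * (- 2 * (v \<bullet> k))"] 1 2
  have "(drift \<gamma> k v)^2 \<le> 116 * (?J^2 * ((?m v)^2 * symb k v))"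
    unfolding d by linarith
  also have "?J^2 * ((?m v)^2 * symb k v) = ?J powr (\<gamma> + 2) * rho \<gamma> k v"
    unfolding mult_weight_square[OF k] japanese_square by (simp add: powr_add)
  finally show ?thesis .
qed

text \<open>Cauchy-Schwarz over the six fields produces \<open>mult_weight^2 * symb\<close>, which
  is <v>^\<gamma> \<rho>: the multiplier is thus controlled by the diffusion energy with weight
  \<rho>. The constant 58 is 2 * 116 / 4.\<close>

lemma transport_bound:
  assumes k: "k \<noteq> 0" and \<gamma>: "-3 \<le> \<gamma>" "\<gamma> \<le> 1"
  shows "(transport \<gamma> k u v)^2 \<le> 2 * (rho \<gamma> k v * (japanese v powr \<gamma> * (\<Sum>a\<in>UNIV. (field a u v)^2)))
     + 58 * (japanese v powr (\<gamma> + 2) * rho \<gamma> k v * (u v)^2)"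
proof -
  let ?m = "mult_weight \<gamma> k" and ?J = "japanese v"
  have "(\<Sum>a\<in>UNIV. ?m v * (field_dir a v \<bullet> k) * field a u v)^2
     \<le> (\<Sum>a\<in>UNIV. (?m v * (field_dir a v \<bullet> k))^2) * (\<Sum>a\<in>UNIV. (field a u v)^2)"
    by (rule Cauchy_Schwarz_ineq_sum)
  also have "\<dots> = ((?m v)^2 * symb k v) * (\<Sum>a\<in>UNIV. (field a u v)^2)"
    by (simp add: symb_def power_mult_distrib sum_distrib_left)
  finally have 1: "(\<Sum>a\<in>UNIV. ?m v * (field_dir a v \<bullet> k) * field a u v)^2
     \<le> rho \<gamma> k v * (?J powr \<gamma> * (\<Sum>a\<in>UNIV. (field a u v)^2))"
    unfolding mult_weight_square[OF k] by (simp add: mult_ac)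
  have "(drift \<gamma> k v / 2 * u v)^2 = (drift \<gamma> k v)^2 * ((u v)^2 / 4)"
    by (simp add: power_mult_distrib power_divide)
  also have "\<dots> \<le> 116 * (japanese v powr (\<gamma> + 2) * rho \<gamma> k v) * ((u v)^2 / 4)"
    by (rule mult_right_mono[OF drift_bound[OF assms]]) simp
  finally have 2: "(drift \<gamma> k v / 2 * u v)^2 \<le> 29 * (japanese v powr (\<gamma> + 2) * rho \<gamma> k v * (u v)^2)" by (simp add: mult_ac)
  have "(x + y)^2 \<le> 2 * x^2 + 2 * y^2" for x y :: real
    using zero_le_power2[of "x - y"] by (simp add: power2_eq_square algebra_simps)
  from this[of "\<Sum>a\<in>UNIV. ?m v * (field_dir a v \<bullet> k) * field a u v" "drift \<gamma> k v / 2 * u v"] 1 2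
  show ?thesis unfolding transport_def by linarith
qed

lemma continuous_transport:
  assumes "k \<noteq> 0" "times_differentiable 2 u"
  shows "continuous_on S (transport \<gamma> k u)"
proof -
  have c: "continuous_on S (field a u)" "continuous_on S u" "continuous_on S (mult_weight \<gamma> k)"
     "continuous_on S (\<lambda>v. field_dir a v \<bullet> k)" for a
    by (rule times_diff_continuous[of 1];
       (rule times_diff_field'[OF assms(2)] times_diff_mono[OF assms(2)]
         times_diff_mult_weight[OF assms(1)] times_diff_field_dir_inner)?; simp)+
  show ?thesis
    unfolding transport_def[abs_def] by (intro continuous_intros c continuous_drift assms) simp
qed

lemma transport_identity:
  assumes k: "k \<noteq> 0" and u: "times_differentiable 2 u" and z: "\<And>v. norm v > r \<Longrightarrow> u v = 0"
  shows "(LBINT v. (rho \<gamma> k v)^2 * (u v)^2) = - 2 * (LBINT v. (\<tau> + v \<bullet> k) * (u v * transport \<gamma> k u v))"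
proof -
  let ?m = "mult_weight \<gamma> k" and ?\<phi> = "\<lambda>v. \<tau> + v \<bullet> k"
  define N where "N a = (\<lambda>w. ?\<phi> w * (?m w * (field_dir a w \<bullet> k)) * (u w * u w))" for a
  have u1: "times_differentiable 1 u" using times_diff_mono[OF u] by simp
  have N: "times_differentiable 2 (N a)" for a
    unfolding N_def by (intro times_diff_mult times_diff_phase u
        times_diff_mult_weight[OF k] times_diff_field_dir_inner)
  have fN: "field a (N a) v = (?m v * (field_dir a v \<bullet> k)^2) * (u v)^2
      + ?\<phi> v * field a (\<lambda>w. ?m w * (field_dir a w \<bullet> k)) v * (u v)^2
      + 2 * (?\<phi> v * (u v * (?m v * (field_dir a v \<bullet> k) * field a u v)))" for a v
  proof -
    have t: "times_differentiable 1 (\<lambda>w. ?m w * (field_dir a w \<bullet> k))"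
      by (intro times_diff_mult times_diff_mult_weight[OF k] times_diff_field_dir_inner)
    have "field a (N a) v = ?\<phi> v * (?m v * (field_dir a v \<bullet> k)) * field a (\<lambda>w. u w * u w) v
       + field a (\<lambda>w. ?\<phi> w * (?m w * (field_dir a w \<bullet> k))) v * (u v * u v)"
      unfolding N_def
      by (rule field_mult) (intro times_diff_mult t times_diff_phase u1)+
    also have "field a (\<lambda>w. u w * u w) v = 2 * u v * field a u v"
      by (subst field_mult[OF u1 u1]) simp
    also have "field a (\<lambda>w. ?\<phi> w * (?m w * (field_dir a w \<bullet> k))) v
      = ?\<phi> v * field a (\<lambda>w. ?m w * (field_dir a w \<bullet> k)) v + (field_dir a v \<bullet> k) * (?m v * (field_dir a v \<bullet> k))"
      by (subst field_mult[OF times_diff_phase t]) (simp only: field_phase)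
    finally show ?thesis by (simp add: power2_eq_square algebra_simps)
  qed
  have sumN: "(\<Sum>a\<in>UNIV. field a (N a) v) = (rho \<gamma> k v)^2 * (u v)^2 + 2 * (?\<phi> v * (u v * transport \<gamma> k u v))" for v
  proof -
    have "(\<Sum>a\<in>UNIV. field a (N a) v) = ?m v * symb k v * (u v)^2 + ?\<phi> v * drift \<gamma> k v * (u v)^2
      + 2 * (?\<phi> v * (u v * (\<Sum>a\<in>UNIV. ?m v * (field_dir a v \<bullet> k) * field a u v)))"
      unfolding fN sum.distrib by (simp add: symb_def drift_def sum_distrib_left sum_distrib_right)
    then show ?thesis
      unfolding mult_weight_symb[OF k] transport_def by (simp add: power2_eq_square algebra_simps)
  qed
  have zN: "norm v > r \<Longrightarrow> N a v = 0" for a v using z by (simp add: N_def)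
  have "(LBINT v. field a (N a) v) = 0" for a by (rule integral_field_eq_0[OF N zN])
  moreover have "integrable lborel (field a (N a))" for a
    by (rule integrable_continuous_support[of _ r])
       (auto intro!: times_diff_continuous[of 1] times_diff_field'[OF N] field_eq_0[of r "N a", OF zN])
  ultimately have "(LBINT v. (\<Sum>a\<in>UNIV. field a (N a) v)) = 0" by simp
  moreover have "integrable lborel (\<lambda>v. (rho \<gamma> k v)^2 * (u v)^2)" "integrable lborel (\<lambda>v. ?\<phi> v * (u v * transport \<gamma> k u v))"
  proof -
    have c: "continuous_on UNIV u" "continuous_on UNIV (rho \<gamma> k)" "continuous_on UNIV (transport \<gamma> k u)" "continuous_on UNIV ?\<phi>"
      by (rule times_diff_continuous[OF u1] times_diff_continuous[OF times_diff_rho[OF k, of 1]]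
        continuous_transport[OF k u] times_diff_continuous[OF times_diff_phase[of 1]]; simp)+
    show "integrable lborel (\<lambda>v. (rho \<gamma> k v)^2 * (u v)^2)" "integrable lborel (\<lambda>v. ?\<phi> v * (u v * transport \<gamma> k u v))"
      by (intro integrable_continuous_support[of _ r] continuous_intros c; simp add: z)+
  qed
  ultimately show ?thesis unfolding sumN by simp
qed

context coefficients
begin

lemma weighted_arith:
  fixes a1 :: real
  assumes "s = a1 + a2" "a1 \<le> x1 + y1" "a2 \<le> x2 + y2" "c1 \<le> x1 + z1" "c2 \<le> x2 + z2"
    "X = 2 * x1 + 2 * x2" "Y = y1 + y2" "Z = z1 + z2"
  shows "s + c1 + c2 \<le> X + Y + Z"
  using assms by linarith

text \<open>The energy estimate with weight <v>^(\<gamma>+2), added for u1 and u2. The factor 27 is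
  3 * 3^2, since |\<gamma> + 2| \<le> 3; the term it multiplies is of lower order in <v> than the
  damping by F and is absorbed there for large v.\<close>

lemma weighted_estimate:
  assumes u: "times_differentiable 3 u1" "times_differentiable 3 u2" and \<phi>: "continuous_on UNIV \<phi>"
    and z: "\<And>v. norm v > r \<Longrightarrow> u1 v = 0" "\<And>v. norm v > r \<Longrightarrow> u2 v = 0"
  shows "(LBINT v. japanese v powr (2 * \<gamma> + 2) * ((\<Sum>a\<in>UNIV. (field a u1 v)^2) + (\<Sum>a\<in>UNIV. (field a u2 v)^2)))
     + (LBINT v. japanese v powr (2 * \<gamma> + 4) * ((u1 v)^2 + (u2 v)^2))
    \<le> 54 * K^2 * (108 * K^2)^2 * ((LBINT v. (diffusion u1 v - \<phi> v * u2 v)^2 + (diffusion u2 v + \<phi> v * u1 v)^2)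
       + (LBINT v. (u1 v)^2 + (u2 v)^2))"
proof -
  let ?\<rho> = "\<lambda>v. japanese v powr (\<gamma> + 2)" and ?J = "\<lambda>s v. japanese v powr s"
  define h1 where "h1 v = diffusion u1 v - \<phi> v * u2 v" for v
  define h2 where "h2 v = diffusion u2 v + \<phi> v * u1 v" for v
  define S where "S u v = (\<Sum>a\<in>UNIV. (field a u v)^2)" for u v
  have cont: "continuous_on UNIV u1" "continuous_on UNIV u2" "continuous_on UNIV (field a u1)" "continuous_on UNIV (field a u2)"
     "continuous_on UNIV (diffusion u1)" "continuous_on UNIV (diffusion u2)" for a
    by (rule times_diff_continuous[of 1] times_diff_diffusion u;
        (rule times_diff_mono[OF u(1)] times_diff_mono[OF u(2)] times_diff_field'[OF u(1)] times_diff_field'[OF u(2)])?; simp)+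
  have cS: "continuous_on UNIV (S u1)" "continuous_on UNIV (S u2)"
    unfolding S_def[abs_def] by (intro continuous_intros cont)+
  have zX: "norm v > r \<Longrightarrow> field a u1 v = 0" "norm v > r \<Longrightarrow> field a u2 v = 0" for a v
    by (rule field_eq_0[of r]; simp add: z)+
  have zS: "norm v > r \<Longrightarrow> S u1 v = 0" "norm v > r \<Longrightarrow> S u2 v = 0" for v
    using zX by (simp_all add: S_def)
  have zL: "norm v > r \<Longrightarrow> diffusion u1 v = 0" "norm v > r \<Longrightarrow> diffusion u2 v = 0" for v
    unfolding diffusion_def using z zX by (simp_all add: field_eq_0[of r])
  have E: "(LBINT v. ?\<rho> v * (?J \<gamma> v * S u v)) / (2 * K) + (LBINT v. ?\<rho> v * (?\<rho> v * (u v)^2)) / K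
     \<le> (LBINT v. ?\<rho> v * (u v * diffusion u v)) + 27 * K * (LBINT v. ?J (2 * \<gamma> + 2) v * (u v)^2)"
    if "times_differentiable 3 u" "\<And>v. norm v > r \<Longrightarrow> u v = 0" for u
  proof -
    have jj: "?J (\<gamma> + 2 * 0) v * ?\<rho> v = ?J (2 * \<gamma> + 2) v" for v
      using japanese_mult_powr[of v \<gamma> "\<gamma> + 2"] by simp
    have "(LBINT v. ?\<rho> v * (?J \<gamma> v * S u v)) / (2 * K) + (LBINT v. ?\<rho> v * (?\<rho> v * (u v)^2)) / K
     \<le> (LBINT v. ?\<rho> v * (u v * diffusion u v)) + 3 * K * \<bar>\<gamma> + 2\<bar>^2 * (LBINT v. ?J (\<gamma> + 2 * 0) v * ?\<rho> v * (u v)^2)"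
      unfolding S_def
      by (rule energy_weight[OF that, where s = 0 and c = "\<bar>\<gamma> + 2\<bar>" and \<rho> = ?\<rho>])
        (simp_all add: field_japanese)
    moreover have "3 * K * \<bar>\<gamma> + 2\<bar>^2 * (LBINT v. ?J (2 * \<gamma> + 2) v * (u v)^2) \<le> 3 * K * 3^2 * (LBINT v. ?J (2 * \<gamma> + 2) v * (u v)^2)"
    proof (rule mult_right_mono)
      have "\<bar>\<gamma> + 2\<bar>^2 \<le> 3^2" by (rule power_mono) (use gamma in auto)
      then show "3 * K * \<bar>\<gamma> + 2\<bar>^2 \<le> 3 * K * 3^2" using K by simp
    qed (rule Bochner_Integration.integral_nonneg, simp)
    ultimately show ?thesis unfolding jj by simp
  qed
  have e1: "?\<rho> v * (?J \<gamma> v * x) = ?J (2 * \<gamma> + 2) v * x" "?\<rho> v * (?\<rho> v * x) = ?J (2 * \<gamma> + 4) v * x" for v x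
    unfolding mult.assoc[symmetric] japanese_mult_powr by (simp_all add: add_ac)
  let ?C = "27 * K * (108 * K^2)^2"
  have i: "integrable lborel (\<lambda>v. ?J (2 * \<gamma> + 2) v * S u1 v)" "integrable lborel (\<lambda>v. ?J (2 * \<gamma> + 2) v * S u2 v)"
     "integrable lborel (\<lambda>v. ?J (2 * \<gamma> + 4) v * (u1 v)^2)" "integrable lborel (\<lambda>v. ?J (2 * \<gamma> + 4) v * (u2 v)^2)"
     "integrable lborel (\<lambda>v. ?J (2 * \<gamma> + 2) v * (u1 v)^2)" "integrable lborel (\<lambda>v. ?J (2 * \<gamma> + 2) v * (u2 v)^2)"
     "integrable lborel (\<lambda>v. ?\<rho> v * (u1 v * diffusion u1 v))" "integrable lborel (\<lambda>v. ?\<rho> v * (u2 v * diffusion u2 v))"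
     "integrable lborel (\<lambda>v. (h1 v)^2 + (h2 v)^2)" "integrable lborel (\<lambda>v. (u1 v)^2 + (u2 v)^2)"
    unfolding h1_def h2_def
    by (intro integrable_continuous_support[of _ r] continuous_intros cont cS \<phi> continuous_japanese; simp add: z zS zL)+
  have pw: "?\<rho> v * (u1 v * diffusion u1 v) + ?\<rho> v * (u2 v * diffusion u2 v)
      + 27 * K * (?J (2 * \<gamma> + 2) v * (u1 v)^2) + 27 * K * (?J (2 * \<gamma> + 2) v * (u2 v)^2)
     \<le> 1 / (2 * K) * (?J (2 * \<gamma> + 4) v * (u1 v)^2 + ?J (2 * \<gamma> + 4) v * (u2 v)^2)
        + K * ((h1 v)^2 + (h2 v)^2) + ?C * ((u1 v)^2 + (u2 v)^2)" for v
  proof -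
    have a: "?\<rho> v * (x * y) \<le> 1 / (4 * K) * (?J (2 * \<gamma> + 4) v * x^2) + K * y^2" for x y
    proof -
      have "0 \<le> (?\<rho> v * x - 2 * K * y)^2 / (4 * K)" using K by simp
      also have "\<dots> = 1 / (4 * K) * (?\<rho> v * (?\<rho> v * x^2)) + K * y^2 - ?\<rho> v * (x * y)"
        using K by (simp add: power2_diff power_mult_distrib power2_eq_square field_simps)
      finally show ?thesis unfolding e1 by simp
    qed
    \<comment> \<open>The threshold is 108 K^2 = 27 K * 4 K. Below it the power is simply bounded,
      with 2 \<gamma> + 2 \<le> 4.\<close>
    have b: "27 * K * ?J (2 * \<gamma> + 2) v \<le> 1 / (4 * K) * ?J (2 * \<gamma> + 4) v + ?C"
    proof (cases "108 * K^2 \<le> (japanese v)^2")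
      case True
      have "27 * K * ?J (2 * \<gamma> + 2) v = 1 / (4 * K) * (108 * K^2 * ?J (2 * \<gamma> + 2) v)"
        using K by (simp add: power2_eq_square)
      also have "\<dots> \<le> 1 / (4 * K) * ((japanese v)^2 * ?J (2 * \<gamma> + 2) v)"
        using True K by (intro mult_left_mono mult_right_mono) auto
      also have "(japanese v)^2 * ?J (2 * \<gamma> + 2) v = ?J (2 * \<gamma> + 4) v"
        unfolding japanese_square japanese_mult_powr by (simp add: add.commute)
      finally show ?thesis using K by (smt (verit) mult_nonneg_nonneg zero_le_power2)
    next
      case False
      have "?J (2 * \<gamma> + 2) v \<le> ?J 4 v"
        using japanese_ge_1[of v] gamma by (intro powr_mono) auto
      also have "\<dots> = ((japanese v)^2)^2" by simp
      also have "\<dots> \<le> (108 * K^2)^2" using False by (intro power_mono) auto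
      finally have "27 * K * ?J (2 * \<gamma> + 2) v \<le> ?C" using K by (intro mult_left_mono) auto
      moreover have "0 \<le> 1 / (4 * K) * ?J (2 * \<gamma> + 4) v" using K by simp
      ultimately show ?thesis by linarith
    qed
    have c: "27 * K * (?J (2 * \<gamma> + 2) v * x^2) \<le> 1 / (4 * K) * (?J (2 * \<gamma> + 4) v * x^2) + ?C * x^2" for x
      using mult_right_mono[OF b, of "x^2"] by (simp add: algebra_simps)
    \<comment> \<open>The coupling through \<phi> is antisymmetric and drops out of this sum, so the
      bound does not depend on the frequency.\<close>
    have "?\<rho> v * (u1 v * diffusion u1 v) + ?\<rho> v * (u2 v * diffusion u2 v) = ?\<rho> v * (u1 v * h1 v) + ?\<rho> v * (u2 v * h2 v)"
      by (simp add: h1_def h2_def algebra_simps)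
    then show ?thesis
      by (rule weighted_arith[OF _ a[of "u1 v" "h1 v"] a[of "u2 v" "h2 v"] c[of "u1 v"] c[of "u2 v"]])
        (use K in \<open>simp_all add: distrib_left mult_ac\<close>)
  qed
  have mono: "(LBINT v. ?\<rho> v * (u1 v * diffusion u1 v) + ?\<rho> v * (u2 v * diffusion u2 v)
      + 27 * K * (?J (2 * \<gamma> + 2) v * (u1 v)^2) + 27 * K * (?J (2 * \<gamma> + 2) v * (u2 v)^2))
     \<le> (LBINT v. 1 / (2 * K) * (?J (2 * \<gamma> + 4) v * (u1 v)^2 + ?J (2 * \<gamma> + 4) v * (u2 v)^2)
        + K * ((h1 v)^2 + (h2 v)^2) + ?C * ((u1 v)^2 + (u2 v)^2))"
    by (intro integral_mono pw Bochner_Integration.integrable_add integrable_mult_right i)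
  have I: "(LBINT v. ?\<rho> v * (u1 v * diffusion u1 v)) + (LBINT v. ?\<rho> v * (u2 v * diffusion u2 v))
      + 27 * K * (LBINT v. ?J (2 * \<gamma> + 2) v * (u1 v)^2) + 27 * K * (LBINT v. ?J (2 * \<gamma> + 2) v * (u2 v)^2)
     \<le> 1 / (2 * K) * ((LBINT v. ?J (2 * \<gamma> + 4) v * (u1 v)^2) + (LBINT v. ?J (2 * \<gamma> + 4) v * (u2 v)^2))
        + K * (LBINT v. (h1 v)^2 + (h2 v)^2) + ?C * (LBINT v. (u1 v)^2 + (u2 v)^2)"
  proof -
    have L: "(LBINT v. p1 v + p2 v + a * q1 v + a * q2 v) = (LBINT v. p1 v) + (LBINT v. p2 v)
       + a * (LBINT v. q1 v) + a * (LBINT v. q2 v)"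
      if "integrable lborel p1" "integrable lborel p2" "integrable lborel q1" "integrable lborel q2"
      for p1 p2 q1 q2 :: "real^3 \<Rightarrow> real" and a
      using that by simp
    have R: "(LBINT v. a * (p1 v + p2 v) + b * q1 v + c * q2 v) = a * ((LBINT v. p1 v) + (LBINT v. p2 v))
       + b * (LBINT v. q1 v) + c * (LBINT v. q2 v)"
      if "integrable lborel p1" "integrable lborel p2" "integrable lborel q1" "integrable lborel q2"
      for p1 p2 q1 q2 :: "real^3 \<Rightarrow> real" and a b c
      using that by simp
    show ?thesis
      using mono unfolding L[OF i(7) i(8) i(5) i(6)] R[OF i(3) i(4) i(9) i(10)] .
  qed
  define A1 A2 E1 E2 H U where defs: "A1 = (LBINT v. ?J (2 * \<gamma> + 2) v * S u1 v)" "A2 = (LBINT v. ?J (2 * \<gamma> + 2) v * S u2 v)"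
    "E1 = (LBINT v. ?J (2 * \<gamma> + 4) v * (u1 v)^2)" "E2 = (LBINT v. ?J (2 * \<gamma> + 4) v * (u2 v)^2)"
    "H = (LBINT v. (h1 v)^2 + (h2 v)^2)" "U = (LBINT v. (u1 v)^2 + (u2 v)^2)"
  have HU: "H \<ge> 0" "U \<ge> 0" unfolding defs by (auto intro!: Bochner_Integration.integral_nonneg)
  have "A1 / (2 * K) + E1 / K + (A2 / (2 * K) + E2 / K) \<le> 1 / (2 * K) * (E1 + E2) + K * H + ?C * U"
    using E[OF u(1) z(1)] E[OF u(2) z(2)] I unfolding e1 defs by linarith
  moreover have "(A1 + A2 + (E1 + E2)) / (2 * K) = A1 / (2 * K) + E1 / K + (A2 / (2 * K) + E2 / K) - 1 / (2 * K) * (E1 + E2)"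
    using K by (simp add: field_simps)
  ultimately have "(A1 + A2 + (E1 + E2)) / (2 * K) \<le> K * H + ?C * U" by linarith
  then have "A1 + A2 + (E1 + E2) \<le> (K * H + ?C * U) * (2 * K)"
    using K by (simp add: pos_divide_le_eq)
  then have "A1 + A2 + (E1 + E2) \<le> 2 * K^2 * H + 2 * K * ?C * U"
    by (simp add: algebra_simps power2_eq_square)
  also have "2 * K * ?C = 54 * K^2 * (108 * K^2)^2" by (simp add: power2_eq_square)
  also have "2 * K^2 * H \<le> 54 * K^2 * (108 * K^2)^2 * H"
  proof (rule mult_right_mono)
    have "1 \<le> 108 * K^2" using one_le_power[OF K, of 2] by linarith
    then have "1 \<le> (108 * K^2)^2" by (rule one_le_power)
    then have "2 * K^2 * 1 \<le> 54 * K^2 * (108 * K^2)^2" by (intro mult_mono) auto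
    then show "2 * K^2 \<le> 54 * K^2 * (108 * K^2)^2" by simp
  qed (rule HU)
  finally have "A1 + A2 + (E1 + E2) \<le> 54 * K^2 * (108 * K^2)^2 * (H + U)" by (simp add: algebra_simps)
  moreover have "(LBINT v. ?J (2 * \<gamma> + 2) v * (S u1 v + S u2 v)) = A1 + A2"
    "(LBINT v. ?J (2 * \<gamma> + 4) v * ((u1 v)^2 + (u2 v)^2)) = E1 + E2"
    unfolding defs distrib_left using i by simp_all
  ultimately show ?thesis unfolding defs h1_def h2_def S_def by simp
qed

end

lemma cauchy_schwarz_2:
  fixes a b c d :: real
  shows "(a * c + b * d)^2 \<le> (a^2 + b^2) * (c^2 + d^2)" "(a * d - b * c)^2 \<le> (a^2 + b^2) * (c^2 + d^2)"
  using zero_le_power2[of "a * d - b * c"] zero_le_power2[of "a * c + b * d"]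
  by (simp_all add: power2_eq_square algebra_simps)

lemma field_rho:
  assumes k: "k \<noteq> 0" and \<gamma>: "-3 \<le> \<gamma>" "\<gamma> \<le> 1"
  shows "\<bar>field a (rho \<gamma> k) v\<bar> \<le> 2 * japanese v powr 1 * rho \<gamma> k v"
proof -
  have "\<bar>field a (rho \<gamma> k) v\<bar> \<le> (\<bar>\<gamma> / 3\<bar> + \<bar>1 / 3\<bar>) * japanese v * rho \<gamma> k v"
    unfolding rho_def by (rule field_weight[OF k])
  also have "\<dots> \<le> 2 * japanese v * rho \<gamma> k v"
    by (intro mult_right_mono) (use \<gamma> rho_pos[OF k, of \<gamma> v] in auto)
  finally show ?thesis by simp
qed

context coefficients
begin

text \<open>L is symmetric, so if \<phi> were constant both sides would vanish. In general only the
  terms with one derivative on \<phi> survive, and the growing factor \<phi> itself is gone.\<close>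

lemma coupling_identity:
  assumes u: "times_differentiable 3 u1" "times_differentiable 3 u2"
    and z: "\<And>v. norm v > r \<Longrightarrow> u1 v = 0" "\<And>v. norm v > r \<Longrightarrow> u2 v = 0"
  shows "(LBINT v. (\<tau> + v \<bullet> k) * (u2 v * diffusion u1 v - u1 v * diffusion u2 v))
    = (LBINT v. (\<Sum>a\<in>UNIV. (field_dir a v \<bullet> k) * (sig (fst a) v * (u2 v * field a u1 v - u1 v * field a u2 v))))"
proof -
  let ?\<phi> = "\<lambda>v. \<tau> + v \<bullet> k"
  have u1: "times_differentiable 2 u1" "times_differentiable 2 u2" "times_differentiable 1 u1" "times_differentiable 1 u2"
    using times_diff_mono[OF u(1)] times_diff_mono[OF u(2)] by simp_all
  have X: "times_differentiable 2 (field a u1)" "times_differentiable 2 (field a u2)"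
     "times_differentiable 1 (field a u1)" "times_differentiable 1 (field a u2)" for a
    by (rule times_diff_field'[OF u(1)] times_diff_field'[OF u(2)]; simp)+
  have s: "times_differentiable 1 (\<lambda>w. sig (fst a) w * field a u1 w)" "times_differentiable 1 (\<lambda>w. sig (fst a) w * field a u2 w)" for a
    by (intro times_diff_mult X sig_td'; simp)+
  define N where "N a = (\<lambda>w. (?\<phi> w * u2 w) * (sig (fst a) w * field a u1 w) - (?\<phi> w * u1 w) * (sig (fst a) w * field a u2 w))" for a
  have N: "times_differentiable 2 (N a)" for a
    unfolding N_def by (intro times_diff_diff times_diff_mult times_diff_phase u1 X sig_td)
  have fp: "field a (\<lambda>w. ?\<phi> w * g w) v = ?\<phi> v * field a g v + (field_dir a v \<bullet> k) * g v"
    if "times_differentiable 1 g" for a g v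
    by (subst field_mult[OF times_diff_phase that]) (simp only: field_phase)
  have fN: "field a (N a) v = (field_dir a v \<bullet> k) * (sig (fst a) v * (u2 v * field a u1 v - u1 v * field a u2 v))
     + ?\<phi> v * (u2 v * field a (\<lambda>w. sig (fst a) w * field a u1 w) v - u1 v * field a (\<lambda>w. sig (fst a) w * field a u2 w) v)" for a v
  proof -
    have "field a (N a) v = field a (\<lambda>w. (?\<phi> w * u2 w) * (sig (fst a) w * field a u1 w)) v
       - field a (\<lambda>w. (?\<phi> w * u1 w) * (sig (fst a) w * field a u2 w)) v"
      unfolding N_def by (rule field_diff) (intro times_diff_mult times_diff_phase u1 s)+
    also have "field a (\<lambda>w. (?\<phi> w * u2 w) * (sig (fst a) w * field a u1 w)) v
      = ?\<phi> v * u2 v * field a (\<lambda>w. sig (fst a) w * field a u1 w) v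
         + (?\<phi> v * field a u2 v + (field_dir a v \<bullet> k) * u2 v) * (sig (fst a) v * field a u1 v)"
      by (subst field_mult[OF times_diff_mult[OF times_diff_phase u1(4)] s(1)]) (simp only: fp[OF u1(4)])
    also have "field a (\<lambda>w. (?\<phi> w * u1 w) * (sig (fst a) w * field a u2 w)) v
      = ?\<phi> v * u1 v * field a (\<lambda>w. sig (fst a) w * field a u2 w) v
         + (?\<phi> v * field a u1 v + (field_dir a v \<bullet> k) * u1 v) * (sig (fst a) v * field a u2 v)"
      by (subst field_mult[OF times_diff_mult[OF times_diff_phase u1(3)] s(2)]) (simp only: fp[OF u1(3)])
    finally show ?thesis by (simp add: algebra_simps)
  qed
  have sumN: "(\<Sum>a\<in>UNIV. field a (N a) v)
     = (\<Sum>a\<in>UNIV. (field_dir a v \<bullet> k) * (sig (fst a) v * (u2 v * field a u1 v - u1 v * field a u2 v)))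
       - ?\<phi> v * (u2 v * diffusion u1 v - u1 v * diffusion u2 v)" for v
  proof -
    let ?p = "\<lambda>a. field a (\<lambda>w. sig (fst a) w * field a u1 w) v" and ?q = "\<lambda>a. field a (\<lambda>w. sig (fst a) w * field a u2 w) v"
    have "(\<Sum>a\<in>UNIV. ?\<phi> v * (u2 v * ?p a - u1 v * ?q a)) = ?\<phi> v * (u2 v * (\<Sum>a\<in>UNIV. ?p a) - u1 v * (\<Sum>a\<in>UNIV. ?q a))"
      by (simp only: sum_distrib_left[symmetric] sum_subtractf)
    also have "u2 v * (\<Sum>a\<in>UNIV. ?p a) - u1 v * (\<Sum>a\<in>UNIV. ?q a) = - (u2 v * diffusion u1 v - u1 v * diffusion u2 v)"
      unfolding diffusion_def by (simp only: algebra_simps)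
    finally show ?thesis unfolding fN sum.distrib mult_minus_right by (simp only: diff_conv_add_uminus)
  qed
  have zN: "norm v > r \<Longrightarrow> N a v = 0" for a v using z by (simp add: N_def)
  have iN: "integrable lborel (field a (N a))" for a
    by (rule integrable_continuous_support[of _ r])
       (auto intro!: times_diff_continuous[of 1] times_diff_field'[OF N] field_eq_0[of r "N a", OF zN])
  have "(LBINT v. field a (N a) v) = 0" for a by (rule integral_field_eq_0[OF N zN])
  then have "(LBINT v. (\<Sum>a\<in>UNIV. field a (N a) v)) = 0" using iN by simp
  moreover have "continuous_on UNIV u1" "continuous_on UNIV u2" "continuous_on UNIV (field a u1)" "continuous_on UNIV (field a u2)"
     "continuous_on UNIV ?\<phi>" "continuous_on UNIV (\<lambda>v. field_dir a v \<bullet> k)" for a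
    by (rule times_diff_continuous[of 1]; (rule u1 X times_diff_phase times_diff_field_dir_inner)?; simp)+
  note c = this
  have "integrable lborel (\<lambda>v. \<Sum>a\<in>UNIV. (field_dir a v \<bullet> k) * (sig (fst a) v * (u2 v * field a u1 v - u1 v * field a u2 v)))"
    "integrable lborel (\<lambda>v. ?\<phi> v * (u2 v * diffusion u1 v - u1 v * diffusion u2 v))"
    by (intro integrable_continuous_support[of _ r] continuous_intros c continuous_sig times_diff_diffusion u; simp add: z)+
  ultimately show ?thesis unfolding sumN by simp
qed

text \<open>The four facts \<open>B\<close>, \<open>T\<close>, \<open>D\<close> and \<open>L\<close>
  below are the hypotheses of \<open>closing_inequality\<close>; the weighted norm of u remains on
  the right and is supplied by \<open>weighted_estimate\<close>.\<close>

lemma hypoelliptic_estimate: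
  fixes \<tau> :: real
  assumes k: "k \<noteq> 0" and u: "times_differentiable 3 u1" "times_differentiable 3 u2"
    and z: "\<And>v. norm v > r \<Longrightarrow> u1 v = 0" "\<And>v. norm v > r \<Longrightarrow> u2 v = 0"
  defines "h1 \<equiv> \<lambda>v. diffusion u1 v - (\<tau> + v \<bullet> k) * u2 v"
    and "h2 \<equiv> \<lambda>v. diffusion u2 v + (\<tau> + v \<bullet> k) * u1 v"
  shows "(LBINT v. (rho \<gamma> k v)^2 * ((u1 v)^2 + (u2 v)^2)) + (LBINT v. (diffusion u1 v)^2 + (diffusion u2 v)^2)
    \<le> 400 * K^2 * (200 * K^2) ^ 8 * ((LBINT v. (h1 v)^2 + (h2 v)^2)
        + (LBINT v. japanese v powr (2 * \<gamma> + 4) * ((u1 v)^2 + (u2 v)^2)))"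
proof -
  let ?\<phi> = "\<lambda>v. \<tau> + v \<bullet> k" and ?J = "\<lambda>s v. japanese v powr s"
  define R where "R = rho \<gamma> k"
  define T1 T2 where "T1 = transport \<gamma> k u1" and "T2 = transport \<gamma> k u2"
  define L1 L2 where "L1 = diffusion u1" and "L2 = diffusion u2"
  define S where "S u v = (\<Sum>a\<in>UNIV. (field a u v)^2)" for u v
  have R0: "R v > 0" for v unfolding R_def by (rule rho_pos[OF k])
  have u2: "times_differentiable 2 u1" "times_differentiable 2 u2" "times_differentiable 1 u1" "times_differentiable 1 u2"
    using times_diff_mono[OF u(1)] times_diff_mono[OF u(2)] by simp_all
  have X: "times_differentiable 1 (field a u1)" "times_differentiable 1 (field a u2)" for a
    by (rule times_diff_field'[OF u(1)] times_diff_field'[OF u(2)]; simp)+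
  have cont: "continuous_on UNIV u1" "continuous_on UNIV u2" "continuous_on UNIV (field a u1)" "continuous_on UNIV (field a u2)"
     "continuous_on UNIV ?\<phi>" "continuous_on UNIV R" "continuous_on UNIV (\<lambda>v. field_dir a v \<bullet> k)" for a
    unfolding R_def
    by (rule times_diff_continuous[of 1];
        (rule u2 X times_diff_phase times_diff_rho[OF k] times_diff_field_dir_inner)?; simp)+
  have cont': "continuous_on UNIV L1" "continuous_on UNIV L2" "continuous_on UNIV T1" "continuous_on UNIV T2"
    unfolding T1_def T2_def L1_def L2_def
    by (intro times_diff_diffusion continuous_transport u u2 k)+
  have cS: "continuous_on UNIV (S u1)" "continuous_on UNIV (S u2)"
    unfolding S_def[abs_def] by (intro continuous_intros cont)+
  have ch: "continuous_on UNIV h1" "continuous_on UNIV h2"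
    unfolding h1_def h2_def L1_def[symmetric] L2_def[symmetric] by (intro continuous_intros cont cont')+
  have zX: "norm v > r \<Longrightarrow> field a u1 v = 0" "norm v > r \<Longrightarrow> field a u2 v = 0" for a v
    by (rule field_eq_0[of r]; simp add: z)+
  have zS: "norm v > r \<Longrightarrow> S u1 v = 0" "norm v > r \<Longrightarrow> S u2 v = 0" for v
    using zX by (simp_all add: S_def)
  have zL: "norm v > r \<Longrightarrow> L1 v = 0" "norm v > r \<Longrightarrow> L2 v = 0" for v
    unfolding diffusion_def L1_def L2_def using z zX by (simp_all add: field_eq_0[of r])
  have zT: "norm v > r \<Longrightarrow> T1 v = 0" "norm v > r \<Longrightarrow> T2 v = 0" for v
    unfolding transport_def T1_def T2_def using z zX by simp_all
  have zh: "norm v > r \<Longrightarrow> h1 v = 0" "norm v > r \<Longrightarrow> h2 v = 0" for v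
    unfolding h1_def h2_def L1_def[symmetric] L2_def[symmetric] using z zL by simp_all
  note ints = integrable_continuous_support[of _ r] continuous_intros cont cont' cS ch continuous_japanese continuous_sig
  define nu where "nu v = (u1 v)^2 + (u2 v)^2" for v
  have nu0: "nu v \<ge> 0" for v by (simp add: nu_def)
  have cnu: "continuous_on UNIV nu" unfolding nu_def[abs_def] by (intro continuous_intros cont)
  have znu: "norm v > r \<Longrightarrow> nu v = 0" for v using z by (simp add: nu_def)
  define Hs Es Ds Ls Bs Ts Ms where defs:
    "Hs = (LBINT v. (h1 v)^2 + (h2 v)^2)" "Es = (LBINT v. ?J (2 * \<gamma> + 4) v * nu v)"
    "Ds = (LBINT v. (R v)^2 * nu v)" "Ls = (LBINT v. (L1 v)^2 + (L2 v)^2)"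
    "Bs = (LBINT v. R v * (?J \<gamma> v * (S u1 v + S u2 v)))" "Ts = (LBINT v. (T1 v)^2 + (T2 v)^2)"
    "Ms = (LBINT v. ?J (\<gamma> + 2) v * R v * nu v)"
  have S0: "S u v \<ge> 0" for u v unfolding S_def by (intro sum_nonneg) simp
  have nn: "Hs \<ge> 0" "Es \<ge> 0" "Ds \<ge> 0" "Ls \<ge> 0" "Bs \<ge> 0" "Ts \<ge> 0"
    unfolding defs by (intro Bochner_Integration.integral_nonneg add_nonneg_nonneg mult_nonneg_nonneg S0 nu0 zero_le_power2 powr_ge_zero less_imp_le[OF R0])+
  have i: "integrable lborel (\<lambda>v. (h1 v)^2 + (h2 v)^2)" "integrable lborel (\<lambda>v. ?J (2 * \<gamma> + 4) v * nu v)"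
    "integrable lborel (\<lambda>v. (R v)^2 * nu v)" "integrable lborel (\<lambda>v. (L1 v)^2 + (L2 v)^2)"
    "integrable lborel (\<lambda>v. R v * (?J \<gamma> v * (S u1 v + S u2 v)))" "integrable lborel (\<lambda>v. (T1 v)^2 + (T2 v)^2)"
    "integrable lborel (\<lambda>v. ?J (\<gamma> + 2) v * R v * nu v)"
    by (intro ints cnu; simp add: znu zS zL zT zh)+
  have Ms: "\<bar>Ms\<bar> \<le> sqrt Es * sqrt Ds"
    unfolding defs
  proof (rule integral_cauchy_schwarz)
    fix v
    have "(?J (\<gamma> + 2) v)^2 = ?J (2 * \<gamma> + 4) v"
      using japanese_mult_powr[of v "\<gamma> + 2" "\<gamma> + 2"] by (simp add: power2_eq_square add_ac)
    then show "(?J (\<gamma> + 2) v * R v * nu v)^2 \<le> ?J (2 * \<gamma> + 4) v * nu v * ((R v)^2 * nu v)"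
      unfolding power_mult_distrib by (simp add: power2_eq_square mult_ac)
  qed (use i nu0 in auto)
  \<comment> \<open>The energy estimate with weight \<rho>. The factor 12 K is 3 K * 2^2, where 2
    bounds the logarithmic derivative of \<rho> in units of <v>.\<close>
  have B: "Bs \<le> 2 * K * (sqrt Hs * sqrt Ds + 12 * K * (sqrt Es * sqrt Ds))"
  proof -
    have E: "(LBINT v. R v * (?J \<gamma> v * S u v)) / (2 * K) + (LBINT v. R v * (?J (\<gamma> + 2) v * (u v)^2)) / K
       \<le> (LBINT v. R v * (u v * diffusion u v)) + 3 * K * 2^2 * (LBINT v. ?J (\<gamma> + 2 * 1) v * R v * (u v)^2)"
      if "times_differentiable 3 u" "\<And>v. norm v > r \<Longrightarrow> u v = 0" for u
      unfolding S_def R_def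
      by (rule energy_weight[OF that]) (simp_all only: times_diff_rho[OF k] field_rho[OF k gamma] less_imp_le[OF rho_pos[OF k]] zero_le_numeral)
    have P: "(LBINT v. R v * (?J (\<gamma> + 2) v * (u v)^2)) / K \<ge> 0" for u
      using K by (intro divide_nonneg_nonneg Bochner_Integration.integral_nonneg mult_nonneg_nonneg less_imp_le[OF R0]) auto
    have j: "integrable lborel (\<lambda>v. R v * (?J \<gamma> v * S u1 v))" "integrable lborel (\<lambda>v. R v * (?J \<gamma> v * S u2 v))"
      "integrable lborel (\<lambda>v. R v * (u1 v * L1 v))" "integrable lborel (\<lambda>v. R v * (u2 v * L2 v))"
      "integrable lborel (\<lambda>v. ?J (\<gamma> + 2) v * R v * (u1 v)^2)" "integrable lborel (\<lambda>v. ?J (\<gamma> + 2) v * R v * (u2 v)^2)"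
      "integrable lborel (\<lambda>v. R v * (u1 v * h1 v + u2 v * h2 v))"
      by (intro ints; simp add: z zS)+
    have b: "Bs = (LBINT v. R v * (?J \<gamma> v * S u1 v)) + (LBINT v. R v * (?J \<gamma> v * S u2 v))"
      unfolding defs distrib_left using j by simp
    have m: "Ms = (LBINT v. ?J (\<gamma> + 2) v * R v * (u1 v)^2) + (LBINT v. ?J (\<gamma> + 2) v * R v * (u2 v)^2)"
      unfolding defs distrib_left nu_def using j by simp
    have "R v * (u1 v * L1 v) + R v * (u2 v * L2 v) = R v * (u1 v * h1 v + u2 v * h2 v)" for v
      by (simp add: h1_def h2_def L1_def L2_def algebra_simps)
    then have p: "(LBINT v. R v * (u1 v * L1 v)) + (LBINT v. R v * (u2 v * L2 v)) = (LBINT v. R v * (u1 v * h1 v + u2 v * h2 v))"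
      using j by (simp flip: Bochner_Integration.integral_add)
    have "\<bar>\<integral>v. R v * (u1 v * h1 v + u2 v * h2 v) \<partial>lborel\<bar> \<le> sqrt Hs * sqrt Ds"
      unfolding defs
    proof (rule integral_cauchy_schwarz)
      fix v
      have "(R v * (u1 v * h1 v + u2 v * h2 v))^2 \<le> (R v)^2 * (((u1 v)^2 + (u2 v)^2) * ((h1 v)^2 + (h2 v)^2))"
        unfolding power_mult_distrib by (intro mult_left_mono cauchy_schwarz_2) auto
      then show "(R v * (u1 v * h1 v + u2 v * h2 v))^2 \<le> ((h1 v)^2 + (h2 v)^2) * ((R v)^2 * nu v)"
        by (simp add: nu_def mult_ac)
    qed (use i j nu0 in auto)
    moreover have "Bs / (2 * K) \<le> (LBINT v. R v * (u1 v * h1 v + u2 v * h2 v)) + 12 * K * Ms"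
    proof -
      have "12 * K * (x + y) = 12 * K * x + 12 * K * y" for x y by (rule distrib_left)
      then show ?thesis
        unfolding b m p[symmetric] add_divide_distrib
        using E[OF u(1) z(1)] E[OF u(2) z(2)] P[of u1] P[of u2] unfolding L1_def L2_def by simp
    qed
    moreover have "12 * K * Ms \<le> 12 * K * (sqrt Es * sqrt Ds)"
      using Ms K by (intro mult_left_mono) auto
    ultimately have "Bs / (2 * K) \<le> sqrt Hs * sqrt Ds + 12 * K * (sqrt Es * sqrt Ds)" by linarith
    then show ?thesis using K by (simp add: pos_divide_le_eq mult_ac)
  qed
  have T: "(sqrt Ts)^2 \<le> 2 * Bs + 58 * (sqrt Es * sqrt Ds)"
  proof -
    have "Ts \<le> (LBINT v. 2 * (R v * (?J \<gamma> v * (S u1 v + S u2 v))) + 58 * (?J (\<gamma> + 2) v * R v * nu v))"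
      unfolding defs
    proof (rule integral_mono)
      fix v
      show "(T1 v)^2 + (T2 v)^2 \<le> 2 * (R v * (?J \<gamma> v * (S u1 v + S u2 v))) + 58 * (?J (\<gamma> + 2) v * R v * nu v)"
        using transport_bound[OF k gamma, of u1 v] transport_bound[OF k gamma, of u2 v]
        unfolding T1_def T2_def S_def R_def nu_def distrib_left by linarith
    qed (use i in auto)
    also have "\<dots> = 2 * Bs + 58 * Ms" unfolding defs using i by simp
    also have "\<dots> \<le> 2 * Bs + 58 * (sqrt Es * sqrt Ds)" using Ms by linarith
    finally show ?thesis using nn by simp
  qed
  have D: "(sqrt Ds)^2 \<le> 2 * (sqrt (2 * (sqrt Hs)^2 + 2 * (sqrt Ls)^2) * sqrt Ts)"
  proof -
    \<comment> \<open>The equations are solved for \<phi> u1 and \<phi> u2 in terms of h and L u.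
      Thus the factor \<phi>, which has no bound uniform in the frequency, leaves the commutator
      identity.\<close>
    let ?w = "\<lambda>v. (h1 v - L1 v) * T2 v - (h2 v - L2 v) * T1 v"
    have j: "integrable lborel (\<lambda>v. (R v)^2 * (u1 v)^2)" "integrable lborel (\<lambda>v. (R v)^2 * (u2 v)^2)"
      "integrable lborel (\<lambda>v. ?\<phi> v * (u1 v * T1 v))" "integrable lborel (\<lambda>v. ?\<phi> v * (u2 v * T2 v))"
      "integrable lborel ?w" "integrable lborel (\<lambda>v. (h1 v - L1 v)^2 + (h2 v - L2 v)^2)"
      by (intro ints; simp add: z zT zh zL)+
    have "Ds = (LBINT v. (R v)^2 * (u1 v)^2) + (LBINT v. (R v)^2 * (u2 v)^2)"
      unfolding defs distrib_left nu_def using j by simp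
    also have "\<dots> = - 2 * ((LBINT v. ?\<phi> v * (u1 v * T1 v)) + (LBINT v. ?\<phi> v * (u2 v * T2 v)))"
      using transport_identity[OF k u2(1) z(1), where \<gamma> = \<gamma> and \<tau> = \<tau>]
        transport_identity[OF k u2(2) z(2), where \<gamma> = \<gamma> and \<tau> = \<tau>]
      unfolding T1_def T2_def R_def by simp
    also have "(LBINT v. ?\<phi> v * (u1 v * T1 v)) + (LBINT v. ?\<phi> v * (u2 v * T2 v))
       = (LBINT v. ?\<phi> v * (u1 v * T1 v) + ?\<phi> v * (u2 v * T2 v))"
      using j by simp
    also have "\<dots> = (LBINT v. - ?w v)"
      by (rule Bochner_Integration.integral_cong) (simp_all add: h1_def h2_def L1_def L2_def algebra_simps)
    also have "\<dots> = - (LBINT v. ?w v)" by (rule Bochner_Integration.integral_minus)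
    finally have "Ds = 2 * (LBINT v. ?w v)" by (simp only: mult_minus_left mult_minus_right minus_minus)
    then have "Ds \<le> 2 * \<bar>\<integral>v. ?w v \<partial>lborel\<bar>" by linarith
    also have "\<bar>\<integral>v. ?w v \<partial>lborel\<bar> \<le> sqrt (LBINT v. (h1 v - L1 v)^2 + (h2 v - L2 v)^2) * sqrt Ts"
      unfolding defs
    proof (rule integral_cauchy_schwarz)
      fix v
      show "(?w v)^2 \<le> ((h1 v - L1 v)^2 + (h2 v - L2 v)^2) * ((T1 v)^2 + (T2 v)^2)"
        by (rule cauchy_schwarz_2)
    qed (use i j in auto)
    also have "(LBINT v. (h1 v - L1 v)^2 + (h2 v - L2 v)^2) \<le> (LBINT v. 2 * ((h1 v)^2 + (h2 v)^2) + 2 * ((L1 v)^2 + (L2 v)^2))"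
    proof (rule integral_mono)
      fix v
      have sq: "(x - y)^2 \<le> 2 * x^2 + 2 * y^2" for x y :: real
        using zero_le_power2[of "x + y"] by (simp add: power2_eq_square algebra_simps)
      have "a \<le> 2 * p + 2 * q \<Longrightarrow> b \<le> 2 * x + 2 * y \<Longrightarrow> a + b \<le> 2 * (p + x) + 2 * (q + y)" for a b p q x y :: real
        unfolding distrib_left by linarith
      from this[OF sq sq]
      show "(h1 v - L1 v)^2 + (h2 v - L2 v)^2 \<le> 2 * ((h1 v)^2 + (h2 v)^2) + 2 * ((L1 v)^2 + (L2 v)^2)" .
    qed (intro Bochner_Integration.integrable_add integrable_mult_right i j)+
    also have "\<dots> = 2 * Hs + 2 * Ls"
      unfolding defs
      by (subst Bochner_Integration.integral_add[OF integrable_mult_right[OF i(1)] integrable_mult_right[OF i(4)]])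
         (simp only: Bochner_Integration.integral_mult_right[OF i(1)] Bochner_Integration.integral_mult_right[OF i(4)])
    finally show ?thesis using nn by (simp add: mult_right_mono)
  qed
  \<comment> \<open>Pair L u with the equations; the part containing \<phi> is the one rewritten by
    \<open>coupling_identity\<close>, and is of first order.\<close>
  have L: "(sqrt Ls)^2 \<le> sqrt Hs * sqrt Ls + K * (sqrt Ds * sqrt Bs)"
  proof -
    let ?w = "\<lambda>v. \<Sum>a\<in>UNIV. (field_dir a v \<bullet> k) * (sig (fst a) v * (u2 v * field a u1 v - u1 v * field a u2 v))"
    have j: "integrable lborel ?w" "integrable lborel (\<lambda>v. L1 v * h1 v + L2 v * h2 v)"
      "integrable lborel (\<lambda>v. ?\<phi> v * (u2 v * L1 v - u1 v * L2 v))"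
      by (intro ints; simp add: z zL)+
    have "Ls = (LBINT v. (L1 v * h1 v + L2 v * h2 v) + ?\<phi> v * (u2 v * L1 v - u1 v * L2 v))"
      unfolding defs
      by (rule Bochner_Integration.integral_cong) (simp_all add: h1_def h2_def L1_def L2_def power2_eq_square algebra_simps)
    also have "\<dots> = (LBINT v. L1 v * h1 v + L2 v * h2 v) + (LBINT v. ?w v)"
      using j coupling_identity[OF u z, where \<tau> = \<tau> and k = k] unfolding L1_def L2_def by simp
    also have "\<dots> \<le> \<bar>\<integral>v. L1 v * h1 v + L2 v * h2 v \<partial>lborel\<bar> + \<bar>\<integral>v. ?w v \<partial>lborel\<bar>" by linarith
    also have "\<bar>\<integral>v. L1 v * h1 v + L2 v * h2 v \<partial>lborel\<bar> \<le> sqrt Hs * sqrt Ls"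
      unfolding defs
    proof (rule integral_cauchy_schwarz)
      fix v
      show "(L1 v * h1 v + L2 v * h2 v)^2 \<le> ((h1 v)^2 + (h2 v)^2) * ((L1 v)^2 + (L2 v)^2)"
        using cauchy_schwarz_2(1)[of "h1 v" "L1 v" "h2 v" "L2 v"] by (simp only: mult.commute)
    qed (use i j in auto)
    also have "\<bar>\<integral>v. ?w v \<partial>lborel\<bar> \<le> sqrt (LBINT v. K^2 * ((R v)^2 * nu v)) * sqrt Bs"
      unfolding defs
    proof (rule integral_cauchy_schwarz)
      fix v
      let ?x = "\<lambda>a. u2 v * field a u1 v - u1 v * field a u2 v"
      have "(?w v)^2 \<le> symb k v * (\<Sum>a\<in>UNIV. (sig (fst a) v * ?x a)^2)"
        unfolding symb_def by (rule Cauchy_Schwarz_ineq_sum)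
      also have "\<dots> \<le> symb k v * (\<Sum>a\<in>UNIV. (K * ?J \<gamma> v)^2 * (nu v * ((field a u1 v)^2 + (field a u2 v)^2)))"
      proof (intro mult_left_mono sum_mono)
        fix a :: "bool \<times> 3"
        have "(sig (fst a) v)^2 \<le> (K * ?J \<gamma> v)^2"
          using sig_upper[of "fst a" v] sig_pos[of "fst a" v] by (intro power_mono) auto
        moreover have "(?x a)^2 \<le> nu v * ((field a u1 v)^2 + (field a u2 v)^2)"
          using cauchy_schwarz_2(2)[of "u1 v" "field a u2 v" "u2 v" "field a u1 v"]
          by (simp add: nu_def power2_commute)
        ultimately show "(sig (fst a) v * ?x a)^2 \<le> (K * ?J \<gamma> v)^2 * (nu v * ((field a u1 v)^2 + (field a u2 v)^2))"
          unfolding power_mult_distrib[of "sig (fst a) v"] by (intro mult_mono) auto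
      qed (use symb_pos[OF k, of v] in auto)
      also have "\<dots> = K^2 * (?J \<gamma> v * symb k v) * (nu v * (?J \<gamma> v * (S u1 v + S u2 v)))"
        unfolding S_def sum.distrib[symmetric] sum_distrib_left[symmetric] by (simp add: power2_eq_square mult_ac)
      \<comment> \<open>The cube is split as \<rho>^2 for the norm of \<rho> u and \<rho> for the
        weighted diffusion energy.\<close>
      also have "?J \<gamma> v * symb k v = R v ^ 3"
        unfolding R_def by (rule rho_cube[OF k, symmetric])
      also have "K^2 * R v ^ 3 * (nu v * (?J \<gamma> v * (S u1 v + S u2 v))) = K^2 * ((R v)^2 * nu v) * (R v * (?J \<gamma> v * (S u1 v + S u2 v)))"
        by (simp add: power2_eq_square power3_eq_cube mult_ac)
      finally show "(?w v)^2 \<le> K^2 * ((R v)^2 * nu v) * (R v * (?J \<gamma> v * (S u1 v + S u2 v)))" .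
    qed (use i j nu0 S0 R0 in \<open>auto intro!: mult_nonneg_nonneg add_nonneg_nonneg intro: less_imp_le\<close>)
    also have "sqrt (LBINT v. K^2 * ((R v)^2 * nu v)) = K * sqrt Ds"
      unfolding defs using K by (simp add: real_sqrt_mult)
    finally show ?thesis using nn by (simp add: mult.assoc)
  qed
  have "(sqrt Ds)^2 + (sqrt Ls)^2 \<le> 400 * K^2 * (200 * K^2) ^ 8 * ((sqrt Hs)^2 + (sqrt Es)^2)"
  proof (rule closing_inequality[OF K _ _ _ _ nn(5) _ _ T D L])
    show "Bs \<le> 2 * K * (sqrt Hs * sqrt Ds + 12 * K * (sqrt Es * sqrt Ds))" by (rule B)
  qed (use nn in auto)
  then have "Ds + Ls \<le> 400 * K^2 * (200 * K^2) ^ 8 * (Hs + Es)"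
    using nn by simp
  then show ?thesis unfolding defs nu_def L1_def L2_def R_def .
qed

end

section \<open>Cutoffs in the velocity\<close>

lemma times_diff_max_power':
  "times_differentiable m g \<Longrightarrow> Suc m \<le> n \<Longrightarrow> times_differentiable m (\<lambda>x. max 0 (g x) ^ n)"
proof -
  assume g: "times_differentiable m g" and le: "Suc m \<le> n"
  obtain l where l: "n = Suc m + l" using le nat_le_iff_add by blast
  show ?thesis unfolding l
  proof (induction l)
    case 0
    then show ?case using times_diff_max_power[OF g] by simp
  next
    case (Suc l)
    have eq: "max 0 y ^ (Suc m + Suc l) = y * max 0 y ^ (Suc m + l)" for y :: real
      by (cases "y \<ge> 0") (simp_all add: max_def power_0_left)
    show ?case unfolding eq by (rule times_diff_mult[OF g Suc])
  qed
qed

lemma field_max_power: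
  assumes "times_differentiable 1 g" "2 \<le> n"
  shows "field a (\<lambda>x. max 0 (g x) ^ n) v = real n * max 0 (g v) ^ (n - 1) * field a g v"
proof -
  obtain l where l: "n = Suc (Suc l)" using assms(2) by (metis Suc_le_D numeral_2_eq_2 Suc_le_mono)
  show ?thesis unfolding l
    using field_chain[OF assms(1) has_real_derivative_max_power] by simp
qed

text \<open>A radial profile of finite regularity, raised to a power wherever derivatives are taken.
  It is used both in v, where rotations annihilate it, and in (t, x).\<close>

definition bump :: "real \<Rightarrow> 'a::euclidean_space \<Rightarrow> real" where
  "bump S v = max 0 (1 - (v \<bullet> v) / S^2)"

lemma bump_bounds: "0 \<le> bump S v" "bump S v \<le> 1"
  by (auto simp: bump_def)

lemma bump_eq_0:
  assumes "S > 0" "norm v \<ge> S"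
  shows "bump S v = 0"
proof -
  have "S^2 \<le> v \<bullet> v" using assms by (simp add: power2_norm_eq_inner[symmetric])
  then have "1 \<le> (v \<bullet> v) / S^2" using assms by (simp add: field_simps)
  then show ?thesis by (simp add: bump_def)
qed

lemma times_diff_bump_inner: "times_differentiable n (\<lambda>v::'a::euclidean_space. 1 - (v \<bullet> v) / S^2)"
proof -
  have "(\<lambda>v::'a. 1 - (v \<bullet> v) / S^2) = (\<lambda>v. 1 - (1 / S^2) * (v \<bullet> v))" by auto
  then show ?thesis by (simp only:) (intro times_diff_diff times_diff_mult times_diff_const times_diff_quadratic)
qed

lemma times_diff_bump: "Suc m \<le> n \<Longrightarrow> times_differentiable m (\<lambda>v. bump S v ^ n)"
  unfolding bump_def by (rule times_diff_max_power'[OF times_diff_bump_inner])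

lemma continuous_bump: "continuous_on A (bump S)"
  unfolding bump_def[abs_def] by (cases "S = 0") (auto intro!: continuous_intros)

lemma field_bump_inner: "field a (\<lambda>v. 1 - (v \<bullet> v) / S^2) v = - 2 * (v \<bullet> field_dir a v) / S^2"
proof -
  have "field a (\<lambda>v. 1 - (1 / S^2) * (v \<bullet> v)) v = - (1 / S^2 * (2 * (v \<bullet> field_dir a v)))"
  proof -
    have q: "times_differentiable 1 (\<lambda>v::real^3. (1 / S^2) * (v \<bullet> v))"
      by (intro times_diff_mult times_diff_const times_diff_quadratic)
    show ?thesis
      unfolding field_diff[OF times_diff_const q] field_cmult[OF times_diff_quadratic] by simp
  qed
  then show ?thesis by simp
qed

lemma field_bump:
  assumes "2 \<le> n"
  shows "field a (\<lambda>v. bump S v ^ n) v = real n * bump S v ^ (n - 1) * (- 2 * (v \<bullet> field_dir a v) / S^2)"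
  unfolding bump_def field_max_power[OF times_diff_bump_inner assms] field_bump_inner ..

lemma radial_slope_bound:
  assumes S: "S > 0" and p: "bump S v \<noteq> 0"
  shows "\<bar>- 2 * (v \<bullet> field_dir a v) / S^2\<bar> \<le> 2 / S"
proof -
  have "norm v \<le> S" using bump_eq_0[OF S, of v] p by linarith
  then have "\<bar>v \<bullet> field_dir a v\<bar> \<le> S" using abs_inner_field_dir[of v a] by linarith
  then have "2 * \<bar>v \<bullet> field_dir a v\<bar> / S^2 \<le> 2 * S / S^2" by (intro divide_right_mono) auto
  then show ?thesis using S by (simp add: abs_mult power2_eq_square)
qed

lemma field_bump_bound:
  assumes S: "S > 0" and n: "2 \<le> n"
  shows "\<bar>field a (\<lambda>v. bump S v ^ n) v\<bar> \<le> real n * bump S v ^ (n - 1) * (2 / S)"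
proof (cases "bump S v = 0")
  case True
  then show ?thesis unfolding field_bump[OF n] using n S by (simp add: power_0_left)
next
  case False
  show ?thesis
    unfolding field_bump[OF n] abs_mult[of "real n * bump S v ^ (n - 1)"]
    by (intro mult_mono radial_slope_bound[OF S False]) (use bump_bounds[of S v] in auto)
qed

text \<open>90 = 5 * 2 + 20 * 4: the second derivative of the profile, and the square of its slope,
  which is at most 2 / S on the support.\<close>

lemma field_field_bump:
  assumes S: "S > 0"
  shows "\<bar>field a (field a (\<lambda>v. bump S v ^ 5)) v\<bar> \<le> bump S v ^ 3 * (90 / S^2)"
proof -
  define b where "b v = - 2 * (v \<bullet> field_dir a v) / S^2" for v
  have b: "b = (if fst a then (\<lambda>v. 0) else (\<lambda>v. v \<bullet> ((- 2 / S^2) *\<^sub>R axis (snd a) 1)))"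
    by (auto simp: b_def fun_eq_iff field_dir_def dot_cross_self)
  have bd: "times_differentiable n b" for n
    unfolding b by (cases "fst a") (simp_all only: if_True if_False times_diff_const times_diff_inner)
  have fb: "\<bar>field a b v\<bar> \<le> 2 / S^2"
  proof (cases "fst a")
    case True
    then show ?thesis unfolding b by simp
  next
    case False
    have "field a b v = field_dir a v \<bullet> ((- 2 / S^2) *\<^sub>R axis (snd a) 1)"
      by (simp only: b False if_False field_inner)
    also have "\<dots> = - 2 / S^2" using False by (simp add: field_dir_def inner_axis_axis)
    finally show ?thesis by simp
  qed
  have f: "field a (\<lambda>v. bump S v ^ 5) = (\<lambda>v. 5 * bump S v ^ 4 * b v)"
    by (rule ext) (simp add: field_bump b_def)
  have t4: "times_differentiable 1 (\<lambda>v. 5 * bump S v ^ 4)"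
    by (intro times_diff_mult times_diff_const times_diff_bump) simp
  have "field a (\<lambda>v. 5 * bump S v ^ 4 * b v) v = 5 * bump S v ^ 4 * field a b v + 5 * (4 * bump S v ^ 3 * b v) * b v"
    by (subst field_mult[OF t4 bd]) (simp add: field_cmult times_diff_bump field_bump b_def)
  also have "\<bar>\<dots>\<bar> \<le> bump S v ^ 3 * (10 / S^2) + bump S v ^ 3 * (80 / S^2)"
  proof (rule order_trans[OF abs_triangle_ineq add_mono])
    have "\<bar>5 * bump S v ^ 4 * field a b v\<bar> \<le> 5 * bump S v ^ 3 * (2 / S^2)"
      unfolding abs_mult using fb bump_bounds[of S v]
      by (intro mult_mono) (auto simp: power_decreasing)
    then show "\<bar>5 * bump S v ^ 4 * field a b v\<bar> \<le> bump S v ^ 3 * (10 / S^2)" by (simp add: mult.commute)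
    show "\<bar>5 * (4 * bump S v ^ 3 * b v) * b v\<bar> \<le> bump S v ^ 3 * (80 / S^2)"
    proof (cases "bump S v = 0")
      case False
      have bb: "\<bar>b v\<bar> \<le> 2 / S" unfolding b_def by (rule radial_slope_bound[OF S False])
      have "\<bar>5 * (4 * bump S v ^ 3 * b v) * b v\<bar> = 20 * bump S v ^ 3 * (\<bar>b v\<bar> * \<bar>b v\<bar>)"
        using bump_bounds[of S v] by (simp add: abs_mult)
      also have "\<dots> \<le> 20 * bump S v ^ 3 * ((2 / S) * (2 / S))"
        using bb bump_bounds[of S v] S by (intro mult_mono) auto
      finally show ?thesis by (simp add: power2_eq_square mult.commute)
    qed simp
  qed
  also have "\<dots> = bump S v ^ 3 * (90 / S^2)" by (simp add: add_divide_distrib[symmetric] distrib_left[symmetric])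
  finally show ?thesis unfolding f .
qed

definition lap :: "bool \<Rightarrow> (real^3 \<Rightarrow> real) \<Rightarrow> real^3 \<Rightarrow> real" where
  "lap b u v = (\<Sum>i\<in>UNIV. field (b, i) (field (b, i) u) v)"

definition energy_density :: "real \<Rightarrow> real^3 \<Rightarrow> (real^3 \<Rightarrow> real) \<Rightarrow> real^3 \<Rightarrow> real" where
  "energy_density \<gamma> k u v = japanese v powr (2 * \<gamma> + 4) * (u v)^2
     + (japanese v powr \<gamma> * lap False u v)^2 + (japanese v powr \<gamma> * lap True u v)^2
     + (rho \<gamma> k v)^2 * (u v)^2"

text \<open>Here e is the constant of \<open>weighted_estimate\<close> and m that of
  \<open>hypoelliptic_estimate\<close>; the remaining factors come from
  \<open>static_estimate\<close>. Only K enters.\<close>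

definition const0 :: "real \<Rightarrow> real" where
  "const0 K = (let e = 54 * K^2 * (108 * K^2)^2; m = 400 * K^2 * (200 * K^2) ^ 8 in
     e + (1 + 6 * K^2) * (m * (1 + e)) + 100 * K^8 * e + 6 * K^4 * e)"

lemma continuous_lap:
  assumes "times_differentiable 3 u"
  shows "continuous_on S (lap b u)"
proof -
  have "times_differentiable 1 (field (b, i) (field (b, i) u))" for i
    by (rule times_diff_field'[OF times_diff_field'[OF assms], of 2]) auto
  then have "continuous_on S (field (b, i) (field (b, i) u))" for i
    using times_diff_continuous by blast
  then show ?thesis unfolding lap_def[abs_def] by (intro continuous_intros)
qed

lemma lap_eq_0: "(\<And>v. norm v > r \<Longrightarrow> u v = 0) \<Longrightarrow> norm v > r \<Longrightarrow> lap b u v = 0"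
  unfolding lap_def by (intro sum.neutral ballI field_eq_0[of r]) auto

lemma continuous_energy_density:
  assumes k: "k \<noteq> 0" and u: "times_differentiable 3 u"
  shows "continuous_on S (energy_density \<gamma> k u)"
proof -
  have cJ: "continuous_on S (\<lambda>v. japanese v powr s)" for s
    by (rule times_diff_continuous[OF times_diff_japanese[of 1]]) simp
  have c: "continuous_on S u" "continuous_on S (rho \<gamma> k)"
    using times_diff_continuous[OF u] times_diff_continuous[OF times_diff_rho[OF k, of 1]] by simp_all
  show ?thesis
    unfolding energy_density_def[abs_def] by (intro continuous_intros continuous_lap[OF u] cJ c)
qed

lemma energy_density_eq_0: "(\<And>v. norm v > r \<Longrightarrow> u v = 0) \<Longrightarrow> norm v > r \<Longrightarrow> energy_density \<gamma> k u v = 0"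
  by (simp add: energy_density_def lap_eq_0[of r])

context coefficients
begin

lemma const0_pos: "const0 K > 0"
  unfolding const0_def Let_def using K by (intro add_pos_nonneg) auto

text \<open>The order matters: first the weighted norms of u and of its first derivatives, then
  \<rho> u and L u in terms of these, and last the second derivatives, which need the bound of L
  u.\<close>

lemma compact_estimate:
  fixes \<tau> :: real
  assumes k: "k \<noteq> 0" and u: "times_differentiable 4 u1" "times_differentiable 4 u2"
    and z: "\<And>v. norm v > r \<Longrightarrow> u1 v = 0" "\<And>v. norm v > r \<Longrightarrow> u2 v = 0"
  shows "(LBINT v. energy_density \<gamma> k u1 v + energy_density \<gamma> k u2 v)
    \<le> const0 K * ((LBINT v. (diffusion u1 v - (\<tau> + v \<bullet> k) * u2 v)^2 + (diffusion u2 v + (\<tau> + v \<bullet> k) * u1 v)^2)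
       + (LBINT v. (u1 v)^2 + (u2 v)^2))"
proof -
  let ?J = "\<lambda>s v. japanese v powr s"
  define S where "S u v = (\<Sum>a\<in>UNIV. (field a u v)^2)" for u v
  have u3: "times_differentiable 3 u1" "times_differentiable 3 u2" "times_differentiable 1 u1" "times_differentiable 1 u2"
    using times_diff_mono[OF u(1)] times_diff_mono[OF u(2)] by simp_all
  have X: "times_differentiable 1 (field a u1)" "times_differentiable 1 (field a u2)" for a
    by (rule times_diff_field'[OF u(1)] times_diff_field'[OF u(2)]; simp)+
  have c: "continuous_on UNIV u1" "continuous_on UNIV u2" "continuous_on UNIV (rho \<gamma> k)"
    "continuous_on UNIV (field a u1)" "continuous_on UNIV (field a u2)" for a
    by (rule times_diff_continuous[of 1]; (rule u3 X times_diff_rho[OF k])?; simp)+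
  have zX: "norm v > r \<Longrightarrow> field a u1 v = 0" "norm v > r \<Longrightarrow> field a u2 v = 0" for a v
    by (rule field_eq_0[of r]; simp add: z)+
  have cS: "continuous_on UNIV (S u1)" "continuous_on UNIV (S u2)"
    unfolding S_def[abs_def] by (intro continuous_intros c)+
  have zS: "norm v > r \<Longrightarrow> S u1 v = 0" "norm v > r \<Longrightarrow> S u2 v = 0" for v
    using zX by (simp_all add: S_def)
  have zL: "norm v > r \<Longrightarrow> diffusion u1 v = 0" "norm v > r \<Longrightarrow> diffusion u2 v = 0" for v
    unfolding diffusion_def using z zX by (simp_all add: field_eq_0[of r])
  have zlap: "norm v > r \<Longrightarrow> lap b u1 v = 0" "norm v > r \<Longrightarrow> lap b u2 v = 0" for b v
    by (rule lap_eq_0[of r]; simp add: z)+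
  define H U where "H = (LBINT v. (diffusion u1 v - (\<tau> + v \<bullet> k) * u2 v)^2 + (diffusion u2 v + (\<tau> + v \<bullet> k) * u1 v)^2)"
    and "U = (LBINT v. (u1 v)^2 + (u2 v)^2)"
  have i: "integrable lborel (\<lambda>v. ?J (2 * \<gamma> + 4) v * (u1 v)^2)" "integrable lborel (\<lambda>v. ?J (2 * \<gamma> + 4) v * (u2 v)^2)"
    "integrable lborel (\<lambda>v. ?J (2 * \<gamma> + 2) v * S u1 v)" "integrable lborel (\<lambda>v. ?J (2 * \<gamma> + 2) v * S u2 v)"
    "integrable lborel (\<lambda>v. (rho \<gamma> k v)^2 * (u1 v)^2)" "integrable lborel (\<lambda>v. (rho \<gamma> k v)^2 * (u2 v)^2)"
    "integrable lborel (\<lambda>v. (diffusion u1 v)^2)" "integrable lborel (\<lambda>v. (diffusion u2 v)^2)"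
    "integrable lborel (\<lambda>v. (?J \<gamma> v * lap b u1 v)^2)" "integrable lborel (\<lambda>v. (?J \<gamma> v * lap b u2 v)^2)" for b
    by (intro integrable_continuous_support[of _ r] continuous_intros c cS continuous_japanese
        times_diff_diffusion continuous_lap u3; simp add: z zS zL zlap)+
  define e1 e2 a1 a2 l1 l2 d1 d2 w1 w2 w3 w4 where defs:
    "e1 = (LBINT v. ?J (2 * \<gamma> + 4) v * (u1 v)^2)" "e2 = (LBINT v. ?J (2 * \<gamma> + 4) v * (u2 v)^2)"
    "a1 = (LBINT v. ?J (2 * \<gamma> + 2) v * S u1 v)" "a2 = (LBINT v. ?J (2 * \<gamma> + 2) v * S u2 v)"
    "l1 = (LBINT v. (diffusion u1 v)^2)" "l2 = (LBINT v. (diffusion u2 v)^2)"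
    "d1 = (LBINT v. (rho \<gamma> k v)^2 * (u1 v)^2)" "d2 = (LBINT v. (rho \<gamma> k v)^2 * (u2 v)^2)"
    "w1 = (LBINT v. (?J \<gamma> v * lap False u1 v)^2)" "w2 = (LBINT v. (?J \<gamma> v * lap True u1 v)^2)"
    "w3 = (LBINT v. (?J \<gamma> v * lap False u2 v)^2)" "w4 = (LBINT v. (?J \<gamma> v * lap True u2 v)^2)"
  have S0: "S u v \<ge> 0" for u v unfolding S_def by (intro sum_nonneg) simp
  have nn: "e1 \<ge> 0" "e2 \<ge> 0" "a1 \<ge> 0" "a2 \<ge> 0" "l1 \<ge> 0" "l2 \<ge> 0" "d1 \<ge> 0" "d2 \<ge> 0" "H \<ge> 0" "U \<ge> 0"
    unfolding defs H_def U_def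
    by (intro Bochner_Integration.integral_nonneg add_nonneg_nonneg mult_nonneg_nonneg S0 zero_le_power2 powr_ge_zero)+
  define e m where "e = 54 * K^2 * (108 * K^2)^2" and "m = 400 * K^2 * (200 * K^2) ^ 8"
  have em: "e \<ge> 0" "m \<ge> 0" by (simp_all add: e_def m_def)
  have "continuous_on UNIV (\<lambda>v. \<tau> + v \<bullet> k)" by (intro continuous_intros)
  from weighted_estimate[OF u3(1,2) this z]
  have 1: "a1 + a2 + (e1 + e2) \<le> e * (H + U)"
    unfolding S_def[symmetric] distrib_left[of "japanese _ powr _"] H_def[symmetric] U_def[symmetric] e_def[symmetric]
    using i by (simp add: defs)
  have "d1 + d2 + (l1 + l2) \<le> m * (H + (e1 + e2))"
    using hypoelliptic_estimate[OF k u3(1,2) z, where \<tau> = \<tau>]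
    unfolding distrib_left[of "japanese _ powr _"] distrib_left[of "(rho _ _ _)^2"] H_def[symmetric] m_def[symmetric]
    using i by (simp add: defs)
  also have "\<dots> \<le> m * ((1 + e) * (H + U))"
    using 1 nn em by (intro mult_left_mono) (auto simp: algebra_simps)
  finally have 2: "d1 + d2 + (l1 + l2) \<le> m * (1 + e) * (H + U)" by simp
  have w: "w1 + w2 \<le> 6 * K^2 * l1 + 100 * K^8 * a1 + 6 * K^4 * e1" "w3 + w4 \<le> 6 * K^2 * l2 + 100 * K^8 * a2 + 6 * K^4 * e2"
    using static_estimate[OF u(1) z(1)] static_estimate[OF u(2) z(2)] unfolding defs S_def lap_def by simp_all
  have lHU: "6 * K^2 * (l1 + l2) \<le> 6 * K^2 * (m * (1 + e) * (H + U))"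
    using 2 nn by (intro mult_left_mono) auto
  have aHU: "100 * K^8 * (a1 + a2) \<le> 100 * K^8 * (e * (H + U))"
    using 1 nn by (intro mult_left_mono) auto
  have eHU: "6 * K^4 * (e1 + e2) \<le> 6 * K^4 * (e * (H + U))"
    using 1 nn by (intro mult_left_mono) auto
  have fin: "const0 K * (H + U) = e * (H + U) + m * (1 + e) * (H + U) + 6 * K^2 * (m * (1 + e) * (H + U))
     + 100 * K^8 * (e * (H + U)) + 6 * K^4 * (e * (H + U))"
    unfolding const0_def Let_def e_def[symmetric] m_def[symmetric] by (simp add: algebra_simps)
  have "(LBINT v. energy_density \<gamma> k u1 v + energy_density \<gamma> k u2 v) = e1 + w1 + w2 + d1 + (e2 + w3 + w4 + d2)"
    unfolding energy_density_def defs using i by simp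
  also have "\<dots> \<le> const0 K * (H + U)"
    unfolding fin using 1 2 w lHU aHU eHU nn unfolding distrib_left by linarith
  finally show ?thesis unfolding H_def U_def .
qed

end

lemma two_sum_squares: "(x + y)^2 \<le> 2 * x^2 + 2 * y^2" "(x - y)^2 \<le> 2 * x^2 + 2 * y^2" for x y :: real
  using zero_le_power2[of "x + y"] zero_le_power2[of "x - y"] by (simp_all add: power2_eq_square algebra_simps)

text \<open>This is where \<gamma> \<le> 1 makes the cutoff harmless: each derivative of the cutoff
  gains 1 / S, which compensates one factor <v>^\<gamma> on the support.\<close>

lemma japanese_powr_le:
  assumes "\<gamma> \<le> 1" "1 \<le> S" "bump S v \<noteq> 0"
  shows "japanese v powr \<gamma> \<le> 2 * S"
proof -
  have "norm v \<le> S" using bump_eq_0[of S v] assms by force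
  have "japanese v powr \<gamma> \<le> japanese v powr 1"
    using japanese_ge_1[of v] assms by (intro powr_mono) auto
  also have "\<dots> \<le> 2 * S"
  proof -
    have "1 \<le> S^2" using assms by simp
    then have "1 + (norm v)^2 \<le> (2 * S)^2"
      using power_mono[OF \<open>norm v \<le> S\<close>, of 2] by (simp add: power2_eq_square)
    then show ?thesis using assms by (simp add: japanese_def real_le_lsqrt)
  qed
  finally show ?thesis .
qed

lemma bump_le_double:
  assumes "S > 0" "bump S v \<noteq> 0"
  shows "1 \<le> 2 * bump (2 * S) v"
proof -
  have "norm v \<le> S" using bump_eq_0[of S v] assms by force
  then have "v \<bullet> v \<le> S^2" using power_mono[of "norm v" S 2] by (simp add: power2_norm_eq_inner[symmetric])
  then have "v \<bullet> v / (2 * S)^2 \<le> 1 / 4" using assms by (simp add: field_simps)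
  then show ?thesis by (simp add: bump_def)
qed

text \<open>Twice the profile at radius 2 S is a continuous, compactly supported majorant of the
  indicator of the smaller ball; it carries all error terms.\<close>

lemma bump_power_le:
  assumes "S > 0" "n > 0"
  shows "bump S v ^ n \<le> 2 * bump (2 * S) v"
proof (cases "bump S v = 0")
  case True
  then show ?thesis using assms bump_bounds[of "2 * S" v] by (simp add: power_0_left)
next
  case False
  have "bump S v ^ n \<le> 1" using bump_bounds by (intro power_le_one) auto
  then show ?thesis using bump_le_double[OF assms(1) False] by linarith
qed

context coefficients
begin

definition commutator :: "real \<Rightarrow> (real^3 \<Rightarrow> real) \<Rightarrow> real^3 \<Rightarrow> real" where
  "commutator S u v = (\<Sum>a\<in>UNIV. 2 * (sig (fst a) v * field a (\<lambda>v. bump S v ^ 5) v) * field a u v)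
     + (\<Sum>a\<in>UNIV. field a (\<lambda>w. sig (fst a) w * field a (\<lambda>v. bump S v ^ 5) w) v) * u v"

lemma diffusion_bump:
  assumes u: "times_differentiable 4 u"
  shows "diffusion (\<lambda>v. bump S v ^ 5 * u v) v = bump S v ^ 5 * diffusion u v - commutator S u v"
proof -
  let ?\<chi> = "\<lambda>v. bump S v ^ 5"
  have c: "times_differentiable 4 ?\<chi>" by (rule times_diff_bump) simp
  have c1: "times_differentiable 1 ?\<chi>" "times_differentiable 1 u" "times_differentiable 1 (field a ?\<chi>)" "times_differentiable 1 (field a u)" for a
    by (rule times_diff_mono[OF c] times_diff_mono[OF u] times_diff_field'[OF c] times_diff_field'[OF u]; simp)+
  have s1: "times_differentiable 1 (\<lambda>w. sig (fst a) w * field a u w)" "times_differentiable 1 (\<lambda>w. sig (fst a) w * field a ?\<chi> w)" for a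
    by (intro times_diff_mult c1 sig_td'; simp)+
  have 1: "field a (\<lambda>v. ?\<chi> v * u v) = (\<lambda>v. ?\<chi> v * field a u v + field a ?\<chi> v * u v)" for a
    by (rule ext) (rule field_mult[OF c1(1,2)])
  have 2: "(\<lambda>w. sig (fst a) w * (?\<chi> w * field a u w + field a ?\<chi> w * u w))
    = (\<lambda>w. ?\<chi> w * (sig (fst a) w * field a u w) + (sig (fst a) w * field a ?\<chi> w) * u w)" for a
    by (auto simp: algebra_simps)
  have 3: "field a (\<lambda>w. sig (fst a) w * field a (\<lambda>v. ?\<chi> v * u v) w) v
     = ?\<chi> v * field a (\<lambda>w. sig (fst a) w * field a u w) v
       + (2 * (sig (fst a) v * field a ?\<chi> v) * field a u v + field a (\<lambda>w. sig (fst a) w * field a ?\<chi> w) v * u v)" for a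
    unfolding 1 2
    unfolding field_add[OF times_diff_mult[OF c1(1) s1(1)] times_diff_mult[OF s1(2) c1(2)]]
      field_mult[OF c1(1) s1(1)] field_mult[OF s1(2) c1(2)]
    by (simp add: algebra_simps)
  show ?thesis
    unfolding diffusion_def commutator_def 3 sum.distrib
    by (simp add: sum_distrib_left sum_distrib_right algebra_simps)
qed

text \<open>In the first order part one derivative falls on the fifth power of the profile; its
  square leaves the power 8, and this is the weight for which \<open>localized_energy\<close> bounds
  the diffusion energy. All constants are free of S.\<close>

lemma commutator_bound:
  assumes S: "1 \<le> S"
  shows "(commutator S u v)^2 \<le> 9600 * K^2 * (bump S v ^ 8 * (japanese v powr \<gamma> * (\<Sum>a\<in>UNIV. (field a u v)^2)))
     + 2880000 * K^2 * (2 * bump (2 * S) v * (u v)^2)"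
proof -
  let ?\<chi> = "\<lambda>v. bump S v ^ 5" and ?G = "japanese v powr \<gamma>" and ?p = "bump S v"
  have S0: "S > 0" using S by simp
  have c: "times_differentiable 4 ?\<chi>" by (rule times_diff_bump) simp
  have X\<chi>: "\<bar>field a ?\<chi> v\<bar> \<le> 10 * ?p ^ 4 / S" for a
    using field_bump_bound[OF S0, of 5 a v] by simp
  have sX: "\<bar>sig (fst a) v * field a ?\<chi> v\<bar> \<le> K * ?G * (10 * ?p ^ 4 / S)" for a
    unfolding abs_mult using sig_upper[of "fst a" v] sig_pos[of "fst a" v] X\<chi>[of a] K
    by (intro mult_mono) auto
  have GS: "?G * ?p ^ n \<le> 2 * S * ?p ^ n" if "n > 0" for n
  proof (cases "?p = 0")
    case False
    then show ?thesis using japanese_powr_le[OF gamma(2) S False] bump_bounds[of S v] by (intro mult_right_mono) auto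
  qed (use that in \<open>simp add: power_0_left\<close>)
  have "(\<Sum>a\<in>UNIV. (2 * (sig (fst a) v * field a ?\<chi> v)) * field a u v)^2
    \<le> (\<Sum>a\<in>UNIV. (2 * (sig (fst a) v * field a ?\<chi> v))^2) * (\<Sum>a\<in>UNIV. (field a u v)^2)"
    by (rule Cauchy_Schwarz_ineq_sum)
  also have "\<dots> \<le> (\<Sum>a\<in>(UNIV :: (bool \<times> 3) set). 800 * K^2 * (?G * ?p ^ 8)) * (\<Sum>a\<in>UNIV. (field a u v)^2)"
  proof (intro mult_right_mono sum_mono)
    fix a :: "bool \<times> 3"
    have "(sig (fst a) v * field a ?\<chi> v)^2 \<le> (K * ?G * (10 * ?p ^ 4 / S))^2"
      using power_mono[OF sX[of a], of 2] by simp
    also have "\<dots> = 100 * K^2 * (?G * ((?G * ?p ^ 8) / S^2))"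
      by (simp add: power_mult_distrib power_divide power_mult[symmetric] power2_eq_square)
    \<comment> \<open>Two factors <v>^\<gamma> are present. One is paid by 1 / S^2, the other stays
      as the weight of the diffusion energy.\<close>
    also have "\<dots> \<le> 100 * K^2 * (?G * (2 * ?p ^ 8))"
    proof (intro mult_left_mono)
      have "?G * ?p ^ 8 \<le> 2 * S * ?p ^ 8" by (rule GS) simp
      also have "\<dots> \<le> S^2 * (2 * ?p ^ 8)"
      proof -
        have "S * (2 * ?p ^ 8) \<le> S^2 * (2 * ?p ^ 8)"
          using S bump_bounds[of S v] by (intro mult_right_mono) (auto simp: self_le_power)
        then show ?thesis by simp
      qed
      finally show "?G * ?p ^ 8 / S^2 \<le> 2 * ?p ^ 8" using S0 by (simp add: pos_divide_le_eq mult_ac)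
    qed auto
    finally show "(2 * (sig (fst a) v * field a ?\<chi> v))^2 \<le> 800 * K^2 * (?G * ?p ^ 8)"
      by (simp add: power_mult_distrib mult_ac)
  qed (auto intro: sum_nonneg)
  also have "\<dots> = 4800 * K^2 * (?p ^ 8 * (?G * (\<Sum>a\<in>UNIV. (field a u v)^2)))"
    by simp
  finally have 1: "(\<Sum>a\<in>UNIV. (2 * (sig (fst a) v * field a ?\<chi> v)) * field a u v)^2
    \<le> 4800 * K^2 * (?p ^ 8 * (?G * (\<Sum>a\<in>UNIV. (field a u v)^2)))" .
  have "\<bar>field a (\<lambda>w. sig (fst a) w * field a ?\<chi> w) v\<bar> \<le> 200 * K * ?p ^ 3" for a
  proof -
    have s: "times_differentiable 1 (sig (fst a))" "times_differentiable 1 (field a ?\<chi>)"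
      by (rule sig_td' times_diff_field'[OF c]; simp)+
    have "\<bar>field a (\<lambda>w. sig (fst a) w * field a ?\<chi> w) v\<bar>
      \<le> \<bar>sig (fst a) v\<bar> * \<bar>field a (field a ?\<chi>) v\<bar> + \<bar>field a (sig (fst a)) v\<bar> * \<bar>field a ?\<chi> v\<bar>"
      unfolding field_mult[OF s] abs_mult[symmetric] by (rule abs_triangle_ineq)
    also have "\<dots> \<le> (K * ?G) * (90 * ?p ^ 3 / S) + (K * ?G) * (10 * ?p ^ 3 / S)"
    proof (intro add_mono mult_mono)
      show "\<bar>sig (fst a) v\<bar> \<le> K * ?G" using sig_upper[of "fst a" v] sig_pos[of "fst a" v] by simp
      have "\<bar>field a (field a ?\<chi>) v\<bar> \<le> ?p ^ 3 * (90 / S^2)" by (rule field_field_bump[OF S0])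
      also have "\<dots> \<le> ?p ^ 3 * (90 / S)"
        using S bump_bounds[of S v] by (intro mult_left_mono divide_left_mono) (auto simp: self_le_power)
      finally show "\<bar>field a (field a ?\<chi>) v\<bar> \<le> 90 * ?p ^ 3 / S" by (simp add: mult.commute)
      show "\<bar>field a (sig (fst a)) v\<bar> \<le> K * ?G" by (rule sig_field)
      have "10 * ?p ^ 4 / S \<le> 10 * ?p ^ 3 / S"
        using S0 bump_bounds[of S v] by (intro divide_right_mono mult_left_mono power_decreasing) auto
      then show "\<bar>field a ?\<chi> v\<bar> \<le> 10 * ?p ^ 3 / S" using X\<chi>[of a] by linarith
    qed (use K in auto)
    also have "\<dots> = 100 * K * (?G * ?p ^ 3) / S" by (simp add: add_divide_distrib[symmetric])
    also have "\<dots> \<le> 100 * K * (2 * S * ?p ^ 3) / S"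
      using GS[of 3] K S0 by (intro divide_right_mono mult_left_mono) auto
    also have "\<dots> = 200 * K * ?p ^ 3" using S0 by simp
    finally show ?thesis .
  qed
  then have "\<bar>\<Sum>a\<in>UNIV. field a (\<lambda>w. sig (fst a) w * field a ?\<chi> w) v\<bar> \<le> (\<Sum>a\<in>(UNIV :: (bool \<times> 3) set). 200 * K * ?p ^ 3)"
    by (intro order_trans[OF sum_abs] sum_mono)
  then have "\<bar>\<Sum>a\<in>UNIV. field a (\<lambda>w. sig (fst a) w * field a ?\<chi> w) v\<bar> \<le> 1200 * K * ?p ^ 3" by simp
  then have "(\<Sum>a\<in>UNIV. field a (\<lambda>w. sig (fst a) w * field a ?\<chi> w) v)^2 \<le> (1200 * K * ?p ^ 3)^2"
    using power_mono[of "\<bar>\<Sum>a\<in>UNIV. field a (\<lambda>w. sig (fst a) w * field a ?\<chi> w) v\<bar>" _ 2] by simp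
  also have "\<dots> = 1440000 * K^2 * ?p ^ 6" by (simp add: power_mult_distrib power_mult[symmetric])
  also have "\<dots> \<le> 1440000 * K^2 * (2 * bump (2 * S) v)"
    using bump_power_le[OF S0, of 6 v] by (intro mult_left_mono) auto
  finally have "(\<Sum>a\<in>UNIV. field a (\<lambda>w. sig (fst a) w * field a ?\<chi> w) v)^2 * (u v)^2 \<le> 1440000 * K^2 * (2 * bump (2 * S) v) * (u v)^2"
    by (rule mult_right_mono) simp
  then have 2: "((\<Sum>a\<in>UNIV. field a (\<lambda>w. sig (fst a) w * field a ?\<chi> w) v) * u v)^2 \<le> 1440000 * K^2 * (2 * bump (2 * S) v * (u v)^2)"
    by (simp add: power_mult_distrib mult_ac)
  show ?thesis
    unfolding commutator_def
    by (rule order_trans[OF two_sum_squares(1)]) (use 1 2 in linarith)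
qed

text \<open>Here the weight is compactly supported and u is arbitrary. The majorant is \<beta> = 256
  p^6 / S^2, with 256 = (8 * 2)^2 from the derivative of p^8; <v>^\<gamma> \<beta> is bounded since
  <v>^\<gamma> \<le> 2 S on the support.\<close>

lemma localized_energy:
  fixes \<tau> :: real
  assumes u: "times_differentiable 3 u1" "times_differentiable 3 u2" and S: "1 \<le> S"
    and \<phi>: "continuous_on UNIV \<phi>"
  defines "h1 \<equiv> \<lambda>v. diffusion u1 v - \<phi> v * u2 v"
    and "h2 \<equiv> \<lambda>v. diffusion u2 v + \<phi> v * u1 v"
  shows "(LBINT v. bump S v ^ 8 * (japanese v powr \<gamma> * ((\<Sum>a\<in>UNIV. (field a u1 v)^2) + (\<Sum>a\<in>UNIV. (field a u2 v)^2))))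
    \<le> 4000 * K^2 * (LBINT v. 2 * bump (2 * S) v * ((h1 v)^2 + (h2 v)^2 + ((u1 v)^2 + (u2 v)^2)))"
proof -
  let ?p = "\<lambda>v. bump S v" and ?P = "\<lambda>v. 2 * bump (2 * S) v" and ?G = "\<lambda>v. japanese v powr \<gamma>"
  let ?b = "\<lambda>v. 256 * ?p v ^ 6 / S^2"
  define Q where "Q u v = (\<Sum>a\<in>UNIV. (field a u v)^2)" for u v
  have S0: "S > 0" using S by simp
  have le: "(field a (\<lambda>v. ?p v ^ 8) v)^2 \<le> ?p v ^ 8 * ?b v" for a v
  proof -
    have "\<bar>field a (\<lambda>v. ?p v ^ 8) v\<bar> \<le> 8 * ?p v ^ 7 * (2 / S)"
      using field_bump_bound[OF S0, of 8 a v] by simp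
    then have "(field a (\<lambda>v. ?p v ^ 8) v)^2 \<le> (8 * ?p v ^ 7 * (2 / S))^2"
      using power_mono[of "\<bar>field a (\<lambda>v. ?p v ^ 8) v\<bar>" _ 2] by simp
    also have "\<dots> = 256 * (?p v ^ 14) / S^2"
      by (simp add: power_mult_distrib power_divide power_mult[symmetric])
    also have "?p v ^ 14 = ?p v ^ 8 * ?p v ^ 6" by (simp flip: power_add)
    finally show ?thesis by (simp add: mult_ac)
  qed
  have cp: "continuous_on UNIV ?p" "continuous_on UNIV (bump (2 * S))" by (rule continuous_bump)+
  have cb: "continuous_on UNIV ?b" by (intro continuous_intros cp) (use S0 in auto)
  have td: "times_differentiable 2 (\<lambda>v. ?p v ^ 8)" by (rule times_diff_bump) simp
  have zp: "norm v > 2 * S \<Longrightarrow> ?p v = 0" "norm v > 2 * S \<Longrightarrow> bump (2 * S) v = 0" for v :: "real^3"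
    using bump_eq_0[of S v] bump_eq_0[of "2 * S" v] S0 by auto
  have E: "(LBINT v. ?p v ^ 8 * (?G v * Q u v)) / (2 * K) + (LBINT v. ?p v ^ 8 * (japanese v powr (\<gamma> + 2) * (u v)^2)) / K
     \<le> (LBINT v. ?p v ^ 8 * (u v * diffusion u v)) + 3 * K * (LBINT v. ?G v * (?b v * (u v)^2))"
    if "times_differentiable 3 u" for u
    unfolding Q_def
    by (rule energy[OF that td cb _ _ le, of "2 * S"]) (use zp bump_bounds in auto)
  have c: "continuous_on UNIV u1" "continuous_on UNIV u2" "continuous_on UNIV (field a u1)" "continuous_on UNIV (field a u2)"
    "continuous_on UNIV (diffusion u1)" "continuous_on UNIV (diffusion u2)" for a
    by (rule times_diff_continuous[of 1] times_diff_diffusion u;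
        (rule times_diff_mono[OF u(1)] times_diff_mono[OF u(2)] times_diff_field'[OF u(1)] times_diff_field'[OF u(2)])?; simp)+
  have cQ: "continuous_on UNIV (Q u1)" "continuous_on UNIV (Q u2)" unfolding Q_def[abs_def] by (intro continuous_intros c)+
  have ch: "continuous_on UNIV h1" "continuous_on UNIV h2" unfolding h1_def h2_def by (intro continuous_intros c \<phi>)+
  note ints = integrable_continuous_support[of _ "2 * S"] continuous_intros c cQ ch cp cb continuous_japanese
  define I where "I = (LBINT v. ?P v * ((h1 v)^2 + (h2 v)^2 + ((u1 v)^2 + (u2 v)^2)))"
  have i: "integrable lborel (\<lambda>v. ?p v ^ 8 * (?G v * Q u1 v))" "integrable lborel (\<lambda>v. ?p v ^ 8 * (?G v * Q u2 v))"
    "integrable lborel (\<lambda>v. ?p v ^ 8 * (u1 v * diffusion u1 v))" "integrable lborel (\<lambda>v. ?p v ^ 8 * (u2 v * diffusion u2 v))"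
    "integrable lborel (\<lambda>v. ?P v * ((h1 v)^2 + (h2 v)^2 + ((u1 v)^2 + (u2 v)^2)))"
    by (intro ints; simp add: zp)+
  have ib: "integrable lborel (\<lambda>v. ?G v * (?b v * (u1 v)^2))" "integrable lborel (\<lambda>v. ?G v * (?b v * (u2 v)^2))"
  proof -
    have "integrable lborel (\<lambda>v. ?G v * (b v * (u1 v)^2))" "integrable lborel (\<lambda>v. ?G v * (b v * (u2 v)^2))"
      if "continuous_on UNIV b" "\<And>v. norm v > 2 * S \<Longrightarrow> b v = 0" for b
      by (intro ints that; simp add: that)+
    from this[OF cb] show "integrable lborel (\<lambda>v. ?G v * (?b v * (u1 v)^2))" "integrable lborel (\<lambda>v. ?G v * (?b v * (u2 v)^2))"
      by (simp_all add: zp)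
  qed
  have pw: "?p v ^ 8 * (u1 v * diffusion u1 v) + ?p v ^ 8 * (u2 v * diffusion u2 v) \<le> ?P v * ((h1 v)^2 + (h2 v)^2 + ((u1 v)^2 + (u2 v)^2))" for v
  proof -
    have y: "x * y + z * w \<le> y^2 + w^2 + (x^2 + z^2)" for x y z w :: real
      using sum_squares_bound[of x y] sum_squares_bound[of z w] zero_le_power2[of x] zero_le_power2[of y] zero_le_power2[of z] zero_le_power2[of w]
      by linarith
    have "?p v ^ 8 * (u1 v * diffusion u1 v) + ?p v ^ 8 * (u2 v * diffusion u2 v) = ?p v ^ 8 * (u1 v * h1 v + u2 v * h2 v)"
      by (simp add: h1_def h2_def algebra_simps)
    also have "\<dots> \<le> ?p v ^ 8 * ((h1 v)^2 + (h2 v)^2 + ((u1 v)^2 + (u2 v)^2))"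
      by (rule mult_left_mono[OF y]) (simp add: bump_bounds)
    also have "\<dots> \<le> ?P v * ((h1 v)^2 + (h2 v)^2 + ((u1 v)^2 + (u2 v)^2))"
      by (rule mult_right_mono[OF bump_power_le[OF S0]]) auto
    finally show ?thesis .
  qed
  have pb: "?G v * (?b v * (u1 v)^2) + ?G v * (?b v * (u2 v)^2) \<le> 512 * (?P v * ((h1 v)^2 + (h2 v)^2 + ((u1 v)^2 + (u2 v)^2)))" for v
  proof (cases "?p v = 0")
    case True
    then show ?thesis using bump_bounds[of "2 * S" v] by simp
  next
    case False
    have "?G v * ?b v \<le> 512 * ?P v"
    proof -
      have "?G v * ?b v \<le> (2 * S) * (256 * 1 / S^2)"
        using japanese_powr_le[OF gamma(2) S False] bump_bounds[of S v] S0
        by (intro mult_mono divide_right_mono) (auto simp: power_le_one)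
      also have "\<dots> \<le> 512" using S by (simp add: power2_eq_square field_simps)
      also have "\<dots> \<le> 512 * ?P v" using bump_le_double[OF S0 False] by simp
      finally show ?thesis .
    qed
    then have "?G v * ?b v * ((u1 v)^2 + (u2 v)^2) \<le> 512 * ?P v * ((u1 v)^2 + (u2 v)^2)"
      by (rule mult_right_mono) simp
    also have "\<dots> \<le> 512 * ?P v * ((h1 v)^2 + (h2 v)^2 + ((u1 v)^2 + (u2 v)^2))"
      using bump_bounds[of "2 * S" v] by (intro mult_left_mono) auto
    finally show ?thesis by (simp add: distrib_left mult.assoc)
  qed
  have "(LBINT v. ?p v ^ 8 * (u1 v * diffusion u1 v) + ?p v ^ 8 * (u2 v * diffusion u2 v)) \<le> I"
    unfolding I_def by (intro integral_mono pw Bochner_Integration.integrable_add i)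
  then have A: "(LBINT v. ?p v ^ 8 * (u1 v * diffusion u1 v)) + (LBINT v. ?p v ^ 8 * (u2 v * diffusion u2 v)) \<le> I"
    by (subst (asm) Bochner_Integration.integral_add[OF i(3,4)])
  have "(LBINT v. ?G v * (?b v * (u1 v)^2) + ?G v * (?b v * (u2 v)^2)) \<le> (LBINT v. 512 * (?P v * ((h1 v)^2 + (h2 v)^2 + ((u1 v)^2 + (u2 v)^2))))"
    by (intro integral_mono pb Bochner_Integration.integrable_add integrable_mult_right ib i)
  then have B: "(LBINT v. ?G v * (?b v * (u1 v)^2)) + (LBINT v. ?G v * (?b v * (u2 v)^2)) \<le> 512 * I"
    unfolding I_def Bochner_Integration.integral_add[OF ib] Bochner_Integration.integral_mult_right[OF i(5)] .
  have nn: "(LBINT v. ?p v ^ 8 * (japanese v powr (\<gamma> + 2) * (u v)^2)) / K \<ge> 0" for u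
    by (intro divide_nonneg_nonneg Bochner_Integration.integral_nonneg mult_nonneg_nonneg zero_le_power2 powr_ge_zero
        zero_le_power[OF bump_bounds(1)]) (use K in auto)
  have I0: "I \<ge> 0" unfolding I_def by (intro Bochner_Integration.integral_nonneg mult_nonneg_nonneg bump_bounds) auto
  have B': "3 * K * (LBINT v. ?G v * (?b v * (u1 v)^2)) + 3 * K * (LBINT v. ?G v * (?b v * (u2 v)^2)) \<le> 1536 * K * I"
    using mult_left_mono[OF B, of "3 * K"] K unfolding distrib_left by simp
  define q1 q2 where "q1 = (LBINT v. ?p v ^ 8 * (?G v * Q u1 v))" and "q2 = (LBINT v. ?p v ^ 8 * (?G v * Q u2 v))"
  have "q1 / (2 * K) + q2 / (2 * K) \<le> I + 1536 * K * I"
    using E[OF u(1)] E[OF u(2)] nn[of u1] nn[of u2] A B' unfolding q1_def q2_def by linarith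
  also have "\<dots> \<le> 2000 * K * I"
    using mult_right_mono[OF K I0] I0 by linarith
  finally have "(q1 + q2) / (2 * K) \<le> 2000 * K * I" by (simp add: add_divide_distrib)
  then have "q1 + q2 \<le> 2000 * K * I * (2 * K)" using K by (simp add: pos_divide_le_eq)
  then have "q1 + q2 \<le> 4000 * K^2 * I" by (simp add: power2_eq_square mult_ac)
  moreover have "(LBINT v. ?p v ^ 8 * (?G v * (Q u1 v + Q u2 v))) = q1 + q2"
    unfolding q1_def q2_def distrib_left by (rule Bochner_Integration.integral_add[OF i(1,2)])
  ultimately show ?thesis unfolding Q_def I_def by simp
qed

text \<open>Apply \<open>compact_estimate\<close> to the cut-off functions. The phase commutes with
  the cutoff, so the only error is the commutator with L, whose first order part is bounded by
  \<open>localized_energy\<close>. The factor 10^8 leaves room for 19200 * 4000 + 5760002 +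
  1.\<close>

lemma localized_estimate:
  fixes \<tau> :: real
  assumes k: "k \<noteq> 0" and u: "times_differentiable 4 u1" "times_differentiable 4 u2" and S: "1 \<le> S"
  defines "h1 \<equiv> \<lambda>v. diffusion u1 v - (\<tau> + v \<bullet> k) * u2 v"
    and "h2 \<equiv> \<lambda>v. diffusion u2 v + (\<tau> + v \<bullet> k) * u1 v"
  shows "(LBINT v. energy_density \<gamma> k (\<lambda>v. bump S v ^ 5 * u1 v) v + energy_density \<gamma> k (\<lambda>v. bump S v ^ 5 * u2 v) v)
    \<le> const0 K * (10^8 * K^4) * (LBINT v. 2 * bump (2 * S) v * ((h1 v)^2 + (h2 v)^2 + ((u1 v)^2 + (u2 v)^2)))"
proof -
  let ?\<chi> = "\<lambda>v. bump S v ^ 5" and ?P = "\<lambda>v. 2 * bump (2 * S) v" and ?G = "\<lambda>v. japanese v powr \<gamma>" and ?\<phi> = "\<lambda>v. \<tau> + v \<bullet> k"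
  define w1 w2 where "w1 v = ?\<chi> v * u1 v" and "w2 v = ?\<chi> v * u2 v" for v
  define Q where "Q u v = (\<Sum>a\<in>UNIV. (field a u v)^2)" for u v
  have S0: "S > 0" using S by simp
  have w: "times_differentiable 4 w1" "times_differentiable 4 w2"
    unfolding w1_def[abs_def] w2_def[abs_def] by (intro times_diff_mult u times_diff_bump; simp)+
  have w3: "times_differentiable 3 w1" "times_differentiable 3 w2" "times_differentiable 3 u1" "times_differentiable 3 u2"
    using times_diff_mono[OF w(1)] times_diff_mono[OF w(2)] times_diff_mono[OF u(1)] times_diff_mono[OF u(2)] by simp_all
  have zp: "norm v > 2 * S \<Longrightarrow> bump S v = 0" "norm v > 2 * S \<Longrightarrow> bump (2 * S) v = 0" for v :: "real^3"
    using bump_eq_0[of S v] bump_eq_0[of "2 * S" v] S0 by auto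
  have zw: "norm v > 2 * S \<Longrightarrow> w1 v = 0" "norm v > 2 * S \<Longrightarrow> w2 v = 0" for v using zp by (simp_all add: w1_def w2_def)
  have zD: "norm v > 2 * S \<Longrightarrow> diffusion w1 v = 0" "norm v > 2 * S \<Longrightarrow> diffusion w2 v = 0" for v
  proof -
    have zX: "norm v > 2 * S \<Longrightarrow> field a w1 v = 0" "norm v > 2 * S \<Longrightarrow> field a w2 v = 0" for a v
      by (rule field_eq_0[of "2 * S"]; simp add: zw)+
    show "norm v > 2 * S \<Longrightarrow> diffusion w1 v = 0" "norm v > 2 * S \<Longrightarrow> diffusion w2 v = 0"
      unfolding diffusion_def using zw zX by (simp_all add: field_eq_0[of "2 * S"])
  qed
  have X: "times_differentiable 1 (field a u1)" "times_differentiable 1 (field a u2)" "times_differentiable 1 u1" "times_differentiable 1 u2"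
    "times_differentiable 1 w1" "times_differentiable 1 w2" for a
    by (rule times_diff_field'[OF u(1)] times_diff_field'[OF u(2)] times_diff_mono[OF u(1)] times_diff_mono[OF u(2)]
      times_diff_mono[OF w(1)] times_diff_mono[OF w(2)]; simp)+
  have c: "continuous_on UNIV u1" "continuous_on UNIV u2" "continuous_on UNIV (field a u1)" "continuous_on UNIV (field a u2)"
    "continuous_on UNIV w1" "continuous_on UNIV w2" "continuous_on UNIV ?\<phi>" for a
    by (rule times_diff_continuous[of 1]; (rule X times_diff_phase)?; simp)+
  have cD: "continuous_on UNIV (diffusion u1)" "continuous_on UNIV (diffusion u2)" "continuous_on UNIV (diffusion w1)" "continuous_on UNIV (diffusion w2)"
    by (rule times_diff_diffusion w3)+
  have cQ: "continuous_on UNIV (Q u1)" "continuous_on UNIV (Q u2)" unfolding Q_def[abs_def] by (intro continuous_intros c)+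
  have ch: "continuous_on UNIV h1" "continuous_on UNIV h2" unfolding h1_def h2_def by (intro continuous_intros c cD)+
  have cp: "continuous_on UNIV (bump S)" "continuous_on UNIV (bump (2 * S))" by (rule continuous_bump)+
  note ints = integrable_continuous_support[of _ "2 * S"] continuous_intros c cD cQ ch cp continuous_japanese
  define I where "I = (LBINT v. ?P v * ((h1 v)^2 + (h2 v)^2 + ((u1 v)^2 + (u2 v)^2)))"
  have i: "integrable lborel (\<lambda>v. bump S v ^ 8 * (?G v * (Q u1 v + Q u2 v)))"
    "integrable lborel (\<lambda>v. ?P v * ((h1 v)^2 + (h2 v)^2 + ((u1 v)^2 + (u2 v)^2)))"
    "integrable lborel (\<lambda>v. (w1 v)^2 + (w2 v)^2)"
    "integrable lborel (\<lambda>v. (diffusion w1 v - ?\<phi> v * w2 v)^2 + (diffusion w2 v + ?\<phi> v * w1 v)^2)"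
    by (intro ints; simp add: zp zw zD)+
  have I0: "I \<ge> 0" unfolding I_def by (intro Bochner_Integration.integral_nonneg mult_nonneg_nonneg bump_bounds) auto
  have \<chi>2: "(?\<chi> v)^2 \<le> ?P v" for v
    using bump_power_le[OF S0, of 10 v] by (simp flip: power_mult)
  have "(LBINT v. (w1 v)^2 + (w2 v)^2) \<le> I"
    unfolding I_def
  proof (intro integral_mono i)
    fix v
    have "(w1 v)^2 + (w2 v)^2 = (?\<chi> v)^2 * ((u1 v)^2 + (u2 v)^2)"
      by (simp add: w1_def w2_def power_mult_distrib distrib_left)
    also have "\<dots> \<le> ?P v * ((h1 v)^2 + (h2 v)^2 + ((u1 v)^2 + (u2 v)^2))"
      using \<chi>2[of v] bump_bounds[of "2 * S" v] by (intro mult_mono) auto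
    finally show "(w1 v)^2 + (w2 v)^2 \<le> ?P v * ((h1 v)^2 + (h2 v)^2 + ((u1 v)^2 + (u2 v)^2))" .
  qed
  moreover have "(LBINT v. (diffusion w1 v - ?\<phi> v * w2 v)^2 + (diffusion w2 v + ?\<phi> v * w1 v)^2)
     \<le> (LBINT v. 19200 * K^2 * (bump S v ^ 8 * (?G v * (Q u1 v + Q u2 v)))
          + (2 + 5760000 * K^2) * (?P v * ((h1 v)^2 + (h2 v)^2 + ((u1 v)^2 + (u2 v)^2))))"
  proof (intro integral_mono i Bochner_Integration.integrable_add integrable_mult_right)
    fix v
    have e: "diffusion w1 v - ?\<phi> v * w2 v = ?\<chi> v * h1 v - commutator S u1 v"
       "diffusion w2 v + ?\<phi> v * w1 v = ?\<chi> v * h2 v - commutator S u2 v"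
      unfolding w1_def[abs_def] w2_def[abs_def] diffusion_bump[OF u(1)] diffusion_bump[OF u(2)] h1_def h2_def
      by (simp_all add: algebra_simps)
    have b: "(?\<chi> v * h v - commutator S u v)^2 \<le> 2 * (?P v * (h v)^2)
        + 19200 * K^2 * (bump S v ^ 8 * (?G v * Q u v)) + 5760000 * K^2 * (?P v * (u v)^2)" for h u
    proof -
      have "(?\<chi> v * h v)^2 \<le> ?P v * (h v)^2"
        unfolding power_mult_distrib by (rule mult_right_mono[OF \<chi>2]) simp
      then show ?thesis
        using two_sum_squares(2)[of "?\<chi> v * h v" "commutator S u v"] commutator_bound[OF S, of u v]
        unfolding Q_def by linarith
    qed
    define p where "p = ?P v"
    have p0: "0 \<le> p" unfolding p_def using bump_bounds[of "2 * S" v] by simp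
    have n: "0 \<le> 5760000 * K^2 * (p * (h1 v)^2)" "0 \<le> 5760000 * K^2 * (p * (h2 v)^2)" "0 \<le> 2 * (p * (u1 v)^2)" "0 \<le> 2 * (p * (u2 v)^2)"
      using p0 by simp_all
    have ar: "x \<le> a1 + b1 + c1 \<Longrightarrow> y \<le> a2 + b2 + c2 \<Longrightarrow> 0 \<le> d1 \<Longrightarrow> 0 \<le> d2 \<Longrightarrow> 0 \<le> d3 \<Longrightarrow> 0 \<le> d4 \<Longrightarrow>
      s = b1 + b2 \<Longrightarrow> t = a1 + a2 + c1 + c2 + d1 + d2 + d3 + d4 \<Longrightarrow> x + y \<le> s + t"
      for x y s t a1 a2 b1 b2 c1 c2 d1 d2 d3 d4 :: real by linarith
    show "(diffusion w1 v - ?\<phi> v * w2 v)^2 + (diffusion w2 v + ?\<phi> v * w1 v)^2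
      \<le> 19200 * K^2 * (bump S v ^ 8 * (?G v * (Q u1 v + Q u2 v)))
          + (2 + 5760000 * K^2) * (?P v * ((h1 v)^2 + (h2 v)^2 + ((u1 v)^2 + (u2 v)^2)))"
      unfolding e p_def[symmetric]
      by (rule ar[OF b[of h1 u1, folded p_def] b[of h2 u2, folded p_def] n]) (simp_all only: algebra_simps)
  qed
  moreover have "\<dots> = 19200 * K^2 * (LBINT v. bump S v ^ 8 * (?G v * (Q u1 v + Q u2 v))) + (2 + 5760000 * K^2) * I"
    unfolding I_def
    by (subst Bochner_Integration.integral_add[OF integrable_mult_right[OF i(1)] integrable_mult_right[OF i(2)]])
       (simp only: Bochner_Integration.integral_mult_right[OF i(1)] Bochner_Integration.integral_mult_right[OF i(2)])
  moreover have "19200 * K^2 * (LBINT v. bump S v ^ 8 * (?G v * (Q u1 v + Q u2 v))) \<le> 19200 * K^2 * (4000 * K^2 * I)"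
    unfolding I_def h1_def h2_def Q_def
    by (intro mult_left_mono localized_energy w3 S continuous_intros) simp
  moreover have "19200 * K^2 * (4000 * K^2 * I) = 76800000 * (K^4 * I)" by (simp add: power2_eq_square power4_eq_xxxx)
  moreover have "(2 + 5760000 * K^2) * I \<le> 5760002 * (K^4 * I)"
  proof -
    have "1 \<le> K^4" "K^2 \<le> K^4" using K by (auto simp: one_le_power intro: power_increasing)
    then have "2 + 5760000 * K^2 \<le> 5760002 * K^4" by linarith
    from mult_right_mono[OF this I0] show ?thesis by simp
  qed
  moreover have "I \<le> K^4 * I" using mult_right_mono[OF one_le_power[OF K, of 4] I0] by simp
  moreover have "0 \<le> K^4 * I" using I0 by simp
  ultimately have "(LBINT v. (diffusion w1 v - ?\<phi> v * w2 v)^2 + (diffusion w2 v + ?\<phi> v * w1 v)^2)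
      + (LBINT v. (w1 v)^2 + (w2 v)^2) \<le> 100000000 * (K^4 * I)"
    by linarith
  then have "const0 K * ((LBINT v. (diffusion w1 v - ?\<phi> v * w2 v)^2 + (diffusion w2 v + ?\<phi> v * w1 v)^2)
      + (LBINT v. (w1 v)^2 + (w2 v)^2)) \<le> const0 K * (10^8 * (K^4 * I))"
    using const0_pos by (intro mult_left_mono) simp_all
  from order_trans[OF compact_estimate[OF k w zw, where \<tau> = \<tau>] this]
  show ?thesis unfolding I_def w1_def[abs_def] w2_def[abs_def] by (simp only: mult.assoc)
qed

end

section \<open>Plancherel's theorem\<close>

lemma integral_lborel_prod:
  fixes f :: "'a::euclidean_space \<Rightarrow> real \<Rightarrow> complex"
  assumes f: "\<And>b. b \<in> Basis \<Longrightarrow> integrable lborel (f b)"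
  shows "(LBINT x. (\<Prod>b\<in>Basis. f b (x \<bullet> b))) = (\<Prod>b\<in>Basis. (LBINT x. f b x))"
proof -
  interpret finite_product_sigma_finite "\<lambda>_. lborel :: real measure" "Basis :: 'a set"
    by standard auto
  have [measurable]: "f b \<in> borel_measurable borel" if "b \<in> Basis" for b
    using borel_measurable_integrable[OF f[OF that]] by simp
  have "(LBINT x. (\<Prod>b\<in>Basis. f b (x \<bullet> b)))
    = (\<integral>x. (\<Prod>b\<in>Basis. f b (x b)) \<partial>(\<Pi>\<^sub>M b\<in>(Basis :: 'a set). lborel))"
    by (subst lborel_eq, subst integral_distr) (auto intro!: Bochner_Integration.integral_cong prod.cong)
  also have "\<dots> = (\<Prod>b\<in>Basis. (LBINT x. f b x))"
    by (rule product_integral_prod) (use f in auto)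
  finally show ?thesis .
qed

definition gauss :: "real \<Rightarrow> 'a::euclidean_space \<Rightarrow> real" where
  "gauss s x = exp (- (s * norm x)\<^sup>2 / 2)"

lemma gauss_pos [simp]: "gauss s x > 0" and gauss_nonneg [simp]: "gauss s x \<ge> 0"
  by (simp_all add: gauss_def)

lemma gauss_le_1: "gauss s x \<le> 1"
  by (simp add: gauss_def)

lemma continuous_gauss [continuous_intros]: "continuous_on S (gauss s)"
  unfolding gauss_def[abs_def] by (intro continuous_intros) auto

lemma gauss_prod: "gauss s x = (\<Prod>b\<in>Basis. exp (- (s * (x \<bullet> b))\<^sup>2 / 2))"
proof -
  have "(s * norm x)^2 = (\<Sum>b\<in>Basis. (s * (x \<bullet> b))^2)"
    unfolding power_mult_distrib power2_norm_eq_inner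
    by (subst euclidean_inner) (simp add: power2_eq_square sum_distrib_left)
  then show ?thesis
    by (simp add: gauss_def exp_sum[symmetric] sum_negf sum_divide_distrib)
qed

text \<open>After rescaling this is the characteristic function of the standard normal
  distribution.\<close>

lemma gaussian_integral_1:
  assumes s: "s > 0"
  shows "integrable lborel (\<lambda>x. exp (- (\<i> * complex_of_real (t * x))) * complex_of_real (exp (- (s * x)\<^sup>2 / 2)))" (is "integrable _ ?f")
    and "(LBINT x. exp (- (\<i> * complex_of_real (t * x))) * complex_of_real (exp (- (s * x)\<^sup>2 / 2)))
      = complex_of_real (sqrt (2 * pi) / s * exp (- (t / s)\<^sup>2 / 2))"
proof -
  let ?g = "\<lambda>x. std_normal_density x *\<^sub>R iexp (- (t / s) * x)"
  have f: "?f (0 + (1 / s) * x) = complex_of_real (sqrt (2 * pi)) * ?g x" for x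
    using s by (simp add: std_normal_density_def scaleR_conv_of_real mult_ac)
  have g: "integrable lborel ?g"
  proof (rule Bochner_Integration.integrable_bound[OF integrable_normal_density[of 1 0]])
    show "AE x in lborel. norm (?g x) \<le> norm (std_normal_density x)" by (auto simp: norm_mult)
  qed auto
  then have "integrable lborel (\<lambda>x. ?f (0 + (1 / s) * x))" unfolding f by (rule integrable_mult_right)
  then show "integrable lborel ?f"
    using s lborel_integrable_real_affine_iff[of "1 / s" ?f 0] by simp
  have "(LBINT x. ?f x) = \<bar>1 / s\<bar> *\<^sub>R (LBINT x. ?f (0 + (1 / s) * x))"
    using s by (intro lborel_integral_real_affine) auto
  also have "\<dots> = \<bar>1 / s\<bar> *\<^sub>R (complex_of_real (sqrt (2 * pi)) * (LBINT x. ?g x))"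
    unfolding f by (simp only: Bochner_Integration.integral_mult_right_zero)
  also have "(LBINT x. ?g x) = char std_normal_distribution (- (t / s))"
    unfolding char_def by (subst integral_density) auto
  also have "\<dots> = complex_of_real (exp (- (t / s)\<^sup>2 / 2))"
    unfolding char_std_normal_distribution by simp
  finally show "(LBINT x. ?f x) = complex_of_real (sqrt (2 * pi) / s * exp (- (t / s)\<^sup>2 / 2))"
    using s by (simp add: scaleR_conv_of_real)
qed

definition fourier :: "('a::euclidean_space \<Rightarrow> complex) \<Rightarrow> 'a \<Rightarrow> complex" where
  "fourier u k = (LBINT x. exp (- (\<i> * complex_of_real (k \<bullet> x))) * u x)"

lemma exp_gauss_prod: "exp (- (\<i> * complex_of_real (k \<bullet> x))) * complex_of_real (gauss s x)
   = (\<Prod>b\<in>Basis. exp (- (\<i> * complex_of_real ((k \<bullet> b) * (x \<bullet> b)))) * complex_of_real (exp (- (s * (x \<bullet> b))\<^sup>2 / 2)))"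
proof -
  have "- (\<i> * complex_of_real (k \<bullet> x)) = (\<Sum>b\<in>Basis. - (\<i> * complex_of_real ((k \<bullet> b) * (x \<bullet> b))))"
    by (subst euclidean_inner) (simp add: sum_negf sum_distrib_left)
  then have "exp (- (\<i> * complex_of_real (k \<bullet> x))) = (\<Prod>b\<in>Basis. exp (- (\<i> * complex_of_real ((k \<bullet> b) * (x \<bullet> b)))))"
    by (simp add: exp_sum)
  then show ?thesis by (simp only: gauss_prod prod.distrib of_real_prod)
qed

lemma fourier_gauss:
  fixes k :: "'a::euclidean_space"
  assumes s: "s > 0"
  shows "fourier (\<lambda>x. complex_of_real (gauss s x)) k
    = complex_of_real ((sqrt (2 * pi) / s) ^ DIM('a) * gauss (1 / s) k)"
proof -
  have "fourier (\<lambda>x. complex_of_real (gauss s x)) k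
    = (\<Prod>b\<in>Basis. complex_of_real (sqrt (2 * pi) / s * exp (- ((k \<bullet> b) / s)\<^sup>2 / 2)))"
    unfolding fourier_def exp_gauss_prod
    using gaussian_integral_1[OF s] by (subst integral_lborel_prod) auto
  also have "\<dots> = complex_of_real ((sqrt (2 * pi) / s) ^ DIM('a) * gauss (1 / s) k)"
    by (simp only: gauss_prod prod.distrib of_real_prod[symmetric] prod_constant) simp
  finally show ?thesis .
qed

lemma integrable_gauss: "s > 0 \<Longrightarrow> integrable lborel (gauss s :: 'a::euclidean_space \<Rightarrow> real)"
proof -
  assume s: "s > 0"
  have 1: "(\<integral>\<^sup>+x. ennreal (exp (- (s * x)\<^sup>2 / 2)) \<partial>lborel) < \<infinity>"
  proof -
    have "integrable lborel (\<lambda>x. exp (- (\<i> * complex_of_real (0 * x))) * complex_of_real (exp (- (s * x)\<^sup>2 / 2)))"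
      by (rule gaussian_integral_1[OF s])
    from integrable_norm[OF this] have "integrable lborel (\<lambda>x. exp (- (s * x)\<^sup>2 / 2))" by (simp add: norm_mult)
    then show ?thesis by (simp add: integrable_iff_bounded)
  qed
  have "(\<integral>\<^sup>+x. ennreal (gauss s (x::'a)) \<partial>lborel) = (\<integral>\<^sup>+x. (\<Prod>b\<in>Basis. ennreal (exp (- (s * ((x::'a) \<bullet> b))\<^sup>2 / 2))) \<partial>lborel)"
    by (simp only: gauss_prod) (simp add: prod_ennreal)
  also have "\<dots> = (\<Prod>b\<in>(Basis::'a set). (\<integral>\<^sup>+x. ennreal (exp (- (s * x)\<^sup>2 / 2)) \<partial>lborel))"
    by (rule nn_integral_lborel_prod[where f = "\<lambda>b x. ennreal (exp (- (s * x)\<^sup>2 / 2))"]) auto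
  also have "\<dots> < \<infinity>" using 1 by (simp add: power_less_top_ennreal)
  finally show ?thesis
    by (simp add: integrable_iff_bounded borel_measurable_continuous_onI[OF continuous_gauss])
qed

lemma borel_measurable_gauss [measurable]: "gauss s \<in> borel_measurable borel"
  by (rule borel_measurable_continuous_onI[OF continuous_gauss])

lemma borel_measurable_cnj [measurable (raw)]:
  "f \<in> borel_measurable M \<Longrightarrow> (\<lambda>x. cnj (f x)) \<in> borel_measurable M"
  by (rule borel_measurable_continuous_on[OF continuous_on_cnj[OF continuous_on_id]])

lemma norm_character [simp]: "norm (exp (- (\<i> * complex_of_real r))) = 1"
  using norm_exp_i_times[of "- r"] by simp

lemma borel_measurable_fourier [measurable]:
  assumes [measurable]: "u \<in> borel_measurable borel"
  shows "fourier u \<in> borel_measurable borel"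
  unfolding fourier_def[abs_def] by measurable

lemma integrable_character_mult:
  assumes "integrable lborel u"
  shows "integrable lborel (\<lambda>x. exp (- (\<i> * complex_of_real (k \<bullet> x))) * u x)"
proof (rule Bochner_Integration.integrable_bound[OF assms])
  have [measurable]: "u \<in> borel_measurable borel" using borel_measurable_integrable[OF assms] by simp
  show "(\<lambda>x. exp (- (\<i> * complex_of_real (k \<bullet> x))) * u x) \<in> borel_measurable lborel" by measurable
qed (simp add: norm_mult)

lemma norm_fourier_le: "norm (fourier u k) \<le> (LBINT x. norm (u x))"
proof -
  have "norm (fourier u k) \<le> (LBINT x. norm (exp (- (\<i> * complex_of_real (k \<bullet> x))) * u x))"
    unfolding fourier_def by (rule integral_norm_bound)
  then show ?thesis by (simp add: norm_mult)
qed

lemma lborel_integral_affine: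
  fixes f :: "'a::euclidean_space \<Rightarrow> 'b::{banach, second_countable_topology}"
  assumes s: "s \<noteq> 0" and [measurable]: "f \<in> borel_measurable borel"
  shows "(LBINT x. f x) = \<bar>s\<bar> ^ DIM('a) *\<^sub>R (LBINT x. f (t + s *\<^sub>R x))"
proof -
  have "(LBINT x. f x) = (\<integral>x. f x \<partial>density (distr lborel borel (\<lambda>x. t + s *\<^sub>R x)) (\<lambda>_. ennreal (\<bar>s\<bar> ^ DIM('a))))"
    using lborel_affine[OF s, of t] by (simp add: ennreal_power)
  also have "\<dots> = \<bar>s\<bar> ^ DIM('a) *\<^sub>R (LBINT x. f (t + s *\<^sub>R x))"
    by (subst integral_density) (auto simp: integral_distr)
  finally show ?thesis .
qed

lemma integrable_tensor:
  fixes a :: "'a::euclidean_space \<Rightarrow> complex" and b :: "'b::euclidean_space \<Rightarrow> complex"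
  assumes a: "integrable lborel a" and b: "integrable lborel b"
  shows "integrable (lborel \<Otimes>\<^sub>M lborel) (\<lambda>(x, y). a x * b y)"
proof (rule lborel_pair.Fubini_integrable)
  have [measurable]: "a \<in> borel_measurable borel" "b \<in> borel_measurable borel"
    using borel_measurable_integrable[OF a] borel_measurable_integrable[OF b] by simp_all
  show "(\<lambda>(x, y). a x * b y) \<in> borel_measurable (lborel \<Otimes>\<^sub>M lborel)" by measurable
  show "integrable lborel (\<lambda>x. \<integral>y. norm (case (x, y) of (x, y) \<Rightarrow> a x * b y) \<partial>lborel)"
    using integrable_norm[OF a] by (simp add: norm_mult)
  show "AE x in lborel. integrable lborel (\<lambda>y. case (x, y) of (x, y) \<Rightarrow> a x * b y)"
    using b by simp
qed

text \<open>Letting the width of the Gaussian weight tend to infinity gives Plancherel's identity.\<close>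

lemma fourier_gauss_weighted:
  fixes u :: "'a::euclidean_space \<Rightarrow> complex"
  assumes u: "integrable lborel u" and s: "s > 0"
  shows "(LBINT k. (norm (fourier u k))^2 * gauss s k)
    = Re (sqrt (2 * pi) ^ DIM('a) * (LBINT x. u x * (LBINT z. cnj (u (x + s *\<^sub>R z)) * gauss 1 z)))"
proof -
  have um[measurable]: "u \<in> borel_measurable borel" using borel_measurable_integrable[OF u] by simp
  let ?e = "\<lambda>k x. exp (- (\<i> * complex_of_real (k \<bullet> x)))"
  let ?M = "lborel :: 'a measure"
  \<comment> \<open>The Gaussian is there to make the triple integrand absolutely integrable, so
    that the k-integral can be carried out first.\<close>
  have pairI: "integrable (lborel \<Otimes>\<^sub>M (lborel \<Otimes>\<^sub>M lborel)) (\<lambda>(k::'a, x, y). ?e k (x - y) * (u x * cnj (u y)) * gauss s k)"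
  proof -
    have "integrable (lborel \<Otimes>\<^sub>M lborel) (\<lambda>(x::'a, y::'a). u x * cnj (u y))"
      by (intro integrable_tensor integrable_cnj u)
    then have I1: "integrable (lborel \<Otimes>\<^sub>M lborel) (\<lambda>p::'a\<times>'a. norm (u (fst p) * cnj (u (snd p))))"
      by (auto simp: split_beta' intro: integrable_norm)
    interpret P: pair_sigma_finite ?M "lborel \<Otimes>\<^sub>M lborel :: ('a \<times> 'a) measure"
      by standard
    have m: "(\<lambda>(k::'a, x, y). ?e k (x - y) * (u x * cnj (u y)) * gauss s k) \<in> borel_measurable (lborel \<Otimes>\<^sub>M (lborel \<Otimes>\<^sub>M lborel))"
      by measurable
    show ?thesis
    proof (rule P.Fubini_integrable[OF m])
      show "AE k in lborel. integrable (lborel \<Otimes>\<^sub>M lborel) (\<lambda>p. case (k, p) of (k, x, y) \<Rightarrow> ?e k (x - y) * (u x * cnj (u y)) * gauss s k)"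
        by (intro AE_I2 Bochner_Integration.integrable_bound[OF integrable_mult_left[OF I1, of "gauss s _"]])
           (auto simp: split_beta' norm_mult)
      have "(\<integral>p. norm (case (k, p) of (k, x, y) \<Rightarrow> ?e k (x - y) * (u x * cnj (u y)) * gauss s k) \<partial>(lborel \<Otimes>\<^sub>M lborel))
        = (\<integral>p. norm (u (fst p) * cnj (u (snd p))) \<partial>(lborel \<Otimes>\<^sub>M lborel)) * gauss s k" for k :: 'a
        by (simp add: split_beta' norm_mult)
      then show "integrable lborel (\<lambda>k::'a. \<integral>p. norm (case (k, p) of (k, x, y) \<Rightarrow> ?e k (x - y) * (u x * cnj (u y)) * gauss s k) \<partial>(lborel \<Otimes>\<^sub>M lborel))"
        using integrable_gauss[OF s, where 'a = 'a] by simp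
    qed
  qed
  interpret P: pair_sigma_finite ?M "lborel \<Otimes>\<^sub>M lborel :: ('a \<times> 'a) measure"
    by standard
  have sq: "complex_of_real ((norm (fourier u k))^2) = (\<integral>p. ?e k (fst p - snd p) * (u (fst p) * cnj (u (snd p))) \<partial>(lborel \<Otimes>\<^sub>M lborel))" for k
  proof -
    have i: "integrable (lborel \<Otimes>\<^sub>M lborel) (\<lambda>(x, y). (?e k x * u x) * cnj (?e k y * u y))"
      by (intro integrable_tensor integrable_cnj integrable_character_mult u)
    have e: "?e k (x - y) = ?e k x * cnj (?e k y)" for x y
      by (simp add: inner_diff_right exp_cnj algebra_simps flip: exp_add)
    have "complex_of_real ((norm (fourier u k))^2) = fourier u k * cnj (fourier u k)"
      by (rule complex_norm_square)
    also have "\<dots> = (LBINT x. (LBINT y. (?e k x * u x) * cnj (?e k y * u y)))"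
      unfolding fourier_def Bochner_Integration.integral_cnj[symmetric] by (simp del: complex_cnj_mult)
    also have "\<dots> = (\<integral>(x, y). (?e k x * u x) * cnj (?e k y * u y) \<partial>(lborel \<Otimes>\<^sub>M lborel))"
      by (rule lborel_pair.integral_fst[OF i])
    finally show ?thesis by (simp add: split_beta' e mult_ac)
  qed
  have "complex_of_real (LBINT k. (norm (fourier u k))^2 * gauss s k)
    = (LBINT k. (\<integral>p. (case p of (x, y) \<Rightarrow> ?e k (x - y) * (u x * cnj (u y)) * gauss s k) \<partial>(lborel \<Otimes>\<^sub>M lborel)))"
    unfolding integral_complex_of_real[symmetric] of_real_mult sq by (simp add: split_beta')
  also have "\<dots> = (\<integral>p. (LBINT k. (case p of (x, y) \<Rightarrow> ?e k (x - y) * (u x * cnj (u y)) * gauss s k)) \<partial>(lborel \<Otimes>\<^sub>M lborel))"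
    by (rule P.Fubini_integral[symmetric]) (use pairI in \<open>simp add: split_beta'\<close>)
  also have "\<dots> = (\<integral>(x, y). (sqrt (2 * pi) / s) ^ DIM('a) * (u x * (cnj (u y) * gauss (1 / s) (x - y))) \<partial>(lborel \<Otimes>\<^sub>M lborel))"
  proof (rule Bochner_Integration.integral_cong[OF refl], clarify)
    fix x y :: 'a
    have "(LBINT k. ?e k (x - y) * (u x * cnj (u y)) * gauss s k) = (LBINT k. (u x * cnj (u y)) * (?e (x - y) k * gauss s k))"
      by (simp add: inner_commute mult_ac)
    also have "\<dots> = (u x * cnj (u y)) * fourier (\<lambda>k. complex_of_real (gauss s k)) (x - y)"
      unfolding fourier_def by simp
    finally show "(LBINT k. ?e k (x - y) * (u x * cnj (u y)) * gauss s k)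
      = (sqrt (2 * pi) / s) ^ DIM('a) * (u x * (cnj (u y) * gauss (1 / s) (x - y)))"
      unfolding fourier_gauss[OF s] by simp
  qed
  also have "\<dots> = (LBINT x. (LBINT y. (sqrt (2 * pi) / s) ^ DIM('a) * (u x * (cnj (u y) * gauss (1 / s) (x - y)))))"
  proof (rule lborel_pair.integral_fst[symmetric])
    have "integrable (lborel \<Otimes>\<^sub>M lborel) (\<lambda>(x::'a, y::'a). u x * cnj (u y))"
      by (intro integrable_tensor integrable_cnj u)
    then have "integrable (lborel \<Otimes>\<^sub>M lborel) (\<lambda>(x::'a, y::'a). u x * (cnj (u y) * gauss (1 / s) (x - y)))"
      by (rule Bochner_Integration.integrable_bound)
         (auto simp: split_beta' norm_mult gauss_le_1 mult_left_le intro!: mult_left_mono)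
    then show "integrable (lborel \<Otimes>\<^sub>M lborel) (\<lambda>(x::'a, y). (sqrt (2 * pi) / s) ^ DIM('a) * (u x * (cnj (u y) * gauss (1 / s) (x - y))))"
      by (simp add: split_beta')
  qed
  \<comment> \<open>The substitution y = x + s z cancels the factor s^(-DIM('a)) and leaves a fixed
    Gaussian average of values of u near x.\<close>
  also have "\<dots> = (LBINT x. sqrt (2 * pi) ^ DIM('a) * (u x * (LBINT z. cnj (u (x + s *\<^sub>R z)) * gauss 1 z)))"
  proof (rule Bochner_Integration.integral_cong[OF refl])
    fix x :: 'a
    have g: "gauss (1 / s) (x - (x + s *\<^sub>R z)) = gauss 1 z" for z
      using s by (simp add: gauss_def power_mult_distrib)
    have "(LBINT y. cnj (u y) * gauss (1 / s) (x - y))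
      = \<bar>s\<bar> ^ DIM('a) *\<^sub>R (LBINT z. cnj (u (x + s *\<^sub>R z)) * gauss (1 / s) (x - (x + s *\<^sub>R z)))"
      using s by (intro lborel_integral_affine) auto
    then have "(LBINT y. cnj (u y) * gauss (1 / s) (x - y)) = s ^ DIM('a) * (LBINT z. cnj (u (x + s *\<^sub>R z)) * gauss 1 z)"
      unfolding g using s by (simp add: scaleR_conv_of_real)
    then show "(LBINT y. (sqrt (2 * pi) / s) ^ DIM('a) * (u x * (cnj (u y) * gauss (1 / s) (x - y))))
      = sqrt (2 * pi) ^ DIM('a) * (u x * (LBINT z. cnj (u (x + s *\<^sub>R z)) * gauss 1 z))"
      using s by (simp add: power_divide)
  qed
  also have "\<dots> = sqrt (2 * pi) ^ DIM('a) * (LBINT x. u x * (LBINT z. cnj (u (x + s *\<^sub>R z)) * gauss 1 z))"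
    by simp
  finally show ?thesis by (metis Re_complex_of_real)
qed

text \<open>As s tends to 0 the weight increases to 1. The space side converges by dominated
  convergence, u being bounded with compact support; on the frequency side monotone convergence
  gives the identity and with it the square integrability of the transform.\<close>

lemma plancherel_continuous:
  fixes u :: "'a::euclidean_space \<Rightarrow> complex"
  assumes c: "continuous_on UNIV u" and z: "\<And>x. norm x > r \<Longrightarrow> u x = 0"
  shows "sqnorm (fourier u) = ennreal ((2 * pi) ^ DIM('a)) * sqnorm u"
proof -
  have u: "integrable lborel u" by (rule integrable_continuous_support[OF c z])
  have um[measurable]: "u \<in> borel_measurable borel" by (rule borel_measurable_continuous_onI[OF c])
  have u2: "integrable lborel (\<lambda>x. (norm (u x))^2)"
    by (rule integrable_continuous_support[of _ r]) (auto intro!: continuous_intros c simp: z)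
  obtain M where M: "\<And>x. norm (u x) \<le> M"
  proof -
    obtain M where M: "\<And>x. x \<in> cball 0 r \<Longrightarrow> norm (u x) \<le> M"
      using compact_imp_bounded[OF compact_continuous_image[OF continuous_on_subset[OF c] compact_cball]]
      unfolding bounded_iff by (metis imageI subset_UNIV)
    have "norm (u x) \<le> max M 0" for x
      using M[of x] z[of x] by (cases "norm x \<le> r") auto
    then show ?thesis by (rule that)
  qed
  define s where "s n = 1 / real (Suc n)" for n
  have s: "s n > 0" for n by (simp add: s_def)
  have s0: "s \<longlonglongrightarrow> 0" unfolding s_def using LIMSEQ_inverse_real_of_nat by (simp add: inverse_eq_divide)
  let ?A = "\<lambda>n x. \<integral>z. cnj (u (x + s n *\<^sub>R z)) * gauss 1 z \<partial>lborel"
  have g: "integrable lborel (gauss 1 :: 'a \<Rightarrow> real)" by (rule integrable_gauss) simp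
  have G: "(LBINT z. gauss 1 (z::'a)) = sqrt (2 * pi) ^ DIM('a)"
  proof -
    have "complex_of_real (LBINT z. gauss 1 (z::'a)) = fourier (\<lambda>x. complex_of_real (gauss 1 x)) (0::'a)"
      unfolding fourier_def by simp
    also have "\<dots> = complex_of_real (sqrt (2 * pi) ^ DIM('a))"
      by (subst fourier_gauss) (auto simp: gauss_def)
    finally show ?thesis by (simp only: of_real_eq_iff)
  qed
  have A: "(\<lambda>n. ?A n x) \<longlonglongrightarrow> (LBINT z. cnj (u x) * gauss 1 (z::'a))" for x
  proof (rule integral_dominated_convergence[where w = "\<lambda>z. M * gauss 1 z"])
    show "integrable lborel (\<lambda>z::'a. M * gauss 1 z)" using g by simp
    show "AE z in lborel. (\<lambda>n. cnj (u (x + s n *\<^sub>R z)) * gauss 1 z) \<longlonglongrightarrow> cnj (u x) * gauss 1 z"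
    proof (rule AE_I2)
      fix z :: 'a
      have "(\<lambda>n. x + s n *\<^sub>R z) \<longlonglongrightarrow> x" using s0 by (auto intro!: tendsto_eq_intros)
      then have "(\<lambda>n. u (x + s n *\<^sub>R z)) \<longlonglongrightarrow> u x"
        using c by (auto simp: continuous_on_eq_continuous_at intro: isCont_tendsto_compose)
      then show "(\<lambda>n. cnj (u (x + s n *\<^sub>R z)) * gauss 1 z) \<longlonglongrightarrow> cnj (u x) * gauss 1 z"
        by (intro tendsto_intros)
    qed
  qed (auto simp: norm_mult M intro!: mult_right_mono)
  have Ab: "norm (?A n x) \<le> M * sqrt (2 * pi) ^ DIM('a)" for n x
  proof -
    have "norm (?A n x) \<le> (LBINT z. norm (cnj (u (x + s n *\<^sub>R z)) * gauss 1 z))"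
      by (rule integral_norm_bound)
    also have "\<dots> \<le> (LBINT z. M * gauss 1 (z::'a))"
    proof (rule integral_mono)
      show "integrable lborel (\<lambda>z::'a. M * gauss 1 z)" using g by simp
      then show "integrable lborel (\<lambda>z. norm (cnj (u (x + s n *\<^sub>R z)) * complex_of_real (gauss 1 z)))"
        by (rule Bochner_Integration.integrable_bound)
           (use order_trans[OF norm_ge_zero M] in \<open>auto simp: norm_mult abs_mult intro!: mult_right_mono M\<close>)
    qed (auto simp: norm_mult M intro!: mult_right_mono)
    finally show ?thesis using G by simp
  qed
  have "(\<lambda>n. \<integral>x. u x * ?A n x \<partial>lborel) \<longlonglongrightarrow> (LBINT x. u x * (cnj (u x) * sqrt (2 * pi) ^ DIM('a)))"
  proof (rule integral_dominated_convergence[where w = "\<lambda>x. norm (u x) * (M * sqrt (2 * pi) ^ DIM('a))"])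
    show "AE x in lborel. (\<lambda>n. u x * ?A n x) \<longlonglongrightarrow> u x * (cnj (u x) * sqrt (2 * pi) ^ DIM('a))"
    proof (rule AE_I2)
      fix x
      show "(\<lambda>n. u x * ?A n x) \<longlonglongrightarrow> u x * (cnj (u x) * sqrt (2 * pi) ^ DIM('a))"
        using tendsto_mult_left[OF A[of x], of "u x"] by (simp add: G)
    qed
    show "AE x in lborel. norm (u x * ?A n x) \<le> norm (u x) * (M * sqrt (2 * pi) ^ DIM('a))" for n
      using Ab by (auto simp: norm_mult intro!: mult_left_mono)
  qed (use u in auto)
  then have "(\<lambda>n. Re (sqrt (2 * pi) ^ DIM('a) * (LBINT x. u x * ?A n x)))
     \<longlonglongrightarrow> Re (sqrt (2 * pi) ^ DIM('a) * (LBINT x. u x * (cnj (u x) * sqrt (2 * pi) ^ DIM('a))))"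
    by (intro tendsto_intros)
  moreover have "(LBINT x. u x * (cnj (u x) * sqrt (2 * pi) ^ DIM('a))) = complex_of_real ((LBINT x. (norm (u x))^2) * sqrt (2 * pi) ^ DIM('a))"
  proof -
    have "(LBINT x. u x * (cnj (u x) * sqrt (2 * pi) ^ DIM('a))) = (LBINT x. complex_of_real ((norm (u x))^2 * sqrt (2 * pi) ^ DIM('a)))"
      by (intro Bochner_Integration.integral_cong refl) (simp add: complex_norm_square[symmetric] mult.assoc[symmetric])
    then show ?thesis by (simp only: integral_complex_of_real Bochner_Integration.integral_mult_left_zero)
  qed
  moreover have "Re (complex_of_real (sqrt (2 * pi) ^ DIM('a)) * complex_of_real (I * sqrt (2 * pi) ^ DIM('a))) = (2 * pi) ^ DIM('a) * I" for I
  proof -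
    have "complex_of_real (sqrt (2 * pi) ^ DIM('a)) * complex_of_real (I * sqrt (2 * pi) ^ DIM('a))
       = complex_of_real (sqrt (2 * pi) ^ DIM('a) * (I * sqrt (2 * pi) ^ DIM('a)))" by (simp only: of_real_mult)
    also have "sqrt (2 * pi) ^ DIM('a) * (I * sqrt (2 * pi) ^ DIM('a)) = I * (sqrt (2 * pi) * sqrt (2 * pi)) ^ DIM('a)"
      unfolding power_mult_distrib by (simp only: mult_ac)
    also have "sqrt (2 * pi) * sqrt (2 * pi) = 2 * pi" by simp
    finally show ?thesis by (simp only: Re_complex_of_real mult.commute)
  qed
  ultimately have lim: "(\<lambda>n. \<integral>k. (norm (fourier u k))^2 * gauss (s n) k \<partial>lborel)
     \<longlonglongrightarrow> (2 * pi) ^ DIM('a) * (LBINT x. (norm (u x))^2)"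
    unfolding fourier_gauss_weighted[OF u s] by (simp only:)
  let ?N = "\<integral>x. norm (u x) \<partial>lborel"
  have ig: "integrable lborel (\<lambda>k. (norm (fourier u k))^2 * gauss (s n) k)" for n
  proof (rule Bochner_Integration.integrable_bound[OF integrable_mult_right[OF integrable_gauss[OF s[of n]], of "?N^2"]])
    show "AE k in lborel. norm ((norm (fourier u k))^2 * gauss (s n) k) \<le> norm (?N^2 * gauss (s n) k)"
      using norm_fourier_le[of u] by (auto intro!: mult_right_mono power_mono)
  qed auto
  have "(\<lambda>n. \<integral>\<^sup>+k. ennreal ((norm (fourier u k))^2 * gauss (s n) k) \<partial>lborel) \<longlonglongrightarrow> (\<integral>\<^sup>+k. ennreal ((norm (fourier u k))^2) \<partial>lborel)"
  proof (rule nn_integral_LIMSEQ)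
    show "incseq (\<lambda>n k. ennreal ((norm (fourier u k))^2 * gauss (s n) k))"
    proof (intro incseq_SucI le_funI ennreal_leI mult_left_mono)
      fix n and k :: 'a
      have "s (Suc n) \<le> s n" by (simp add: s_def field_simps)
      then have "(s (Suc n) * norm k)^2 \<le> (s n * norm k)^2"
        using s[of "Suc n"] by (intro power_mono mult_right_mono) (auto intro: less_imp_le)
      then show "gauss (s n) k \<le> gauss (s (Suc n)) k" by (simp add: gauss_def)
    qed simp
    fix k :: 'a
    have "(\<lambda>n. gauss (s n) k) \<longlonglongrightarrow> gauss 0 k"
      unfolding gauss_def by (intro tendsto_intros s0) simp
    then have "(\<lambda>n. (norm (fourier u k))^2 * gauss (s n) k) \<longlonglongrightarrow> (norm (fourier u k))^2 * gauss 0 k"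
      by (intro tendsto_intros)
    then show "(\<lambda>n. ennreal ((norm (fourier u k))^2 * gauss (s n) k)) \<longlonglongrightarrow> ennreal ((norm (fourier u k))^2)"
      by (simp add: gauss_def)
  qed auto
  moreover have "(\<integral>\<^sup>+k. ennreal ((norm (fourier u k))^2 * gauss (s n) k) \<partial>lborel) = ennreal (LBINT k. (norm (fourier u k))^2 * gauss (s n) k)" for n
    by (rule nn_integral_eq_integral[OF ig]) auto
  moreover have "(\<lambda>n. ennreal (LBINT k. (norm (fourier u k))^2 * gauss (s n) k)) \<longlonglongrightarrow> ennreal ((2 * pi) ^ DIM('a) * (LBINT x. (norm (u x))^2))"
    by (rule tendsto_ennrealI[OF lim])
  ultimately have "sqnorm (fourier u) = ennreal ((2 * pi) ^ DIM('a) * (LBINT x. (norm (u x))^2))"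
    unfolding sqnorm_def by (simp add: LIMSEQ_unique)
  also have "\<dots> = ennreal ((2 * pi) ^ DIM('a)) * sqnorm u"
    unfolding sqnorm_def by (subst nn_integral_eq_integral[OF u2]) (auto simp: ennreal_mult)
  finally show ?thesis .
qed

section \<open>Square integrable functions and their approximation\<close>

lemma in_L2_iff: "in_L2 g \<longleftrightarrow> g \<in> borel_measurable borel \<and> integrable lborel (\<lambda>x. (norm (g x))^2)"
proof (cases "g \<in> borel_measurable borel")
  case True
  note this[measurable]
  show ?thesis unfolding in_L2_def sqnorm_def integrable_iff_bounded by simp
qed (auto simp: in_L2_def)

lemma in_L2D:
  assumes "in_L2 g"
  shows "g \<in> borel_measurable borel" "integrable lborel (\<lambda>x. (norm (g x))^2)"
    "sqnorm g = ennreal (LBINT x. (norm (g x))^2)"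
  using assms unfolding in_L2_iff sqnorm_def by (auto intro: nn_integral_eq_integral)

lemma norm_add_square_le: "(norm (a + b))^2 \<le> 2 * (norm a)^2 + 2 * (norm b)^2"
proof -
  have "(norm (a + b))^2 \<le> (norm a + norm b)^2" by (intro power_mono norm_triangle_ineq) auto
  also have "\<dots> \<le> 2 * (norm a)^2 + 2 * (norm b)^2" by (rule two_sum_squares)
  finally show ?thesis .
qed

lemma sqnorm_add_le:
  assumes [measurable]: "a \<in> borel_measurable borel" "b \<in> borel_measurable borel"
  shows "sqnorm (\<lambda>x. a x + b x) \<le> 2 * sqnorm a + 2 * sqnorm b"
proof -
  have "sqnorm (\<lambda>x. a x + b x) \<le> (\<integral>\<^sup>+x. 2 * ennreal ((norm (a x))^2) + 2 * ennreal ((norm (b x))^2) \<partial>lborel)"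
    unfolding sqnorm_def
  proof (rule nn_integral_mono)
    fix x
    have "ennreal ((norm (a x + b x))^2) \<le> ennreal (2 * (norm (a x))^2 + 2 * (norm (b x))^2)"
      by (intro ennreal_leI norm_add_square_le)
    then show "ennreal ((norm (a x + b x))^2) \<le> 2 * ennreal ((norm (a x))^2) + 2 * ennreal ((norm (b x))^2)"
      by (simp add: ennreal_plus ennreal_mult)
  qed
  also have "\<dots> = 2 * sqnorm a + 2 * sqnorm b"
    unfolding sqnorm_def by (simp add: nn_integral_add nn_integral_cmult)
  finally show ?thesis .
qed

lemma sqnorm_minus_commute: "sqnorm (\<lambda>x. a x - b x) = sqnorm (\<lambda>x. b x - a x)"
  unfolding sqnorm_def by (simp add: norm_minus_commute)

lemma sqnorm_diff_le:
  fixes a b :: "'a::euclidean_space \<Rightarrow> complex"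
  assumes "a \<in> borel_measurable borel" "b \<in> borel_measurable borel"
  shows "sqnorm (\<lambda>x. a x - b x) \<le> 2 * sqnorm a + 2 * sqnorm b"
  using sqnorm_add_le[OF assms(1) borel_measurable_uminus[OF assms(2)]] by (simp add: sqnorm_def)

lemma sqnorm_cmult:
  fixes g :: "'a::euclidean_space \<Rightarrow> complex"
  assumes [measurable]: "g \<in> borel_measurable borel"
  shows "sqnorm (\<lambda>x. c * g x) = ennreal ((norm c)^2) * sqnorm g"
  unfolding sqnorm_def by (simp add: norm_mult power_mult_distrib ennreal_mult nn_integral_cmult)

lemma in_L2_diff: "in_L2 a \<Longrightarrow> in_L2 b \<Longrightarrow> in_L2 (\<lambda>x. a x - b x)"
  for a b :: "'a::euclidean_space \<Rightarrow> complex"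
proof -
  assume a: "in_L2 a" and b: "in_L2 b"
  have "2 * sqnorm a + 2 * sqnorm b < \<infinity>"
    using a b by (simp add: in_L2_def ennreal_mult_less_top)
  then show ?thesis
    using sqnorm_diff_le[OF in_L2D(1)[OF a] in_L2D(1)[OF b]] in_L2D(1)[OF a] in_L2D(1)[OF b]
    by (auto simp: in_L2_def intro: le_less_trans)
qed

lemma in_L2_mult_integrable:
  fixes a b :: "'a::euclidean_space \<Rightarrow> complex"
  assumes a: "in_L2 a" and b: "in_L2 b"
  shows "integrable lborel (\<lambda>x. a x * b x)"
    and "norm (LBINT x. a x * b x) \<le> sqrt (LBINT x. (norm (a x))^2) * sqrt (LBINT x. (norm (b x))^2)"
proof -
  note [measurable] = in_L2D(1)[OF a] in_L2D(1)[OF b]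
  have i: "integrable lborel (\<lambda>x. norm (a x) * norm (b x))"
  proof (rule Bochner_Integration.integrable_bound[OF Bochner_Integration.integrable_add[OF in_L2D(2)[OF a] in_L2D(2)[OF b]]])
    have "norm (a x) * norm (b x) \<le> (norm (a x))^2 + (norm (b x))^2" for x
      using sum_squares_bound[of "norm (a x)" "norm (b x)"] mult_nonneg_nonneg[OF norm_ge_zero[of "a x"] norm_ge_zero[of "b x"]] by linarith
    then show "AE x in lborel. norm (norm (a x) * norm (b x)) \<le> norm ((norm (a x))^2 + (norm (b x))^2)" by simp
  qed measurable
  then show I: "integrable lborel (\<lambda>x. a x * b x)"
    by (rule Bochner_Integration.integrable_bound) (auto simp: norm_mult)
  have "norm (LBINT x. a x * b x) \<le> (LBINT x. norm (a x * b x))" by (rule integral_norm_bound)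
  also have "\<dots> = \<bar>\<integral>x. norm (a x) * norm (b x) \<partial>lborel\<bar>" by (simp add: norm_mult)
  also have "\<dots> \<le> sqrt (LBINT x. (norm (a x))^2) * sqrt (LBINT x. (norm (b x))^2)"
    by (rule integral_cauchy_schwarz[OF i in_L2D(2)[OF a] in_L2D(2)[OF b]]) (auto simp: power_mult_distrib)
  finally show "norm (LBINT x. a x * b x) \<le> sqrt (LBINT x. (norm (a x))^2) * sqrt (LBINT x. (norm (b x))^2)" .
qed

lemma sqnorm_tendsto_0_iff:
  assumes "\<And>n. in_L2 (d n)"
  shows "(\<lambda>n. sqnorm (d n)) \<longlonglongrightarrow> 0 \<longleftrightarrow> (\<lambda>n. \<integral>x. (norm (d n x))^2 \<partial>lborel) \<longlonglongrightarrow> 0"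
  unfolding in_L2D(3)[OF assms] using tendsto_ennreal_iff[of "\<lambda>n. \<integral>x. (norm (d n x))^2 \<partial>lborel" sequentially 0]
  by (simp add: zero_ennreal.abs_eq[symmetric])

text \<open>With d = b - a the squared norms differ by the squared norm of d plus twice a real inner
  product of a and d, and both tend to 0.\<close>

lemma sqnorm_tendsto:
  fixes a :: "'a::euclidean_space \<Rightarrow> complex"
  assumes a: "in_L2 a" and d: "\<And>n. in_L2 (b n)" and lim: "(\<lambda>n. sqnorm (\<lambda>x. b n x - a x)) \<longlonglongrightarrow> 0"
  shows "(\<lambda>n. sqnorm (b n)) \<longlonglongrightarrow> sqnorm a"
proof -
  let ?N = "\<lambda>g. \<integral>x. (norm (g x :: complex))^2 \<partial>lborel"
  define d where "d n = (\<lambda>x. b n x - a x)" for n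
  have dL: "in_L2 (d n)" for n unfolding d_def by (intro in_L2_diff assms)
  have d0: "(\<lambda>n. ?N (d n)) \<longlonglongrightarrow> 0"
    using lim sqnorm_tendsto_0_iff[of d, OF dL] by (simp add: d_def)
  have cL: "in_L2 (\<lambda>x. cnj (g x))" if "in_L2 g" for g :: "'a \<Rightarrow> complex"
    using that unfolding in_L2_iff by (auto intro!: borel_measurable_cnj)
  have b: "\<bar>?N (b n) - ?N a\<bar> \<le> ?N (d n) + 2 * (sqrt (?N a) * sqrt (?N (d n)))" for n
  proof -
    have e: "(norm (b n x))^2 - (norm (a x))^2 = (norm (d n x))^2 + 2 * Re (cnj (a x) * d n x)" for x
    proof -
      have "(norm (b n x))^2 = (norm (a x + d n x))^2" by (simp add: d_def)
      also have "\<dots> = (norm (a x))^2 + (norm (d n x))^2 + 2 * Re (cnj (a x) * d n x)"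
        by (simp add: cmod_power2 power2_sum)
      finally show ?thesis by simp
    qed
    note i = in_L2_mult_integrable[OF cL[OF a] dL[of n]]
    have "?N (b n) - ?N a = (LBINT x. (norm (d n x))^2 + 2 * Re (cnj (a x) * d n x))"
      unfolding e[symmetric] using in_L2D(2)[OF a] in_L2D(2)[OF d[of n]] by simp
    also have "\<dots> = ?N (d n) + 2 * Re (LBINT x. cnj (a x) * d n x)"
      by (subst Bochner_Integration.integral_add[OF in_L2D(2)[OF dL[of n]] integrable_mult_right[OF integrable_Re[OF i(1)]]])
         (simp only: Bochner_Integration.integral_mult_right_zero integral_Re[OF i(1)])
    finally have "\<bar>?N (b n) - ?N a\<bar> \<le> \<bar>?N (d n)\<bar> + 2 * \<bar>Re (LBINT x. cnj (a x) * d n x)\<bar>" by linarith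
    also have "\<bar>Re (LBINT x. cnj (a x) * d n x)\<bar> \<le> sqrt (?N a) * sqrt (?N (d n))"
      using order_trans[OF abs_Re_le_cmod i(2)] by simp
    finally show ?thesis by simp
  qed
  have "(\<lambda>n. ?N (b n) - ?N a) \<longlonglongrightarrow> 0"
  proof (rule Lim_null_comparison)
    show "\<forall>\<^sub>F n in sequentially. norm (?N (b n) - ?N a) \<le> ?N (d n) + 2 * (sqrt (?N a) * sqrt (?N (d n)))"
      using b by simp
    have "(\<lambda>n. ?N (d n) + 2 * (sqrt (?N a) * sqrt (?N (d n)))) \<longlonglongrightarrow> 0 + 2 * (sqrt (?N a) * sqrt 0)"
      by (intro tendsto_intros d0)
    then show "(\<lambda>n. ?N (d n) + 2 * (sqrt (?N a) * sqrt (?N (d n)))) \<longlonglongrightarrow> 0" by simp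
  qed
  then have "(\<lambda>n. ?N (b n)) \<longlonglongrightarrow> ?N a" by (simp add: LIM_zero_iff)
  then show ?thesis unfolding in_L2D(3)[OF a] in_L2D(3)[OF d] by (rule tendsto_ennrealI)
qed

text \<open>Continuous functions converging almost everywhere come with the notion
  \<open>measurable_on\<close>. They are capped in size and support so that dominated convergence
  applies.\<close>

lemma bounded_L2_approx:
  fixes u :: "'a::euclidean_space \<Rightarrow> complex"
  assumes um[measurable]: "u \<in> borel_measurable borel" and M: "\<And>x. norm (u x) \<le> M" "M > 0"
    and z: "\<And>x. norm x > r \<Longrightarrow> u x = 0"
  shows "\<exists>h. (\<forall>n. continuous_on UNIV (h n)) \<and> (\<forall>n x. norm x > r + 1 \<longrightarrow> h n x = 0) \<and>
    (\<lambda>n. sqnorm (\<lambda>x. h n x - u x)) \<longlonglongrightarrow> 0"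
proof -
  have "u measurable_on UNIV"
    by (rule lebesgue_measurable_imp_measurable_on) (auto simp: measurable_completion)
  then obtain N g where N: "negligible N" and g: "\<And>n. continuous_on UNIV (g n)"
    and lim: "\<And>x. x \<notin> N \<Longrightarrow> (\<lambda>n. g n x) \<longlonglongrightarrow> u x"
    unfolding measurable_on_def by auto
  define \<psi> :: "'a \<Rightarrow> real" where "\<psi> x = max 0 (min 1 (r + 1 - norm x))" for x
  \<comment> \<open>The quotient by the maximum caps the modulus at M and preserves continuity. In
    the limit it is 1 because u is bounded by M, and \<psi> is 1 on the support of u.\<close>
  define h where "h n x = complex_of_real (\<psi> x * (M / max M (norm (g n x)))) * g n x" for n x
  have \<psi>: "0 \<le> \<psi> x" "\<psi> x \<le> 1" "norm x \<le> r \<Longrightarrow> \<psi> x = 1" "norm x > r + 1 \<Longrightarrow> \<psi> x = 0" for x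
    by (auto simp: \<psi>_def)
  have c\<psi>: "continuous_on UNIV \<psi>" unfolding \<psi>_def[abs_def] by (intro continuous_intros)
  have ch: "continuous_on UNIV (h n)" for n
  proof -
    have "max M (norm (g n x)) \<noteq> 0" for x
      using M(2) max.cobounded1[of M "norm (g n x)"] by linarith
    then show ?thesis unfolding h_def[abs_def] by (intro continuous_intros c\<psi> g) auto
  qed
  have [measurable]: "h n \<in> borel_measurable borel" for n by (rule borel_measurable_continuous_onI[OF ch])
  have hz: "norm x > r + 1 \<Longrightarrow> h n x = 0" for n x by (simp add: h_def \<psi>)
  have hM: "norm (h n x) \<le> M" for n x
  proof -
    have "norm (h n x) = \<psi> x * (M * norm (g n x) / max M (norm (g n x)))"
    proof -
      have "\<bar>max M (norm (g n x))\<bar> = max M (norm (g n x))" using M(2) by simp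
      then show ?thesis
        using M(2) \<psi>(1)[of x] unfolding h_def norm_mult norm_of_real abs_mult abs_divide by simp
    qed
    also have "\<dots> \<le> 1 * M"
      using M(2) \<psi>[of x] by (intro mult_mono) (auto simp: divide_le_eq mult_left_mono)
    finally show ?thesis by simp
  qed
  have "(\<lambda>n. \<integral>x. (norm (h n x - u x))^2 \<partial>lborel) \<longlonglongrightarrow> (\<integral>x. 0 \<partial>(lborel :: 'a measure))"
  proof (rule integral_dominated_convergence[where w = "\<lambda>x. (2 * M)^2 * indicat_real (cball 0 (r + 1)) x"])
    show "integrable lborel (\<lambda>x::'a. (2 * M)^2 * indicat_real (cball 0 (r + 1)) x)"
      by (rule integrable_mult_right) (use integrable_real_indicator[OF _ emeasure_lborel_cball_finite] in auto)
    have "AE x in lebesgue. x \<notin> N" using N by (simp add: negligible_iff_null_sets AE_not_in)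
    then have "AE x in lborel. x \<notin> N" by (simp add: AE_completion_iff)
    then show "AE x in lborel. (\<lambda>n. (norm (h n x - u x))^2) \<longlonglongrightarrow> 0"
    proof eventually_elim
      case (elim x)
      have "(\<lambda>n. h n x) \<longlonglongrightarrow> complex_of_real (\<psi> x * (M / max M (norm (u x)))) * u x"
        unfolding h_def by (intro tendsto_intros lim elim) (use M(2) max.cobounded1[of M "norm (u x)"] in linarith)
      also have "complex_of_real (\<psi> x * (M / max M (norm (u x)))) * u x = u x"
        using M(1)[of x] M(2) \<psi>(3)[of x] z[of x] by (cases "norm x \<le> r") (auto simp: max_def)
      finally have "(\<lambda>n. h n x - u x) \<longlonglongrightarrow> 0" by (simp add: LIM_zero)
      then have "(\<lambda>n. (norm (h n x - u x))^2) \<longlonglongrightarrow> (norm (0::complex))^2" by (intro tendsto_intros)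
      then show ?case by simp
    qed
    show "AE x in lborel. norm ((norm (h n x - u x))^2) \<le> (2 * M)^2 * indicat_real (cball 0 (r + 1)) x" for n
    proof (rule AE_I2)
      fix x
      show "norm ((norm (h n x - u x))^2) \<le> (2 * M)^2 * indicat_real (cball 0 (r + 1)) x"
      proof (cases "norm x \<le> r + 1")
        case True
        have "norm (h n x - u x) \<le> 2 * M" using norm_triangle_ineq4[of "h n x" "u x"] hM[of n x] M(1)[of x] by linarith
        then have "(norm (h n x - u x))^2 \<le> (2 * M)^2" by (intro power_mono) auto
        then show ?thesis using True by simp
      next
        case False
        then show ?thesis using hz[of x n] z[of x] by simp
      qed
    qed
  qed measurable
  moreover have "in_L2 (\<lambda>x. h n x - u x)" for n
  proof -
    have "integrable lborel (\<lambda>x. (norm (h n x - u x))^2)"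
    proof (rule Bochner_Integration.integrable_bound)
      show "integrable lborel (\<lambda>x::'a. (2 * M)^2 * indicat_real (cball 0 (r + 1)) x)"
        by (rule integrable_mult_right) (use integrable_real_indicator[OF _ emeasure_lborel_cball_finite] in auto)
      show "AE x in lborel. norm ((norm (h n x - u x))^2) \<le> norm ((2 * M)^2 * indicat_real (cball 0 (r + 1)) x)"
      proof (rule AE_I2)
        fix x
        show "norm ((norm (h n x - u x))^2) \<le> norm ((2 * M)^2 * indicat_real (cball 0 (r + 1)) x)"
        proof (cases "norm x \<le> r + 1")
          case True
          have "norm (h n x - u x) \<le> 2 * M" using norm_triangle_ineq4[of "h n x" "u x"] hM[of n x] M(1)[of x] by linarith
          then have "(norm (h n x - u x))^2 \<le> (2 * M)^2" by (intro power_mono) auto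
          then show ?thesis using True by simp
        next
          case False
          then show ?thesis using hz[of x n] z[of x] by simp
        qed
      qed
    qed measurable
    then show ?thesis by (simp add: in_L2_iff)
  qed
  ultimately have "(\<lambda>n. sqnorm (\<lambda>x. h n x - u x)) \<longlonglongrightarrow> 0"
    by (subst sqnorm_tendsto_0_iff) auto
  then show ?thesis using ch hz by blast
qed

text \<open>Setting u to 0 where it exceeds n + 1 reduces to bounded functions; a close continuous
  approximant is picked for each n.\<close>

lemma L2_approx:
  fixes u :: "'a::euclidean_space \<Rightarrow> complex"
  assumes u: "in_L2 u" and z: "\<And>x. norm x > r \<Longrightarrow> u x = 0"
  shows "\<exists>h. (\<forall>n. continuous_on UNIV (h n)) \<and> (\<forall>n x. norm x > r + 1 \<longrightarrow> h n x = 0) \<and>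
    (\<lambda>n. sqnorm (\<lambda>x. h n x - u x)) \<longlonglongrightarrow> 0"
proof -
  note [measurable] = in_L2D(1)[OF u]
  define v where "v n x = (if norm (u x) \<le> real (Suc n) then u x else 0)" for n x
  have [measurable]: "v n \<in> borel_measurable borel" for n unfolding v_def[abs_def] by measurable
  have "\<exists>h. continuous_on UNIV h \<and> (\<forall>x. norm x > r + 1 \<longrightarrow> h x = 0) \<and> sqnorm (\<lambda>x. h x - v n x) \<le> ennreal (1 / real (Suc n))" for n
  proof -
    obtain h where h: "\<And>n. continuous_on UNIV (h n)" "\<And>n x. norm x > r + 1 \<Longrightarrow> h n x = 0"
      "(\<lambda>m. sqnorm (\<lambda>x. h m x - v n x)) \<longlonglongrightarrow> 0"
    proof -
      have vb: "norm (v n x) \<le> real (Suc n)" for x by (simp add: v_def)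
      have vz: "norm x > r \<Longrightarrow> v n x = 0" for x by (simp add: v_def z)
      have vm: "v n \<in> borel_measurable borel" by measurable
      have "\<exists>h. (\<forall>m. continuous_on UNIV (h m)) \<and> (\<forall>m x. norm x > r + 1 \<longrightarrow> h m x = 0) \<and>
        (\<lambda>m. sqnorm (\<lambda>x. h m x - v n x)) \<longlonglongrightarrow> 0"
        by (rule bounded_L2_approx[OF vm vb _ vz]) simp_all
      then show ?thesis using that by auto
    qed
    have "eventually (\<lambda>m. sqnorm (\<lambda>x. h m x - v n x) < ennreal (1 / real (Suc n))) sequentially"
      by (rule order_tendstoD(2)[OF h(3)]) simp
    then obtain m where "sqnorm (\<lambda>x. h m x - v n x) < ennreal (1 / real (Suc n))"
      by (auto simp: eventually_sequentially)
    then show ?thesis using h by (intro exI[of _ "h m"]) auto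
  qed
  then obtain h where h: "\<And>n. continuous_on UNIV (h n)" "\<And>n x. norm x > r + 1 \<Longrightarrow> h n x = 0"
      "\<And>n. sqnorm (\<lambda>x. h n x - v n x) \<le> ennreal (1 / real (Suc n))" by metis
  have [measurable]: "h n \<in> borel_measurable borel" for n by (rule borel_measurable_continuous_onI[OF h(1)])
  have vu: "(\<lambda>n. sqnorm (\<lambda>x. v n x - u x)) \<longlonglongrightarrow> 0"
  proof (subst sqnorm_tendsto_0_iff)
    have b: "norm ((norm (v n x - u x))^2) \<le> (norm (u x))^2" for n x by (simp add: v_def)
    show "in_L2 (\<lambda>x. v n x - u x)" for n
      unfolding in_L2_iff
      by (auto intro!: Bochner_Integration.integrable_bound[OF in_L2D(2)[OF u]] simp: v_def)
    have "(\<lambda>n. \<integral>x. (norm (v n x - u x))^2 \<partial>lborel) \<longlonglongrightarrow> (\<integral>x. 0 \<partial>(lborel :: 'a measure))"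
    proof (rule integral_dominated_convergence[where w = "\<lambda>x. (norm (u x))^2"])
      show "AE x in lborel. (\<lambda>n. (norm (v n x - u x))^2) \<longlonglongrightarrow> 0"
      proof (rule AE_I2)
        fix x
        obtain m where m: "norm (u x) \<le> real m" using real_arch_simple by blast
        have "(norm (v n x - u x))^2 = 0" if "n \<ge> m" for n
          using m that by (simp add: v_def)
        then show "(\<lambda>n. (norm (v n x - u x))^2) \<longlonglongrightarrow> 0"
          by (intro tendsto_eventually) (auto simp: eventually_sequentially)
      qed
    qed (use in_L2D(2)[OF u] b in auto)
    then show "(\<lambda>n. \<integral>x. (norm (v n x - u x))^2 \<partial>lborel) \<longlonglongrightarrow> 0" by simp
  qed
  have le: "sqnorm (\<lambda>x. h n x - u x) \<le> 2 * ennreal (1 / real (Suc n)) + 2 * sqnorm (\<lambda>x. v n x - u x)" for n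
  proof -
    have "sqnorm (\<lambda>x. h n x - u x) = sqnorm (\<lambda>x. (h n x - v n x) + (v n x - u x))" by simp
    also have "\<dots> \<le> 2 * sqnorm (\<lambda>x. h n x - v n x) + 2 * sqnorm (\<lambda>x. v n x - u x)"
      by (rule sqnorm_add_le) measurable
    also have "\<dots> \<le> 2 * ennreal (1 / real (Suc n)) + 2 * sqnorm (\<lambda>x. v n x - u x)"
      by (intro add_mono mult_left_mono h) auto
    finally show ?thesis .
  qed
  have "(\<lambda>n. 2 * ennreal (1 / real (Suc n)) + 2 * sqnorm (\<lambda>x. v n x - u x)) \<longlonglongrightarrow> 2 * ennreal 0 + 2 * 0"
  proof (intro tendsto_add ennreal_tendsto_cmult vu tendsto_ennrealI)
    show "(\<lambda>n. 1 / real (Suc n)) \<longlonglongrightarrow> 0" using LIMSEQ_inverse_real_of_nat by (simp add: inverse_eq_divide)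
  qed auto
  then have "(\<lambda>n. 2 * ennreal (1 / real (Suc n)) + 2 * sqnorm (\<lambda>x. v n x - u x)) \<longlonglongrightarrow> 0" by simp
  then have "(\<lambda>n. sqnorm (\<lambda>x. h n x - u x)) \<longlonglongrightarrow> 0"
    by (rule tendsto_sandwich[OF always_eventually always_eventually tendsto_const, rotated 2]) (use le in auto)
  then show ?thesis using h by blast
qed

lemma L2_support_integrable:
  fixes u :: "'a::euclidean_space \<Rightarrow> complex"
  assumes u: "in_L2 u" and z: "\<And>x. norm x > r \<Longrightarrow> u x = 0"
  shows "integrable lborel u"
    and "(LBINT x. norm (u x)) \<le> sqrt (LBINT x. (norm (u x))^2) * sqrt (measure lborel (cball 0 r :: 'a set))"
proof -
  have I: "integrable lborel (\<lambda>x::'a. complex_of_real (indicator (cball 0 r) x))"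
    by (rule integrable_of_real) (use integrable_real_indicator[OF _ emeasure_lborel_cball_finite] in auto)
  have i: "in_L2 (\<lambda>x::'a. complex_of_real (indicator (cball 0 r) x))"
  proof -
    have "(norm (complex_of_real (indicator (cball 0 r) x)))^2 = norm (complex_of_real (indicator (cball 0 r) x))" for x :: 'a
      by (cases "x \<in> cball 0 r") auto
    then show ?thesis unfolding in_L2_iff using integrable_norm[OF I] by simp
  qed
  have e: "norm (u x) * complex_of_real (indicator (cball 0 r) x) = norm (u x)" for x
    using z[of x] by (cases "norm x \<le> r") auto
  have un: "in_L2 (\<lambda>x. complex_of_real (norm (u x)))"
    using u unfolding in_L2_iff by auto
  note p = in_L2_mult_integrable[OF un i, unfolded e]
  have m: "(LBINT x. (norm (complex_of_real (indicat_real (cball 0 r :: 'a set) x)))^2) = measure lborel (cball 0 r :: 'a set)"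
  proof -
    have "(norm (complex_of_real (indicat_real (cball 0 r) x)))^2 = indicat_real (cball 0 r) x" for x :: 'a
      by (simp add: indicator_def)
    then have "(LBINT x. (norm (complex_of_real (indicat_real (cball 0 r :: 'a set) x)))^2) = (LBINT x. indicat_real (cball 0 r :: 'a set) x)"
      by (intro Bochner_Integration.integral_cong refl)
    also have "\<dots> = measure lborel (cball 0 r :: 'a set)"
      by (subst Bochner_Integration.integral_indicator) simp
    finally show ?thesis .
  qed
  have "integrable lborel (\<lambda>x. norm (u x))" using integrable_norm[OF p(1)] by simp
  then show "integrable lborel u" using in_L2D(1)[OF u] integrable_norm_iff[of u lborel] by simp
  show "(LBINT x. norm (u x)) \<le> sqrt (LBINT x. (norm (u x))^2) * sqrt (measure lborel (cball 0 r :: 'a set))"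
    using p(2) unfolding m by (simp add: abs_of_nonneg)
qed

lemma fourier_diff:
  assumes "integrable lborel a" "integrable lborel b"
  shows "fourier (\<lambda>x. a x - b x) k = fourier a k - fourier b k"
  unfolding fourier_def using integrable_character_mult[OF assms(1), of k] integrable_character_mult[OF assms(2), of k]
  by (simp add: right_diff_distrib)

lemma in_L2_continuous_support:
  fixes u :: "'a::euclidean_space \<Rightarrow> complex"
  assumes "continuous_on UNIV u" "\<And>x. norm x > r \<Longrightarrow> u x = 0"
  shows "in_L2 u"
  unfolding in_L2_iff
  by (intro conjI borel_measurable_continuous_onI integrable_continuous_support[of _ r] continuous_intros assms(1))
     (simp add: assms(2))

text \<open>A square integrable function of compact support is integrable, so its Fourier integral
  exists pointwise. Approximation in L2 with a common support gives convergence in L1 as well, hence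
  pointwise convergence of the transforms, which identifies their L2 limit.\<close>

lemma plancherel_support:
  fixes u :: "'a::euclidean_space \<Rightarrow> complex"
  assumes u: "in_L2 u" and z: "\<And>x. norm x > r \<Longrightarrow> u x = 0"
  shows "sqnorm (fourier u) = ennreal ((2 * pi) ^ DIM('a)) * sqnorm u" and "in_L2 (fourier u)"
proof -
  let ?c = "ennreal ((2 * pi) ^ DIM('a))"
  obtain h where h: "\<And>n. continuous_on UNIV (h n)" "\<And>n x. norm x > r + 1 \<Longrightarrow> h n x = 0"
    "(\<lambda>n. sqnorm (\<lambda>x. h n x - u x)) \<longlonglongrightarrow> 0"
    using L2_approx[OF u z] by blast
  have hL: "in_L2 (h n)" for n by (rule in_L2_continuous_support[OF h(1,2)])
  have hi: "integrable lborel (h n)" for n by (rule integrable_continuous_support[OF h(1,2)])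
  have ui: "integrable lborel u" by (rule L2_support_integrable[OF u z])
  note [measurable] = in_L2D(1)[OF u] in_L2D(1)[OF hL]
  have dL: "in_L2 (\<lambda>x. h n x - u x)" for n by (intro in_L2_diff hL u)
  have ptw: "(\<lambda>n. fourier (h n) k) \<longlonglongrightarrow> fourier u k" for k
  proof -
    have "(\<lambda>n. fourier (h n) k - fourier u k) \<longlonglongrightarrow> 0"
    proof (rule Lim_null_comparison)
      have "norm (fourier (h n) k - fourier u k) \<le> sqrt (LBINT x. (norm (h n x - u x))^2) * sqrt (measure lborel (cball 0 (r + 1) :: 'a set))" for n
      proof -
        have "norm (fourier (h n) k - fourier u k) \<le> (LBINT x. norm (h n x - u x))"
          unfolding fourier_diff[OF hi ui, symmetric] by (rule norm_fourier_le)
        also have "\<dots> \<le> sqrt (LBINT x. (norm (h n x - u x))^2) * sqrt (measure lborel (cball 0 (r + 1) :: 'a set))"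
          by (rule L2_support_integrable(2)[OF dL]) (simp add: h(2) z)
        finally show ?thesis .
      qed
      then show "\<forall>\<^sub>F n in sequentially. norm (fourier (h n) k - fourier u k) \<le> sqrt (LBINT x. (norm (h n x - u x))^2) * sqrt (measure lborel (cball 0 (r + 1) :: 'a set))"
        by simp
      have "(\<lambda>n. \<integral>x. (norm (h n x - u x))^2 \<partial>lborel) \<longlonglongrightarrow> 0"
        using h(3) sqnorm_tendsto_0_iff[OF dL] by simp
      then have "(\<lambda>n. sqrt (LBINT x. (norm (h n x - u x))^2) * sqrt (measure lborel (cball 0 (r + 1) :: 'a set))) \<longlonglongrightarrow> sqrt 0 * sqrt (measure lborel (cball 0 (r + 1) :: 'a set))"
        by (intro tendsto_intros)
      then show "(\<lambda>n. sqrt (LBINT x. (norm (h n x - u x))^2) * sqrt (measure lborel (cball 0 (r + 1) :: 'a set))) \<longlonglongrightarrow> 0" by simp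
    qed
    then show ?thesis by (simp add: LIM_zero_iff)
  qed
  have hm: "sqnorm (\<lambda>k. fourier (h m) k - fourier (h n) k) \<le> ?c * (2 * sqnorm (\<lambda>x. h m x - u x) + 2 * sqnorm (\<lambda>x. h n x - u x))" for m n
  proof -
    have "sqnorm (\<lambda>k. fourier (h m) k - fourier (h n) k) = sqnorm (fourier (\<lambda>x. h m x - h n x))"
      using fourier_diff[OF hi hi, symmetric] by (intro arg_cong[where f = sqnorm] ext) simp
    also have "\<dots> = ?c * sqnorm (\<lambda>x. h m x - h n x)"
      by (rule plancherel_continuous[of _ "r + 1"]) (auto intro!: continuous_intros h(1) simp: h(2))
    also have "sqnorm (\<lambda>x. h m x - h n x) = sqnorm (\<lambda>x. (h m x - u x) - (h n x - u x))" by simp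
    also have "\<dots> \<le> 2 * sqnorm (\<lambda>x. h m x - u x) + 2 * sqnorm (\<lambda>x. h n x - u x)"
      by (rule sqnorm_diff_le) measurable
    finally show ?thesis by (simp add: mult_left_mono)
  qed
  \<comment> \<open>Fatou in m along the pointwise limit turns the Cauchy bound \<open>hm\<close>
    into a bound for the distance to the transform of u.\<close>
  have lim1: "sqnorm (\<lambda>k. fourier (h n) k - fourier u k) \<le> ?c * (2 * sqnorm (\<lambda>x. h n x - u x))" for n
  proof -
    have "sqnorm (\<lambda>k. fourier (h n) k - fourier u k) = (\<integral>\<^sup>+k. liminf (\<lambda>m. ennreal ((norm (fourier (h m) k - fourier (h n) k))^2)) \<partial>lborel)"
      unfolding sqnorm_def
    proof (rule nn_integral_cong)
      fix k
      have "(\<lambda>m. ennreal ((norm (fourier (h m) k - fourier (h n) k))^2)) \<longlonglongrightarrow> ennreal ((norm (fourier u k - fourier (h n) k))^2)"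
        by (intro tendsto_ennrealI tendsto_intros ptw)
      from lim_imp_Liminf[OF _ this]
      show "ennreal ((norm (fourier (h n) k - fourier u k))^2) = liminf (\<lambda>m. ennreal ((norm (fourier (h m) k - fourier (h n) k))^2))"
        by (simp add: norm_minus_commute)
    qed
    also have "\<dots> \<le> liminf (\<lambda>m. sqnorm (\<lambda>k. fourier (h m) k - fourier (h n) k))"
      unfolding sqnorm_def by (rule nn_integral_liminf) measurable
    also have "\<dots> \<le> liminf (\<lambda>m. ?c * (2 * sqnorm (\<lambda>x. h m x - u x) + 2 * sqnorm (\<lambda>x. h n x - u x)))"
      by (intro Liminf_mono always_eventually allI hm)
    also have "\<dots> = ?c * (2 * 0 + 2 * sqnorm (\<lambda>x. h n x - u x))"
    proof (rule lim_imp_Liminf)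
      show "(\<lambda>m. ?c * (2 * sqnorm (\<lambda>x. h m x - u x) + 2 * sqnorm (\<lambda>x. h n x - u x))) \<longlonglongrightarrow> ?c * (2 * 0 + 2 * sqnorm (\<lambda>x. h n x - u x))"
        by (intro ennreal_tendsto_cmult tendsto_add tendsto_const h(3)) auto
    qed simp
    finally show ?thesis by simp
  qed
  have "(\<lambda>n. ?c * (2 * sqnorm (\<lambda>x. h n x - u x))) \<longlonglongrightarrow> ?c * (2 * 0)"
    by (intro ennreal_tendsto_cmult h(3)) auto
  then have 0: "(\<lambda>n. ?c * (2 * sqnorm (\<lambda>x. h n x - u x))) \<longlonglongrightarrow> 0" by simp
  have lim: "(\<lambda>n. sqnorm (\<lambda>k. fourier (h n) k - fourier u k)) \<longlonglongrightarrow> 0"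
    by (rule tendsto_sandwich[OF always_eventually always_eventually tendsto_const 0]) (use lim1 in auto)
  have hp: "sqnorm (fourier (h n)) = ?c * sqnorm (h n)" for n
    by (rule plancherel_continuous[OF h(1)]) (rule h(2))
  have hFL: "in_L2 (fourier (h n))" for n
    using hL[of n] plancherel_continuous[OF h(1)[of n] h(2)[of _ n]] unfolding in_L2_def
    by (auto simp: ennreal_mult_less_top simp del: power_mult_distrib)
  show uFL: "in_L2 (fourier u)"
  proof -
    have "sqnorm (\<lambda>k. fourier (h 0) k - fourier u k) < \<infinity>"
      using lim1[of 0] dL[of 0] by (auto simp: in_L2_def ennreal_mult_less_top intro: le_less_trans)
    then have "in_L2 (\<lambda>k. fourier (h 0) k - fourier u k)" by (simp add: in_L2_def)
    from in_L2_diff[OF hFL[of 0] this] show ?thesis by simp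
  qed
  have "(\<lambda>n. sqnorm (fourier (h n))) \<longlonglongrightarrow> sqnorm (fourier u)"
    by (rule sqnorm_tendsto[OF uFL hFL lim])
  moreover have "(\<lambda>n. sqnorm (fourier (h n))) \<longlonglongrightarrow> ?c * sqnorm u"
    unfolding hp
    by (intro ennreal_tendsto_cmult sqnorm_tendsto[OF u hL h(3)]) simp
  ultimately show "sqnorm (fourier u) = ?c * sqnorm u" by (rule LIMSEQ_unique)
qed

section \<open>The L2 Fourier transform as a limit of truncated integrals\<close>

definition cut :: "real \<Rightarrow> ('a::euclidean_space \<Rightarrow> complex) \<Rightarrow> 'a \<Rightarrow> complex" where
  "cut R u x = indicator (ball 0 R) x *\<^sub>R u x"

lemma borel_measurable_cut [measurable]:
  "u \<in> borel_measurable borel \<Longrightarrow> cut R u \<in> borel_measurable borel"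
  unfolding cut_def[abs_def] by (intro borel_measurable_scaleR borel_measurable_indicator) auto

lemma norm_cut_le: "norm (cut R u x) \<le> norm (u x)"
  by (simp add: cut_def indicator_def)

lemma cut_eq_0: "norm x > R \<Longrightarrow> cut R u x = 0"
  by (simp add: cut_def)

lemma norm_sub_cut_le: "norm (u x - cut R u x) \<le> norm (u x)"
  by (simp add: cut_def indicator_def)

lemma in_L2_bounded_by:
  fixes u w :: "'a::euclidean_space \<Rightarrow> complex"
  assumes u: "in_L2 u" and [measurable]: "w \<in> borel_measurable borel" and le: "\<And>x. norm (w x) \<le> norm (u x)"
  shows "in_L2 w"
  unfolding in_L2_iff
proof
  show "integrable lborel (\<lambda>x. (norm (w x))^2)"
    by (rule Bochner_Integration.integrable_bound[OF in_L2D(2)[OF u]]) (auto intro!: power_mono le)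
qed measurable

lemma in_L2_cut: "in_L2 u \<Longrightarrow> in_L2 (cut R u)"
  using in_L2_bounded_by[of u "cut R u"] in_L2D(1)[of u] norm_cut_le by auto

lemma sqnorm_mono:
  assumes "\<And>x. norm (a x) \<le> norm (b x)"
  shows "sqnorm a \<le> sqnorm b"
  unfolding sqnorm_def by (intro nn_integral_mono ennreal_leI power_mono assms) auto

lemma sqnorm_tail_tendsto_0:
  fixes u :: "'a::euclidean_space \<Rightarrow> complex"
  assumes u: "in_L2 u"
  shows "((\<lambda>R. sqnorm (\<lambda>x. u x - cut R u x)) \<longlongrightarrow> 0) at_top"
proof (rule tendsto_at_topI_sequentially)
  fix X :: "nat \<Rightarrow> real"
  assume X: "filterlim X at_top sequentially"
  note [measurable] = in_L2D(1)[OF u]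
  have L: "in_L2 (\<lambda>x. u x - cut (X n) u x)" for n by (intro in_L2_diff u in_L2_cut)
  have "(\<lambda>n. \<integral>x. (norm (u x - cut (X n) u x))^2 \<partial>lborel) \<longlonglongrightarrow> (\<integral>x. 0 \<partial>(lborel :: 'a measure))"
  proof (rule integral_dominated_convergence[where w = "\<lambda>x. (norm (u x))^2"])
    show "AE x in lborel. (\<lambda>n. (norm (u x - cut (X n) u x))^2) \<longlonglongrightarrow> 0"
    proof (rule AE_I2)
      fix x :: 'a
      have "eventually (\<lambda>n. X n > norm x) sequentially"
        using X by (simp add: filterlim_at_top_dense)
      then show "(\<lambda>n. (norm (u x - cut (X n) u x))^2) \<longlonglongrightarrow> 0"
        by (intro tendsto_eventually) (auto elim!: eventually_mono simp: cut_def)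
    qed
    show "AE x in lborel. norm ((norm (u x - cut (X n) u x))^2) \<le> (norm (u x))^2" for n
      using norm_sub_cut_le[of u] by (auto intro!: power_mono)
  qed (use in_L2D(2)[OF u] in auto)
  then show "(\<lambda>n. sqnorm (\<lambda>x. u x - cut (X n) u x)) \<longlonglongrightarrow> 0"
    by (subst sqnorm_tendsto_0_iff[OF L]) simp
qed

lemma sqnorm_cut_tendsto:
  assumes u: "in_L2 u"
  shows "(\<lambda>n. sqnorm (cut (real n) u)) \<longlonglongrightarrow> sqnorm u"
  by (rule sqnorm_tendsto[OF u in_L2_cut[OF u]], subst sqnorm_minus_commute)
     (rule filterlim_compose[OF sqnorm_tail_tendsto_0[OF u] filterlim_real_sequentially])

lemma fourier_L2_iff:
  "fourier_L2 u U \<longleftrightarrow> in_L2 u \<and> in_L2 U \<and> ((\<lambda>R. sqnorm (\<lambda>k. U k - fourier (cut R u) k)) \<longlongrightarrow> 0) at_top"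
proof -
  have "(LINT x:ball 0 R|lborel. exp (- (\<i> * complex_of_real (k \<bullet> x))) * u x) = fourier (cut R u) k" for R k
    by (simp add: set_lebesgue_integral_def fourier_def cut_def)
  then show ?thesis unfolding fourier_L2_def by simp
qed

lemma in_L2_fourier_cut: "in_L2 u \<Longrightarrow> in_L2 (fourier (cut R u))"
  by (rule plancherel_support(2)[OF in_L2_cut cut_eq_0])

lemma sqnorm_fourier_cut:
  fixes u :: "'a::euclidean_space \<Rightarrow> complex"
  shows "in_L2 u \<Longrightarrow> sqnorm (fourier (cut R u)) = ennreal ((2 * pi) ^ DIM('a)) * sqnorm (cut R u)"
  by (rule plancherel_support(1)[OF in_L2_cut cut_eq_0])

lemma fourier_L2_sqnorm:
  assumes "fourier_L2 u U"
  shows "sqnorm U = ennreal ((2 * pi) ^ 3) * sqnorm u"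
proof -
  have u: "in_L2 u" and U: "in_L2 U" and lim: "((\<lambda>R. sqnorm (\<lambda>k. U k - fourier (cut R u) k)) \<longlongrightarrow> 0) at_top"
    using assms unfolding fourier_L2_iff by auto
  have "(\<lambda>n. sqnorm (fourier (cut (real n) u))) \<longlonglongrightarrow> sqnorm U"
    by (rule sqnorm_tendsto[OF U in_L2_fourier_cut[OF u]], subst sqnorm_minus_commute)
       (rule filterlim_compose[OF lim filterlim_real_sequentially])
  moreover have "(\<lambda>n. sqnorm (fourier (cut (real n) u))) \<longlonglongrightarrow> ennreal ((2 * pi) ^ 3) * sqnorm u"
    unfolding sqnorm_fourier_cut[OF u] DIM_cart
    using ennreal_tendsto_cmult[OF _ sqnorm_cut_tendsto[OF u]] by simp
  ultimately show ?thesis by (rule LIMSEQ_unique)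
qed

lemma fourier_L2_support:
  fixes u :: "real^3 \<Rightarrow> complex"
  assumes u: "in_L2 u" and z: "\<And>x. norm x > r \<Longrightarrow> u x = 0"
  shows "fourier_L2 u (fourier u)"
proof -
  have "((\<lambda>R. sqnorm (\<lambda>k. fourier u k - fourier (cut R u) k)) \<longlongrightarrow> 0) at_top"
  proof (rule tendsto_eventually)
    show "\<forall>\<^sub>F R in at_top. sqnorm (\<lambda>k. fourier u k - fourier (cut R u) k) = 0"
      using eventually_gt_at_top[of r]
    proof eventually_elim
      case (elim R)
      have "cut R u = u"
      proof
        fix x show "cut R u x = u x" using z[of x] elim by (cases "norm x < R") (auto simp: cut_def)
      qed
      then show ?case by (simp add: sqnorm_def)
    qed
  qed
  then show ?thesis
    using u plancherel_support(2)[OF u z] unfolding fourier_L2_iff by blast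
qed

lemma cut_diff: "cut R (\<lambda>x. a x - b x) = (\<lambda>x. cut R a x - cut R b x)"
  by (auto simp: cut_def scaleR_diff_right)

lemma cut_integrable: "in_L2 u \<Longrightarrow> integrable lborel (cut R u)"
  by (rule L2_support_integrable(1)[OF in_L2_cut cut_eq_0])

lemma fourier_L2_diff:
  assumes "fourier_L2 a A" "fourier_L2 b B"
  shows "fourier_L2 (\<lambda>x. a x - b x) (\<lambda>k. A k - B k)"
proof -
  have a: "in_L2 a" "in_L2 A" "((\<lambda>R. sqnorm (\<lambda>k. A k - fourier (cut R a) k)) \<longlongrightarrow> 0) at_top"
   and b: "in_L2 b" "in_L2 B" "((\<lambda>R. sqnorm (\<lambda>k. B k - fourier (cut R b) k)) \<longlongrightarrow> 0) at_top"
    using assms unfolding fourier_L2_iff by auto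
  have le: "sqnorm (\<lambda>k. (A k - B k) - fourier (cut R (\<lambda>x. a x - b x)) k)
    \<le> 2 * sqnorm (\<lambda>k. A k - fourier (cut R a) k) + 2 * sqnorm (\<lambda>k. B k - fourier (cut R b) k)" for R
  proof -
    have "sqnorm (\<lambda>k. (A k - B k) - fourier (cut R (\<lambda>x. a x - b x)) k)
      = sqnorm (\<lambda>k. (A k - fourier (cut R a) k) - (B k - fourier (cut R b) k))"
      unfolding cut_diff fourier_diff[OF cut_integrable[OF a(1)] cut_integrable[OF b(1)]] by (simp add: algebra_simps)
    also have "\<dots> \<le> 2 * sqnorm (\<lambda>k. A k - fourier (cut R a) k) + 2 * sqnorm (\<lambda>k. B k - fourier (cut R b) k)"
      by (rule sqnorm_diff_le; rule in_L2D(1); intro in_L2_diff a b in_L2_fourier_cut)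
    finally show ?thesis .
  qed
  have "((\<lambda>R. 2 * sqnorm (\<lambda>k. A k - fourier (cut R a) k) + 2 * sqnorm (\<lambda>k. B k - fourier (cut R b) k)) \<longlongrightarrow> 2 * 0 + 2 * 0) at_top"
    by (intro tendsto_add ennreal_tendsto_cmult a b) auto
  then have 0: "((\<lambda>R. 2 * sqnorm (\<lambda>k. A k - fourier (cut R a) k) + 2 * sqnorm (\<lambda>k. B k - fourier (cut R b) k)) \<longlongrightarrow> 0) at_top" by simp
  have "((\<lambda>R. sqnorm (\<lambda>k. (A k - B k) - fourier (cut R (\<lambda>x. a x - b x)) k)) \<longlongrightarrow> 0) at_top"
    by (rule tendsto_sandwich[OF always_eventually always_eventually tendsto_const 0]) (use le in auto)
  then show ?thesis unfolding fourier_L2_iff using a b by (auto intro: in_L2_diff)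
qed

lemma in_L2_cmult: "in_L2 (u :: 'a::euclidean_space \<Rightarrow> complex) \<Longrightarrow> in_L2 (\<lambda>x. c * u x)"
  unfolding in_L2_iff by (auto simp: norm_mult power_mult_distrib)

lemma fourier_L2_cmult:
  assumes "fourier_L2 u U"
  shows "fourier_L2 (\<lambda>x. c * u x) (\<lambda>k. c * U k)"
proof -
  have u: "in_L2 u" "in_L2 U" "((\<lambda>R. sqnorm (\<lambda>k. U k - fourier (cut R u) k)) \<longlongrightarrow> 0) at_top"
    using assms unfolding fourier_L2_iff by auto
  have "fourier (cut R (\<lambda>x. c * u x)) k = c * fourier (cut R u) k" for R k
  proof -
    have "fourier (cut R (\<lambda>x. c * u x)) k = (LBINT x. c * (exp (- (\<i> * complex_of_real (k \<bullet> x))) * cut R u x))"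
      unfolding fourier_def cut_def by (intro Bochner_Integration.integral_cong refl) simp
    then show ?thesis by (simp add: fourier_def)
  qed
  then have e: "sqnorm (\<lambda>k. c * U k - fourier (cut R (\<lambda>x. c * u x)) k) = ennreal ((norm c)^2) * sqnorm (\<lambda>k. U k - fourier (cut R u) k)" for R
    using sqnorm_cmult[OF in_L2D(1)[OF in_L2_diff[OF u(2) in_L2_fourier_cut[OF u(1)]]], of c] by (simp add: right_diff_distrib)
  have "((\<lambda>R. ennreal ((norm c)^2) * sqnorm (\<lambda>k. U k - fourier (cut R u) k)) \<longlongrightarrow> ennreal ((norm c)^2) * 0) at_top"
    by (intro ennreal_tendsto_cmult u) simp
  then show ?thesis unfolding fourier_L2_iff e using u by (auto intro: in_L2_cmult)
qed

lemma fourier_swap: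
  fixes a b :: "'a::euclidean_space \<Rightarrow> complex"
  assumes a: "integrable lborel a" and b: "integrable lborel b"
  shows "(LBINT k. fourier a k * b k) = (LBINT x. a x * fourier b x)"
proof -
  have [measurable]: "a \<in> borel_measurable borel" "b \<in> borel_measurable borel"
    using borel_measurable_integrable[OF a] borel_measurable_integrable[OF b] by simp_all
  have i: "integrable (lborel \<Otimes>\<^sub>M lborel) (\<lambda>(x, k). exp (- (\<i> * complex_of_real (k \<bullet> x))) * (a x * b k))"
    by (rule Bochner_Integration.integrable_bound[OF integrable_tensor[OF a b]]) (auto simp: norm_mult split_beta')
  have "(LBINT k. fourier a k * b k) = (LBINT k. (LBINT x. exp (- (\<i> * complex_of_real (k \<bullet> x))) * (a x * b k)))"
  proof (intro Bochner_Integration.integral_cong refl)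
    fix k
    have "fourier a k * b k = (LBINT x. exp (- (\<i> * complex_of_real (k \<bullet> x))) * a x * b k)"
      unfolding fourier_def by (rule integral_mult_left_zero[symmetric])
    then show "fourier a k * b k = (LBINT x. exp (- (\<i> * complex_of_real (k \<bullet> x))) * (a x * b k))"
      by (simp only: mult.assoc)
  qed
  also have "\<dots> = (LBINT x. (LBINT k. exp (- (\<i> * complex_of_real (k \<bullet> x))) * (a x * b k)))"
    by (rule lborel_pair.Fubini_integral) (use i in \<open>simp add: split_beta'\<close>)
  also have "\<dots> = (LBINT x. a x * fourier b x)"
  proof (intro Bochner_Integration.integral_cong refl)
    fix x
    have "a x * fourier b x = (LBINT k. a x * (exp (- (\<i> * complex_of_real (x \<bullet> k))) * b k))"
      unfolding fourier_def by (rule integral_mult_right_zero[symmetric])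
    moreover have "(LBINT k. exp (- (\<i> * complex_of_real (k \<bullet> x))) * (a x * b k))
      = (LBINT k. a x * (exp (- (\<i> * complex_of_real (x \<bullet> k))) * b k))"
      by (intro Bochner_Integration.integral_cong refl) (simp add: inner_commute)
    ultimately show "(LBINT k. exp (- (\<i> * complex_of_real (k \<bullet> x))) * (a x * b k)) = a x * fourier b x"
      by (simp only:)
  qed
  finally show ?thesis .
qed

text \<open>The formula for integrable functions holds for the truncations of a. One side converges
  because their transforms converge in L2, the other by dominated convergence.\<close>

lemma fourier_L2_multiplication:
  assumes "fourier_L2 a A" and w: "in_L2 w" and z: "\<And>x. norm x > r \<Longrightarrow> w x = 0"
  shows "(LBINT k. A k * w k) = (LBINT x. a x * fourier w x)"
proof -
  have a: "in_L2 a" and A: "in_L2 A" and lim: "((\<lambda>R. sqnorm (\<lambda>k. A k - fourier (cut R a) k)) \<longlongrightarrow> 0) at_top"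
    using assms(1) unfolding fourier_L2_iff by auto
  have W: "in_L2 (fourier w)" by (rule plancherel_support(2)[OF w z])
  have wi: "integrable lborel w" by (rule L2_support_integrable(1)[OF w z])
  note [measurable] = in_L2D(1)[OF a] in_L2D(1)[OF A] in_L2D(1)[OF w] in_L2D(1)[OF W]
  define T where "T n = fourier (cut (real n) a)" for n
  have TL: "in_L2 (T n)" for n unfolding T_def by (rule in_L2_fourier_cut[OF a])
  have dL: "in_L2 (\<lambda>k. A k - T n k)" for n by (intro in_L2_diff A TL)
  have "(\<lambda>n. sqnorm (\<lambda>k. A k - T n k)) \<longlonglongrightarrow> 0"
    unfolding T_def by (rule filterlim_compose[OF lim filterlim_real_sequentially])
  then have d0: "(\<lambda>n. \<integral>k. (norm (A k - T n k))^2 \<partial>lborel) \<longlonglongrightarrow> 0"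
    using sqnorm_tendsto_0_iff[OF dL] by simp
  have "(\<lambda>n. (LBINT k. A k * w k) - (LBINT k. T n k * w k)) \<longlonglongrightarrow> 0"
  proof (rule Lim_null_comparison)
    have "norm ((LBINT k. A k * w k) - (LBINT k. T n k * w k)) \<le> sqrt (LBINT k. (norm (A k - T n k))^2) * sqrt (LBINT k. (norm (w k))^2)" for n
    proof -
      have "(LBINT k. A k * w k) - (LBINT k. T n k * w k) = (LBINT k. (A k - T n k) * w k)"
        using in_L2_mult_integrable(1)[OF A w] in_L2_mult_integrable(1)[OF TL w, of n] by (simp add: left_diff_distrib)
      then show ?thesis using in_L2_mult_integrable(2)[OF dL w, of n] by simp
    qed
    then show "\<forall>\<^sub>F n in sequentially. norm ((LBINT k. A k * w k) - (LBINT k. T n k * w k)) \<le> sqrt (LBINT k. (norm (A k - T n k))^2) * sqrt (LBINT k. (norm (w k))^2)"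
      by simp
    have "(\<lambda>n. sqrt (LBINT k. (norm (A k - T n k))^2) * sqrt (LBINT k. (norm (w k))^2)) \<longlonglongrightarrow> sqrt 0 * sqrt (LBINT k. (norm (w k))^2)"
      by (intro tendsto_intros d0)
    then show "(\<lambda>n. sqrt (LBINT k. (norm (A k - T n k))^2) * sqrt (LBINT k. (norm (w k))^2)) \<longlonglongrightarrow> 0" by simp
  qed
  then have 1: "(\<lambda>n. \<integral>k. T n k * w k \<partial>lborel) \<longlonglongrightarrow> (LBINT k. A k * w k)"
    using tendsto_diff[OF tendsto_const[of "\<integral>k. A k * w k \<partial>lborel"]] by fastforce
  have "(\<lambda>n. \<integral>x. cut (real n) a x * fourier w x \<partial>lborel) \<longlonglongrightarrow> (LBINT x. a x * fourier w x)"
  proof (rule integral_dominated_convergence[where w = "\<lambda>x. norm (a x * fourier w x)"])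
    show "integrable lborel (\<lambda>x. norm (a x * fourier w x))" by (intro integrable_norm in_L2_mult_integrable(1) a W)
    show "AE x in lborel. (\<lambda>n. cut (real n) a x * fourier w x) \<longlonglongrightarrow> a x * fourier w x"
    proof (rule AE_I2)
      fix x :: "real^3"
      have "eventually (\<lambda>n. real n > norm x) sequentially"
        using filterlim_real_sequentially by (simp add: filterlim_at_top_dense)
      then show "(\<lambda>n. cut (real n) a x * fourier w x) \<longlonglongrightarrow> a x * fourier w x"
        by (intro tendsto_eventually) (auto elim!: eventually_mono simp: cut_def)
    qed
    show "AE x in lborel. norm (cut (real n) a x * fourier w x) \<le> norm (a x * fourier w x)" for n
      by (auto simp: norm_mult intro!: mult_right_mono norm_cut_le)
  qed measurable
  moreover have "(LBINT k. T n k * w k) = (LBINT x. cut (real n) a x * fourier w x)" for n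
    unfolding T_def by (rule fourier_swap[OF cut_integrable[OF a] wi])
  ultimately show ?thesis using LIMSEQ_unique[OF 1] by simp
qed

lemma in_L2_cnj: "in_L2 u \<Longrightarrow> in_L2 (\<lambda>x. cnj (u x))"
  unfolding in_L2_iff by (auto intro!: borel_measurable_cnj)

text \<open>Fourier inversion from the isometry and the multiplication formula alone:
  \<open>\<parallel>c a\<^sup>* - T\<^sub>R A\<^sup>*\<parallel>^2\<close> is expanded, and its cross term is again a norm of \<open>A\<close>.\<close>

lemma fourier_L2_inversion:
  assumes F: "fourier_L2 a A"
  shows "fourier_L2 (\<lambda>k. cnj (A k)) (\<lambda>x. complex_of_real ((2 * pi) ^ 3) * cnj (a x))"
proof -
  let ?c = "(2 * pi) ^ 3 :: real"
  have a: "in_L2 a" and A: "in_L2 A" using F unfolding fourier_L2_iff by auto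
  have A': "in_L2 (\<lambda>k. cnj (A k))" and a': "in_L2 (\<lambda>x. cnj (a x))" by (intro in_L2_cnj a A)+
  note [measurable] = in_L2D(1)[OF a] in_L2D(1)[OF A]
  let ?N = "\<lambda>g :: real^3 \<Rightarrow> complex. \<integral>x. (norm (g x))^2 \<partial>lborel"
  have NA: "?N A = ?c * ?N a"
    using fourier_L2_sqnorm[OF F] unfolding in_L2D(3)[OF a] in_L2D(3)[OF A]
    by (simp add: ennreal_mult[symmetric] del: power_mult_distrib)
  define w where "w R = cut R (\<lambda>k. cnj (A k))" for R
  have wL: "in_L2 (w R)" for R unfolding w_def by (intro in_L2_cut A')
  have wz: "norm x > R \<Longrightarrow> w R x = 0" for R x by (simp add: w_def cut_eq_0)
  have WL: "in_L2 (fourier (w R))" for R by (rule plancherel_support(2)[OF wL wz])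
  have NW: "?N (fourier (w R)) = ?c * ?N (w R)" for R
    using plancherel_support(1)[OF wL wz, of R R] unfolding in_L2D(3)[OF wL] in_L2D(3)[OF WL] DIM_cart
    by (simp add: ennreal_mult[symmetric] del: power_mult_distrib)
  \<comment> \<open>\<open>w R\<close> is the truncated conjugate of A, so the multiplication
    formula turns the pairing with a into the integral of |A|^2 over the ball.\<close>
  have cross: "(LBINT x. a x * fourier (w R) x) = complex_of_real (?N (w R))" for R
  proof -
    have "(LBINT x. a x * fourier (w R) x) = (LBINT k. A k * w R k)"
      by (rule fourier_L2_multiplication[OF F wL wz, symmetric])
    also have "\<dots> = (LBINT k. complex_of_real ((norm (w R k))^2))"
      by (intro Bochner_Integration.integral_cong refl)
         (auto simp: w_def cut_def indicator_def complex_norm_square[symmetric])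
    finally show ?thesis by (simp only: integral_complex_of_real)
  qed
  let ?d = "\<lambda>R x. complex_of_real ?c * cnj (a x) - fourier (w R) x"
  have dL: "in_L2 (?d R)" for R by (intro in_L2_diff in_L2_cmult a' WL)
  \<comment> \<open>With c = (2 pi)^3 the terms are c^2 |a|^2 = c |A|^2, then c |w|^2, then -2 c
    |w|^2. They leave c times the tail of |A|^2, which tends to 0.\<close>
  have Nd: "?N (?d R) = ?c * (?N A - ?N (w R))" for R
  proof -
    have e: "(norm (?d R x))^2 = ?c^2 * (norm (a x))^2 + (norm (fourier (w R) x))^2 - 2 * ?c * Re (a x * fourier (w R) x)" for x
    proof -
      have "(cmod (complex_of_real c * cnj z - y))^2 = c^2 * (cmod z)^2 + (cmod y)^2 - 2 * c * Re (z * y)" for c z y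
        unfolding cmod_power2 by (simp add: power2_eq_square algebra_simps)
      then show ?thesis .
    qed
    note ia = in_L2D(2)[OF a] and iW = in_L2D(2)[OF WL[of R]] and i = in_L2_mult_integrable(1)[OF a WL[of R]]
    have "?N (?d R) = ?c^2 * ?N a + ?N (fourier (w R)) - 2 * ?c * Re (LBINT x. a x * fourier (w R) x)"
      unfolding e integral_Re[OF i, symmetric]
      by (subst Bochner_Integration.integral_diff[OF Bochner_Integration.integrable_add[OF integrable_mult_right[OF ia] iW] integrable_mult_right[OF integrable_Re[OF i]]],
          subst Bochner_Integration.integral_add[OF integrable_mult_right[OF ia] iW])
         (simp only: Bochner_Integration.integral_mult_right_zero)
    also have "\<dots> = ?c * (?N A - ?N (w R))"
      unfolding cross NW NA by (simp add: power2_eq_square algebra_simps del: power_mult_distrib)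
    finally show ?thesis .
  qed
  have "((\<lambda>R. sqnorm (\<lambda>x. complex_of_real ?c * cnj (a x) - fourier (cut R (\<lambda>k. cnj (A k))) x)) \<longlongrightarrow> 0) at_top"
  proof (rule tendsto_at_topI_sequentially)
    fix X :: "nat \<Rightarrow> real"
    assume X: "filterlim X at_top sequentially"
    have "(\<lambda>n. sqnorm (w (X n))) \<longlonglongrightarrow> sqnorm (\<lambda>k. cnj (A k))"
      unfolding w_def
      by (rule sqnorm_tendsto[OF A' in_L2_cut[OF A']], subst sqnorm_minus_commute)
         (rule filterlim_compose[OF sqnorm_tail_tendsto_0[OF A'] X])
    then have "(\<lambda>n. ?N (w (X n))) \<longlonglongrightarrow> ?N A"
      unfolding in_L2D(3)[OF wL] in_L2D(3)[OF A'] by (subst (asm) tendsto_ennreal_iff) auto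
    then have "(\<lambda>n. ?c * (?N A - ?N (w (X n)))) \<longlonglongrightarrow> ?c * (?N A - ?N A)" by (intro tendsto_intros)
    then have "(\<lambda>n. ?N (?d (X n))) \<longlonglongrightarrow> 0" unfolding Nd by simp
    then have "(\<lambda>n. sqnorm (?d (X n))) \<longlonglongrightarrow> 0" by (subst sqnorm_tendsto_0_iff[OF dL])
    then show "(\<lambda>n. sqnorm (\<lambda>x. complex_of_real ?c * cnj (a x) - fourier (cut (X n) (\<lambda>k. cnj (A k))) x)) \<longlonglongrightarrow> 0"
      unfolding w_def .
  qed
  then show ?thesis
    unfolding fourier_L2_iff using A' in_L2_cmult[OF a', of "complex_of_real ?c"] by blast
qed

text \<open>Conjugation reverses the sign of the phase, so the existence of forward transforms
  yields a preimage of any given W.\<close>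

lemma fourier_L2_inverse:
  assumes "fourier_L2 (\<lambda>k. cnj (W k)) Z"
  shows "fourier_L2 (\<lambda>x. complex_of_real (1 / (2 * pi) ^ 3) * cnj (Z x)) W"
  using fourier_L2_cmult[OF fourier_L2_inversion[OF assms], of "complex_of_real (1 / (2 * pi) ^ 3)"]
  by (simp add: field_simps)

lemma sqnorm_dominated:
  fixes u :: "'a::euclidean_space \<Rightarrow> complex" and w :: "nat \<Rightarrow> 'a \<Rightarrow> complex"
  assumes u: "in_L2 u" and m: "\<And>n. w n \<in> borel_measurable borel" and le: "\<And>n x. norm (w n x) \<le> norm (u x)"
    and lim: "\<And>x. (\<lambda>n. w n x) \<longlonglongrightarrow> 0"
  shows "(\<lambda>n. sqnorm (w n)) \<longlonglongrightarrow> 0"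
proof -
  note [measurable] = m
  have "(\<lambda>n. \<integral>x. (norm (w n x))^2 \<partial>lborel) \<longlonglongrightarrow> (\<integral>x. 0 \<partial>(lborel :: 'a measure))"
  proof (rule integral_dominated_convergence[where w = "\<lambda>x. (norm (u x))^2"])
    show "AE x in lborel. (\<lambda>n. (norm (w n x))^2) \<longlonglongrightarrow> 0"
    proof (rule AE_I2)
      fix x
      have "(\<lambda>n. (norm (w n x))^2) \<longlonglongrightarrow> (norm (0::complex))^2" by (intro tendsto_power tendsto_norm lim)
      then show "(\<lambda>n. (norm (w n x))^2) \<longlonglongrightarrow> 0" by simp
    qed
    show "AE x in lborel. norm ((norm (w n x))^2) \<le> (norm (u x))^2" for n
      using le by (auto intro!: power_mono)
  qed (use in_L2D(2)[OF u] in auto)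
  moreover have "in_L2 (w n)" for n by (rule in_L2_bounded_by[OF u m le])
  ultimately show ?thesis by (subst sqnorm_tendsto_0_iff) auto
qed

section \<open>Transforms in some of the variables\<close>

lemma sqnorm_prod:
  fixes W :: "'p::euclidean_space \<times> 'a::euclidean_space \<Rightarrow> 'b::euclidean_space"
  assumes [measurable]: "W \<in> borel_measurable borel"
  shows "sqnorm W = (\<integral>\<^sup>+p. sqnorm (\<lambda>x. W (p, x)) \<partial>lborel)"
proof -
  have "(\<lambda>z. ennreal ((norm (W z))^2)) \<in> borel_measurable (lborel \<Otimes>\<^sub>M lborel)"
    unfolding lborel_prod by measurable
  from lborel.nn_integral_fst[OF this] show ?thesis
    unfolding sqnorm_def lborel_prod by simp
qed

lemma slice_measurable:
  fixes W :: "'p::euclidean_space \<times> 'a::euclidean_space \<Rightarrow> 'b::euclidean_space"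
  assumes "W \<in> borel_measurable borel"
  shows "(\<lambda>x. W (p, x)) \<in> borel_measurable borel"
  by (rule measurable_compose[OF _ assms]) (intro borel_measurable_continuous_onI continuous_intros)

lemma sqnorm_slice_measurable:
  fixes W :: "'p::euclidean_space \<times> 'a::euclidean_space \<Rightarrow> 'b::euclidean_space"
  assumes [measurable]: "W \<in> borel_measurable borel"
  shows "(\<lambda>p. sqnorm (\<lambda>x. W (p, x))) \<in> borel_measurable lborel"
proof -
  have "(\<lambda>z. ennreal ((norm (W z))^2)) \<in> borel_measurable (lborel \<Otimes>\<^sub>M lborel)"
    unfolding lborel_prod by measurable
  from lborel.borel_measurable_nn_integral_fst[OF this] show ?thesis
    unfolding sqnorm_def by simp
qed

lemma in_L2_slices:
  fixes W :: "'p::euclidean_space \<times> 'a::euclidean_space \<Rightarrow> complex"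
  assumes "in_L2 W"
  shows "AE p in lborel. in_L2 (\<lambda>x. W (p, x))"
proof -
  note m = in_L2D(1)[OF assms]
  have "(\<integral>\<^sup>+p. sqnorm (\<lambda>x. W (p, x)) \<partial>lborel) \<noteq> \<infinity>"
    using assms unfolding in_L2_def sqnorm_prod[OF m, symmetric] by auto
  from nn_integral_noteq_infinite[OF sqnorm_slice_measurable[OF m] this]
  show ?thesis
    by eventually_elim (use slice_measurable[OF m] in \<open>auto simp: in_L2_def less_top\<close>)
qed

lemma measurable_partial_fourier:
  fixes W :: "'p::euclidean_space \<times> 'a::euclidean_space \<Rightarrow> complex"
  assumes [measurable]: "W \<in> borel_measurable borel"
  shows "(\<lambda>z. fourier (cut R (\<lambda>x. W (fst z, x))) (snd z)) \<in> borel_measurable borel"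
proof -
  have [measurable]: "W \<in> borel_measurable (borel \<Otimes>\<^sub>M borel)" unfolding borel_prod by measurable
  have [measurable]: "(\<lambda>x::'a. indicat_real (ball 0 R) x) \<in> borel_measurable borel" by (intro borel_measurable_indicator) auto
  have "(\<lambda>z. \<integral>x. exp (- (\<i> * complex_of_real (snd z \<bullet> x))) * (indicat_real (ball 0 R) x *\<^sub>R W (fst z, x)) \<partial>lborel)
    \<in> borel_measurable (borel \<Otimes>\<^sub>M borel :: ('p \<times> 'a) measure)"
    by (rule lborel.borel_measurable_lebesgue_integral) measurable
  then show ?thesis unfolding fourier_def cut_def borel_prod .
qed

text \<open>The weights 2^j make the increments at most a constant times 2^(-j/2), so they are
  absolutely summable; square summability alone would not be enough.\<close>

lemma convergent_of_weighted_increments: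
  fixes f :: "nat \<Rightarrow> complex"
  assumes "(\<Sum>j. ennreal (2 ^ j * (norm (f (Suc j) - f j))^2)) < \<infinity>"
  shows "convergent f"
proof -
  define T where "T = enn2real (\<Sum>j. ennreal (2 ^ j * (norm (f (Suc j) - f j))^2))"
  have T: "2 ^ j * (norm (f (Suc j) - f j))^2 \<le> T" for j
  proof -
    have "ennreal (2 ^ j * (norm (f (Suc j) - f j))^2) \<le> (\<Sum>j. ennreal (2 ^ j * (norm (f (Suc j) - f j))^2))"
    proof -
      have "g j \<le> (\<Sum>j. g j)" for g :: "nat \<Rightarrow> ennreal"
        using sum_le_suminf[of g "{j}"] by simp
      then show ?thesis .
    qed
    also have "\<dots> = ennreal T" unfolding T_def using assms by simp
    finally show ?thesis
      by (subst (asm) ennreal_le_iff[OF enn2real_nonneg[of "\<Sum>j. ennreal (2 ^ j * (norm (f (Suc j) - f j))^2)", folded T_def]])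
  qed
  have b: "norm (f (Suc j) - f j) \<le> sqrt T * sqrt (1 / 2) ^ j" for j
  proof -
    have "(norm (f (Suc j) - f j))^2 \<le> T * (1 / 2) ^ j"
      using T[of j] by (simp add: field_simps)
    then have "norm (f (Suc j) - f j) \<le> sqrt (T * (1 / 2) ^ j)" by (rule real_le_rsqrt)
    then show ?thesis unfolding real_sqrt_mult real_sqrt_power .
  qed
  have s1: "sqrt (1 / 2) < 1" by simp
  have "summable (\<lambda>j. sqrt T * sqrt (1 / 2) ^ j)"
    by (intro summable_mult summable_geometric) (use s1 in simp)
  then have "summable (\<lambda>j. f (Suc j) - f j)"
    by (rule summable_comparison_test') (rule b)
  then have "convergent (\<lambda>n. \<Sum>j<n. f (Suc j) - f j)" by (simp add: summable_iff_convergent)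
  then have "convergent (\<lambda>n. f n - f 0)" by (simp add: sum_lessThan_telescope)
  then obtain l where "(\<lambda>n. f n - f 0) \<longlonglongrightarrow> l" by (auto simp: convergent_def)
  from tendsto_add[OF this tendsto_const[of "f 0"]] show ?thesis by (auto simp: convergent_def)
qed

text \<open>The difference is the transform of u restricted to a shell, and Plancherel bounds it by
  the whole tail outside the smaller ball.\<close>

lemma sqnorm_fourier_cut_diff:
  fixes w :: "'a::euclidean_space \<Rightarrow> complex"
  assumes w: "in_L2 w" and le: "R \<le> R'"
  shows "sqnorm (\<lambda>k. fourier (cut R' w) k - fourier (cut R w) k)
    \<le> ennreal ((2 * pi) ^ DIM('a)) * sqnorm (\<lambda>x. w x - cut R w x)"
proof -
  have "sqnorm (\<lambda>k. fourier (cut R' w) k - fourier (cut R w) k) = sqnorm (fourier (\<lambda>x. cut R' w x - cut R w x))"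
    using fourier_diff[OF cut_integrable[OF w] cut_integrable[OF w], symmetric]
    by (intro arg_cong[where f = sqnorm] ext) simp
  also have "\<dots> = ennreal ((2 * pi) ^ DIM('a)) * sqnorm (\<lambda>x. cut R' w x - cut R w x)"
    by (rule plancherel_support(1)[of _ R', OF in_L2_diff[OF in_L2_cut[OF w] in_L2_cut[OF w]]])
       (use le in \<open>simp add: cut_def\<close>)
  also have "sqnorm (\<lambda>x. cut R' w x - cut R w x) \<le> sqnorm (\<lambda>x. w x - cut R w x)"
    by (rule sqnorm_mono) (use le in \<open>auto simp: cut_def indicator_def\<close>)
  finally show ?thesis by (simp add: mult_left_mono)
qed

text \<open>The subsequence is chosen once, for the whole parameter space, so that the pointwise limit
  \<open>G\<close> is jointly measurable.\<close>

lemma partial_fourier_exists: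
  fixes W :: "'p::euclidean_space \<times> (real^3) \<Rightarrow> complex"
  assumes W: "in_L2 W"
  shows "\<exists>G. G \<in> borel_measurable borel \<and> (AE p in lborel. fourier_L2 (\<lambda>x. W (p, x)) (\<lambda>k. G (p, k)))"
proof -
  note Wm[measurable] = in_L2D(1)[OF W]
  let ?c = "ennreal ((2 * pi) ^ 3)"
  define F where "F n = (\<lambda>z. fourier (cut (real n) (\<lambda>x. W (fst z, x))) (snd z))" for n :: nat
  have Fm[measurable]: "F n \<in> borel_measurable borel" for n
    unfolding F_def by (rule measurable_partial_fourier[OF Wm])
  define D where "D n = (\<lambda>z. W z - cut (real n) (\<lambda>x. W (fst z, x)) (snd z))" for n :: nat
  have De: "D n = (\<lambda>z. W z - indicator (ball 0 (real n)) (snd z) *\<^sub>R W z)" for n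
    by (auto simp: D_def cut_def)
  have ind: "(\<lambda>z::'p \<times> (real^3). indicat_real (ball 0 R) (snd z)) \<in> borel_measurable borel" for R
    by (rule measurable_compose[of snd borel borel])
       (auto intro!: borel_measurable_continuous_onI continuous_intros borel_measurable_indicator)
  have Dm[measurable]: "D n \<in> borel_measurable borel" for n
    unfolding De by (intro borel_measurable_diff borel_measurable_scaleR ind Wm)
  have D0: "(\<lambda>n. sqnorm (D n)) \<longlonglongrightarrow> 0"
  proof (rule sqnorm_dominated[OF W Dm])
    fix n z show "norm (D n z) \<le> norm (W z)" by (simp add: De indicator_def)
  next
    fix z :: "'p \<times> (real^3)"
    have "eventually (\<lambda>n. real n > norm (snd z)) sequentially"
      using filterlim_real_sequentially by (simp add: filterlim_at_top_dense)
    then show "(\<lambda>n. D n z) \<longlonglongrightarrow> 0"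
      by (intro tendsto_eventually) (auto elim!: eventually_mono simp: De)
  qed
  \<comment> \<open>Tails below 8^(-j) beat the weight 2^j of
    \<open>convergent_of_weighted_increments\<close>.\<close>
  have "\<exists>n. \<forall>m\<ge>n. sqnorm (D m) < ennreal ((1 / 8) ^ j)" for j
    using order_tendstoD(2)[OF D0, of "ennreal ((1 / 8) ^ j)"] by (simp add: eventually_sequentially)
  then obtain \<nu> where \<nu>: "\<And>j m. m \<ge> \<nu> j \<Longrightarrow> sqnorm (D m) < ennreal ((1 / 8) ^ j)" by metis
  \<comment> \<open>The sum makes r increasing and at least \<nu>; the summand j forces it to
    infinity.\<close>
  define r where "r j = (\<Sum>i\<le>j. \<nu> i) + j" for j
  have rn: "\<nu> j \<le> r j" for j
    using member_le_sum[of j "{..j}" \<nu>] by (simp add: r_def)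
  have rS: "r j \<le> r (Suc j)" for j by (simp add: r_def)
  have rlim: "filterlim (\<lambda>j. real (r j)) at_top sequentially"
    by (rule filterlim_at_top_mono[OF filterlim_real_sequentially]) (auto simp: r_def sum_nonneg)
  have slices: "AE p in lborel. in_L2 (\<lambda>x. W (p, x))" by (rule in_L2_slices[OF W])
  define d where "d j = (\<lambda>z. F (r (Suc j)) z - F (r j) z)" for j
  have dm[measurable]: "d j \<in> borel_measurable borel" for j unfolding d_def by measurable
  have dle: "sqnorm (d j) \<le> ?c * ennreal ((1 / 8) ^ j)" for j
  proof -
    have "sqnorm (d j) = (\<integral>\<^sup>+p. sqnorm (\<lambda>k. d j (p, k)) \<partial>lborel)" by (rule sqnorm_prod[OF dm])
    also have "\<dots> \<le> (\<integral>\<^sup>+p. ?c * sqnorm (\<lambda>x. D (r j) (p, x)) \<partial>lborel)"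
    proof (rule nn_integral_mono_AE)
      show "AE p in lborel. sqnorm (\<lambda>k. d j (p, k)) \<le> ?c * sqnorm (\<lambda>x. D (r j) (p, x))"
        using slices
      proof eventually_elim
        case (elim p)
        show ?case
          using sqnorm_fourier_cut_diff[OF elim, of "real (r j)" "real (r (Suc j))"] rS[of j]
          by (simp add: d_def F_def D_def)
      qed
    qed
    also have "\<dots> = ?c * sqnorm (D (r j))"
      unfolding sqnorm_prod[OF Dm] by (rule nn_integral_cmult) (rule sqnorm_slice_measurable[OF Dm])
    also have "\<dots> \<le> ?c * ennreal ((1 / 8) ^ j)"
      by (intro mult_left_mono less_imp_le \<nu> rn) simp
    finally show ?thesis .
  qed
  have "(\<integral>\<^sup>+z. (\<Sum>j. ennreal (2 ^ j * (norm (d j z))^2)) \<partial>lborel) = (\<Sum>j. \<integral>\<^sup>+z. ennreal (2 ^ j * (norm (d j z))^2) \<partial>lborel)"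
    by (rule nn_integral_suminf) measurable
  also have "\<dots> \<le> (\<Sum>j. ennreal ((2 * pi) ^ 3 * (1 / 4) ^ j))"
  proof (rule suminf_le)
    fix j
    have "(\<integral>\<^sup>+z. ennreal (2 ^ j * (norm (d j z))^2) \<partial>lborel) = ennreal (2 ^ j) * sqnorm (d j)"
      unfolding sqnorm_def by (simp add: ennreal_mult nn_integral_cmult)
    also have "\<dots> \<le> ennreal (2 ^ j) * (?c * ennreal ((1 / 8) ^ j))"
      by (intro mult_left_mono dle) simp
    also have "\<dots> = ennreal ((2 * pi) ^ 3 * (2 ^ j * (1 / 8) ^ j))"
      by (simp add: ennreal_mult[symmetric] mult_ac del: power_mult_distrib)
    also have "(2::real) ^ j * (1 / 8) ^ j = (1 / 4) ^ j" by (simp flip: power_mult_distrib)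
    finally show "(\<integral>\<^sup>+z. ennreal (2 ^ j * (norm (d j z))^2) \<partial>lborel) \<le> ennreal ((2 * pi) ^ 3 * (1 / 4) ^ j)" .
  qed auto
  also have "\<dots> = ennreal (\<Sum>j. (2 * pi) ^ 3 * (1 / 4) ^ j)"
    by (rule suminf_ennreal2) (auto intro!: summable_mult summable_geometric)
  also have "\<dots> < \<infinity>" by simp
  finally have fin: "(\<integral>\<^sup>+z. (\<Sum>j. ennreal (2 ^ j * (norm (d j z))^2)) \<partial>lborel) \<noteq> \<infinity>" by simp
  have "AE z in lborel. (\<Sum>j. ennreal (2 ^ j * (norm (d j z))^2)) \<noteq> \<infinity>"
    by (rule nn_integral_noteq_infinite[OF _ fin]) measurable
  then have conv: "AE z in lborel. convergent (\<lambda>j. F (r j) z)"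
    by eventually_elim (rule convergent_of_weighted_increments, simp add: d_def less_top)
  define G where "G z = lim (\<lambda>j. F (r j) z)" for z
  have Gm: "G \<in> borel_measurable borel" unfolding G_def by (rule borel_measurable_lim_metric) measurable
  have "AE z in lborel. (\<lambda>j. F (r j) z) \<longlonglongrightarrow> G z"
    using conv unfolding G_def by eventually_elim (simp add: convergent_LIMSEQ_iff)
  then have "AE z in lborel \<Otimes>\<^sub>M lborel. (\<lambda>j. F (r j) z) \<longlonglongrightarrow> G z" unfolding lborel_prod .
  from lborel_pair.AE_pair[OF this]
  have "AE p in lborel. AE k in lborel. (\<lambda>j. F (r j) (p, k)) \<longlonglongrightarrow> G (p, k)" .
  then have "AE p in lborel. fourier_L2 (\<lambda>x. W (p, x)) (\<lambda>k. G (p, k))"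
    using slices
  proof eventually_elim
    case (elim p)
    define w where "w x = W (p, x)" for x
    define g where "g k = G (p, k)" for k
    have w: "in_L2 w" using elim(2) by (simp add: w_def[abs_def])
    have gm[measurable]: "g \<in> borel_measurable borel" unfolding g_def[abs_def] by (rule slice_measurable[OF Gm])
    have lim: "AE k in lborel. (\<lambda>j. fourier (cut (real (r j)) w) k) \<longlonglongrightarrow> g k"
      using elim(1) by (simp add: F_def w_def[abs_def] g_def)
    have [measurable]: "fourier (cut R w) \<in> borel_measurable borel" for R
      by (rule in_L2D(1)[OF in_L2_fourier_cut[OF w]])
    \<comment> \<open>The subsequence only identifies g. Comparing it with an arbitrary R and
      applying Fatou bounds the error by the tail of w, so convergence holds along all R, as
      \<open>fourier_L2\<close> demands.\<close>
    have le: "sqnorm (\<lambda>k. g k - fourier (cut R w) k) \<le> ?c * sqnorm (\<lambda>x. w x - cut R w x)" for R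
    proof -
      have "sqnorm (\<lambda>k. g k - fourier (cut R w) k)
        = (\<integral>\<^sup>+k. liminf (\<lambda>j. ennreal ((norm (fourier (cut (real (r j)) w) k - fourier (cut R w) k))^2)) \<partial>lborel)"
        unfolding sqnorm_def
      proof (rule nn_integral_cong_AE)
        show "AE k in lborel. ennreal ((norm (g k - fourier (cut R w) k))^2)
          = liminf (\<lambda>j. ennreal ((norm (fourier (cut (real (r j)) w) k - fourier (cut R w) k))^2))"
          using lim
        proof eventually_elim
          case (elim k)
          have "(\<lambda>j. ennreal ((norm (fourier (cut (real (r j)) w) k - fourier (cut R w) k))^2)) \<longlonglongrightarrow> ennreal ((norm (g k - fourier (cut R w) k))^2)"
            by (intro tendsto_ennrealI tendsto_intros elim)
          from lim_imp_Liminf[OF _ this] show ?case by simp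
        qed
      qed
      also have "\<dots> \<le> liminf (\<lambda>j. sqnorm (\<lambda>k. fourier (cut (real (r j)) w) k - fourier (cut R w) k))"
        unfolding sqnorm_def by (rule nn_integral_liminf) measurable
      also have "\<dots> \<le> liminf (\<lambda>j. ?c * sqnorm (\<lambda>x. w x - cut R w x))"
      proof (rule Liminf_mono)
        have "eventually (\<lambda>j. real (r j) \<ge> R) sequentially"
          using rlim by (simp add: filterlim_at_top)
        then show "\<forall>\<^sub>F j in sequentially. sqnorm (\<lambda>k. fourier (cut (real (r j)) w) k - fourier (cut R w) k) \<le> ?c * sqnorm (\<lambda>x. w x - cut R w x)"
        proof eventually_elim
          case (elim j)
          then show ?case using sqnorm_fourier_cut_diff[OF w elim] by simp
        qed
      qed
      also have "\<dots> = ?c * sqnorm (\<lambda>x. w x - cut R w x)" by (simp add: Liminf_const)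
      finally show ?thesis .
    qed
    have "((\<lambda>R. ?c * sqnorm (\<lambda>x. w x - cut R w x)) \<longlongrightarrow> ?c * 0) at_top"
      by (intro ennreal_tendsto_cmult sqnorm_tail_tendsto_0 w) simp
    then have 0: "((\<lambda>R. ?c * sqnorm (\<lambda>x. w x - cut R w x)) \<longlongrightarrow> 0) at_top" by simp
    have lim0: "((\<lambda>R. sqnorm (\<lambda>k. g k - fourier (cut R w) k)) \<longlongrightarrow> 0) at_top"
      by (rule tendsto_sandwich[OF always_eventually always_eventually tendsto_const 0]) (use le in auto)
    have "in_L2 g"
    proof -
      \<comment> \<open>The ball of radius 0 is empty, so the bound \<open>le\<close> at R = 0
        estimates g itself.\<close>
      have "cut 0 w = (\<lambda>x. 0)" by (auto simp: cut_def)
      then have "sqnorm g \<le> ?c * sqnorm w" using le[of 0] by (simp add: fourier_def)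
      also have "\<dots> < \<infinity>" using w by (simp add: in_L2_def ennreal_mult_less_top del: power_mult_distrib)
      finally show ?thesis by (simp add: in_L2_def)
    qed
    then have "fourier_L2 w g" unfolding fourier_L2_iff using w lim0 by blast
    then show ?case by (simp add: w_def[abs_def] g_def[abs_def])
  qed
  then show ?thesis using Gm by blast
qed

section \<open>Modulated averages of a solution\<close>

type_synonym spacetime = "real \<times> (real^3)"

abbreviation point :: "spacetime \<Rightarrow> real^3 \<Rightarrow> phase" where
  "point y v \<equiv> (fst y, snd y, v)"

lemma integral_eq_cbox:
  fixes g :: "'a::euclidean_space \<Rightarrow> 'b::euclidean_space"
  assumes "continuous_on UNIV g" "\<And>x. x \<notin> cbox a b \<Longrightarrow> g x = 0"
  shows "(LBINT x. g x) = integral (cbox a b) g"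
proof -
  obtain r where r: "\<And>x. x \<in> cbox a b \<Longrightarrow> norm x \<le> r"
    using bounded_cbox[of a b] unfolding bounded_iff by metis
  have "g x = 0" if "norm x > r" for x using assms(2)[of x] r[of x] that by linarith
  then have "integrable lborel g" by (rule integrable_continuous_support[OF assms(1)])
  then have "(LBINT x. g x) = integral UNIV g" by (rule integral_lborel[symmetric])
  also have "g = (\<lambda>x. if x \<in> cbox a b then g x else 0)" using assms(2) by auto
  then have "integral UNIV g = integral UNIV (\<lambda>x. if x \<in> cbox a b then g x else 0)" by simp
  also have "\<dots> = integral (cbox a b) g" by (rule integral_restrict_UNIV)
  finally show ?thesis .
qed

lemma continuous_parameter_integral:
  fixes g :: "'a::euclidean_space \<Rightarrow> 'b::euclidean_space \<Rightarrow> 'c::euclidean_space"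
  assumes "continuous_on UNIV (\<lambda>z. g (fst z) (snd z))" "\<And>x y. norm y > r \<Longrightarrow> g x y = 0"
  shows "continuous_on UNIV (\<lambda>x. \<integral>y. g x y \<partial>lborel)"
proof -
  obtain c :: 'b where c: "cball 0 r \<subseteq> cbox (- c) c"
    using bounded_subset_cbox_symmetric[OF bounded_cball] by blast
  have g1: "continuous_on UNIV (g x)" for x
    by (rule continuous_on_compose2[OF assms(1), of UNIV "\<lambda>y. (x, y)", simplified]) (intro continuous_intros)
  have z: "g x y = 0" if "y \<notin> cbox (- c) c" for x y
    using assms(2)[of y x] that c by (meson mem_cball_0 not_le subsetD)
  have e: "(LBINT y. g x y) = integral (cbox (- c) c) (g x)" for x
    by (rule integral_eq_cbox[OF g1 z])
  show ?thesis
    unfolding e by (rule integral_continuous_on_param)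
      (use continuous_on_subset[OF assms(1)] in \<open>simp add: split_beta'\<close>)
qed

lemma Basis_vel: "b \<in> Basis \<Longrightarrow> (0, 0, b) \<in> (Basis :: phase set)"
  unfolding Basis_prod_def zero_prod_def by blast

text \<open>For the weights \<open>mode\<close> below this is the real or imaginary part of a
  Fourier coefficient in (t, x). It is a classical function of v, so that the estimates at fixed
  frequency apply to it directly.\<close>

definition smear :: "(spacetime \<Rightarrow> real) \<Rightarrow> (phase \<Rightarrow> real) \<Rightarrow> real^3 \<Rightarrow> real" where
  "smear w g v = (LBINT y. w y * g (point y v))"

lemma continuous_point: "continuous_on UNIV g \<Longrightarrow> continuous_on UNIV (\<lambda>z. g (point (snd z) (fst z)))"
  "continuous_on UNIV g \<Longrightarrow> continuous_on UNIV (\<lambda>y. g (point y v))"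
  "continuous_on UNIV g \<Longrightarrow> continuous_on UNIV (\<lambda>v. g (point y v))"
  for g :: "phase \<Rightarrow> 'a::topological_space"
  by (rule continuous_on_compose2[of UNIV g]; auto intro!: continuous_intros)+

lemma smear_integrable:
  fixes w :: "spacetime \<Rightarrow> real"
  assumes "continuous_on UNIV w" "\<forall>y. norm y > r \<longrightarrow> w y = 0" "continuous_on UNIV g"
  shows "integrable lborel (\<lambda>y. w y * g (point y v))"
proof (rule integrable_continuous_support)
  show "continuous_on UNIV (\<lambda>y. w y * g (point y v))"
    by (intro continuous_intros assms(1) continuous_point(2)[OF assms(3)])
  show "w y * g (point y v) = 0" if "norm y > r" for y using assms(2) that by (metis mult_zero_left)
qed

text \<open>Differentiation under the integral asks for a jointly continuous derivative with values
  in the bounded linear maps; \<open>fx\<close> assembles it from the continuous partial derivatives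
  in v.\<close>

lemma smear_has_derivative:
  assumes w: "continuous_on UNIV w" and z: "\<forall>y. norm y > r \<longrightarrow> w y = 0" and g: "times_differentiable 2 g"
  shows "smear w g differentiable (at v)" and "b \<in> Basis \<Longrightarrow> partial b (smear w g) v = smear w (partial (0, 0, b) g) v"
proof -
  have g1: "times_differentiable 1 g" using times_diff_mono[OF g] by simp
  have cg: "continuous_on UNIV g" by (rule times_diff_continuous[OF g1 order_refl])
  have cp: "continuous_on UNIV (partial (0, 0, b) g)" if "b \<in> Basis" for b :: "real^3"
    using g that by (intro times_diff_continuous[of 1] times_diff_partial Basis_vel) (simp_all add: numeral_2_eq_2)
  obtain c :: spacetime where c: "cball 0 r \<subseteq> cbox (- c) c"
    using bounded_subset_cbox_symmetric[OF bounded_cball] by blast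
  have zc: "w y = 0" if "y \<notin> cbox (- c) c" for y
    using z that c by (meson mem_cball_0 not_le subsetD)
  have e: "smear w g v = integral (cbox (- c) c) (\<lambda>y. w y * g (point y v))" if "continuous_on UNIV g" for g v
    unfolding smear_def
    by (rule integral_eq_cbox) (auto intro!: continuous_intros w continuous_point(2)[OF that] simp: zc)
  define fx :: "real^3 \<Rightarrow> spacetime \<Rightarrow> (real^3) \<Rightarrow>\<^sub>L real" where
    "fx v y = (\<Sum>b\<in>Basis. (w y * partial (0, 0, b) g (point y v)) *\<^sub>R blinfun_inner_left b)" for v y
  have cw: "continuous_on UNIV (\<lambda>z::(real^3) \<times> spacetime. w (snd z))"
    by (rule continuous_on_compose2[OF w]) (auto intro!: continuous_intros)
  have cfx: "continuous_on UNIV (\<lambda>z. fx (fst z) (snd z))"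
    unfolding fx_def by (intro continuous_intros cw continuous_point(1)[OF cp]) auto
  have D: "((\<lambda>v. w y * g (point y v)) has_derivative blinfun_apply (fx v y)) (at v)" for v y
  proof -
    have l: "linear (frechet_derivative g (at (point y v)))"
      using g1 linear_frechet_derivative times_differentiableD by blast
    have "((\<lambda>v. g (point y v)) has_derivative (\<lambda>h. frechet_derivative g (at (point y v)) (0, 0, h))) (at v)"
      by (rule has_derivative_compose[OF _ has_derivative_frechet[OF times_differentiableD[OF g1 order_refl]], of "\<lambda>v. point y v"])
         (auto intro!: derivative_eq_intros)
    then have "((\<lambda>v. w y * g (point y v)) has_derivative (\<lambda>h. w y * frechet_derivative g (at (point y v)) (0, 0, h))) (at v)"
      by (rule has_derivative_mult_right)
    moreover have "w y * frechet_derivative g (at (point y v)) (0, 0, h) = blinfun_apply (fx v y) h" for h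
    proof -
      have "(0, 0, h) = (\<Sum>b\<in>Basis. (h \<bullet> b) *\<^sub>R ((0, 0, b) :: phase))"
      proof -
        have "(\<Sum>b\<in>Basis. (h \<bullet> b) *\<^sub>R ((0, 0, b) :: phase)) = (0, 0, \<Sum>b\<in>Basis. (h \<bullet> b) *\<^sub>R b)"
          by (simp add: prod_eq_iff fst_sum snd_sum)
        then show ?thesis by (simp add: euclidean_representation)
      qed
      then have "frechet_derivative g (at (point y v)) (0, 0, h)
        = frechet_derivative g (at (point y v)) (\<Sum>b\<in>Basis. (h \<bullet> b) *\<^sub>R ((0, 0, b) :: phase))" by simp
      also have "\<dots> = (\<Sum>b\<in>Basis. (h \<bullet> b) * partial (0, 0, b) g (point y v))"
        by (simp add: linear_sum[OF l] linear_cmul[OF l] partial_def del: scaleR_Pair)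
      finally show ?thesis
        by (simp add: fx_def blinfun.sum_left blinfun.scaleR_left sum_distrib_left inner_commute mult_ac)
    qed
    ultimately show ?thesis by simp
  qed
  have ig: "(\<lambda>y. w y * g (point y v)) integrable_on cbox (- c) c" for v
    by (rule integrable_continuous) (auto intro!: continuous_intros continuous_on_subset[OF w] continuous_on_subset[OF continuous_point(2)[OF cg]])
  have "((\<lambda>v. integral (cbox (- c) c) (\<lambda>y. w y * g (point y v))) has_derivative
     blinfun_apply (integral (cbox (- c) c) (fx v))) (at v within UNIV)"
    by (rule leibniz_rule) (auto intro!: D ig continuous_on_subset[OF cfx] simp: split_beta')
  then have L: "(smear w g has_derivative blinfun_apply (integral (cbox (- c) c) (fx v))) (at v)"
    unfolding e[OF cg, abs_def] by simp
  then show "smear w g differentiable (at v)" by (auto simp: differentiable_def)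
  show "partial b (smear w g) v = smear w (partial (0, 0, b) g) v" if b: "b \<in> Basis"
  proof -
    have "continuous_on (cbox (- c) c) (fx v)"
      by (rule continuous_on_compose2[OF cfx, of _ "\<lambda>y. (v, y)", simplified]) (auto intro!: continuous_intros)
    then have "fx v integrable_on cbox (- c) c" by (rule integrable_continuous)
    then have "partial b (smear w g) v = integral (cbox (- c) c) (\<lambda>y. blinfun_apply (fx v y) b)"
      using partial_eqI[OF L] by (simp add: blinfun_apply_integral)
    moreover have "blinfun_apply (fx v y) b = w y * partial (0, 0, b) g (point y v)" for y
      using b by (simp add: fx_def blinfun.sum_left blinfun.scaleR_left inner_Basis if_distrib cong: if_cong)
    ultimately show ?thesis unfolding e[OF cp[OF b]] by simp
  qed
qed

text \<open>One order is lost because differentiation under the integral needs a continuous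
  derivative, and \<open>times_differentiable\<close> ensures continuity only below the highest
  order.\<close>

lemma times_diff_smear:
  assumes w: "continuous_on UNIV w" and z: "\<forall>y. norm y > r \<longrightarrow> w y = 0"
  shows "times_differentiable (Suc n) g \<Longrightarrow> times_differentiable n (smear w g)"
proof (induction n arbitrary: g)
  case (Suc n)
  have g2: "times_differentiable 2 g" using times_diff_mono[OF Suc.prems] by simp
  have "times_differentiable n (partial b (smear w g))" if b: "b \<in> Basis" for b
  proof -
    have "partial b (smear w g) = smear w (partial (0, 0, b) g)"
      using smear_has_derivative(2)[OF w z g2 b] by auto
    moreover have "times_differentiable (Suc n) (partial (0, 0, b) g)"
      using Suc.prems b by (intro times_diff_partial Basis_vel)
    ultimately show ?thesis using Suc.IH by simp
  qed
  then show ?case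
    using smear_has_derivative(1)[OF w z g2] by (simp add: times_differentiable.simps(2))
qed simp

text \<open>The fields acting in the velocity variable of a function on phase space; averaging with
  \<open>smear\<close> turns them into \<open>field\<close>.\<close>

definition vfield :: "bool \<times> 3 \<Rightarrow> (phase \<Rightarrow> real) \<Rightarrow> phase \<Rightarrow> real" where
  "vfield a g p = (\<Sum>i\<in>UNIV. field_dir a (vel p) $ i * partial (0, 0, axis i 1) g p)"

lemma times_diff_vel:
  "times_differentiable n c \<Longrightarrow> times_differentiable n (\<lambda>p :: phase. c (vel p))"
proof -
  have "linear (\<lambda>p :: phase. vel p)" by (rule linearI) auto
  moreover have "vel b \<in> Basis \<or> vel b = 0" if "b \<in> Basis" for b :: phase
    using that by (auto simp: Basis_prod_def zero_prod_def)
  ultimately show "times_differentiable n c \<Longrightarrow> times_differentiable n (\<lambda>p :: phase. c (vel p))"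
    using times_diff_affine(1)[of "\<lambda>p :: phase. vel p" n c 0] by simp
qed

lemma times_diff_vfield:
  "times_differentiable m g \<Longrightarrow> Suc n \<le> m \<Longrightarrow> times_differentiable n (vfield a g)"
  unfolding vfield_def[abs_def]
  by (intro times_diff_sum times_diff_mult times_diff_vel times_diff_field_dir
      times_diff_partial[OF times_diff_mono] Basis_vel axis_Basis)

lemma smear_sum_mult:
  assumes w: "continuous_on UNIV w" "\<forall>y. norm y > r \<longrightarrow> w y = 0"
  shows "continuous_on UNIV g \<Longrightarrow> c v * smear w g v = smear w (\<lambda>p. c (vel p) * g p) v"
    and "finite I \<Longrightarrow> (\<And>i. i \<in> I \<Longrightarrow> continuous_on UNIV (G i)) \<Longrightarrow> (\<Sum>i\<in>I. smear w (G i) v) = smear w (\<lambda>p. \<Sum>i\<in>I. G i p) v"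
    and "continuous_on UNIV g \<Longrightarrow> - smear w g v = smear w (\<lambda>p. - g p) v"
    and "continuous_on UNIV g \<Longrightarrow> continuous_on UNIV g' \<Longrightarrow> smear w g v + smear w g' v = smear w (\<lambda>p. g p + g' p) v"
proof -
  show "c v * smear w g v = smear w (\<lambda>p. c (vel p) * g p) v" if "continuous_on UNIV g"
  proof -
    have "c v * smear w g v = (LBINT y. c v * (w y * g (point y v)))"
      unfolding smear_def by (rule integral_mult_right_zero[symmetric])
    then show ?thesis by (simp add: smear_def mult_ac)
  qed
  show "(\<Sum>i\<in>I. smear w (G i) v) = smear w (\<lambda>p. \<Sum>i\<in>I. G i p) v"
    if "finite I" "\<And>i. i \<in> I \<Longrightarrow> continuous_on UNIV (G i)"
    unfolding smear_def sum_distrib_left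
    by (rule Bochner_Integration.integral_sum[symmetric]) (rule smear_integrable[OF w that(2)])
  show "- smear w g v = smear w (\<lambda>p. - g p) v" by (simp add: smear_def)
  show "smear w g v + smear w g' v = smear w (\<lambda>p. g p + g' p) v" if "continuous_on UNIV g" "continuous_on UNIV g'"
    unfolding smear_def distrib_left using smear_integrable[OF w that(1)] smear_integrable[OF w that(2)] by simp
qed

lemma field_smear:
  assumes w: "continuous_on UNIV w" and z: "\<forall>y. norm y > r \<longrightarrow> w y = 0" and g: "times_differentiable 2 g"
  shows "field a (smear w g) = smear w (vfield a g)"
proof
  fix v
  have c: "continuous_on UNIV (partial (0, 0, axis i 1) g)" for i :: 3
    using g by (intro times_diff_continuous[of 1] times_diff_partial Basis_vel axis_Basis) (simp_all add: numeral_2_eq_2)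
  have c': "continuous_on UNIV (\<lambda>p :: phase. field_dir a (vel p) $ i * partial (0, 0, axis i 1) g p)" for i :: 3
    by (intro continuous_on_mult c times_diff_continuous[OF times_diff_vel[OF times_diff_field_dir[of 1 a i]]]) simp
  have "field a (smear w g) v = (\<Sum>i\<in>UNIV. field_dir a v $ i * smear w (partial (0, 0, axis i 1) g) v)"
    unfolding field_def using smear_has_derivative(2)[OF w z g] by simp
  also have "\<dots> = (\<Sum>i\<in>UNIV. smear w (\<lambda>p. field_dir a (vel p) $ i * partial (0, 0, axis i 1) g p) v)"
    by (intro sum.cong refl smear_sum_mult(1)[OF w z c, where c = "\<lambda>v. field_dir a v $ _"])
  also have "\<dots> = smear w (vfield a g) v"
    unfolding vfield_def[abs_def] by (rule smear_sum_mult(2)[OF w z]) (auto intro: c')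
  finally show "field a (smear w g) v = smear w (vfield a g) v" .
qed

definition vlap :: "bool \<Rightarrow> (phase \<Rightarrow> real) \<Rightarrow> phase \<Rightarrow> real" where
  "vlap b g p = (\<Sum>i\<in>UNIV. vfield (b, i) (vfield (b, i) g) p)"

lemma lap_smear:
  assumes w: "continuous_on UNIV w" and z: "\<forall>y. norm y > r \<longrightarrow> w y = 0" and g: "times_differentiable 3 g"
  shows "lap b (smear w g) v = smear w (vlap b g) v"
proof -
  have g2: "times_differentiable 2 g" using times_diff_mono[OF g] by simp
  have g1: "times_differentiable 2 (vfield a g)" for a by (rule times_diff_vfield[OF g]) simp
  have "continuous_on UNIV (vfield a (vfield a g))" for a
    by (rule times_diff_continuous[OF times_diff_vfield[OF g1, of 1]]) auto
  then have "(\<Sum>i\<in>UNIV. smear w (vfield (b, i) (vfield (b, i) g)) v)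
    = smear w (\<lambda>p. \<Sum>i\<in>UNIV. vfield (b, i) (vfield (b, i) g) p) v"
    by (intro smear_sum_mult(2)[OF w z]) simp_all
  moreover have "field a (field a (smear w g)) = smear w (vfield a (vfield a g))" for a
    by (simp only: field_smear[OF w z g2] field_smear[OF w z g1])
  ultimately show ?thesis
    unfolding lap_def vlap_def[abs_def] by simp
qed

definition (in coefficients) vdiffusion :: "(phase \<Rightarrow> real) \<Rightarrow> phase \<Rightarrow> real" where
  "vdiffusion g p = - (\<Sum>a\<in>UNIV. vfield a (\<lambda>q. sig (fst a) (vel q) * vfield a g q) p) + F (vel p) * g p"

lemma (in coefficients) vdiffusion_continuous:
  assumes g: "times_differentiable 3 g"
  shows "continuous_on UNIV (vdiffusion g)"
    and "continuous_on UNIV (vfield a (\<lambda>q. sig (fst a) (vel q) * vfield a g q))"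
proof -
  have "times_differentiable 2 (\<lambda>q. sig (fst a) (vel q) * vfield a g q)" for a
    by (intro times_diff_mult times_diff_vel sig_td times_diff_vfield[OF g]) simp
  then show c: "continuous_on UNIV (vfield a (\<lambda>q. sig (fst a) (vel q) * vfield a g q))" for a
    by (intro times_diff_continuous[OF times_diff_vfield, of 2 _ 1]) auto
  have "continuous_on UNIV g" "continuous_on UNIV (\<lambda>p :: phase. F (vel p))"
    using times_diff_continuous[OF g] times_diff_continuous[OF times_diff_vel[OF F_td]] by auto
  then show "continuous_on UNIV (vdiffusion g)"
    unfolding vdiffusion_def[abs_def] by (intro continuous_intros c)
qed

lemma (in coefficients) diffusion_smear:
  assumes w: "continuous_on UNIV w" and z: "\<forall>y. norm y > r \<longrightarrow> w y = 0" and g: "times_differentiable 3 g"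
  shows "diffusion (smear w g) v = smear w (vdiffusion g) v"
proof -
  have g2: "times_differentiable 2 g" using times_diff_mono[OF g] by simp
  have g1: "times_differentiable 2 (vfield a g)" for a by (rule times_diff_vfield[OF g]) simp
  have cv: "continuous_on UNIV (vfield a g)" for a by (rule times_diff_continuous[OF g1]) simp
  have cg: "continuous_on UNIV g" by (rule times_diff_continuous[OF g]) simp
  have g3: "times_differentiable 2 (\<lambda>q. sig (fst a) (vel q) * vfield a g q)" for a
    by (intro times_diff_mult times_diff_vel sig_td g1)
  have s: "(\<lambda>v. sig (fst a) v * smear w (vfield a g) v) = smear w (\<lambda>q. sig (fst a) (vel q) * vfield a g q)" for a
    using smear_sum_mult(1)[OF w z cv] by auto
  have F: "continuous_on UNIV (\<lambda>p :: phase. F (vel p) * g p)"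
    by (intro continuous_intros cg times_diff_continuous[OF times_diff_vel[OF F_td]]) simp
  have S: "continuous_on UNIV (\<lambda>p. \<Sum>a\<in>UNIV. vfield a (\<lambda>q. sig (fst a) (vel q) * vfield a g q) p)"
    by (intro continuous_intros vdiffusion_continuous(2)[OF g])
  show ?thesis
    unfolding diffusion_def vdiffusion_def[abs_def] field_smear[OF w z g2] s field_smear[OF w z g3]
    using smear_sum_mult(2)[OF w z, where I = UNIV and G = "\<lambda>a. vfield a (\<lambda>q. sig (fst a) (vel q) * vfield a g q)", OF _ vdiffusion_continuous(2)[OF g], where v = v]
      smear_sum_mult(1)[OF w z cg, where c = F and v = v] smear_sum_mult(3)[OF w z S, where v = v]
      smear_sum_mult(4)[OF w z continuous_on_minus[OF S] F, where v = v]
    by simp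
qed

definition free_transport :: "(phase \<Rightarrow> real) \<Rightarrow> phase \<Rightarrow> real" where
  "free_transport f p = d_t f p + vel p \<bullet> grad_x f p"

text \<open>The shift c selects the part of the character: c = 0 is the real part of exp (- i \<eta>
  \<bullet> y) and c = pi / 2 its imaginary part. Differentiating the cosine raises c by pi / 2. The
  cube leaves two derivatives for integration by parts.\<close>

definition mode :: "real \<Rightarrow> spacetime \<Rightarrow> real \<Rightarrow> spacetime \<Rightarrow> real" where
  "mode S \<eta> c y = cos (\<eta> \<bullet> y + c) * bump S y ^ 3"

text \<open>The derivative of \<open>bump S y ^ 3\<close> along \<open>\<partial>\<^sub>t + v \<cdot> \<nabla>\<^sub>x\<close>.\<close>

definition cutoff_drift :: "real \<Rightarrow> real^3 \<Rightarrow> spacetime \<Rightarrow> real" where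
  "cutoff_drift S v y = - 6 / S^2 * bump S y ^ 2 * (fst y + v \<bullet> snd y)"

lemma cos_mode:
  fixes \<eta> :: "'a::euclidean_space"
  shows "(\<lambda>y. cos (\<eta> \<bullet> y + c)) differentiable (at y)"
    and "partial b (\<lambda>y. cos (\<eta> \<bullet> y + c)) y = (\<eta> \<bullet> b) * cos (\<eta> \<bullet> y + (c + pi / 2))"
proof -
  have d: "((\<lambda>y. cos (\<eta> \<bullet> y + c)) has_derivative (\<lambda>h. - sin (\<eta> \<bullet> y + c) * (\<eta> \<bullet> h))) (at y)"
    by (auto intro!: derivative_eq_intros)
  then show "(\<lambda>y. cos (\<eta> \<bullet> y + c)) differentiable (at y)" by (auto simp: differentiable_def)
  have "cos (\<eta> \<bullet> y + (c + pi / 2)) = - sin (\<eta> \<bullet> y + c)" by (simp add: cos_add sin_add flip: add.assoc)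
  then show "partial b (\<lambda>y. cos (\<eta> \<bullet> y + c)) y = (\<eta> \<bullet> b) * cos (\<eta> \<bullet> y + (c + pi / 2))"
    by (simp only: partial_eqI[OF d]) simp
qed

lemma times_diff_cos:
  "times_differentiable n (\<lambda>y. cos (\<eta> \<bullet> y + c))" for \<eta> :: "'a::euclidean_space"
proof (induction n arbitrary: c)
  case (Suc n)
  have "times_differentiable n (partial b (\<lambda>y. cos (\<eta> \<bullet> y + c)))" for b
    using times_diff_mult[OF times_diff_const Suc.IH[of "c + pi / 2"], of "\<eta> \<bullet> b"]
    by (simp add: cos_mode(2)[abs_def])
  moreover have "\<forall>p. (\<lambda>y. cos (\<eta> \<bullet> y + c)) differentiable at p" by (intro allI cos_mode(1))
  ultimately show ?case by (simp add: times_differentiable.simps(2))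
qed simp

lemma times_diff_mode: "times_differentiable 2 (mode S \<eta> c)"
  unfolding mode_def[abs_def] by (intro times_diff_mult times_diff_cos times_diff_bump) simp

lemma mode_support: "S > 0 \<Longrightarrow> \<forall>y. norm y > S \<longrightarrow> mode S \<eta> c y = 0"
  by (simp add: mode_def bump_eq_0)

lemma continuous_mode: "continuous_on A (mode S \<eta> c)"
  by (rule times_diff_continuous[OF times_diff_mode]) simp

lemma partial_bump_cube: "partial b (\<lambda>y. bump S y ^ 3) y = - 6 / S^2 * bump S y ^ 2 * (y \<bullet> b)"
proof -
  have d: "((\<lambda>v. 1 - (v \<bullet> v) / S^2) has_derivative (\<lambda>h. - (2 * (y \<bullet> h)) / S^2)) (at y)"
  proof -
    have "((\<lambda>v. 1 - inverse (S^2) * (v \<bullet> v)) has_derivative (\<lambda>h. - (inverse (S^2) * (y \<bullet> h + h \<bullet> y)))) (at y)"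
      by (auto intro!: derivative_eq_intros)
    then show ?thesis by (simp add: divide_inverse inner_commute mult_ac)
  qed
  have "partial b (\<lambda>v. 1 - (v \<bullet> v) / S^2) y = - (2 * (y \<bullet> b)) / S^2"
    by (rule partial_eqI[OF d])
  then show ?thesis
    using partial_max_power[OF differentiableI[OF d], where b = b and n = 1]
    by (simp add: bump_def numeral_3_eq_3 numeral_2_eq_2)
qed

lemma partial_mode:
  "partial b (mode S \<eta> c) y = (\<eta> \<bullet> b) * mode S \<eta> (c + pi / 2) y - 6 / S^2 * bump S y ^ 2 * (y \<bullet> b) * cos (\<eta> \<bullet> y + c)"
  unfolding mode_def[abs_def]
  by (subst partial_mult[OF cos_mode(1) times_differentiableD[OF times_diff_bump[of 1]]])
     (simp_all add: cos_mode(2) partial_bump_cube mult_ac)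

lemma point_slice:
  fixes f :: "phase \<Rightarrow> real"
  shows "times_differentiable n f \<Longrightarrow> times_differentiable n (\<lambda>y. f (point y v))"
    and "times_differentiable 1 f \<Longrightarrow> partial b (\<lambda>y. f (point y v)) y = partial (fst b, snd b, 0) f (point y v)"
proof -
  let ?e = "\<lambda>y :: spacetime. (fst y, snd y, 0) :: phase"
  have l: "linear ?e" by (rule linearI) auto
  have B: "?e b \<in> Basis \<or> ?e b = 0" if "b \<in> Basis" for b :: spacetime
    using that by (auto simp: Basis_prod_def zero_prod_def)
  show "times_differentiable n f \<Longrightarrow> times_differentiable n (\<lambda>y. f (point y v))"
    using times_diff_affine(1)[of ?e n f "(0, 0, v)"] l B by simp
  show "times_differentiable 1 f \<Longrightarrow> partial b (\<lambda>y. f (point y v)) y = partial (fst b, snd b, 0) f (point y v)"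
    using times_diff_affine(2)[of ?e f b "(0, 0, v)" y] l B by simp
qed

lemma integral_by_parts_slice:
  fixes f :: "phase \<Rightarrow> real"
  assumes w: "times_differentiable 2 w" and z: "\<forall>y. norm y > r \<longrightarrow> w y = 0"
    and f: "times_differentiable 2 f" and b: "b \<in> Basis"
  shows "(LBINT y. w y * partial (fst b, snd b, 0) f (point y v)) = - (LBINT y. partial b w y * f (point y v))"
    and "integrable lborel (\<lambda>y. w y * partial (fst b, snd b, 0) f (point y v))"
    and "integrable lborel (\<lambda>y. partial b w y * f (point y v))"
proof -
  have f1: "times_differentiable 1 f" and w1: "times_differentiable 1 w"
    using f w times_diff_mono by force+
  have fb: "(fst b, snd b, 0) \<in> (Basis :: phase set)" using b by (auto simp: Basis_prod_def zero_prod_def)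
  have c: "continuous_on UNIV (partial (fst b, snd b, 0) f)" "continuous_on UNIV (partial b w)"
     "continuous_on UNIV w" "continuous_on UNIV f"
    using f w f1 w1 b fb
    by (auto intro!: times_diff_continuous[of 1] times_diff_partial simp: numeral_2_eq_2)
  have pz: "partial b w y = 0" if "norm y > r" for y
  proof -
    have "open {y. norm y > r}" by (intro open_Collect_less continuous_intros)
    then have "(w has_derivative (\<lambda>_. 0)) (at y)"
      by (rule has_derivative_transform_within_open[OF has_derivative_const[of 0]]) (use that z in auto)
    then show ?thesis using partial_eqI by blast
  qed
  show 1: "integrable lborel (\<lambda>y. w y * partial (fst b, snd b, 0) f (point y v))"
    by (rule smear_integrable[OF c(3) z c(1)])
  show 2: "integrable lborel (\<lambda>y. partial b w y * f (point y v))"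
    by (rule smear_integrable[OF c(2) _ c(4), of r]) (use pz in auto)
  let ?q = "\<lambda>y. w y * f (point y v)"
  have "partial b ?q y = w y * partial (fst b, snd b, 0) f (point y v) + partial b w y * f (point y v)" for y
    using partial_mult[OF times_differentiableD[OF w1] times_differentiableD[OF point_slice(1)[OF f1]], where b = b]
      point_slice(2)[OF f1] by simp
  moreover have "(LBINT y. partial b ?q y) = 0"
    by (rule integral_partial_eq_0[of _ r]) (use w f z b in \<open>auto intro!: times_diff_mult point_slice(1)\<close>)
  ultimately show "(LBINT y. w y * partial (fst b, snd b, 0) f (point y v)) = - (LBINT y. partial b w y * f (point y v))"
    using Bochner_Integration.integral_add[OF 1 2] by simp
qed

text \<open>After integration by parts the transport derivative falls on the cosine, which yields
  the phase \<tau> + v \<bullet> k and a quarter turn, or on the cutoff, which yields an error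
  without derivatives of f.\<close>

lemma smear_mode_transport:
  assumes S: "S > 0" and f: "times_differentiable 2 f"
  shows "smear (mode S \<eta> c) (free_transport f) v
    = - (fst \<eta> + v \<bullet> snd \<eta>) * smear (mode S \<eta> (c + pi / 2)) f v
      - (LBINT y. cos (\<eta> \<bullet> y + c) * (f (point y v) * cutoff_drift S v y))"
proof -
  note ibp = integral_by_parts_slice[OF times_diff_mode mode_support[OF S] f, of _ \<eta> c v]
  define d where "d b y = mode S \<eta> c y * partial (fst b, snd b, 0) f (point y v)" for b y
  define e where "e b y = partial b (mode S \<eta> c) y * f (point y v)" for b y
  have B: "(1, 0) \<in> (Basis :: spacetime set)" "(0, axis i 1) \<in> (Basis :: spacetime set)" for i :: 3
    by (auto simp: Basis_prod_def axis_Basis)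
  have I: "integrable lborel (d b)" "integrable lborel (e b)" "(LBINT y. d b y) = - (LBINT y. e b y)"
    if "b \<in> Basis" for b
    unfolding d_def e_def using ibp[OF that] by auto
  have f1: "continuous_on UNIV f" by (rule times_diff_continuous[OF f]) simp
  have de: "e (1, 0) y + (\<Sum>i\<in>UNIV. v $ i * e (0, axis i 1) y)
     = (fst \<eta> + v \<bullet> snd \<eta>) * (mode S \<eta> (c + pi / 2) y * f (point y v)) + cos (\<eta> \<bullet> y + c) * (f (point y v) * cutoff_drift S v y)" for y
  proof -
    have "y \<bullet> (1, 0) + (\<Sum>i\<in>UNIV. v $ i * (y \<bullet> (0, axis i 1))) = fst y + v \<bullet> snd y" for y :: spacetime
      by (simp add: inner_prod_def inner_axis) (simp add: inner_vec_def)
    note i = this[of y] this[of \<eta>]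
    have "e (1, 0) y + (\<Sum>i\<in>UNIV. v $ i * e (0, axis i 1) y) =
       (\<eta> \<bullet> (1, 0) + (\<Sum>i\<in>UNIV. v $ i * (\<eta> \<bullet> (0, axis i 1)))) * (mode S \<eta> (c + pi / 2) y * f (point y v))
       + (- 6 / S^2 * bump S y ^ 2 * (y \<bullet> (1, 0) + (\<Sum>i\<in>UNIV. v $ i * (y \<bullet> (0, axis i 1)))) * cos (\<eta> \<bullet> y + c)) * f (point y v)"
      unfolding e_def partial_mode sum_3 by (simp add: algebra_simps)
    then show ?thesis unfolding i cutoff_drift_def by (simp add: mult_ac)
  qed
  have "smear (mode S \<eta> c) (free_transport f) v = (LBINT y. d (1, 0) y + (\<Sum>i\<in>UNIV. v $ i * d (0, axis i 1) y))"
    unfolding smear_def free_transport_def d_t_def grad_x_def inner_vec_def d_def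
    by (simp add: sum_distrib_left algebra_simps)
  also have "\<dots> = - ((LBINT y. e (1, 0) y) + (\<Sum>i\<in>UNIV. v $ i * (LBINT y. e (0, axis i 1) y)))"
    using I[OF B(1)] I[OF B(2)]
    by (subst Bochner_Integration.integral_add) (auto simp: Bochner_Integration.integral_sum sum_negf)
  also have "\<dots> = - (LBINT y. e (1, 0) y + (\<Sum>i\<in>UNIV. v $ i * e (0, axis i 1) y))"
    using I[OF B(1)] I[OF B(2)]
    by (subst Bochner_Integration.integral_add) (auto simp: Bochner_Integration.integral_sum)
  also have "(LBINT y. e (1, 0) y + (\<Sum>i\<in>UNIV. v $ i * e (0, axis i 1) y))
     = (LBINT y. (fst \<eta> + v \<bullet> snd \<eta>) * (mode S \<eta> (c + pi / 2) y * f (point y v)) + cos (\<eta> \<bullet> y + c) * (f (point y v) * cutoff_drift S v y))"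
    by (simp only: de)
  also have "(LBINT y. (fst \<eta> + v \<bullet> snd \<eta>) * (mode S \<eta> (c + pi / 2) y * f (point y v)) + cos (\<eta> \<bullet> y + c) * (f (point y v) * cutoff_drift S v y))
     = (fst \<eta> + v \<bullet> snd \<eta>) * smear (mode S \<eta> (c + pi / 2)) f v + (LBINT y. cos (\<eta> \<bullet> y + c) * (f (point y v) * cutoff_drift S v y))"
  proof (subst Bochner_Integration.integral_add)
    show "integrable lborel (\<lambda>y. (fst \<eta> + v \<bullet> snd \<eta>) * (mode S \<eta> (c + pi / 2) y * f (point y v)))"
      by (intro integrable_mult_right smear_integrable[OF continuous_mode mode_support[OF S] f1])
    show "integrable lborel (\<lambda>y. cos (\<eta> \<bullet> y + c) * (f (point y v) * cutoff_drift S v y))"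
    proof (rule integrable_continuous_support)
      show "continuous_on UNIV (\<lambda>y. cos (\<eta> \<bullet> y + c) * (f (point y v) * cutoff_drift S v y))"
        unfolding cutoff_drift_def by (intro continuous_intros continuous_point(2)[OF f1] continuous_bump)
      show "cos (\<eta> \<bullet> y + c) * (f (point y v) * cutoff_drift S v y) = 0" if "norm y > S" for y
        using that S by (simp add: cutoff_drift_def bump_eq_0)
    qed
  qed (simp add: smear_def)
  finally show ?thesis by (simp add: algebra_simps)
qed

context coefficients
begin

text \<open>The shifts c = 0 and c = pi / 2 give the two equations of the real system: in the second
  the shift pi appears, which is minus the shift 0. The cutoff error joins h in the source.\<close>

lemma modulated_equation:
  fixes f h :: "phase \<Rightarrow> real"
  assumes S: "S > 0" and f: "times_differentiable 3 f" and h: "continuous_on UNIV h"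
    and eq: "\<And>p. free_transport f p + vdiffusion f p = h p"
  shows "diffusion (smear (mode S \<eta> c) f) v - (fst \<eta> + v \<bullet> snd \<eta>) * smear (mode S \<eta> (c + pi / 2)) f v
    = (LBINT y. cos (\<eta> \<bullet> y + c) * (bump S y ^ 3 * h (point y v) + f (point y v) * cutoff_drift S v y))"
proof -
  have f2: "times_differentiable 2 f" using times_diff_mono[OF f] by simp
  have cf: "continuous_on UNIV f" by (rule times_diff_continuous[OF f2]) simp
  have t: "free_transport f = (\<lambda>p. h p + - vdiffusion f p)" using eq by (auto simp: fun_eq_iff algebra_simps)
  note w = continuous_mode[of UNIV S \<eta> c] mode_support[OF S, of \<eta> c]
  have "smear (mode S \<eta> c) (free_transport f) v = smear (mode S \<eta> c) h v - diffusion (smear (mode S \<eta> c) f) v"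
    unfolding t diffusion_smear[OF w f]
    using smear_sum_mult(4)[OF w h continuous_on_minus[OF vdiffusion_continuous(1)[OF f]], of v]
      smear_sum_mult(3)[OF w vdiffusion_continuous(1)[OF f], of v] by simp
  then have "diffusion (smear (mode S \<eta> c) f) v - (fst \<eta> + v \<bullet> snd \<eta>) * smear (mode S \<eta> (c + pi / 2)) f v
    = smear (mode S \<eta> c) h v + (LBINT y. cos (\<eta> \<bullet> y + c) * (f (point y v) * cutoff_drift S v y))"
    unfolding smear_mode_transport[OF S f2] by (simp add: algebra_simps)
  also have "\<dots> = (LBINT y. mode S \<eta> c y * h (point y v) + cos (\<eta> \<bullet> y + c) * (f (point y v) * cutoff_drift S v y))"
    unfolding smear_def
  proof (subst Bochner_Integration.integral_add)
    show "integrable lborel (\<lambda>y. mode S \<eta> c y * h (point y v))" by (rule smear_integrable[OF w h])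
    show "integrable lborel (\<lambda>y. cos (\<eta> \<bullet> y + c) * (f (point y v) * cutoff_drift S v y))"
    proof (rule integrable_continuous_support)
      show "continuous_on UNIV (\<lambda>y. cos (\<eta> \<bullet> y + c) * (f (point y v) * cutoff_drift S v y))"
        unfolding cutoff_drift_def by (intro continuous_intros continuous_point(2)[OF cf] continuous_bump)
      show "cos (\<eta> \<bullet> y + c) * (f (point y v) * cutoff_drift S v y) = 0" if "norm y > S" for y
        using that S by (simp add: cutoff_drift_def bump_eq_0)
    qed
  qed simp
  also have "\<dots> = (LBINT y. cos (\<eta> \<bullet> y + c) * (bump S y ^ 3 * h (point y v) + f (point y v) * cutoff_drift S v y))"
    by (intro Bochner_Integration.integral_cong refl) (simp add: mode_def algebra_simps)
  finally show ?thesis .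
qed

end

section \<open>Integration over the frequencies\<close>

lemma
  fixes u :: "'a::euclidean_space \<times> 'b::euclidean_space \<Rightarrow> ennreal"
  assumes "u \<in> borel_measurable borel"
  shows lborel_nn_integral_prod: "(\<integral>\<^sup>+z. u z \<partial>lborel) = (\<integral>\<^sup>+a. \<integral>\<^sup>+b. u (a, b) \<partial>lborel \<partial>lborel)"
    and lborel_nn_integral_swap:
      "(\<integral>\<^sup>+a. \<integral>\<^sup>+b. u (a, b) \<partial>lborel \<partial>lborel) = (\<integral>\<^sup>+b. \<integral>\<^sup>+a. u (a, b) \<partial>lborel \<partial>lborel)"
  using lborel.nn_integral_fst[of u lborel] lborel_pair.Fubini'[of "\<lambda>a b. u (a, b)"] assms
  by (simp_all add: lborel_prod split_beta')

text \<open>Two groupings are needed: v outside and (t, x) inside for Plancherel in spacetime, and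
  (t, v) outside and x inside for the multipliers in x.\<close>

lemma phase_nn_integral:
  fixes g :: "phase \<Rightarrow> ennreal"
  assumes g[measurable]: "g \<in> borel_measurable borel"
  shows "(\<integral>\<^sup>+p. g p \<partial>lborel) = (\<integral>\<^sup>+v. \<integral>\<^sup>+y. g (point y v) \<partial>lborel \<partial>lborel)"
    and "(\<integral>\<^sup>+p. g p \<partial>lborel) = (\<integral>\<^sup>+q. \<integral>\<^sup>+x. g (fst q, x, snd q) \<partial>lborel \<partial>lborel)"
proof -
  note F = lborel_nn_integral_prod and swap = lborel_nn_integral_swap
  have m: "(\<lambda>z. g (l z)) \<in> borel_measurable borel" if "continuous_on UNIV l" for l :: "'c::euclidean_space \<Rightarrow> phase"
    by (rule measurable_compose[OF borel_measurable_continuous_onI[OF that] g])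
  have mx: "(\<lambda>z. \<integral>\<^sup>+x. g (fst z, x, snd z) \<partial>lborel) \<in> borel_measurable (borel :: (real \<times> (real^3)) measure)"
  proof -
    have "(\<lambda>w. g (fst (fst w), snd w, snd (fst w))) \<in> borel_measurable (borel \<Otimes>\<^sub>M lborel :: ((real \<times> (real^3)) \<times> (real^3)) measure)"
      unfolding measurable_cong_sets[OF sets_pair_measure_cong[OF refl sets_lborel] refl] borel_prod
      by (rule m) (intro continuous_intros)
    from lborel.borel_measurable_nn_integral_fst[OF this] show ?thesis by simp
  qed
  have 1: "(\<integral>\<^sup>+p. g p \<partial>lborel) = (\<integral>\<^sup>+t. \<integral>\<^sup>+v. \<integral>\<^sup>+x. g (t, x, v) \<partial>lborel \<partial>lborel \<partial>lborel)"
  proof -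
    have "(\<integral>\<^sup>+p. g p \<partial>lborel) = (\<integral>\<^sup>+t. \<integral>\<^sup>+z. g (t, z) \<partial>lborel \<partial>lborel)" by (rule F) simp
    also have "\<dots> = (\<integral>\<^sup>+t. \<integral>\<^sup>+x. \<integral>\<^sup>+v. g (t, x, v) \<partial>lborel \<partial>lborel \<partial>lborel)"
      by (intro nn_integral_cong F m) (intro continuous_intros)
    also have "\<dots> = (\<integral>\<^sup>+t. \<integral>\<^sup>+v. \<integral>\<^sup>+x. g (t, x, v) \<partial>lborel \<partial>lborel \<partial>lborel)"
      by (intro nn_integral_cong swap m) (intro continuous_intros)
    finally show ?thesis .
  qed
  then show "(\<integral>\<^sup>+p. g p \<partial>lborel) = (\<integral>\<^sup>+q. \<integral>\<^sup>+x. g (fst q, x, snd q) \<partial>lborel \<partial>lborel)"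
    using F[OF mx] by simp
  have "(\<integral>\<^sup>+t. \<integral>\<^sup>+v. \<integral>\<^sup>+x. g (t, x, v) \<partial>lborel \<partial>lborel \<partial>lborel) = (\<integral>\<^sup>+v. \<integral>\<^sup>+t. \<integral>\<^sup>+x. g (t, x, v) \<partial>lborel \<partial>lborel \<partial>lborel)"
    using swap[OF mx] by simp
  also have "\<dots> = (\<integral>\<^sup>+v. \<integral>\<^sup>+y. g (point y v) \<partial>lborel \<partial>lborel)"
  proof (intro nn_integral_cong)
    fix v :: "real^3"
    have "(\<integral>\<^sup>+y. g (point y v) \<partial>lborel) = (\<integral>\<^sup>+t. \<integral>\<^sup>+x. g (point (t, x) v) \<partial>lborel \<partial>lborel)"
      by (intro F m) (intro continuous_intros)
    then show "(\<integral>\<^sup>+t. \<integral>\<^sup>+x. g (t, x, v) \<partial>lborel \<partial>lborel) = (\<integral>\<^sup>+y. g (point y v) \<partial>lborel)" by simp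
  qed
  finally show "(\<integral>\<^sup>+p. g p \<partial>lborel) = (\<integral>\<^sup>+v. \<integral>\<^sup>+y. g (point y v) \<partial>lborel \<partial>lborel)" using 1 by simp
qed

lemma continuous_fourier_parameter:
  fixes g :: "'p::euclidean_space \<Rightarrow> 'a::euclidean_space \<Rightarrow> complex"
  assumes g: "continuous_on UNIV (\<lambda>z. g (fst z) (snd z))" and z: "\<And>p x. norm x > r \<Longrightarrow> g p x = 0"
  shows "continuous_on UNIV (\<lambda>z. fourier (g (fst z)) (snd z))"
  unfolding fourier_def
proof (rule continuous_parameter_integral)
  have "continuous_on UNIV (\<lambda>w :: ('p \<times> 'a) \<times> 'a. g (fst (fst w)) (snd w))"
    by (rule continuous_on_compose2[OF g, of UNIV "\<lambda>w. (fst (fst w), snd w)", simplified]) (intro continuous_intros)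
  then show "continuous_on UNIV (\<lambda>w. exp (- (\<i> * complex_of_real (snd (fst w) \<bullet> snd w))) * g (fst (fst w)) (snd w))"
    by (intro continuous_intros)
qed (use z in auto)

lemma continuous_slice2:
  fixes g :: "'p::topological_space \<Rightarrow> 'a::topological_space \<Rightarrow> 'b::topological_space"
  assumes "continuous_on UNIV (\<lambda>z. g (fst z) (snd z))"
  shows "continuous_on UNIV (g p)"
  by (rule continuous_on_compose2[OF assms, of UNIV "\<lambda>x. (p, x)", simplified]) (intro continuous_intros)

text \<open>Plancherel for each parameter p, after exchanging the order of integration; the weight
  depends only on p and is therefore unaffected.\<close>

lemma weighted_plancherel:
  fixes g :: "'p::euclidean_space \<Rightarrow> 'a::euclidean_space \<Rightarrow> complex"
  assumes g: "continuous_on UNIV (\<lambda>z. g (fst z) (snd z))" and z: "\<And>p x. norm x > r \<Longrightarrow> g p x = 0"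
    and a[measurable]: "a \<in> borel_measurable borel" and a0: "\<And>p. 0 \<le> a p"
  shows "(\<integral>\<^sup>+\<eta>. \<integral>\<^sup>+p. ennreal (a p * (norm (fourier (g p) \<eta>))^2) \<partial>lborel \<partial>lborel)
    = ennreal ((2 * pi) ^ DIM('a)) * (\<integral>\<^sup>+p. ennreal (a p) * sqnorm (g p) \<partial>lborel)"
    and "(\<lambda>p. ennreal (a p) * sqnorm (g p)) \<in> borel_measurable borel"
proof -
  note m[measurable] = borel_measurable_continuous_onI[OF continuous_fourier_parameter[OF g z]]
  have "(\<lambda>z. a (fst z) * (norm (fourier (g (fst z)) (snd z)))^2) \<in> borel_measurable borel"
    using measurable_compose[OF borel_measurable_continuous_onI[OF continuous_on_fst[OF continuous_on_id]] a]
    by (intro borel_measurable_times) (auto simp: id_def)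
  note this[measurable]
  have M: "(\<lambda>z. ennreal (a (fst z) * (norm (fourier (g (fst z)) (snd z)))^2)) \<in> borel_measurable (lborel \<Otimes>\<^sub>M lborel)"
    unfolding lborel_prod by simp
  have s: "(\<integral>\<^sup>+\<eta>. ennreal (a p * (norm (fourier (g p) \<eta>))^2) \<partial>lborel) = ennreal ((2 * pi) ^ DIM('a)) * (ennreal (a p) * sqnorm (g p))" for p
  proof -
    have [measurable]: "fourier (g p) \<in> borel_measurable borel"
      by (rule borel_measurable_continuous_onI, rule continuous_slice2[OF continuous_fourier_parameter[OF g z]])
    have "(\<integral>\<^sup>+\<eta>. ennreal (a p * (norm (fourier (g p) \<eta>))^2) \<partial>lborel) = ennreal (a p) * sqnorm (fourier (g p))"
      unfolding sqnorm_def by (simp add: ennreal_mult a0 nn_integral_cmult)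
    also have "sqnorm (fourier (g p)) = ennreal ((2 * pi) ^ DIM('a)) * sqnorm (g p)"
      by (rule plancherel_continuous[OF continuous_slice2[OF g] z])
    finally show ?thesis by (simp add: mult_ac)
  qed
  \<comment> \<open>Measurability of the slice norms in p is obtained on the Fourier side, where the
    integrand is jointly measurable; the constant is divided out afterwards.\<close>
  have mm: "(\<lambda>p. ennreal ((2 * pi) ^ DIM('a)) * (ennreal (a p) * sqnorm (g p))) \<in> borel_measurable borel"
    using lborel.borel_measurable_nn_integral_fst[OF M] by (simp add: s)
  have "(\<lambda>p. ennreal (1 / (2 * pi) ^ DIM('a)) * (ennreal ((2 * pi) ^ DIM('a)) * (ennreal (a p) * sqnorm (g p)))) \<in> borel_measurable borel"
    using mm by measurable
  then show 2: "(\<lambda>p. ennreal (a p) * sqnorm (g p)) \<in> borel_measurable borel"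
    by (simp add: mult.assoc[symmetric] ennreal_mult[symmetric] del: power_mult_distrib)
  have "(\<integral>\<^sup>+\<eta>. \<integral>\<^sup>+p. ennreal (a p * (norm (fourier (g p) \<eta>))^2) \<partial>lborel \<partial>lborel)
    = (\<integral>\<^sup>+p. \<integral>\<^sup>+\<eta>. ennreal (a p * (norm (fourier (g p) \<eta>))^2) \<partial>lborel \<partial>lborel)"
    using lborel_pair.Fubini'[of "\<lambda>p \<eta>. ennreal (a p * (norm (fourier (g p) \<eta>))^2)"] M by (simp add: split_beta')
  then show "(\<integral>\<^sup>+\<eta>. \<integral>\<^sup>+p. ennreal (a p * (norm (fourier (g p) \<eta>))^2) \<partial>lborel \<partial>lborel)
    = ennreal ((2 * pi) ^ DIM('a)) * (\<integral>\<^sup>+p. ennreal (a p) * sqnorm (g p) \<partial>lborel)"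
    using 2 by (simp add: s nn_integral_cmult)
qed

lemma norm_fourier_real:
  fixes u :: "'a::euclidean_space \<Rightarrow> real"
  assumes u: "integrable lborel u"
  shows "(norm (fourier (\<lambda>y. complex_of_real (u y)) \<eta>))^2
    = (LBINT y. cos (\<eta> \<bullet> y + 0) * u y)^2 + (LBINT y. cos (\<eta> \<bullet> y + pi / 2) * u y)^2"
proof -
  let ?g = "\<lambda>y. exp (- (\<i> * complex_of_real (\<eta> \<bullet> y))) * complex_of_real (u y)"
  have i: "integrable lborel ?g" by (rule integrable_character_mult) (use u in simp)
  have e: "Re (?g y) = cos (\<eta> \<bullet> y + 0) * u y" "Im (?g y) = cos (\<eta> \<bullet> y + pi / 2) * u y" for y
    by (simp_all add: Re_exp Im_exp cos_add)
  have "Re (fourier (\<lambda>y. complex_of_real (u y)) \<eta>) = (LBINT y. cos (\<eta> \<bullet> y + 0) * u y)"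
    "Im (fourier (\<lambda>y. complex_of_real (u y)) \<eta>) = (LBINT y. cos (\<eta> \<bullet> y + pi / 2) * u y)"
    unfolding fourier_def integral_Re[OF i, symmetric] integral_Im[OF i, symmetric] e by (rule refl)+
  then show ?thesis by (simp add: cmod_power2)
qed

definition spec :: "real \<Rightarrow> (phase \<Rightarrow> real) \<Rightarrow> real^3 \<Rightarrow> spacetime \<Rightarrow> complex" where
  "spec S g v = fourier (\<lambda>y. complex_of_real (bump S y ^ 3 * g (point y v)))"

definition source :: "real \<Rightarrow> (phase \<Rightarrow> real) \<Rightarrow> (phase \<Rightarrow> real) \<Rightarrow> real^3 \<Rightarrow> spacetime \<Rightarrow> real" where
  "source S f h v y = bump S y ^ 3 * h (point y v) + f (point y v) * cutoff_drift S v y"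

lemma bump_slice:
  assumes "S > 0" "continuous_on UNIV g"
  shows "continuous_on UNIV (\<lambda>z. bump S (snd z) ^ 3 * g (point (snd z) (fst z)))"
    and "norm y > S \<Longrightarrow> bump S y ^ 3 * g (point y v) = 0"
    and "integrable lborel (\<lambda>y. bump S y ^ 3 * g (point y v))"
proof -
  show 2: "norm y > S \<Longrightarrow> bump S y ^ 3 * g (point y v) = 0" for y using assms(1) by (simp add: bump_eq_0)
  show "continuous_on UNIV (\<lambda>z. bump S (snd z) ^ 3 * g (point (snd z) (fst z)))"
    by (intro continuous_intros continuous_point(1)[OF assms(2)] continuous_on_compose2[OF continuous_bump[of UNIV]]) auto
  show "integrable lborel (\<lambda>y. bump S y ^ 3 * g (point y v))"
    by (rule smear_integrable[OF _ _ assms(2), of _ S]) (use assms(1) in \<open>auto simp: bump_eq_0 intro!: continuous_intros continuous_bump\<close>)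
qed

lemma source_slice:
  assumes S: "S > 0" and c: "continuous_on UNIV f" "continuous_on UNIV h"
  shows "continuous_on UNIV (\<lambda>z. source S f h (fst z) (snd z))"
    and "norm y > S \<Longrightarrow> source S f h v y = 0"
    and "integrable lborel (source S f h v)"
proof -
  show 1: "continuous_on UNIV (\<lambda>z. source S f h (fst z) (snd z))"
    unfolding source_def cutoff_drift_def
    by (intro continuous_intros continuous_point(1) c continuous_on_compose2[OF continuous_bump[of UNIV]]) auto
  show 2: "norm y > S \<Longrightarrow> source S f h v y = 0" for y using S by (simp add: source_def cutoff_drift_def bump_eq_0)
  show "integrable lborel (source S f h v)"
    by (rule integrable_continuous_support[OF continuous_slice2[OF 1] 2])
qed

lemma norm_spec:
  assumes "S > 0" "continuous_on UNIV g"
  shows "(norm (spec S g v \<eta>))^2 = (smear (mode S \<eta> 0) g v)^2 + (smear (mode S \<eta> (pi / 2)) g v)^2"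
  unfolding spec_def norm_fourier_real[OF bump_slice(3)[OF assms]] smear_def mode_def by (simp add: mult.assoc)

text \<open>On the supports |t + v \<bullet> x| \<le> S + 2 S * S \<le> 3 S^2, which cancels the 1 /
  S^2 of the cutoff derivative: this is why v is cut off at the scale of (t, x). The drift is at
  most 6 * 3 = 18, and 648 = 2 * 18^2.\<close>

lemma sq_source_le:
  assumes S: "S \<ge> 1" and v: "norm v \<le> 2 * S"
  shows "(source S f h v y)^2 \<le> 2 * (h (point y v))^2 + 648 * (f (point y v))^2"
proof (cases "norm y \<le> S")
  case True
  have b: "0 \<le> bump S y" "bump S y \<le> 1" by (rule bump_bounds)+
  have "\<bar>fst y + v \<bullet> snd y\<bar> \<le> \<bar>fst y\<bar> + norm v * norm (snd y)"
    using Cauchy_Schwarz_ineq2[of v "snd y"] by linarith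
  also have "\<dots> \<le> S + (2 * S) * S"
    using v True norm_fst_le[of "fst y" "snd y"] norm_snd_le[of "snd y" "fst y"] S by (intro add_mono mult_mono) auto
  also have "\<dots> \<le> 3 * S^2" using S by (simp add: power2_eq_square)
  finally have 1: "\<bar>fst y + v \<bullet> snd y\<bar> \<le> 3 * S^2" .
  have b2: "bump S y ^ 2 \<le> 1" "bump S y ^ 3 \<le> 1" using b by (simp_all add: power_le_one)
  have "\<bar>cutoff_drift S v y\<bar> = 6 * bump S y ^ 2 * (\<bar>fst y + v \<bullet> snd y\<bar> / S^2)"
    by (simp add: cutoff_drift_def abs_mult)
  also have "\<dots> \<le> 6 * 1 * 3"
    using 1 S b2 by (intro mult_mono) (auto simp: pos_divide_le_eq)
  finally have 2: "\<bar>cutoff_drift S v y\<bar> \<le> 18" by simp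
  have "(source S f h v y)^2 \<le> 2 * (bump S y ^ 3 * h (point y v))^2 + 2 * (f (point y v) * cutoff_drift S v y)^2"
    unfolding source_def using sum_squares_bound[of "bump S y ^ 3 * h (point y v)" "f (point y v) * cutoff_drift S v y"]
    by (simp add: power2_sum)
  also have "(bump S y ^ 3 * h (point y v))^2 \<le> 1 * (h (point y v))^2"
    unfolding power_mult_distrib using b b2 by (intro mult_right_mono) (simp_all add: power_le_one)
  also have "(f (point y v) * cutoff_drift S v y)^2 \<le> (f (point y v))^2 * 18^2"
    unfolding power_mult_distrib using 2 abs_le_square_iff[of "cutoff_drift S v y" 18] by (intro mult_left_mono) simp_all
  finally show ?thesis by simp
next
  case False
  then show ?thesis using S by (simp add: source_def cutoff_drift_def bump_eq_0)
qed

text \<open>At k = 0 the symbol vanishes and the multiplier weight is singular; those frequencies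
  form a null set.\<close>

lemma AE_snd_ne_0: "AE \<eta> in lborel. snd (\<eta> :: spacetime) \<noteq> 0"
proof -
  have "negligible {\<eta> :: spacetime. (0, axis 1 1) \<bullet> \<eta> = 0}"
    by (rule negligible_hyperplane) (simp add: zero_prod_def)
  then have "AE \<eta> in lebesgue. \<eta> \<notin> {\<eta> :: spacetime. (0, axis 1 1) \<bullet> \<eta> = 0}"
    unfolding negligible_iff_null_sets by (rule AE_not_in)
  then have "AE \<eta> in lebesgue. snd (\<eta> :: spacetime) \<noteq> 0"
    by eventually_elim (auto simp: inner_prod_def)
  then show ?thesis by (simp add: AE_completion_iff)
qed

abbreviation vcut :: "real \<Rightarrow> (phase \<Rightarrow> real) \<Rightarrow> phase \<Rightarrow> real" where
  "vcut S f \<equiv> \<lambda>p. bump S (vel p) ^ 5 * f p"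

lemma times_diff_vcut: "times_differentiable 4 f \<Longrightarrow> times_differentiable 4 (vcut S f)"
  by (intro times_diff_mult times_diff_vel times_diff_bump) simp

lemma ennreal_integral_le:
  assumes "\<And>x. 0 \<le> g x"
  shows "ennreal (\<integral>x. g x \<partial>M) \<le> (\<integral>\<^sup>+x. ennreal (g x) \<partial>M)"
proof (cases "integrable M g")
  case True
  then show ?thesis by (simp add: nn_integral_eq_integral assms)
qed (simp add: not_integrable_integral_eq)

lemma mult_sqnorm_add:
  fixes a b :: "'a::euclidean_space \<Rightarrow> 'b::euclidean_space"
  assumes [measurable]: "a \<in> borel_measurable borel" "b \<in> borel_measurable borel"
  shows "c * (sqnorm a + sqnorm b) = (\<integral>\<^sup>+x. c * (ennreal ((norm (a x))^2) + ennreal ((norm (b x))^2)) \<partial>lborel)"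
  unfolding sqnorm_def by (subst nn_integral_cmult) (simp_all add: nn_integral_add)

text \<open>The sum of \<open>energy_density\<close> over the real and imaginary parts of the
  transform.\<close>

definition spectral_density :: "real \<Rightarrow> real \<Rightarrow> (phase \<Rightarrow> real) \<Rightarrow> spacetime \<Rightarrow> real^3 \<Rightarrow> real" where
  "spectral_density \<gamma> S g \<eta> v = japanese v powr (2 * \<gamma> + 4) * (norm (spec S g v \<eta>))^2
     + (japanese v powr \<gamma>)^2 * (norm (spec S (vlap False g) v \<eta>))^2
     + (japanese v powr \<gamma>)^2 * (norm (spec S (vlap True g) v \<eta>))^2
     + (rho \<gamma> (snd \<eta>) v)^2 * (norm (spec S g v \<eta>))^2"

lemma continuous_vlap: "times_differentiable 3 g \<Longrightarrow> continuous_on UNIV (vlap b g)"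
  unfolding vlap_def[abs_def]
  by (intro continuous_intros times_diff_continuous[of 1 "vfield _ _"] times_diff_vfield[of 2] times_diff_vfield[of 3]) auto

context coefficients
begin

text \<open>Averaging in (t, x) commutes with the fields, with the coefficients and with the
  velocity cutoff. So \<open>localized_estimate\<close>, applied to the real and imaginary parts of
  the transform of f, is a statement about transforms.\<close>

lemma spectral_estimate:
  fixes f h :: "phase \<Rightarrow> real"
  assumes S: "S \<ge> 1" and f: "times_differentiable 5 f" and h: "continuous_on UNIV h"
    and eq: "\<And>p. free_transport f p + vdiffusion f p = h p" and k: "snd \<eta> \<noteq> 0"
  shows "(\<integral>\<^sup>+v. ennreal (spectral_density \<gamma> S (vcut S f) \<eta> v) \<partial>lborel)
    \<le> ennreal (const0 K * (10^8 * K^4)) *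
      (\<integral>\<^sup>+v. ennreal (2 * bump (2 * S) v * (norm (fourier (\<lambda>y. complex_of_real (source S f h v y)) \<eta>))^2)
          + ennreal (2 * bump (2 * S) v * (norm (spec S f v \<eta>))^2) \<partial>lborel)"
proof -
  have S0: "S > 0" using S by simp
  have f4: "times_differentiable 4 f" and f3: "times_differentiable 3 f" using times_diff_mono[OF f] by simp_all
  have cf: "continuous_on UNIV f" by (rule times_diff_continuous[OF f]) simp
  let ?g = "vcut S f"
  have g4: "times_differentiable 4 ?g" by (rule times_diff_vcut[OF f4])
  have g3: "times_differentiable 3 ?g" using times_diff_mono[OF g4] by simp
  have cg: "continuous_on UNIV ?g" by (rule times_diff_continuous[OF g3]) simp
  define u where "u c = smear (mode S \<eta> c) f" for c
  note w = continuous_mode[of UNIV S \<eta>] mode_support[OF S0, of \<eta>]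
  have cut: "(\<lambda>v. bump S v ^ 5 * u c v) = smear (mode S \<eta> c) ?g" for c
    unfolding u_def using smear_sum_mult(1)[OF w cf, where c = "\<lambda>v. bump S v ^ 5"] by auto
  have u4: "times_differentiable 4 (u c)" for c
    unfolding u_def by (rule times_diff_smear[OF w]) (use f in \<open>simp add: numeral_eq_Suc\<close>)
  define H where "H c v = diffusion (u c) v - (fst \<eta> + v \<bullet> snd \<eta>) * u (c + pi / 2) v" for c v
  have H: "H c v = (LBINT y. cos (\<eta> \<bullet> y + c) * source S f h v y)" for c v
    unfolding H_def u_def source_def by (rule modulated_equation[OF S0 f3 h eq])
  have upi: "u pi v = - u 0 v" for v
    unfolding u_def smear_def mode_def by simp
  have H0: "H 0 = (\<lambda>v. diffusion (u 0) v - (fst \<eta> + v \<bullet> snd \<eta>) * u (pi / 2) v)"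
    and H1: "H (pi / 2) = (\<lambda>v. diffusion (u (pi / 2)) v + (fst \<eta> + v \<bullet> snd \<eta>) * u 0 v)"
    by (rule ext, simp add: H_def upi)+
  have HN: "(H 0 v)^2 + (H (pi / 2) v)^2 = (norm (fourier (\<lambda>y. complex_of_real (source S f h v y)) \<eta>))^2" for v
    unfolding norm_fourier_real[OF source_slice(3)[OF S0 cf h]] H by simp
  have uN: "(u 0 v)^2 + (u (pi / 2) v)^2 = (norm (spec S f v \<eta>))^2" for v
    unfolding norm_spec[OF S0 cf] u_def by simp
  define ED where "ED c = energy_density \<gamma> (snd \<eta>) (\<lambda>v. bump S v ^ 5 * u c v)" for c
  have ED: "ED 0 v + ED (pi / 2) v = spectral_density \<gamma> S ?g \<eta> v" for v
    unfolding ED_def energy_density_def spectral_density_def cut lap_smear[OF w g3]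
      norm_spec[OF S0 cg] norm_spec[OF S0 continuous_vlap[OF g3]] power_mult_distrib
    by (simp add: algebra_simps)
  have EDi: "integrable lborel (ED c)" "0 \<le> ED c v" for c v
  proof -
    have t: "times_differentiable 4 (\<lambda>v. bump S v ^ 5 * u c v)"
      by (intro times_diff_mult times_diff_bump u4) simp
    show "integrable lborel (ED c)"
      unfolding ED_def
    proof (rule integrable_continuous_support)
      show "continuous_on UNIV (energy_density \<gamma> (snd \<eta>) (\<lambda>v. bump S v ^ 5 * u c v))"
        by (rule continuous_energy_density) (use times_diff_mono[OF t] k in auto)
      show "energy_density \<gamma> (snd \<eta>) (\<lambda>v. bump S v ^ 5 * u c v) v = 0" if "norm v > S" for v
        by (rule energy_density_eq_0[OF _ that]) (use S0 in \<open>simp add: bump_eq_0\<close>)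
    qed
    show "0 \<le> ED c v" unfolding ED_def energy_density_def by (intro add_nonneg_nonneg mult_nonneg_nonneg) auto
  qed
  let ?R = "\<lambda>v. 2 * bump (2 * S) v * ((H 0 v)^2 + (H (pi / 2) v)^2 + ((u 0 v)^2 + (u (pi / 2) v)^2))"
  have "(\<integral>\<^sup>+v. ennreal (spectral_density \<gamma> S ?g \<eta> v) \<partial>lborel) = ennreal (LBINT v. ED 0 v + ED (pi / 2) v)"
    unfolding ED[symmetric] by (rule nn_integral_eq_integral) (use EDi in auto)
  also have "\<dots> \<le> ennreal (const0 K * (10^8 * K^4) * (LBINT v. ?R v))"
    unfolding ED_def H0 H1 by (intro ennreal_leI localized_estimate[OF k u4 u4 S])
  also have "\<dots> = ennreal (const0 K * (10^8 * K^4)) * ennreal (LBINT v. ?R v)"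
    by (rule ennreal_mult''[OF Bochner_Integration.integral_nonneg]) (simp add: bump_bounds)
  also have "\<dots> \<le> ennreal (const0 K * (10^8 * K^4)) * (\<integral>\<^sup>+v. ennreal (?R v) \<partial>lborel)"
    by (intro mult_left_mono ennreal_integral_le) (simp_all add: bump_bounds)
  also have "(\<lambda>v. ennreal (?R v)) = (\<lambda>v. ennreal (2 * bump (2 * S) v * (norm (fourier (\<lambda>y. complex_of_real (source S f h v y)) \<eta>))^2)
          + ennreal (2 * bump (2 * S) v * (norm (spec S f v \<eta>))^2))"
    unfolding HN uN distrib_left by (intro ext ennreal_plus) (simp_all add: bump_bounds)
  finally show ?thesis .
qed

text \<open>The power of 2 pi is Plancherel's constant in the four variables (t, x). The factor 1298
  is 2 * (648 + 1): the velocity weight is at most 2, the source contributes 648 and f itself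
  1.\<close>

definition const1 :: real where
  "const1 = const0 K * (10^8 * K^4) * ((2 * pi) ^ 4 * 1298)"

lemma const1_pos: "const1 > 0"
  unfolding const1_def using const0_pos K by (intro mult_pos_pos) auto

text \<open>The weight on the right of \<open>spectral_estimate\<close> restricts to |v| \<le> 2 S,
  where \<open>sq_source_le\<close> bounds the source by f and h uniformly in S. Plancherel returns
  from frequencies to f and h.\<close>

lemma integrated_estimate:
  fixes f h :: "phase \<Rightarrow> real"
  assumes S: "S \<ge> 1" and f: "times_differentiable 5 f" and h: "continuous_on UNIV h"
    and eq: "\<And>p. free_transport f p + vdiffusion f p = h p"
  shows "(\<integral>\<^sup>+\<eta>. \<integral>\<^sup>+v. ennreal (spectral_density \<gamma> S (vcut S f) \<eta> v) \<partial>lborel \<partial>lborel)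
    \<le> ennreal const1 * (sqnorm f + sqnorm h)"
proof -
  have S0: "S > 0" using S by simp
  have cf: "continuous_on UNIV f" by (rule times_diff_continuous[OF f]) simp
  note [measurable] = borel_measurable_continuous_onI[OF cf] borel_measurable_continuous_onI[OF h]
  let ?b = "\<lambda>v :: real^3. 2 * bump (2 * S) v"
  let ?s = "\<lambda>v y. complex_of_real (source S f h v y)" and ?u = "\<lambda>v y. complex_of_real (bump S y ^ 3 * f (point y v))"
  have C: "const0 K * (10^8 * K^4) \<ge> 0" using const0_pos K by simp
  have cs: "continuous_on UNIV (\<lambda>z. ?s (fst z) (snd z))" "continuous_on UNIV (\<lambda>z. ?u (fst z) (snd z))"
    by (intro continuous_intros source_slice(1)[OF S0 cf h] bump_slice(1)[OF S0 cf])+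
  have zs: "norm y > S \<Longrightarrow> ?s v y = 0" "norm y > S \<Longrightarrow> ?u v y = 0" for v y
    using source_slice(2)[OF S0 cf h] bump_slice(2)[OF S0 cf] by (simp_all only: of_real_0)
  have bm[measurable]: "?b \<in> borel_measurable borel"
    by (intro borel_measurable_continuous_onI continuous_intros continuous_bump)
  have b0: "0 \<le> ?b v" for v by (simp add: bump_bounds)
  have cF: "continuous_on UNIV (\<lambda>z. fourier (?s (fst z)) (snd z))" "continuous_on UNIV (\<lambda>z. fourier (?u (fst z)) (snd z))"
    by (rule continuous_fourier_parameter[OF cs(1) zs(1)], assumption, rule continuous_fourier_parameter[OF cs(2) zs(2)])
  have P1: "(\<integral>\<^sup>+\<eta>. \<integral>\<^sup>+v. ennreal (?b v * (norm (fourier (?s v) \<eta>))^2) \<partial>lborel \<partial>lborel)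
      = ennreal ((2 * pi) ^ DIM(spacetime)) * (\<integral>\<^sup>+v. ennreal (?b v) * sqnorm (?s v) \<partial>lborel)"
    "(\<lambda>v. ennreal (?b v) * sqnorm (?s v)) \<in> borel_measurable borel"
    by (rule weighted_plancherel[OF cs(1) zs(1) bm b0], assumption)+
  have P2: "(\<integral>\<^sup>+\<eta>. \<integral>\<^sup>+v. ennreal (?b v * (norm (fourier (?u v) \<eta>))^2) \<partial>lborel \<partial>lborel)
      = ennreal ((2 * pi) ^ DIM(spacetime)) * (\<integral>\<^sup>+v. ennreal (?b v) * sqnorm (?u v) \<partial>lborel)"
    "(\<lambda>v. ennreal (?b v) * sqnorm (?u v)) \<in> borel_measurable borel"
    by (rule weighted_plancherel[OF cs(2) zs(2) bm b0], assumption)+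
  define M1 where "M1 z = ennreal (?b (snd z) * (norm (fourier (?s (snd z)) (fst z)))^2)" for z
  define M2 where "M2 z = ennreal (?b (snd z) * (norm (fourier (?u (snd z)) (fst z)))^2)" for z
  have swc: "continuous_on UNIV (\<lambda>z :: spacetime \<times> (real^3). (snd z, fst z))" by (intro continuous_intros)
  have Mm: "M1 \<in> borel_measurable (lborel \<Otimes>\<^sub>M lborel)" "M2 \<in> borel_measurable (lborel \<Otimes>\<^sub>M lborel)"
  proof -
    have c: "continuous_on UNIV (\<lambda>z. norm (fourier (?s (snd z)) (fst z)))" "continuous_on UNIV (\<lambda>z. norm (fourier (?u (snd z)) (fst z)))"
      by (rule continuous_on_norm, rule continuous_on_compose2[OF cF(1) swc, simplified fst_conv snd_conv], rule subset_UNIV,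
          rule continuous_on_norm, rule continuous_on_compose2[OF cF(2) swc, simplified fst_conv snd_conv], rule subset_UNIV)
    have cb: "continuous_on UNIV (\<lambda>z :: spacetime \<times> (real^3). bump (2 * S) (snd z))"
      by (rule continuous_on_compose2[OF continuous_bump[of UNIV]]) (auto intro!: continuous_intros)
    show "M1 \<in> borel_measurable (lborel \<Otimes>\<^sub>M lborel)" "M2 \<in> borel_measurable (lborel \<Otimes>\<^sub>M lborel)"
      unfolding M1_def[abs_def] M2_def[abs_def] lborel_prod
      by (simp_all only: measurable_lborel2, (intro measurable_compose[OF _ measurable_ennreal] borel_measurable_continuous_onI continuous_intros cb c)+)
  qed
  have N1: "(\<lambda>\<eta>. \<integral>\<^sup>+v. M1 (\<eta>, v) \<partial>lborel) \<in> borel_measurable lborel" "(\<lambda>\<eta>. \<integral>\<^sup>+v. M2 (\<eta>, v) \<partial>lborel) \<in> borel_measurable lborel"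
    using lborel.borel_measurable_nn_integral_fst[OF Mm(1)] lborel.borel_measurable_nn_integral_fst[OF Mm(2)] by simp_all
  have N2: "(\<lambda>v. M1 (\<eta>, v)) \<in> borel_measurable lborel" "(\<lambda>v. M2 (\<eta>, v)) \<in> borel_measurable lborel" for \<eta>
    using Mm by (auto intro: measurable_compose[OF measurable_Pair1'])
  let ?C = "ennreal (const0 K * (10^8 * K^4))"
  have "(\<integral>\<^sup>+\<eta>. \<integral>\<^sup>+v. ennreal (spectral_density \<gamma> S (vcut S f) \<eta> v) \<partial>lborel \<partial>lborel)
    \<le> (\<integral>\<^sup>+\<eta>. ?C * (\<integral>\<^sup>+v. M1 (\<eta>, v) + M2 (\<eta>, v) \<partial>lborel) \<partial>lborel)"
  proof (rule nn_integral_mono_AE, rule eventually_mono[OF AE_snd_ne_0])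
    fix \<eta> :: spacetime assume "snd \<eta> \<noteq> 0"
    from spectral_estimate[OF S f h eq this]
    show "(\<integral>\<^sup>+v. ennreal (spectral_density \<gamma> S (vcut S f) \<eta> v) \<partial>lborel) \<le> ?C * (\<integral>\<^sup>+v. M1 (\<eta>, v) + M2 (\<eta>, v) \<partial>lborel)"
      by (simp add: M1_def M2_def spec_def[abs_def])
  qed
  also have "\<dots> = ?C * ((\<integral>\<^sup>+\<eta>. \<integral>\<^sup>+v. M1 (\<eta>, v) \<partial>lborel \<partial>lborel) + (\<integral>\<^sup>+\<eta>. \<integral>\<^sup>+v. M2 (\<eta>, v) \<partial>lborel \<partial>lborel))"
    using N1 N2 by (simp add: nn_integral_add nn_integral_cmult)
  also have "\<dots> = ?C * (ennreal ((2 * pi) ^ 4) * (\<integral>\<^sup>+v. ennreal (?b v) * sqnorm (?s v) \<partial>lborel)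
     + ennreal ((2 * pi) ^ 4) * (\<integral>\<^sup>+v. ennreal (?b v) * sqnorm (?u v) \<partial>lborel))"
    unfolding M1_def M2_def fst_conv snd_conv P1(1) P2(1) by simp
  also have "\<dots> = ?C * ennreal ((2 * pi) ^ 4) * (\<integral>\<^sup>+v. ennreal (?b v) * (sqnorm (?s v) + sqnorm (?u v)) \<partial>lborel)"
    using P1(2) P2(2) by (simp add: nn_integral_add distrib_left mult.assoc)
  also have "(\<integral>\<^sup>+v. ennreal (?b v) * (sqnorm (?s v) + sqnorm (?u v)) \<partial>lborel)
    \<le> (\<integral>\<^sup>+v. \<integral>\<^sup>+y. ennreal 1298 * (ennreal ((norm (f (point y v)))^2) + ennreal ((norm (h (point y v)))^2)) \<partial>lborel \<partial>lborel)"
  proof (rule nn_integral_mono)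
    fix v :: "real^3"
    have sm: "?s v \<in> borel_measurable borel" "?u v \<in> borel_measurable borel"
      by (rule borel_measurable_continuous_onI, rule continuous_slice2[OF cs(1)], rule borel_measurable_continuous_onI, rule continuous_slice2[OF cs(2)])
    show "ennreal (?b v) * (sqnorm (?s v) + sqnorm (?u v))
      \<le> (\<integral>\<^sup>+y. ennreal 1298 * (ennreal ((norm (f (point y v)))^2) + ennreal ((norm (h (point y v)))^2)) \<partial>lborel)"
    proof (cases "norm v \<le> 2 * S")
      case True
      have "ennreal (?b v) * (sqnorm (?s v) + sqnorm (?u v)) \<le> ennreal 2 * (sqnorm (?s v) + sqnorm (?u v))"
        by (intro mult_right_mono ennreal_leI) (simp_all add: bump_bounds)
      also have "\<dots> = (\<integral>\<^sup>+y. ennreal 2 * (ennreal ((norm (?s v y))^2) + ennreal ((norm (?u v y))^2)) \<partial>lborel)"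
        by (rule mult_sqnorm_add[OF sm])
      also have "\<dots> \<le> (\<integral>\<^sup>+y. ennreal 1298 * (ennreal ((norm (f (point y v)))^2) + ennreal ((norm (h (point y v)))^2)) \<partial>lborel)"
      proof (rule nn_integral_mono)
        fix y :: spacetime
        have "(bump S y ^ 3)^2 \<le> 1" using bump_bounds[of S y] by (simp add: power_le_one)
        then have "(bump S y ^ 3 * f (point y v))^2 \<le> 1 * (f (point y v))^2"
          unfolding power_mult_distrib[of "bump S y ^ 3"] by (intro mult_right_mono) auto
        note 1 = sq_source_le[OF S True, of f h y] this
        have A: "a \<le> 2 * q + 648 * p \<Longrightarrow> b \<le> 1 * p \<Longrightarrow> 0 \<le> q \<Longrightarrow> 2 * (a + b) \<le> 1298 * (p + q)" for a b p q :: real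
          by (simp add: algebra_simps)
        have le: "2 * ((norm (?s v y))^2 + (norm (?u v y))^2) \<le> 1298 * ((norm (f (point y v)))^2 + (norm (h (point y v)))^2)"
          unfolding norm_of_real real_norm_def power2_abs by (rule A[OF 1 zero_le_power2])
        show "ennreal 2 * (ennreal ((norm (?s v y))^2) + ennreal ((norm (?u v y))^2))
          \<le> ennreal 1298 * (ennreal ((norm (f (point y v)))^2) + ennreal ((norm (h (point y v)))^2))"
          using ennreal_leI[OF le] by (simp only: ennreal_mult ennreal_plus zero_le_power2 zero_le_numeral add_nonneg_nonneg)
      qed
      finally show ?thesis .
    next
      case False
      then show ?thesis using bump_eq_0[of "2 * S" v] S0 by simp
    qed
  qed
  also have "\<dots> = ennreal 1298 * (sqnorm f + sqnorm h)"
  proof -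
    have "(\<integral>\<^sup>+v. \<integral>\<^sup>+y. ennreal 1298 * (ennreal ((norm (f (point y v)))^2) + ennreal ((norm (h (point y v)))^2)) \<partial>lborel \<partial>lborel)
      = (\<integral>\<^sup>+p. ennreal 1298 * (ennreal ((norm (f p))^2) + ennreal ((norm (h p))^2)) \<partial>lborel)"
      by (rule phase_nn_integral(1)[symmetric]) measurable
    then show ?thesis by (simp only: mult_sqnorm_add[OF \<open>f \<in> borel_measurable borel\<close> \<open>h \<in> borel_measurable borel\<close>])
  qed
  finally have "(\<integral>\<^sup>+\<eta>. \<integral>\<^sup>+v. ennreal (spectral_density \<gamma> S (vcut S f) \<eta> v) \<partial>lborel \<partial>lborel)
    \<le> ?C * ennreal ((2 * pi) ^ 4) * (ennreal 1298 * (sqnorm f + sqnorm h))"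
    by (simp only: mult_left_mono zero_le)
  also have "ennreal const1 = ?C * (ennreal ((2 * pi) ^ 4) * ennreal 1298)"
    unfolding const1_def using C by (simp only: ennreal_mult mult_nonneg_nonneg zero_le_numeral zero_le_power pi_ge_zero)
  then have "?C * ennreal ((2 * pi) ^ 4) * (ennreal 1298 * (sqnorm f + sqnorm h)) = ennreal const1 * (sqnorm f + sqnorm h)"
    by (simp only: mult.assoc)
  finally show ?thesis .
qed

end

section \<open>Removing the cutoffs from the velocity terms\<close>

lemma vfield_point:
  assumes g: "times_differentiable 1 g"
  shows "vfield a g (point y v) = field a (\<lambda>w. g (point y w)) v"
proof -
  let ?e = "\<lambda>w :: real^3. (0, 0, w) :: phase"
  have l: "linear ?e" by (rule linearI) auto
  have B: "?e b \<in> Basis \<or> ?e b = 0" if "b \<in> Basis" for b using Basis_vel[OF that] by simp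
  have "partial b (\<lambda>w. g (point y w)) v = partial (0, 0, b) g (point y v)" for b
    using times_diff_affine(2)[of ?e g b "(fst y, snd y, 0)" v] l B g by simp
  then show ?thesis by (simp add: vfield_def field_def)
qed

lemma vlap_point:
  assumes g: "times_differentiable 2 g"
  shows "vlap b g (point y v) = lap b (\<lambda>w. g (point y w)) v"
proof -
  have "times_differentiable 1 (vfield a g)" for a by (rule times_diff_vfield[OF g]) simp
  moreover have "times_differentiable 1 g" using times_diff_mono[OF g] by simp
  ultimately show ?thesis by (simp add: vlap_def lap_def vfield_point)
qed

lemma velocity_slice:
  "times_differentiable n g \<Longrightarrow> times_differentiable n (\<lambda>w. g (point y w))" for g :: "phase \<Rightarrow> real"
proof -
  let ?e = "\<lambda>w :: real^3. (0, 0, w) :: phase"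
  have l: "linear ?e" by (rule linearI) auto
  have B: "?e b \<in> Basis \<or> ?e b = 0" if "b \<in> Basis" for b using Basis_vel[OF that] by simp
  show "times_differentiable n g \<Longrightarrow> times_differentiable n (\<lambda>w. g (point y w))"
    using times_diff_affine(1)[of ?e n g "(fst y, snd y, 0)"] l B by simp
qed

lemma inverse_Suc_tendsto: "(\<lambda>n. c / real (Suc n)) \<longlonglongrightarrow> 0" "(\<lambda>n. c / (real (Suc n))^2) \<longlonglongrightarrow> 0"
proof -
  show 1: "(\<lambda>n. c / real (Suc n)) \<longlonglongrightarrow> 0" for c
    using tendsto_mult_right_zero[OF LIMSEQ_inverse_real_of_nat, of c] by (simp add: divide_inverse)
  show "(\<lambda>n. c / (real (Suc n))^2) \<longlonglongrightarrow> 0"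
    using tendsto_mult_right_zero[OF 1[of 1], of "1::real"] tendsto_mult_zero[OF 1[of c] 1[of 1]]
    by (simp add: power2_eq_square)
qed

lemma bump_tendsto: "(\<lambda>n. bump (real (Suc n)) v ^ m) \<longlonglongrightarrow> 1"
proof -
  have "(\<lambda>n. max 0 (1 - (v \<bullet> v) / (real (Suc n))^2) ^ m) \<longlonglongrightarrow> max 0 (1 - 0) ^ m"
    by (intro tendsto_intros inverse_Suc_tendsto)
  then show ?thesis by (simp add: bump_def)
qed

text \<open>Every derivative on the cutoff brings a factor that tends to 0. Pointwise convergence is
  what Fatou's lemma will ask for.\<close>

lemma lap_bump_tendsto:
  assumes u: "times_differentiable 2 u"
  shows "(\<lambda>n. lap b (\<lambda>v. bump (real (Suc n)) v ^ 5 * u v) v) \<longlonglongrightarrow> lap b u v"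
proof -
  let ?\<chi> = "\<lambda>n v. bump (real (Suc n)) v ^ 5"
  have u1: "times_differentiable 1 u" using times_diff_mono[OF u] by simp
  have c1: "times_differentiable 1 (?\<chi> n)" for n by (rule times_diff_bump) simp
  have fu: "times_differentiable 1 (field a u)" for a by (rule times_diff_field'[OF u]) simp
  have fc: "times_differentiable 1 (field a (?\<chi> n))" for a n
    by (rule times_diff_field'[OF times_diff_bump[of 2]]) simp_all
  have f: "field a (\<lambda>v. ?\<chi> n v * u v) = (\<lambda>v. ?\<chi> n v * field a u v + field a (?\<chi> n) v * u v)" for a n
    by (rule ext, rule field_mult[OF c1 u1])
  have e: "field a (field a (\<lambda>v. ?\<chi> n v * u v)) v
     = (?\<chi> n v * field a (field a u) v + field a (?\<chi> n) v * field a u v)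
       + (field a (?\<chi> n) v * field a u v + field a (field a (?\<chi> n)) v * u v)" for a n
    unfolding f field_add[OF times_diff_mult[OF c1 fu] times_diff_mult[OF fc u1]]
      field_mult[OF c1 fu] field_mult[OF fc u1] ..
  have b1: "(\<lambda>n. field a (?\<chi> n) v) \<longlonglongrightarrow> 0" for a
  proof (rule Lim_null_comparison[OF _ inverse_Suc_tendsto(1)[of 10]])
    have "\<bar>field a (?\<chi> n) v\<bar> \<le> 10 / real (Suc n)" for n
    proof -
      have "\<bar>field a (?\<chi> n) v\<bar> \<le> real 5 * bump (real (Suc n)) v ^ (5 - 1) * (2 / real (Suc n))"
        by (rule field_bump_bound) auto
      also have "\<dots> \<le> real 5 * 1 * (2 / real (Suc n))"
        by (intro mult_right_mono mult_left_mono power_le_one bump_bounds) auto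
      finally show ?thesis by simp
    qed
    then show "\<forall>\<^sub>F n in sequentially. norm (field a (?\<chi> n) v) \<le> 10 / real (Suc n)" by simp
  qed
  have b2: "(\<lambda>n. field a (field a (?\<chi> n)) v) \<longlonglongrightarrow> 0" for a
  proof (rule Lim_null_comparison[OF _ inverse_Suc_tendsto(2)[of 90]])
    have "\<bar>field a (field a (?\<chi> n)) v\<bar> \<le> 90 / (real (Suc n))^2" for n
    proof -
      have "\<bar>field a (field a (?\<chi> n)) v\<bar> \<le> bump (real (Suc n)) v ^ 3 * (90 / (real (Suc n))^2)"
        by (rule field_field_bump) simp
      also have "\<dots> \<le> 1 * (90 / (real (Suc n))^2)"
        by (intro mult_right_mono power_le_one bump_bounds) auto
      finally show ?thesis by simp
    qed
    then show "\<forall>\<^sub>F n in sequentially. norm (field a (field a (?\<chi> n)) v) \<le> 90 / (real (Suc n))^2" by simp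
  qed
  have "(\<lambda>n. field a (field a (\<lambda>v. ?\<chi> n v * u v)) v) \<longlonglongrightarrow> (1 * field a (field a u) v + 0 * field a u v) + (0 * field a u v + 0 * u v)" for a
    unfolding e by (intro tendsto_intros b1 b2 bump_tendsto)
  then have "(\<lambda>n. \<Sum>i\<in>UNIV. field (b, i) (field (b, i) (\<lambda>v. ?\<chi> n v * u v)) v) \<longlonglongrightarrow> (\<Sum>i\<in>UNIV. field (b, i) (field (b, i) u) v)"
    by (intro tendsto_sum) simp
  then show ?thesis by (simp add: lap_def)
qed

lemma vfield_V: "vfield (True, j) g = V j g"
  by (rule ext) (simp add: vfield_def V_def field_dir_def grad_v_def inner_vec_def)

lemma vfield_grad: "vfield (False, i) g = partial (0, 0, axis i 1) g"
  by (rule ext) (simp add: vfield_def field_dir_def axis_def if_distrib[of "\<lambda>x. x * _"] cong: if_cong)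

lemma vlap_eq: "vlap False f p = - Dv_squared f p" "vlap True f p = - rot_squared f p"
  by (simp_all add: vlap_def Dv_squared_def rot_squared_def div_v_def grad_v_def vfield_grad vfield_V)

lemma vfield_minus:
  assumes "times_differentiable 1 g"
  shows "vfield a (\<lambda>q. - g q) p = - vfield a g p"
proof -
  have "partial b (\<lambda>q. - g q) p = - partial b g p" for b
    using partial_diff[OF times_differentiableD[OF times_diff_const[of 1 0]] times_differentiableD[OF assms], where b = b] by simp
  then show ?thesis by (simp add: vfield_def sum_negf)
qed

text \<open>The components of \<open>rot_v\<close> are minus the rotation fields; the sign occurs in
  the gradient and again in the divergence, and cancels.\<close>

lemma (in coefficients) kinetic_op_eq:
  assumes f: "times_differentiable 3 f"
  shows "kinetic_op (sig False) (sig True) F f p = free_transport f p + vdiffusion f p"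
proof -
  have r: "rot_v g p $ i = - V i g p" for g i p
    unfolding rot_v_eq_V by (simp add: axis_def if_distrib cong: if_cong)
  have t: "times_differentiable 1 (\<lambda>q. sig (fst a) (vel q) * vfield a f q)" for a
    by (intro times_diff_mult times_diff_vel times_diff_mono[OF sig_td] times_diff_vfield[OF f]) simp_all
  have 1: "div_v (\<lambda>q. sig False (vel q) *\<^sub>R grad_v f q) p
     = (\<Sum>i\<in>UNIV. vfield (False, i) (\<lambda>q. sig False (vel q) * vfield (False, i) f q) p)"
    by (simp add: div_v_def grad_v_def vfield_grad)
  have 2: "rot_div_v (\<lambda>q. sig True (vel q) *\<^sub>R rot_v f q) p
     = (\<Sum>i\<in>UNIV. vfield (True, i) (\<lambda>q. sig True (vel q) * vfield (True, i) f q) p)"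
  proof -
    have "vfield (True, i) (\<lambda>q. - (sig True (vel q) * vfield (True, i) f q)) p
      = - vfield (True, i) (\<lambda>q. sig True (vel q) * vfield (True, i) f q) p" for i
      using vfield_minus[OF t[of "(True, i)"]] by simp
    then show ?thesis by (simp add: rot_div_v_def r vfield_V sum_negf)
  qed
  show ?thesis
    unfolding kinetic_op_def 1 2 free_transport_def vdiffusion_def sum_bool_3 by simp
qed

text \<open>Plancherel read backwards. Its constant is at least 1 and is dropped, which is all that
  an upper bound requires.\<close>

lemma spec_term_bound:
  fixes g :: "phase \<Rightarrow> real"
  assumes S: "S > 0" and g: "continuous_on UNIV g" and a[measurable]: "a \<in> borel_measurable borel"
    and B: "(\<integral>\<^sup>+\<eta>. \<integral>\<^sup>+v. ennreal ((a v)^2 * (norm (spec S g v \<eta>))^2) \<partial>lborel \<partial>lborel) \<le> B"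
  shows "sqnorm (\<lambda>p. a (vel p) * (bump S (fst p, fst (snd p)) ^ 3 * g p)) \<le> B"
proof -
  let ?u = "\<lambda>v y. complex_of_real (bump S y ^ 3 * g (point y v))"
  have c: "continuous_on UNIV (\<lambda>z. ?u (fst z) (snd z))" by (intro continuous_intros bump_slice(1)[OF S g])
  have z: "norm y > S \<Longrightarrow> ?u v y = 0" for v y using bump_slice(2)[OF S g] by (simp only: of_real_0)
  have ma: "(\<lambda>v. (a v)^2) \<in> borel_measurable borel" by measurable
  have m: "(\<lambda>p. a (vel p) * (bump S (fst p, fst (snd p)) ^ 3 * g p)) \<in> borel_measurable borel"
  proof (rule borel_measurable_times)
    show "(\<lambda>p. a (vel p)) \<in> borel_measurable borel"
      by (rule measurable_compose[OF _ a]) (intro borel_measurable_continuous_onI continuous_intros)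
    show "(\<lambda>p. bump S (fst p, fst (snd p)) ^ 3 * g p) \<in> borel_measurable borel"
      by (intro borel_measurable_continuous_onI continuous_intros g continuous_on_compose2[OF continuous_bump[of UNIV]]) auto
  qed
  have "sqnorm (\<lambda>p. a (vel p) * (bump S (fst p, fst (snd p)) ^ 3 * g p))
    = (\<integral>\<^sup>+v. \<integral>\<^sup>+y. ennreal ((norm (a v * (bump S y ^ 3 * g (point y v))))^2) \<partial>lborel \<partial>lborel)"
    unfolding sqnorm_def using m by (subst phase_nn_integral(1)) simp_all
  also have "\<dots> = (\<integral>\<^sup>+v. ennreal ((a v)^2) * sqnorm (?u v) \<partial>lborel)"
  proof (intro nn_integral_cong)
    fix v
    have [measurable]: "?u v \<in> borel_measurable borel" by (rule borel_measurable_continuous_onI, rule continuous_slice2[OF c])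
    have "(\<integral>\<^sup>+y. ennreal ((norm (a v * (bump S y ^ 3 * g (point y v))))^2) \<partial>lborel)
      = (\<integral>\<^sup>+y. ennreal ((a v)^2) * ennreal ((norm (?u v y))^2) \<partial>lborel)"
      unfolding norm_of_real by (intro nn_integral_cong) (simp add: ennreal_mult[symmetric] power_mult_distrib)
    also have "\<dots> = ennreal ((a v)^2) * sqnorm (?u v)"
      unfolding sqnorm_def by (rule nn_integral_cmult) measurable
    finally show "(\<integral>\<^sup>+y. ennreal ((norm (a v * (bump S y ^ 3 * g (point y v))))^2) \<partial>lborel) = ennreal ((a v)^2) * sqnorm (?u v)" .
  qed
  also have "\<dots> = 1 * (\<integral>\<^sup>+v. ennreal ((a v)^2) * sqnorm (?u v) \<partial>lborel)" by simp
  also have "\<dots> \<le> ennreal ((2 * pi) ^ DIM(spacetime)) * (\<integral>\<^sup>+v. ennreal ((a v)^2) * sqnorm (?u v) \<partial>lborel)"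
  proof (rule mult_right_mono)
    show "1 \<le> ennreal ((2 * pi) ^ DIM(spacetime))"
      unfolding ennreal_1[symmetric] using pi_gt3 by (intro ennreal_leI one_le_power) linarith
  qed simp
  also have "\<dots> = (\<integral>\<^sup>+\<eta>. \<integral>\<^sup>+v. ennreal ((a v)^2 * (norm (spec S g v \<eta>))^2) \<partial>lborel \<partial>lborel)"
    unfolding spec_def by (rule weighted_plancherel(1)[OF c z ma, symmetric]) auto
  finally show ?thesis using B by simp
qed

lemma sqnorm_fatou:
  fixes G :: "nat \<Rightarrow> 'a::euclidean_space \<Rightarrow> 'b::euclidean_space"
  assumes m: "\<And>n. G n \<in> borel_measurable borel" and lim: "AE x in lborel. (\<lambda>n. G n x) \<longlonglongrightarrow> g x"
    and B: "\<And>n. sqnorm (G n) \<le> B"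
  shows "sqnorm g \<le> B"
proof -
  note [measurable] = m
  have "sqnorm g = (\<integral>\<^sup>+x. liminf (\<lambda>n. ennreal ((norm (G n x))^2)) \<partial>lborel)"
    unfolding sqnorm_def
  proof (rule nn_integral_cong_AE, use lim in eventually_elim)
    fix x assume "(\<lambda>n. G n x) \<longlonglongrightarrow> g x"
    then have "(\<lambda>n. ennreal ((norm (G n x))^2)) \<longlonglongrightarrow> ennreal ((norm (g x))^2)" by (intro tendsto_intros)
    then show "ennreal ((norm (g x))^2) = liminf (\<lambda>n. ennreal ((norm (G n x))^2))"
      using lim_imp_Liminf[OF sequentially_bot] by metis
  qed
  also have "\<dots> \<le> liminf (\<lambda>n. sqnorm (G n))" unfolding sqnorm_def by (rule nn_integral_liminf) measurable
  also have "\<dots> \<le> liminf (\<lambda>n :: nat. B)" by (rule Liminf_mono) (simp add: B)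
  finally show ?thesis by (simp add: Liminf_const)
qed

context coefficients
begin

lemma spectral_terms:
  assumes S: "S \<ge> 1" and f: "times_differentiable 5 f" and h: "continuous_on UNIV h"
    and eq: "\<And>p. kinetic_op (sig False) (sig True) F f p = h p"
  defines "B \<equiv> ennreal const1 * (sqnorm f + sqnorm h)"
  shows "(\<integral>\<^sup>+\<eta>. \<integral>\<^sup>+v. ennreal ((japanese v powr (\<gamma> + 2))^2 * (norm (spec S (vcut S f) v \<eta>))^2) \<partial>lborel \<partial>lborel) \<le> B"
    and "(\<integral>\<^sup>+\<eta>. \<integral>\<^sup>+v. ennreal ((japanese v powr \<gamma>)^2 * (norm (spec S (vlap b (vcut S f)) v \<eta>))^2) \<partial>lborel \<partial>lborel) \<le> B"
    and "(\<integral>\<^sup>+\<eta>. \<integral>\<^sup>+v. ennreal ((rho \<gamma> (snd \<eta>) v)^2 * (norm (spec S (vcut S f) v \<eta>))^2) \<partial>lborel \<partial>lborel) \<le> B"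
proof -
  have f3: "times_differentiable 3 f" using times_diff_mono[OF f] by simp
  have "(\<integral>\<^sup>+\<eta>. \<integral>\<^sup>+v. ennreal (spectral_density \<gamma> S (vcut S f) \<eta> v) \<partial>lborel \<partial>lborel) \<le> B"
    unfolding B_def by (rule integrated_estimate[OF S f h]) (use eq kinetic_op_eq[OF f3] in simp)
  then have *: "(\<integral>\<^sup>+\<eta>. \<integral>\<^sup>+v. ennreal (T \<eta> v) \<partial>lborel \<partial>lborel) \<le> B"
    if "\<And>\<eta> v. T \<eta> v \<le> spectral_density \<gamma> S (vcut S f) \<eta> v" for T
    by (rule order_trans[rotated]) (intro nn_integral_mono ennreal_leI that)
  have p: "(japanese v powr (\<gamma> + 2))^2 = japanese v powr (2 * \<gamma> + 4)" for v
    by (simp add: power2_eq_square powr_add[symmetric] algebra_simps)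
  have a: "x \<le> x + y + z + w" "y \<le> x + y + z + w" "z \<le> x + y + z + w" "w \<le> x + y + z + w"
    if "0 \<le> x" "0 \<le> y" "0 \<le> z" "0 \<le> w" for x y z w :: real using that by auto
  show "(\<integral>\<^sup>+\<eta>. \<integral>\<^sup>+v. ennreal ((japanese v powr (\<gamma> + 2))^2 * (norm (spec S (vcut S f) v \<eta>))^2) \<partial>lborel \<partial>lborel) \<le> B"
    by (rule *) (unfold spectral_density_def p, rule a(1); simp)
  show "(\<integral>\<^sup>+\<eta>. \<integral>\<^sup>+v. ennreal ((japanese v powr \<gamma>)^2 * (norm (spec S (vlap b (vcut S f)) v \<eta>))^2) \<partial>lborel \<partial>lborel) \<le> B"
  proof (rule *)
    fix \<eta> v
    show "(japanese v powr \<gamma>)^2 * (norm (spec S (vlap b (vcut S f)) v \<eta>))^2 \<le> spectral_density \<gamma> S (vcut S f) \<eta> v"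
    proof (cases b)
      case True
      then have b: "b = True" by simp
      show ?thesis unfolding spectral_density_def b by (rule a(3); simp)
    next
      case False
      then have b: "b = False" by simp
      show ?thesis unfolding spectral_density_def b by (rule a(2); simp)
    qed
  qed
  show "(\<integral>\<^sup>+\<eta>. \<integral>\<^sup>+v. ennreal ((rho \<gamma> (snd \<eta>) v)^2 * (norm (spec S (vcut S f) v \<eta>))^2) \<partial>lborel \<partial>lborel) \<le> B"
    by (rule *) (unfold spectral_density_def, rule a(4); simp)
qed

text \<open>Let S run through n + 1. In the second order terms the velocity cutoff stands inside the
  derivatives, so their pointwise limit needs \<open>lap_bump_tendsto\<close>.\<close>

lemma velocity_estimates:
  assumes f: "times_differentiable 5 f" and h: "continuous_on UNIV h"
    and eq: "\<And>p. kinetic_op (sig False) (sig True) F f p = h p"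
  shows "sqnorm (\<lambda>p. japanese (vel p) powr (\<gamma> + 2) * f p) \<le> ennreal const1 * (sqnorm f + sqnorm h)"
    and "sqnorm (\<lambda>p. japanese (vel p) powr \<gamma> * vlap b f p) \<le> ennreal const1 * (sqnorm f + sqnorm h)"
proof -
  let ?S = "\<lambda>n. real (Suc n)" and ?\<theta> = "\<lambda>n p. bump (real (Suc n)) (fst p, fst (snd p)) ^ 3 :: real"
  have f2: "times_differentiable 2 f" and f4: "times_differentiable 4 f" using times_diff_mono[OF f] by simp_all
  have g4: "times_differentiable 4 (vcut (?S n) f)" for n by (rule times_diff_vcut[OF f4])
  have cg: "continuous_on UNIV (vcut (?S n) f)" "continuous_on UNIV (vlap b (vcut (?S n) f))" for n
    using times_diff_continuous[OF g4] continuous_vlap[OF times_diff_mono[OF g4]] by auto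
  have cth: "continuous_on UNIV (?\<theta> n)" for n
    by (intro continuous_intros continuous_on_compose2[OF continuous_bump[of UNIV]]) auto
  have J: "(\<lambda>v. japanese v powr s) \<in> borel_measurable borel" "(\<lambda>p :: phase. japanese (vel p) powr s) \<in> borel_measurable borel" for s
    using times_diff_continuous[OF times_diff_japanese[of 1 s]]
      times_diff_continuous[OF times_diff_vel[OF times_diff_japanese[of 1 s]]]
    by (auto intro!: borel_measurable_continuous_onI)
  have lim: "(\<lambda>n. ?\<theta> n p) \<longlonglongrightarrow> 1" for p by (rule bump_tendsto)
  have S1: "?S n \<ge> 1" "?S n > 0" for n by simp_all
  show "sqnorm (\<lambda>p. japanese (vel p) powr (\<gamma> + 2) * f p) \<le> ennreal const1 * (sqnorm f + sqnorm h)"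
  proof (rule sqnorm_fatou)
    show "(\<lambda>p. japanese (vel p) powr (\<gamma> + 2) * (?\<theta> n p * vcut (?S n) f p)) \<in> borel_measurable borel" for n
      by (intro borel_measurable_times J borel_measurable_continuous_onI[OF cth] borel_measurable_continuous_onI[OF cg(1)])
    have "(\<lambda>n. japanese (vel p) powr (\<gamma> + 2) * (?\<theta> n p * (bump (?S n) (vel p) ^ 5 * f p))) \<longlonglongrightarrow> japanese (vel p) powr (\<gamma> + 2) * (1 * (1 * f p))" for p
      by (intro tendsto_mult tendsto_const lim bump_tendsto)
    then show "AE p in lborel. (\<lambda>n. japanese (vel p) powr (\<gamma> + 2) * (?\<theta> n p * vcut (?S n) f p)) \<longlonglongrightarrow> japanese (vel p) powr (\<gamma> + 2) * f p"
      by simp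
    show "sqnorm (\<lambda>p. japanese (vel p) powr (\<gamma> + 2) * (?\<theta> n p * vcut (?S n) f p)) \<le> ennreal const1 * (sqnorm f + sqnorm h)" for n
      by (rule spec_term_bound[OF S1(2) cg(1) J(1) spectral_terms(1)[OF S1(1) f h eq]])
  qed
  show "sqnorm (\<lambda>p. japanese (vel p) powr \<gamma> * vlap b f p) \<le> ennreal const1 * (sqnorm f + sqnorm h)"
  proof (rule sqnorm_fatou)
    show "(\<lambda>p. japanese (vel p) powr \<gamma> * (?\<theta> n p * vlap b (vcut (?S n) f) p)) \<in> borel_measurable borel" for n
      by (intro borel_measurable_times J borel_measurable_continuous_onI[OF cth] borel_measurable_continuous_onI[OF cg(2)])
    have v: "(\<lambda>n. vlap b (vcut (?S n) f) p) \<longlonglongrightarrow> vlap b f p" for p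
    proof -
      have p: "p = point (fst p, fst (snd p)) (vel p)" by simp
      have "times_differentiable 2 (vcut (?S n) f)" for n using times_diff_mono[OF g4] by simp
      then have "vlap b (vcut (?S n) f) p = lap b (\<lambda>w. bump (?S n) w ^ 5 * f (point (fst p, fst (snd p)) w)) (vel p)" for n
        using vlap_point[of "vcut (?S n) f" b "(fst p, fst (snd p))" "vel p"] p by simp
      then show ?thesis
        using lap_bump_tendsto[OF velocity_slice[OF f2, of "(fst p, fst (snd p))"], of b "vel p"]
          vlap_point[OF f2, of b "(fst p, fst (snd p))" "vel p"] p by simp
    qed
    have "(\<lambda>n. japanese (vel p) powr \<gamma> * (?\<theta> n p * vlap b (vcut (?S n) f) p)) \<longlonglongrightarrow> japanese (vel p) powr \<gamma> * (1 * vlap b f p)" for p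
      by (intro tendsto_mult tendsto_const lim v)
    then show "AE p in lborel. (\<lambda>n. japanese (vel p) powr \<gamma> * (?\<theta> n p * vlap b (vcut (?S n) f) p)) \<longlonglongrightarrow> japanese (vel p) powr \<gamma> * vlap b f p"
      by simp
    show "sqnorm (\<lambda>p. japanese (vel p) powr \<gamma> * (?\<theta> n p * vlap b (vcut (?S n) f) p)) \<le> ennreal const1 * (sqnorm f + sqnorm h)" for n
      by (rule spec_term_bound[OF S1(2) cg(2) J(1) spectral_terms(2)[OF S1(1) f h eq]])
  qed
qed

end

section \<open>Fractional derivatives in x\<close>

lemma fourier_fubini:
  fixes u :: "'a::euclidean_space \<times> 'b::euclidean_space \<Rightarrow> complex"
  assumes c: "continuous_on UNIV u" and z: "\<And>x. norm x > r \<Longrightarrow> u x = 0"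
  shows "fourier u (\<tau>, k) = fourier (\<lambda>t. fourier (\<lambda>x. u (t, x)) k) \<tau>"
proof -
  have i: "integrable lborel (\<lambda>z. exp (- (\<i> * complex_of_real ((\<tau>, k) \<bullet> z))) * u z)"
    by (rule integrable_character_mult[OF integrable_continuous_support[OF c z]])
  have "fourier u (\<tau>, k) = (LBINT t. (LBINT x. exp (- (\<i> * complex_of_real ((\<tau>, k) \<bullet> (t, x)))) * u (t, x)))"
    unfolding fourier_def using lborel_pair.integral_fst'[of "\<lambda>z. exp (- (\<i> * complex_of_real ((\<tau>, k) \<bullet> z))) * u z"] i
    by (simp add: lborel_prod)
  also have "\<dots> = (LBINT t. exp (- (\<i> * complex_of_real (\<tau> \<bullet> t))) * (LBINT x. exp (- (\<i> * complex_of_real (k \<bullet> x))) * u (t, x)))"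
    by (simp add: exp_add[symmetric] ring_distribs flip: integral_mult_right_zero mult.assoc)
  finally show ?thesis by (simp add: fourier_def)
qed

text \<open>The transform in x alone, with t kept: the multipliers in the theorem act for fixed t
  and v, whereas \<open>spec\<close> transforms in t as well.\<close>

definition xspec :: "real \<Rightarrow> (phase \<Rightarrow> real) \<Rightarrow> phase \<Rightarrow> complex" where
  "xspec S g p = fourier (\<lambda>x. complex_of_real (bump S (fst p, x) ^ 3 * g (fst p, x, vel p))) (fst (snd p))"

lemma continuous_xspec:
  assumes S: "S > 0" and g: "continuous_on UNIV g"
  shows "continuous_on UNIV (xspec S g)"
proof -
  let ?g = "\<lambda>q x. complex_of_real (bump S (fst q, x) ^ 3 * g (fst q, x, snd q))"
  have "continuous_on UNIV (\<lambda>z. ?g (fst z) (snd z))"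
    by (intro continuous_intros continuous_on_compose2[OF continuous_bump[of UNIV]] continuous_on_compose2[OF g]) auto
  moreover have "?g q x = 0" if "norm x > S" for q x
  proof -
    have "norm (fst q, x) > S" using that norm_snd_le[of x "fst q"] by linarith
    then show ?thesis using S by (simp add: bump_eq_0)
  qed
  ultimately have F: "continuous_on UNIV (\<lambda>z. fourier (?g (fst z)) (snd z))"
    by (rule continuous_fourier_parameter)
  have "continuous_on UNIV (\<lambda>p :: phase. ((fst p, vel p), fst (snd p)))" by (intro continuous_intros)
  from continuous_on_compose2[OF F this] show ?thesis by (simp add: xspec_def[abs_def])
qed

lemma xspec_time_plancherel:
  assumes S: "S > 0" and g: "continuous_on UNIV g"
  shows "sqnorm (\<lambda>\<tau>. spec S g v (\<tau>, k)) = ennreal (2 * pi) * sqnorm (\<lambda>t. xspec S g (t, k, v))"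
proof -
  let ?u = "\<lambda>y. complex_of_real (bump S y ^ 3 * g (point y v))"
  have c: "continuous_on UNIV ?u" and z: "\<And>y. norm y > S \<Longrightarrow> ?u y = 0"
    using continuous_on_of_real[OF continuous_slice2[OF bump_slice(1)[OF S g], of v]] bump_slice(2)[OF S g]
    by (simp_all only: of_real_0)
  have x: "xspec S g (t, k, v) = fourier (\<lambda>x. ?u (t, x)) k" for t by (simp add: xspec_def)
  have "(\<lambda>\<tau>. spec S g v (\<tau>, k)) = fourier (\<lambda>t. xspec S g (t, k, v))"
    unfolding x spec_def by (rule ext) (rule fourier_fubini[OF c z])
  moreover have "continuous_on UNIV (\<lambda>t. xspec S g (t, k, v))"
    by (rule continuous_on_compose2[OF continuous_xspec[OF S g]]) (auto intro!: continuous_intros)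
  moreover have "xspec S g (t, k, v) = 0" if "norm t > S" for t
  proof -
    have "norm (t, x) \<ge> S" for x :: "real^3" using that norm_fst_le[of t x] by linarith
    then have "bump S (t, x) = 0" for x :: "real^3" by (rule bump_eq_0[OF S])
    then show ?thesis by (simp add: xspec_def fourier_def)
  qed
  ultimately show ?thesis using plancherel_continuous[of "\<lambda>t. xspec S g (t, k, v)" S] by simp
qed

text \<open>The weight does not depend on the frequency of t, so Plancherel in time can be applied
  for fixed k and v.\<close>

lemma xspec_weighted:
  assumes S: "S > 0" and g: "continuous_on UNIV g" and a: "(\<lambda>p :: phase. a (fst (snd p)) (vel p) :: real) \<in> borel_measurable borel"
  shows "sqnorm (\<lambda>p. complex_of_real (a (fst (snd p)) (vel p)) * xspec S g p)
    \<le> (\<integral>\<^sup>+\<eta>. \<integral>\<^sup>+v. ennreal ((a (snd \<eta>) v)^2 * (norm (spec S g v \<eta>))^2) \<partial>lborel \<partial>lborel)"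
proof -
  note [measurable] = a borel_measurable_continuous_onI[OF continuous_xspec[OF S g]]
  define X where "X p = ennreal ((norm (complex_of_real (a (fst (snd p)) (vel p)) * xspec S g p))^2)" for p
  define Y where "Y p = ennreal ((a (fst (snd p)) (vel p))^2 * (norm (spec S g (vel p) (fst p, fst (snd p))))^2)" for p
  have Xm: "X \<in> borel_measurable borel" unfolding X_def by measurable
  have Ym: "Y \<in> borel_measurable borel"
  proof -
    have "continuous_on UNIV (\<lambda>z. spec S g (fst z) (snd z))"
      unfolding spec_def
      by (rule continuous_fourier_parameter[of "\<lambda>v y. complex_of_real (bump S y ^ 3 * g (point y v))" S])
         (rule continuous_on_of_real[OF bump_slice(1)[OF S g]], simp only: bump_slice(2)[OF S g] of_real_0)
    moreover have "continuous_on UNIV (\<lambda>p :: phase. (vel p, fst p, fst (snd p)))" by (intro continuous_intros)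
    ultimately have "continuous_on UNIV (\<lambda>p :: phase. spec S g (vel p) (fst p, fst (snd p)))"
      using continuous_on_compose2[of UNIV "\<lambda>z. spec S g (fst z) (snd z)" UNIV "\<lambda>p :: phase. (vel p, fst p, fst (snd p))"] by simp
    note [measurable] = borel_measurable_continuous_onI[OF this]
    show ?thesis unfolding Y_def by measurable
  qed
  have time: "(\<integral>\<^sup>+t. X (t, z) \<partial>lborel) \<le> (\<integral>\<^sup>+\<tau>. Y (\<tau>, z) \<partial>lborel)" for z
  proof -
    let ?a = "ennreal ((a (fst z) (snd z))^2)"
    have m: "(\<lambda>t. xspec S g (t, z)) \<in> borel_measurable borel" "(\<lambda>\<tau>. spec S g (snd z) (\<tau>, fst z)) \<in> borel_measurable borel"
    proof -
      show "(\<lambda>t. xspec S g (t, z)) \<in> borel_measurable borel"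
        by (rule borel_measurable_continuous_onI, rule continuous_on_compose2[OF continuous_xspec[OF S g]]) (auto intro!: continuous_intros)
      have "continuous_on UNIV (spec S g (snd z))"
        unfolding spec_def
        by (rule continuous_slice2[OF continuous_fourier_parameter[of "\<lambda>v y. complex_of_real (bump S y ^ 3 * g (point y v))" S]])
           (rule continuous_on_of_real[OF bump_slice(1)[OF S g]], simp only: bump_slice(2)[OF S g] of_real_0)
      then show "(\<lambda>\<tau>. spec S g (snd z) (\<tau>, fst z)) \<in> borel_measurable borel"
        by (intro borel_measurable_continuous_onI) (rule continuous_on_compose2, auto intro!: continuous_intros)
    qed
    have "(\<integral>\<^sup>+t. X (t, z) \<partial>lborel) = ?a * sqnorm (\<lambda>t. xspec S g (t, z))"
      unfolding X_def sqnorm_def using m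
      by (subst nn_integral_cmult[symmetric]) (auto simp: norm_mult power_mult_distrib ennreal_mult)
    also have "\<dots> = 1 * (?a * sqnorm (\<lambda>t. xspec S g (t, z)))" by simp
    also have "\<dots> \<le> ennreal (2 * pi) * (?a * sqnorm (\<lambda>t. xspec S g (t, z)))"
    proof (rule mult_right_mono)
      show "1 \<le> ennreal (2 * pi)" unfolding ennreal_1[symmetric] using pi_gt3 by (intro ennreal_leI) linarith
    qed simp
    also have "\<dots> = ?a * sqnorm (\<lambda>\<tau>. spec S g (snd z) (\<tau>, fst z))"
      unfolding xspec_time_plancherel[OF S g] by (simp add: mult_ac)
    also have "\<dots> = (\<integral>\<^sup>+\<tau>. Y (\<tau>, z) \<partial>lborel)"
      unfolding Y_def sqnorm_def using m
      by (subst nn_integral_cmult[symmetric]) (auto simp: ennreal_mult)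
    finally show ?thesis .
  qed
  have "sqnorm (\<lambda>p. complex_of_real (a (fst (snd p)) (vel p)) * xspec S g p) = (\<integral>\<^sup>+z. \<integral>\<^sup>+t. X (t, z) \<partial>lborel \<partial>lborel)"
    unfolding sqnorm_def X_def[symmetric] lborel_nn_integral_prod[OF Xm] by (rule lborel_nn_integral_swap[OF Xm])
  also have "\<dots> \<le> (\<integral>\<^sup>+z. \<integral>\<^sup>+\<tau>. Y (\<tau>, z) \<partial>lborel \<partial>lborel)" by (intro nn_integral_mono time)
  also have "\<dots> = (\<integral>\<^sup>+p. Y p \<partial>lborel)"
    unfolding lborel_nn_integral_prod[OF Ym] by (rule lborel_nn_integral_swap[OF Ym, symmetric])
  also have "\<dots> = (\<integral>\<^sup>+v. \<integral>\<^sup>+\<eta>. Y (point \<eta> v) \<partial>lborel \<partial>lborel)" by (rule phase_nn_integral(1)[OF Ym])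
  also have "\<dots> = (\<integral>\<^sup>+\<eta>. \<integral>\<^sup>+v. Y (point \<eta> v) \<partial>lborel \<partial>lborel)"
  proof -
    have "(\<lambda>w :: (real^3) \<times> spacetime. Y (point (snd w) (fst w))) \<in> borel_measurable borel"
      by (rule measurable_compose[OF borel_measurable_continuous_onI Ym]) (intro continuous_intros)
    from lborel_nn_integral_swap[OF this] show ?thesis by simp
  qed
  finally show ?thesis by (simp add: Y_def)
qed

lemma measurable_rho: "(\<lambda>p :: phase. rho \<gamma> (fst (snd p)) (vel p)) \<in> borel_measurable borel"
proof -
  have "(\<lambda>p :: phase. japanese (vel p)) \<in> borel_measurable borel"
    unfolding japanese_def by (intro borel_measurable_continuous_onI continuous_intros)
  moreover have "(\<lambda>p :: phase. symb (fst (snd p)) (vel p)) \<in> borel_measurable borel"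
    unfolding symb_eq by (intro borel_measurable_continuous_onI continuous_intros)
  ultimately show ?thesis unfolding rho_def by measurable
qed

text \<open>Groups (t, v) as the parameter and x as the variable, the arrangement of
  \<open>partial_fourier_exists\<close>.\<close>

abbreviation x_slice :: "(phase \<Rightarrow> real) \<Rightarrow> (real \<times> (real^3)) \<times> (real^3) \<Rightarrow> complex" where
  "x_slice f w \<equiv> complex_of_real (f (fst (fst w), snd w, snd (fst w)))"

lemma in_L2_x_slice:
  assumes "in_L2 f"
  shows "in_L2 (x_slice f)"
proof -
  have m: "f \<in> borel_measurable borel" by (rule in_L2D(1)[OF assms])
  have mx: "x_slice f \<in> borel_measurable borel"
    by (rule measurable_compose[OF measurable_compose[OF _ m] borel_measurable_of_real]) (intro borel_measurable_continuous_onI continuous_intros)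
  have "sqnorm (x_slice f) = sqnorm f"
    unfolding sqnorm_prod[OF mx] unfolding sqnorm_def using m by (subst phase_nn_integral(2)[of "\<lambda>p. ennreal ((norm (f p))^2)"]) auto
  then show ?thesis using assms mx by (simp add: in_L2_def)
qed

text \<open>The isometry in x on almost every slice. It turns the L2 convergence of the cut-off
  functions to f into convergence of their transforms to G.\<close>

lemma sqnorm_xspec_diff:
  assumes S: "S > 0" and f: "continuous_on UNIV f" "in_L2 f" and g: "continuous_on UNIV g"
    and G: "G \<in> borel_measurable borel" "AE q in lborel. fourier_L2 (\<lambda>x. x_slice f (q, x)) (\<lambda>k. G (q, k))"
  shows "sqnorm (\<lambda>p. xspec S g p - G ((fst p, vel p), fst (snd p)))
    = ennreal ((2 * pi) ^ 3) * sqnorm (\<lambda>p. complex_of_real (bump S (fst p, fst (snd p)) ^ 3 * g p - f p))"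
proof -
  have G': "(\<lambda>p :: phase. G ((fst p, vel p), fst (snd p))) \<in> borel_measurable borel"
    by (rule measurable_compose[OF _ G(1)]) (intro borel_measurable_continuous_onI continuous_intros)
  note [measurable] = G' borel_measurable_continuous_onI[OF continuous_xspec[OF S g]] borel_measurable_continuous_onI[OF f(1)] borel_measurable_continuous_onI[OF g]
  have cb: "continuous_on UNIV (\<lambda>p :: phase. bump S (fst p, fst (snd p)))"
    by (intro continuous_intros continuous_on_compose2[OF continuous_bump[of UNIV]]) auto
  note [measurable] = borel_measurable_continuous_onI[OF cb]
  define D where "D p = complex_of_real (bump S (fst p, fst (snd p)) ^ 3 * g p - f p)" for p
  have Dm: "D \<in> borel_measurable borel" unfolding D_def by measurable
  have "sqnorm (\<lambda>p. xspec S g p - G ((fst p, vel p), fst (snd p)))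
    = (\<integral>\<^sup>+q. sqnorm (\<lambda>k. xspec S g (fst q, k, snd q) - G (q, k)) \<partial>lborel)"
    unfolding sqnorm_def by (subst phase_nn_integral(2)) simp_all
  also have "\<dots> = (\<integral>\<^sup>+q. ennreal ((2 * pi) ^ 3) * sqnorm (\<lambda>x. D (fst q, x, snd q)) \<partial>lborel)"
  proof (rule nn_integral_cong_AE, use G(2) in eventually_elim)
    fix q assume F: "fourier_L2 (\<lambda>x. x_slice f (q, x)) (\<lambda>k. G (q, k))"
    let ?u = "\<lambda>x. complex_of_real (bump S (fst q, x) ^ 3 * g (fst q, x, snd q))"
    have c: "continuous_on UNIV ?u"
      by (intro continuous_intros continuous_on_compose2[OF continuous_bump[of UNIV]] continuous_on_compose2[OF g]) auto
    have z: "?u x = 0" if "norm x > S" for x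
    proof -
      have "norm (fst q, x) > S" using that norm_snd_le[of x "fst q"] by linarith
      then show ?thesis using S by (simp add: bump_eq_0)
    qed
    have "fourier_L2 ?u (fourier ?u)" by (rule fourier_L2_support[OF in_L2_continuous_support[OF c z] z])
    from fourier_L2_sqnorm[OF fourier_L2_diff[OF this F]]
    show "sqnorm (\<lambda>k. xspec S g (fst q, k, snd q) - G (q, k)) = ennreal ((2 * pi) ^ 3) * sqnorm (\<lambda>x. D (fst q, x, snd q))"
      by (simp add: xspec_def D_def)
  qed
  also have "\<dots> = ennreal ((2 * pi) ^ 3) * (\<integral>\<^sup>+q. sqnorm (\<lambda>x. D (fst q, x, snd q)) \<partial>lborel)"
  proof (rule nn_integral_cmult)
    have "(\<lambda>w. D (fst (fst w), snd w, snd (fst w))) \<in> borel_measurable borel"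
      by (rule measurable_compose[OF _ Dm]) (intro borel_measurable_continuous_onI continuous_intros)
    from sqnorm_slice_measurable[OF this] show "(\<lambda>q. sqnorm (\<lambda>x. D (fst q, x, snd q))) \<in> borel_measurable lborel" by simp
  qed
  also have "(\<integral>\<^sup>+q. sqnorm (\<lambda>x. D (fst q, x, snd q)) \<partial>lborel) = sqnorm D"
    unfolding sqnorm_def using Dm by (subst phase_nn_integral(2)[of "\<lambda>p. ennreal ((norm (D p))^2)"]) auto
  finally show ?thesis by (simp only: D_def[abs_def])
qed

text \<open>The weight \<open>rho\<close> is not bounded, so L2 convergence of the transforms does
  not pass through it directly. A subsequence converges almost everywhere, and Fatou's lemma then
  carries the uniform weighted bound to the limit.\<close>

lemma (in coefficients) fractional_estimate:
  assumes f: "times_differentiable 5 f" and f2: "in_L2 f" and h: "continuous_on UNIV h"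
    and eq: "\<And>p. kinetic_op (sig False) (sig True) F f p = h p"
    and G: "G \<in> borel_measurable borel" "AE q in lborel. fourier_L2 (\<lambda>x. x_slice f (q, x)) (\<lambda>k. G (q, k))"
  shows "sqnorm (\<lambda>p :: phase. complex_of_real (rho \<gamma> (fst (snd p)) (vel p)) * G ((fst p, vel p), fst (snd p)))
    \<le> ennreal const1 * (sqnorm f + sqnorm h)"
proof -
  let ?S = "\<lambda>n. real (Suc n)"
  let ?G = "\<lambda>p :: phase. G ((fst p, vel p), fst (snd p))"
  have S: "?S n \<ge> 1" "?S n > 0" for n by simp_all
  have cf: "continuous_on UNIV f" by (rule times_diff_continuous[OF f]) simp
  have cg: "continuous_on UNIV (vcut (?S n) f)" for n
    by (rule times_diff_continuous[OF times_diff_vcut[OF times_diff_mono[OF f]]]) simp_all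
  have Gm: "?G \<in> borel_measurable borel"
    by (rule measurable_compose[OF _ G(1)]) (intro borel_measurable_continuous_onI continuous_intros)
  define A where "A n = xspec (?S n) (vcut (?S n) f)" for n
  have Am: "A n \<in> borel_measurable borel" for n
    unfolding A_def by (rule borel_measurable_continuous_onI[OF continuous_xspec[OF S(2) cg]])
  define D where "D n p = complex_of_real (bump (?S n) (fst p, fst (snd p)) ^ 3 * vcut (?S n) f p - f p)" for n p
  have cb: "continuous_on UNIV (\<lambda>p :: phase. bump (?S n) (fst p, fst (snd p)))" for n
    by (intro continuous_intros continuous_on_compose2[OF continuous_bump[of UNIV]]) auto
  have Dm: "D n \<in> borel_measurable borel" for n
    unfolding D_def by (intro borel_measurable_continuous_onI continuous_intros cb cf cg)
  have fc: "in_L2 (\<lambda>p. complex_of_real (f p))"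
    using f2 measurable_compose[OF in_L2D(1)[OF f2] borel_measurable_of_real] by (simp add: in_L2_iff)
  have Dle: "norm (D n p) \<le> norm (complex_of_real (f p))" for n p
  proof -
    define c where "c = bump (?S n) (fst p, fst (snd p)) ^ 3 * bump (?S n) (vel p) ^ 5"
    have c: "0 \<le> c" "c \<le> 1"
      unfolding c_def by (intro mult_nonneg_nonneg mult_le_one zero_le_power power_le_one bump_bounds)+
    have "D n p = complex_of_real ((c - 1) * f p)" unfolding D_def c_def by (simp add: algebra_simps)
    then have "norm (D n p) = \<bar>c - 1\<bar> * \<bar>f p\<bar>" by (simp only: norm_of_real abs_mult)
    also have "\<dots> \<le> 1 * \<bar>f p\<bar>" using c by (intro mult_right_mono) auto
    finally show ?thesis by simp
  qed
  have D2: "in_L2 (D n)" for n by (rule in_L2_bounded_by[OF fc Dm Dle])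
  have "(\<lambda>n. sqnorm (D n)) \<longlonglongrightarrow> 0"
  proof (rule sqnorm_dominated[OF fc Dm Dle])
    fix p
    have "(\<lambda>n. complex_of_real (bump (?S n) (fst p, fst (snd p)) ^ 3 * (bump (?S n) (vel p) ^ 5 * f p) - f p))
        \<longlonglongrightarrow> complex_of_real (1 * (1 * f p) - f p)"
      by (intro tendsto_intros bump_tendsto)
    then show "(\<lambda>n. D n p) \<longlonglongrightarrow> 0" by (simp add: D_def)
  qed
  then have "(\<lambda>n. ennreal ((2 * pi) ^ 3) * sqnorm (D n)) \<longlonglongrightarrow> ennreal ((2 * pi) ^ 3) * 0"
    by (intro ennreal_tendsto_cmult) simp
  moreover have AD: "sqnorm (\<lambda>p. A n p - ?G p) = ennreal ((2 * pi) ^ 3) * sqnorm (D n)" for n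
    unfolding A_def D_def by (rule sqnorm_xspec_diff[OF S(2) cf f2 cg G])
  ultimately have lim: "(\<lambda>n. sqnorm (\<lambda>p. A n p - ?G p)) \<longlonglongrightarrow> 0" by simp
  have A2: "in_L2 (\<lambda>p. A n p - ?G p)" for n
    unfolding in_L2_def AD using D2[of n] Am[of n] Gm by (simp add: in_L2_def ennreal_mult_less_top)
  have i0: "(\<lambda>n. \<integral>p. norm ((norm (A n p - ?G p))^2) \<partial>lborel) \<longlonglongrightarrow> 0"
    using lim unfolding sqnorm_tendsto_0_iff[OF A2] by simp
  obtain r where "AE p in lborel. (\<lambda>n. (norm (A (r n) p - ?G p))^2) \<longlonglongrightarrow> 0"
    using tendsto_L1_AE_subseq[OF in_L2D(2)[OF A2] i0] by blast
  then have conv: "AE p in lborel. (\<lambda>n. A (r n) p) \<longlonglongrightarrow> ?G p"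
  proof eventually_elim
    fix p assume "(\<lambda>n. (norm (A (r n) p - ?G p))^2) \<longlonglongrightarrow> 0"
    from tendsto_real_sqrt[OF this] have "(\<lambda>n. norm (A (r n) p - ?G p)) \<longlonglongrightarrow> 0" by simp
    then show "(\<lambda>n. A (r n) p) \<longlonglongrightarrow> ?G p" by (simp only: tendsto_norm_zero_iff LIM_zero_iff)
  qed
  show ?thesis
  proof (rule sqnorm_fatou)
    show "(\<lambda>p. complex_of_real (rho \<gamma> (fst (snd p)) (vel p)) * A (r n) p) \<in> borel_measurable borel" for n
      by (intro borel_measurable_times measurable_compose[OF measurable_rho borel_measurable_of_real] Am)
    show "AE p in lborel. (\<lambda>n. complex_of_real (rho \<gamma> (fst (snd p)) (vel p)) * A (r n) p)
        \<longlonglongrightarrow> complex_of_real (rho \<gamma> (fst (snd p)) (vel p)) * ?G p"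
      using conv by eventually_elim (intro tendsto_intros)
    show "sqnorm (\<lambda>p. complex_of_real (rho \<gamma> (fst (snd p)) (vel p)) * A (r n) p) \<le> ennreal const1 * (sqnorm f + sqnorm h)" for n
      unfolding A_def
      by (rule order_trans[OF xspec_weighted[OF S(2) cg measurable_rho] spectral_terms(3)[OF S(1) f h eq]])
  qed
qed

text \<open>The product of m with the transform need not be square integrable over all of phase
  space, since the weight in v may decay. The weighted product is, so it is inverted first and the
  weight is removed afterwards, where it is a constant on each slice.\<close>

lemma multiplier_exists:
  fixes m :: "real^3 \<Rightarrow> real^3 \<Rightarrow> real"
  assumes G: "G \<in> borel_measurable borel" "AE q in lborel. fourier_L2 (\<lambda>x. x_slice f (q, x)) (\<lambda>k. G (q, k))"
    and m: "(\<lambda>p :: phase. m (vel p) (fst (snd p))) \<in> borel_measurable borel"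
    and m0: "\<And>v k. 0 \<le> m v k" and le: "\<And>v k. japanese v powr s * m v k \<le> rho \<gamma> k v"
    and B: "sqnorm (\<lambda>p :: phase. complex_of_real (rho \<gamma> (fst (snd p)) (vel p)) * G ((fst p, vel p), fst (snd p))) \<le> B" "B < \<infinity>"
  shows "\<exists>g. x_multiplier m f g \<and> sqnorm (\<lambda>p. (japanese (vel p) powr s) *\<^sub>R g p) \<le> B"
proof -
  let ?J = "\<lambda>q :: real \<times> (real^3). japanese (snd q) powr s"
  have J0: "japanese v powr s > 0" for v using japanese_ge_1[of v] by simp
  have Jm: "(\<lambda>p :: phase. japanese (vel p) powr r) \<in> borel_measurable borel" for r
    by (intro borel_measurable_continuous_onI times_diff_continuous[OF times_diff_vel[OF times_diff_japanese[of 1]]]) simp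
  have perm: "(\<lambda>w :: (real \<times> (real^3)) \<times> (real^3). (fst (fst w), snd w, snd (fst w))) \<in> borel \<rightarrow>\<^sub>M borel"
    "(\<lambda>p :: phase. ((fst p, vel p), fst (snd p))) \<in> borel \<rightarrow>\<^sub>M borel"
    by (intro borel_measurable_continuous_onI continuous_intros)+
  \<comment> \<open>The transform of the weighted function; it is dominated by the quantity bounded
    in \<open>fractional_estimate\<close>.\<close>
  define W where "W w = complex_of_real (?J (fst w) * m (snd (fst w)) (snd w)) * G w" for w
  have Wm: "W \<in> borel_measurable borel"
    unfolding W_def
    using measurable_compose[OF perm(1) Jm[of s]] measurable_compose[OF perm(1) m]
    by (intro borel_measurable_times measurable_compose[OF borel_measurable_times borel_measurable_of_real] G(1)) simp_all
  define R where "R p = complex_of_real (rho \<gamma> (fst (snd p)) (vel p)) * G ((fst p, vel p), fst (snd p))" for p :: phase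
  have Rm: "R \<in> borel_measurable borel"
    unfolding R_def
    by (intro borel_measurable_times measurable_compose[OF measurable_rho borel_measurable_of_real] measurable_compose[OF perm(2) G(1)])
  have WR: "norm (W (q, k)) \<le> norm (R (fst q, k, snd q))" for q k
    unfolding W_def R_def norm_mult norm_of_real
    using le[of "snd q" k] m0[of "snd q" k] J0[of "snd q"] by (simp add: abs_mult mult_right_mono)
  have "sqnorm W = (\<integral>\<^sup>+q. sqnorm (\<lambda>k. W (q, k)) \<partial>lborel)" by (rule sqnorm_prod[OF Wm])
  also have "\<dots> \<le> (\<integral>\<^sup>+q. sqnorm (\<lambda>k. R (fst q, k, snd q)) \<partial>lborel)"
    by (intro nn_integral_mono sqnorm_mono WR)
  also have "\<dots> = sqnorm R"
    unfolding sqnorm_def using Rm by (subst phase_nn_integral(2)[of "\<lambda>p. ennreal ((norm (R p))^2)"]) auto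
  finally have WB: "sqnorm W \<le> B" using B(1) by (simp add: R_def[abs_def])
  then have W2: "in_L2 W" using B(2) Wm by (simp add: in_L2_def)
  obtain Z where Z: "Z \<in> borel_measurable borel" "AE q in lborel. fourier_L2 (\<lambda>k. cnj (W (q, k))) (\<lambda>x. Z (q, x))"
    using partial_fourier_exists[OF in_L2_cnj[OF W2]] by blast
  let ?c = "complex_of_real (1 / (2 * pi) ^ 3)"
  \<comment> \<open>The inverse transform of \<open>W\<close>, written with a forward transform of
    its conjugate as in \<open>fourier_L2_inverse\<close>, and divided by the weight.\<close>
  define g where "g p = complex_of_real (japanese (vel p) powr - s) * (?c * cnj (Z ((fst p, vel p), fst (snd p))))" for p :: phase
  have gm: "g \<in> borel_measurable borel"
    unfolding g_def
    by (intro borel_measurable_times borel_measurable_const measurable_compose[OF Jm borel_measurable_of_real]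
        borel_measurable_cnj measurable_compose[OF perm(2) Z(1)])
  have inv: "AE q in lborel. fourier_L2 (\<lambda>x. ?c * cnj (Z (q, x))) (\<lambda>k. W (q, k))"
    using Z(2) by eventually_elim (rule fourier_L2_inverse)
  have Jg: "(japanese (snd q) powr s) *\<^sub>R g (fst q, x, snd q) = ?c * cnj (Z (q, x))" for q x
  proof -
    have "complex_of_real (japanese (snd q) powr s) * complex_of_real (japanese (snd q) powr - s) = 1"
      using J0[of "snd q"] by (simp add: powr_minus flip: of_real_mult)
    then show ?thesis by (simp add: g_def scaleR_conv_of_real flip: mult.assoc)
  qed
  have "x_multiplier m f g"
    unfolding x_multiplier_def
  proof
    show "g \<in> borel_measurable lborel" using gm by simp
    show "AE tv in lborel. fourier_multiplier (m (snd tv)) (\<lambda>x. complex_of_real (f (fst tv, x, snd tv))) (\<lambda>x. g (fst tv, x, snd tv))"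
      using G(2) inv
    proof eventually_elim
      fix q assume u: "fourier_L2 (\<lambda>x. x_slice f (q, x)) (\<lambda>k. G (q, k))" and w: "fourier_L2 (\<lambda>x. ?c * cnj (Z (q, x))) (\<lambda>k. W (q, k))"
      let ?j = "complex_of_real (japanese (snd q) powr - s)"
      have "fourier_L2 (\<lambda>x. ?j * (?c * cnj (Z (q, x)))) (\<lambda>k. ?j * W (q, k))" by (rule fourier_L2_cmult[OF w])
      moreover have "?j * W (q, k) = complex_of_real (m (snd q) k) * G (q, k)" for k
      proof -
        have "?j * complex_of_real (japanese (snd q) powr s) = 1"
          using J0[of "snd q"] by (simp add: powr_minus flip: of_real_mult)
        then show ?thesis by (simp add: W_def flip: mult.assoc)
      qed
      ultimately have "fourier_L2 (\<lambda>x. g (fst q, x, snd q)) (\<lambda>k. complex_of_real (m (snd q) k) * G (q, k))"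
        by (simp add: g_def)
      then show "fourier_multiplier (m (snd q)) (\<lambda>x. complex_of_real (f (fst q, x, snd q))) (\<lambda>x. g (fst q, x, snd q))"
        unfolding fourier_multiplier_def using u by auto
    qed
  qed
  moreover have "sqnorm (\<lambda>p. (japanese (vel p) powr s) *\<^sub>R g p) \<le> B"
  proof -
    define E where "E p = (japanese (vel p) powr s) *\<^sub>R g p" for p
    have Em: "E \<in> borel_measurable borel" unfolding E_def by (intro borel_measurable_scaleR Jm gm)
    have "sqnorm E = (\<integral>\<^sup>+q. sqnorm (\<lambda>x. E (fst q, x, snd q)) \<partial>lborel)"
      unfolding sqnorm_def using Em by (subst phase_nn_integral(2)) auto
    also have "\<dots> \<le> (\<integral>\<^sup>+q. sqnorm (\<lambda>k. W (q, k)) \<partial>lborel)"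
    proof (rule nn_integral_mono_AE, use inv in eventually_elim)
      fix q assume w: "fourier_L2 (\<lambda>x. ?c * cnj (Z (q, x))) (\<lambda>k. W (q, k))"
      have "sqnorm (\<lambda>x. E (fst q, x, snd q)) = sqnorm (\<lambda>x. ?c * cnj (Z (q, x)))"
        using Jg[of q] by (simp add: E_def)
      also have "\<dots> = 1 * sqnorm (\<lambda>x. ?c * cnj (Z (q, x)))" by simp
      also have "\<dots> \<le> ennreal ((2 * pi) ^ 3) * sqnorm (\<lambda>x. ?c * cnj (Z (q, x)))"
      proof (rule mult_right_mono)
        show "1 \<le> ennreal ((2 * pi) ^ 3)"
          unfolding ennreal_1[symmetric] using pi_gt3 by (intro ennreal_leI one_le_power) linarith
      qed simp
      also have "\<dots> = sqnorm (\<lambda>k. W (q, k))" by (rule fourier_L2_sqnorm[OF w, symmetric])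
      finally show "sqnorm (\<lambda>x. E (fst q, x, snd q)) \<le> sqnorm (\<lambda>k. W (q, k))" .
    qed
    also have "\<dots> = sqnorm W" by (rule sqnorm_prod[OF Wm, symmetric])
    finally show ?thesis using WB by (simp add: E_def[abs_def])
  qed
  ultimately show ?thesis by blast
qed

section \<open>Constants from the hypotheses, and conclusion\<close>

lemma borel_measurable_norm_powr:
  fixes u :: "'a::topological_space \<Rightarrow> 'b::real_normed_vector"
  assumes "continuous_on UNIV u"
  shows "(\<lambda>x. norm (u x) powr r) \<in> borel_measurable borel"
proof -
  have [measurable]: "(\<lambda>x. norm (u x)) \<in> borel_measurable borel"
    by (intro borel_measurable_continuous_onI continuous_intros assms)
  show ?thesis by measurable
qed

lemma powr_two_thirds_le:
  fixes x y :: real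
  assumes "0 \<le> x" "x^2 \<le> y"
  shows "x powr (2 / 3) \<le> y powr (1 / 3)"
proof (cases "x = 0")
  case False
  then have "x powr (2 / 3) = (x powr 2) powr (1 / 3)" by (simp add: powr_powr)
  also have "x powr 2 = x^2" using False assms(1) by (simp add: powr_numeral)
  also have "(x^2) powr (1 / 3) \<le> y powr (1 / 3)" using assms(2) by (intro powr_mono2) auto
  finally show ?thesis .
qed simp

text \<open>Components of the fields are at most <v>, which restores the power lost by the
  derivative; the factor 3 counts the components.\<close>

lemma coefficient_bounds_field:
  assumes c: "coefficient_bounds A s c" and A: "A > 0"
  shows "\<bar>c v\<bar> \<le> A * japanese v powr s" and "\<bar>field a c v\<bar> \<le> 3 * A * japanese v powr s"
proof -
  have b: "\<bar>partials bs c v\<bar> \<le> A * japanese v powr (s - real (length bs))" if "set bs \<subseteq> Basis" "length bs \<le> 2" for bs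
    using c that unfolding coefficient_bounds_def by blast
  show "\<bar>c v\<bar> \<le> A * japanese v powr s" using b[of "[]"] by simp
  have p: "\<bar>partial (axis i 1) c v\<bar> \<le> A * japanese v powr (s - 1)" for i using b[of "[axis i 1]"] axis_Basis by simp
  have d: "\<bar>field_dir a v $ i\<bar> \<le> japanese v" for i
  proof (cases "fst a")
    case True
    have "\<bar>field_dir a v $ i\<bar> \<le> norm (cross3 v (axis (snd a) 1))"
      using component_le_norm_cart[of "cross3 v (axis (snd a) 1)" i] True by (simp add: field_dir_def)
    also have "\<dots> \<le> norm v * norm (axis (snd a) 1 :: real^3)"
    proof (rule power2_le_imp_le)
      show "(norm (cross3 v (axis (snd a) 1)))^2 \<le> (norm v * norm (axis (snd a) 1 :: real^3))^2"
        unfolding norm_cross power_mult_distrib by simp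
    qed simp
    finally show ?thesis using norm_le_japanese[of v] by simp
  next
    case False
    then show ?thesis using japanese_ge_1[of v] by (simp add: field_dir_def axis_def)
  qed
  have "\<bar>field a c v\<bar> \<le> (\<Sum>i\<in>UNIV. \<bar>field_dir a v $ i * partial (axis i 1) c v\<bar>)"
    unfolding field_def by (rule sum_abs)
  also have "\<dots> \<le> (\<Sum>i\<in>(UNIV :: 3 set). japanese v * (A * japanese v powr (s - 1)))"
    unfolding abs_mult using d p japanese_ge_1[of v] by (intro sum_mono mult_mono) auto
  also have "\<dots> = 3 * A * (japanese v powr 1 * japanese v powr (s - 1))"
    using japanese_ge_1[of v] by simp
  also have "\<dots> = 3 * A * japanese v powr s" unfolding powr_add[symmetric] by simp
  finally show "\<bar>field a c v\<bar> \<le> 3 * A * japanese v powr s" .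
qed

text \<open>3 A bounds derivatives along the fields, and the added 1 ensures that the constant of
  the locale is at least 1.\<close>

lemma coefficients_of_bounds:
  assumes \<gamma>: "-3 \<le> \<gamma>" "\<gamma> \<le> 1" and A: "A > 0"
    and c: "coefficient_bounds A \<gamma> lam" "coefficient_bounds A \<gamma> mu" "coefficient_bounds A (\<gamma> + 2) F"
  shows "coefficients \<gamma> (3 * A + 1) (\<lambda>b. if b then mu else lam) F"
proof -
  have le: "x \<le> (3 * A + 1) * y" if "\<bar>x\<bar> \<le> 3 * A * y" "0 \<le> y" for x y
    using that by (simp add: algebra_simps)
  have le1: "x \<le> (3 * A + 1) * y" if "x \<le> A * y" "0 \<le> y" for x y
  proof -
    have "A * y \<le> (3 * A + 1) * y" using that A by (intro mult_right_mono) auto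
    then show ?thesis using that by linarith
  qed
  have low: "japanese v powr s \<le> (3 * A + 1) * c v" and up: "c v \<le> (3 * A + 1) * japanese v powr s"
    and fld: "\<bar>field a c v\<bar> \<le> (3 * A + 1) * japanese v powr s" and td: "times_differentiable 2 c"
    if "coefficient_bounds A s c" for s c v a
  proof -
    have "japanese v powr s \<le> A * c v" "0 < c v" and td: "times_differentiable 2 c"
      using that unfolding coefficient_bounds_def by blast+
    then show "japanese v powr s \<le> (3 * A + 1) * c v" by (intro le1) auto
    show "c v \<le> (3 * A + 1) * japanese v powr s"
      using coefficient_bounds_field(1)[OF that A, of v] by (intro le1) auto
    show "\<bar>field a c v\<bar> \<le> (3 * A + 1) * japanese v powr s"
      using coefficient_bounds_field(2)[OF that A, of a v] by (intro le) auto
    show "times_differentiable 2 c" by (rule td)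
  qed
  show ?thesis
  proof unfold_locales
    fix b a v
    show "times_differentiable 2 (if b then mu else lam)" using td[OF c(1)] td[OF c(2)] by simp
    show "japanese v powr \<gamma> \<le> (3 * A + 1) * (if b then mu else lam) v" using low[OF c(1)] low[OF c(2)] by simp
    show "(if b then mu else lam) v \<le> (3 * A + 1) * japanese v powr \<gamma>" using up[OF c(1)] up[OF c(2)] by simp
    show "\<bar>field a (if b then mu else lam) v\<bar> \<le> (3 * A + 1) * japanese v powr \<gamma>" using fld[OF c(1)] fld[OF c(2)] by simp
  qed (use \<gamma> A td[OF c(3)] low[OF c(3)] up[OF c(3)] in auto)
qed

theorem theorem1p1:
  fixes \<gamma> A :: real
  assumes "-3 \<le> \<gamma>" and "\<gamma> \<le> 1" and "A > 0"
  shows "\<exists>C::real. C > 0 \<and>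
    (\<forall>(lam :: real^3 \<Rightarrow> real) (mu :: real^3 \<Rightarrow> real) (F :: real^3 \<Rightarrow> real)
      (f :: phase \<Rightarrow> real) (h :: phase \<Rightarrow> real).
      coefficient_bounds A \<gamma> lam \<and> coefficient_bounds A \<gamma> mu \<and> coefficient_bounds A (\<gamma> + 2) F \<and>
      smooth f \<and> smooth h \<and> in_L2 f \<and> in_L2 h \<and>
      (\<forall>p. kinetic_op lam mu F f p = h p)
      \<longrightarrow> (\<exists>g1 g2 :: phase \<Rightarrow> complex.
            is_Dx_power (2/3) f g1 \<and> is_rot_Dx_power (2/3) f g2 \<and>
            sqnorm (\<lambda>p. japanese (vel p) powr (\<gamma> + 2) * f p)
            + sqnorm (\<lambda>p. japanese (vel p) powr \<gamma> * Dv_squared f p)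
            + sqnorm (\<lambda>p. japanese (vel p) powr \<gamma> * rot_squared f p)
            + sqnorm (\<lambda>p. (japanese (vel p) powr (\<gamma>/3)) *\<^sub>R g1 p)
            + sqnorm (\<lambda>p. (japanese (vel p) powr (\<gamma>/3)) *\<^sub>R g2 p)
            \<le> ennreal C * (sqnorm f + sqnorm h)))"
proof -
  \<comment> \<open>\<open>const1\<close> depends on 3 A + 1 only, so C is fixed before the
    coefficient functions are introduced. Its positivity is available only inside the locale, hence
    the absolute value; the factor 5 counts the terms on the left.\<close>
  define C where "C = (1 + \<bar>coefficients.const1 (3 * A + 1)\<bar>) * 5"
  have "C > 0" unfolding C_def by simp
  moreover have "\<exists>g1 g2 :: phase \<Rightarrow> complex.
            is_Dx_power (2/3) f g1 \<and> is_rot_Dx_power (2/3) f g2 \<and>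
            sqnorm (\<lambda>p. japanese (vel p) powr (\<gamma> + 2) * f p)
            + sqnorm (\<lambda>p. japanese (vel p) powr \<gamma> * Dv_squared f p)
            + sqnorm (\<lambda>p. japanese (vel p) powr \<gamma> * rot_squared f p)
            + sqnorm (\<lambda>p. (japanese (vel p) powr (\<gamma>/3)) *\<^sub>R g1 p)
            + sqnorm (\<lambda>p. (japanese (vel p) powr (\<gamma>/3)) *\<^sub>R g2 p)
            \<le> ennreal C * (sqnorm f + sqnorm h)"
    if c: "coefficient_bounds A \<gamma> lam" "coefficient_bounds A \<gamma> mu" "coefficient_bounds A (\<gamma> + 2) F"
      and f: "smooth f" "in_L2 f" and h: "smooth h" "in_L2 h" and eq: "\<And>p. kinetic_op lam mu F f p = h p"
    for lam mu F :: "real^3 \<Rightarrow> real" and f h :: "phase \<Rightarrow> real"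
  proof -
    interpret coefficients \<gamma> "3 * A + 1" "\<lambda>b. if b then mu else lam" F
      by (rule coefficients_of_bounds[OF assms c])
    define B where "B = ennreal const1 * (sqnorm f + sqnorm h)"
    have BC: "B + B + B + B + B \<le> ennreal C * (sqnorm f + sqnorm h)"
    proof -
      have "ennreal 5 = 1 + 1 + 1 + 1 + 1" by simp
      then have "B + B + B + B + B = ennreal 5 * B" by (simp only: distrib_right mult_1)
      also have "\<dots> = ennreal (5 * const1) * (sqnorm f + sqnorm h)"
        unfolding B_def using const1_pos by (simp add: ennreal_mult mult.assoc)
      also have "\<dots> \<le> ennreal C * (sqnorm f + sqnorm h)"
        unfolding C_def using const1_pos by (intro mult_right_mono ennreal_leI) auto
      finally show ?thesis .
    qed
    have Bfin: "B < \<infinity>" using f(2) h(2) by (simp add: B_def in_L2_def ennreal_mult_less_top)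
    have f5: "times_differentiable 5 f" and ch: "continuous_on UNIV h"
      using f(1) h(1) times_diff_continuous[of 1 h] by (auto simp: smooth_def)
    have eq': "kinetic_op (if False then mu else lam) (if True then mu else lam) F f p = h p" for p using eq by simp
    \<comment> \<open>One partial transform serves both multipliers, because the same
      \<open>rho\<close> dominates their symbols.\<close>
    obtain G where G: "G \<in> borel_measurable borel" "AE q in lborel. fourier_L2 (\<lambda>x. x_slice f (q, x)) (\<lambda>k. G (q, k))"
      using partial_fourier_exists[OF in_L2_x_slice[OF f(2)]] by blast
    note R = fractional_estimate[OF f5 f(2) ch eq' G, folded B_def]
    have "\<exists>g. is_Dx_power (2/3) f g \<and> sqnorm (\<lambda>p. (japanese (vel p) powr (\<gamma>/3)) *\<^sub>R g p) \<le> B"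
      unfolding is_Dx_power_def
    proof (rule multiplier_exists[OF G _ _ _ R Bfin])
      show "(\<lambda>p :: phase. norm (fst (snd p)) powr (2 / 3)) \<in> borel_measurable borel"
        by (rule borel_measurable_norm_powr) (intro continuous_intros)
      show "japanese v powr (\<gamma> / 3) * norm k powr (2 / 3) \<le> rho \<gamma> k v" for v k
        unfolding rho_def by (intro mult_left_mono powr_two_thirds_le norm_le_symb) auto
    qed simp
    then obtain g1 where g1: "is_Dx_power (2/3) f g1" "sqnorm (\<lambda>p. (japanese (vel p) powr (\<gamma>/3)) *\<^sub>R g1 p) \<le> B" by blast
    have "\<exists>g. is_rot_Dx_power (2/3) f g \<and> sqnorm (\<lambda>p. (japanese (vel p) powr (\<gamma>/3)) *\<^sub>R g p) \<le> B"
      unfolding is_rot_Dx_power_def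
    proof (rule multiplier_exists[OF G _ _ _ R Bfin])
      show "(\<lambda>p :: phase. norm (cross3 (vel p) (fst (snd p))) powr (2 / 3)) \<in> borel_measurable borel"
        by (rule borel_measurable_norm_powr) (intro continuous_intros continuous_on_cross)
      show "japanese v powr (\<gamma> / 3) * norm (cross3 v k) powr (2 / 3) \<le> rho \<gamma> k v" for v k
        unfolding rho_def by (intro mult_left_mono powr_two_thirds_le cross_le_symb) auto
    qed simp
    then obtain g2 where g2: "is_rot_Dx_power (2/3) f g2" "sqnorm (\<lambda>p. (japanese (vel p) powr (\<gamma>/3)) *\<^sub>R g2 p) \<le> B" by blast
    note v = velocity_estimates[OF f5 ch eq', folded B_def]
    have "sqnorm (\<lambda>p. japanese (vel p) powr \<gamma> * Dv_squared f p) \<le> B" "sqnorm (\<lambda>p. japanese (vel p) powr \<gamma> * rot_squared f p) \<le> B"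
      using v(2)[of False] v(2)[of True] by (simp_all add: vlap_eq sqnorm_def)
    with v(1) g1(2) g2(2) have total: "sqnorm (\<lambda>p. japanese (vel p) powr (\<gamma> + 2) * f p)
            + sqnorm (\<lambda>p. japanese (vel p) powr \<gamma> * Dv_squared f p)
            + sqnorm (\<lambda>p. japanese (vel p) powr \<gamma> * rot_squared f p)
            + sqnorm (\<lambda>p. (japanese (vel p) powr (\<gamma>/3)) *\<^sub>R g1 p)
            + sqnorm (\<lambda>p. (japanese (vel p) powr (\<gamma>/3)) *\<^sub>R g2 p) \<le> B + B + B + B + B"
      by (intro add_mono)
    show ?thesis by (intro exI[of _ g1] exI[of _ g2] conjI g1(1) g2(1) order_trans[OF total BC])
  qed
  ultimately show ?thesis by blast
qed

end
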